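(* Each of the following three conditions (all as $x\to\infty$) is equivalent to the Riemann Hypothesis; that is, the Riemann Hypothesis holds if and only if at least one of them is fulfilled, and then all of them are: (i) for every $\varepsilon>0$, $\Phi(x)=O(x^{1.5+\varepsilon})$, with an implied constant that may depend on $\varepsilon$; (ii) $\Phi(x)=O(x^{1.5})$; (iii) $\int_0^x(\psi(t)-t)^2\,dt=O(x^2)$.
   Context: $\theta(x):=\sum_{p\le x}\log p$ (sum over primes $p$) is the first Chebyshev function, $\psi(x):=\sum_{p^m\le x,\ m\ge1}\log p$ (sum over prime powers) is the second Chebyshev function, $\log$ is the natural logarithm, and $\Phi(x):=\int_0^x(\theta(t)-t)\,dt$. *)

theory Defs
  imports
    "HOL-Complex_Analysis.Complex_Analysis"
    "HOL-Library.Landau_Symbols"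
    "HOL-Computational_Algebra.Primes"
begin

definition chebyshev_theta :: "real \<Rightarrow> real" where
  "chebyshev_theta x = (\<Sum>p | prime p \<and> real p \<le> x. ln (real p))"

definition chebyshev_psi :: "real \<Rightarrow> real" where
  "chebyshev_psi x =
     (\<Sum>(p, m) | prime p \<and> 1 \<le> m \<and> real (p ^ m) \<le> x. ln (real p))"

definition theta_error_integral :: "real \<Rightarrow> real" where
  "theta_error_integral x = integral {0..x} (\<lambda>t. chebyshev_theta t - t)"

text \<open>
  A holomorphic function on the punctured plane says nothing about its value at the
  puncture, so the value at the pole is fixed to be 0 to make the description unique.
  That such a function exists is the theorem \<open>ex1_is_riemann_zeta\<close> below.
\<close>

definition is_riemann_zeta :: "(complex \<Rightarrow> complex) \<Rightarrow> bool" where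
  "is_riemann_zeta f \<longleftrightarrow>
     f holomorphic_on (- {1}) \<and>
     (\<forall>s. Re s > 1 \<longrightarrow> (\<lambda>n. 1 / of_nat (Suc n) powr s) sums f s) \<and>
     f 1 = 0"

definition riemann_zeta :: "complex \<Rightarrow> complex" where
  "riemann_zeta = (THE f. is_riemann_zeta f)"

definition Riemann_Hypothesis :: bool where
  "Riemann_Hypothesis \<longleftrightarrow>
     (\<forall>s. 0 < Re s \<and> Re s < 1 \<and> riemann_zeta s = 0 \<longrightarrow> Re s = 1 / 2)"


subsection \<open>The zeta function is well defined\<close>

lemma open_Re_gt: "open {s. Re s > a}"
  by (simp add: open_halfspace_Re_gt)

lemma connected_Re_gt: "connected {s. Re s > a}"
  by (intro convex_connected convex_halfspace_Re_gt)

lemma holomorphic_suminf_Re_gt: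
  fixes f :: "nat \<Rightarrow> complex \<Rightarrow> complex"
  assumes hol: "\<And>i. f i holomorphic_on {s. Re s > a}"
    and bnd: "\<And>s0 d. \<lbrakk>d > 0; Re s0 - d > a\<rbrakk> \<Longrightarrow>
       \<exists>g. summable g \<and> (\<forall>\<^sub>F i in sequentially. \<forall>s\<in>cball s0 d. norm (f i s) \<le> g i)"
  shows "(\<lambda>s. \<Sum>i. f i s) holomorphic_on {s. Re s > a}"
    and "\<And>s. Re s > a \<Longrightarrow> summable (\<lambda>i. f i s)"
proof -
  show "(\<lambda>s. \<Sum>i. f i s) holomorphic_on {s. Re s > a}"
  proof (rule holomorphic_uniform_sequence [OF open_Re_gt, of "\<lambda>n s. \<Sum>i<n. f i s"])
    show "(\<lambda>s. \<Sum>i<n. f i s) holomorphic_on {s. Re s > a}" for n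
      by (intro holomorphic_intros hol)
    fix s0 assume s0: "s0 \<in> {s. Re s > a}"
    define d where "d = (Re s0 - a) / 2"
    have d: "d > 0" "Re s0 - d > a" using s0 by (auto simp: d_def field_simps)
    have sub: "cball s0 d \<subseteq> {s. Re s > a}"
    proof
      fix s assume "s \<in> cball s0 d"
      then have "\<bar>Re (s0 - s)\<bar> \<le> d"
        using abs_Re_le_cmod[of "s0 - s"] by (auto simp: dist_norm)
      then show "s \<in> {s. Re s > a}" using d by simp
    qed
    obtain g where g: "summable g"
      "\<forall>\<^sub>F i in sequentially. \<forall>s\<in>cball s0 d. norm (f i s) \<le> g i"
      using bnd[OF d] by blast
    have "uniform_limit (cball s0 d) (\<lambda>n s. \<Sum>i<n. f i s) (\<lambda>s. \<Sum>i. f i s) sequentially"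
      by (rule Weierstrass_m_test_ev[OF g(2) g(1)])
    then show "\<exists>d>0. cball s0 d \<subseteq> {s. Re s > a} \<and>
        uniform_limit (cball s0 d) (\<lambda>n s. \<Sum>i<n. f i s) (\<lambda>s. \<Sum>i. f i s) sequentially"
      using d sub by blast
  qed
  show "summable (\<lambda>i. f i s)" if "Re s > a" for s
  proof -
    have half: "(Re s - a) / 2 > 0" "Re s - (Re s - a) / 2 > a"
      using that by (auto simp: field_simps)
    obtain g where g: "summable g"
      "\<forall>\<^sub>F i in sequentially. \<forall>t\<in>cball s ((Re s - a)/2). norm (f i t) \<le> g i"
      using bnd[of "(Re s - a) / 2" s, OF half] by blast
    have "\<forall>\<^sub>F i in sequentially. norm (f i s) \<le> g i"
      using g(2) by (rule eventually_mono) (use that in auto)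
    then show ?thesis using g(1) by (rule summable_comparison_test_ev)
  qed
qed

lemma summable_powr_Suc:
  fixes c :: real
  assumes "c > 1"
  shows "summable (\<lambda>i. real (Suc i) powr - c)"
  using summable_Suc_iff[of "\<lambda>i. real i powr - c"] assms
  by (simp add: summable_real_powr_iff del: of_nat_Suc)

lemma cball_Re_ge:
  assumes "s \<in> cball s0 d"
  shows "Re s \<ge> Re s0 - d"
  using assms abs_Re_le_cmod[of "s0 - s"] by (auto simp: dist_norm)

lemma zeta_series:
  shows zeta_series_holomorphic:
      "(\<lambda>s. \<Sum>i. 1 / of_nat (Suc i) powr s) holomorphic_on {s. Re s > 1}"
    and zeta_series_summable:
      "\<And>s. Re s > 1 \<Longrightarrow> summable (\<lambda>i. 1 / of_nat (Suc i) powr s :: complex)"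
proof -
  have hol: "(\<lambda>s. 1 / of_nat (Suc i) powr s) holomorphic_on {s. Re s > 1}" for i
    by (intro holomorphic_intros) (auto simp del: of_nat_Suc)
  have bnd: "\<exists>g. summable g \<and>
     (\<forall>\<^sub>F i in sequentially. \<forall>s\<in>cball s0 d. norm (1 / of_nat (Suc i) powr s :: complex) \<le> g i)"
    if "d > 0" "Re s0 - d > 1" for s0 d
  proof (intro exI conjI always_eventually allI ballI)
    show "summable (\<lambda>i. real (Suc i) powr - (Re s0 - d))"
      by (rule summable_powr_Suc) (use that in simp)
    fix i s assume s: "s \<in> cball s0 d"
    have "norm (1 / of_nat (Suc i) powr s :: complex) = real (Suc i) powr - Re s"
      by (simp add: norm_divide norm_powr_real_powr powr_minus divide_simps del: of_nat_Suc)
    also have "\<dots> \<le> real (Suc i) powr - (Re s0 - d)"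
      using cball_Re_ge[OF s] by (intro powr_mono) auto
    finally show "norm (1 / of_nat (Suc i) powr s :: complex) \<le> real (Suc i) powr - (Re s0 - d)" .
  qed
  show "(\<lambda>s. \<Sum>i. 1 / of_nat (Suc i) powr s) holomorphic_on {s. Re s > 1}"
    by (rule holomorphic_suminf_Re_gt(1)[OF hol bnd])
  show "\<And>s. Re s > 1 \<Longrightarrow> summable (\<lambda>i. 1 / of_nat (Suc i) powr s :: complex)"
    by (rule holomorphic_suminf_Re_gt(2)[OF hol bnd])
qed

text \<open>
  Remainder of the binomial expansion of \<open>(n + 1) powr (1 - s)\<close> in powers of \<open>1 / n\<close>,
  for \<open>n = i + 1\<close>.
\<close>

definition zeta_rem :: "nat \<Rightarrow> nat \<Rightarrow> complex \<Rightarrow> complex" where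
  "zeta_rem K i s = of_nat (Suc (Suc i)) powr (1 - s) -
     (\<Sum>k\<le>K. ((1 - s) gchoose k) * of_nat (Suc i) powr (1 - s - of_nat k))"

lemma norm_gchoose_le:
  fixes a :: complex
  assumes "norm a \<le> M"
  shows "norm (a gchoose k) \<le> pochhammer M k / fact k"
proof -
  have "norm (a gchoose k) = (\<Prod>i<k. norm (a - of_nat i)) / fact k"
    by (simp add: gbinomial_prod_rev norm_divide prod_norm atLeast0LessThan)
  also have "(\<Prod>i<k. norm (a - of_nat i)) \<le> (\<Prod>i<k. M + of_nat i)"
  proof (rule prod_mono, intro conjI)
    fix i
    show "norm (a - of_nat i) \<le> M + of_nat i"
      using norm_triangle_ineq4[of a "of_nat i"] assms by simp
  qed simp
  also have "\<dots> = pochhammer M k"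
    by (simp add: pochhammer_prod atLeast0LessThan)
  finally show ?thesis by (simp add: divide_right_mono)
qed

lemma summable_poch_half:
  fixes M :: real
  assumes "M > 0"
  shows "summable (\<lambda>k. pochhammer M k / fact k * (1/2) ^ k)"
proof -
  have "(\<lambda>k. (complex_of_real (- M) gchoose k) * (- 1 / 2) ^ k) sums
          (1 + (- 1 / 2)) powr (complex_of_real (- M))"
    by (rule gen_binomial_complex) simp
  then have "summable (\<lambda>k. (complex_of_real (- M) gchoose k) * (- 1 / 2) ^ k)"
    by (rule sums_summable)
  also have "(\<lambda>k. (complex_of_real (- M) gchoose k) * (- 1 / 2) ^ k) =
     (\<lambda>k. complex_of_real (pochhammer M k / fact k * (1/2) ^ k))"
  proof
    fix k
    have "(complex_of_real (- M) gchoose k) = (- 1) ^ k * pochhammer (complex_of_real M) k / fact k"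
      by (simp add: gbinomial_pochhammer)
    moreover have "(- 1 / 2 :: complex) ^ k = (- 1) ^ k * (1 / 2) ^ k"
      by (metis mult.right_neutral mult_minus_left power_mult_distrib times_divide_eq_right mult_1)
    moreover have "((- 1) ^ k * (- 1) ^ k :: complex) = 1"
      by (metis minus_one_power_iff mult.right_neutral mult_minus1_right minus_minus)
    ultimately show "(complex_of_real (- M) gchoose k) * (- 1 / 2) ^ k =
        complex_of_real (pochhammer M k / fact k * (1/2) ^ k)"
      by (simp add: pochhammer_of_real)
  qed
  finally show ?thesis by (simp only: summable_of_real_iff)
qed

lemma zeta_rem_bound:
  assumes M: "M > 0" and s: "norm (1 - s) \<le> M" and i: "i \<ge> 1"
  shows "norm (zeta_rem K i s) \<le>
     real (Suc i) powr - (Re s + real K) *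
       (2 ^ Suc K * (\<Sum>k. pochhammer M (k + Suc K) / fact (k + Suc K) * (1/2) ^ (k + Suc K)))"
proof -
  define n where "n = Suc i"
  define z :: complex where "z = 1 / of_nat n"
  define p where "p = (\<lambda>k. pochhammer M k / fact k * (1/2 :: real) ^ k)"
  have n: "n \<ge> 2" "real n > 0" using i by (auto simp: n_def)
  have z: "norm z < 1" using n by (simp add: z_def norm_divide)
  have powr_k: "of_nat n powr (1 - s - of_nat k) = of_nat n powr (1 - s) * z ^ k" for k
    using n by (simp add: powr_diff z_def power_divide powr_nat')
  have "(\<lambda>k. ((1 - s) gchoose k) * z ^ k) sums (1 + z) powr (1 - s)"
    by (rule gen_binomial_complex[OF z])
  then have "(\<lambda>k. of_nat n powr (1 - s) * (((1 - s) gchoose k) * z ^ k)) sums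
      (of_nat n powr (1 - s) * (1 + z) powr (1 - s))"
    by (rule sums_mult)
  also have "of_nat n powr (1 - s) * (1 + z) powr (1 - s) = of_nat (Suc n) powr (1 - s)"
  proof -
    have eq: "1 + z = of_real (1 + 1 / real n)" by (simp add: z_def)
    have "of_nat n powr (1 - s) * (1 + z) powr (1 - s) = (of_nat n * (1 + z)) powr (1 - s)"
      unfolding eq using n by (subst powr_times_real) auto
    also have "of_nat n * (1 + z) = of_nat (Suc n)"
      using n by (simp add: z_def field_simps)
    finally show ?thesis .
  qed
  finally have sums: "(\<lambda>k. of_nat n powr (1 - s) * (((1 - s) gchoose k) * z ^ k)) sums
      of_nat (Suc n) powr (1 - s)" .
  have rem: "(\<lambda>k. of_nat n powr (1 - s) * (((1 - s) gchoose (k + Suc K)) * z ^ (k + Suc K))) sums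
      zeta_rem K i s"
    using sums_split_initial_segment[OF sums, of "Suc K"]
    by (simp add: zeta_rem_def powr_k n_def[symmetric] lessThan_Suc_atMost mult_ac
        del: of_nat_Suc)
  have sp: "summable (\<lambda>k. p (k + Suc K))"
    using summable_poch_half[OF M] unfolding p_def by (subst summable_iff_shift)
  have p0: "p k \<ge> 0" for k
    using M by (auto simp: p_def intro!: mult_nonneg_nonneg divide_nonneg_nonneg pochhammer_nonneg)
  have nn: "norm (of_nat n powr (1 - s) :: complex) = real n powr (1 - Re s)"
    using n by (simp add: norm_powr_real_powr)
  have term_le: "norm (of_nat n powr (1 - s) * (((1 - s) gchoose (k + Suc K)) * z ^ (k + Suc K)))
     \<le> real n powr - (Re s + real K) * 2 ^ Suc K * p (k + Suc K)" for k
  proof -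
    have "norm z ^ (k + Suc K) = (1 / real n) ^ k * (1 / real n) ^ Suc K"
      by (simp add: z_def norm_divide power_add)
    also have "\<dots> \<le> (1 / 2) ^ k * (1 / real n) ^ Suc K"
      using n by (intro mult_right_mono power_mono) (auto simp: field_simps)
    also have "\<dots> = 2 ^ Suc K * (1 / 2) ^ (k + Suc K) * (1 / real n) ^ Suc K"
      by (simp add: power_add power_divide)
    finally have zle: "norm z ^ (k + Suc K) \<le>
        2 ^ Suc K * (1 / 2) ^ (k + Suc K) * (1 / real n) ^ Suc K" .
    have "norm (of_nat n powr (1 - s) * (((1 - s) gchoose (k + Suc K)) * z ^ (k + Suc K)))
       = real n powr (1 - Re s) * (norm ((1 - s) gchoose (k + Suc K)) * norm z ^ (k + Suc K))"
      by (simp add: norm_mult norm_power nn)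
    also have "\<dots> \<le> real n powr (1 - Re s) * (pochhammer M (k + Suc K) / fact (k + Suc K) *
        (2 ^ Suc K * (1 / 2) ^ (k + Suc K) * (1 / real n) ^ Suc K))"
      using M by (intro mult_left_mono mult_mono norm_gchoose_le s zle)
        (auto intro!: divide_nonneg_nonneg pochhammer_nonneg)
    also have "\<dots> = (real n powr (1 - Re s) * (1 / real n) ^ Suc K) * 2 ^ Suc K * p (k + Suc K)"
      by (simp only: p_def mult_ac)
    also have "real n powr (1 - Re s) * (1 / real n) ^ Suc K = real n powr - (Re s + real K)"
    proof -
      have "(1 / real n) ^ Suc K = real n powr - real (Suc K)"
        using n by (simp add: powr_minus powr_realpow power_divide divide_simps del: of_nat_Suc power_Suc)
      then show ?thesis by (simp add: powr_add[symmetric])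
    qed
    finally show ?thesis .
  qed
  have "norm (zeta_rem K i s) =
      norm (\<Sum>k. of_nat n powr (1 - s) * (((1 - s) gchoose (k + Suc K)) * z ^ (k + Suc K)))"
    using rem by (simp add: sums_iff)
  also have "\<dots> \<le> (\<Sum>k. real n powr - (Re s + real K) * 2 ^ Suc K * p (k + Suc K))"
    by (rule norm_suminf_le[OF term_le]) (intro summable_mult sp)
  also have "\<dots> = real n powr - (Re s + real K) * 2 ^ Suc K * (\<Sum>k. p (k + Suc K))"
    by (rule suminf_mult[OF sp])
  finally show ?thesis by (simp only: n_def p_def mult.assoc)
qed

lemma holomorphic_gchoose:
  assumes "f holomorphic_on A"
  shows "(\<lambda>s. f s gchoose k) holomorphic_on A"
  unfolding gbinomial_prod_rev
  by (intro holomorphic_intros assms) auto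

lemma zeta_rem_series:
  shows zeta_rem_holomorphic:
      "(\<lambda>s. \<Sum>i. zeta_rem K i s) holomorphic_on {s. Re s > 1 - real K}"
    and zeta_rem_summable:
      "\<And>s. Re s > 1 - real K \<Longrightarrow> summable (\<lambda>i. zeta_rem K i s)"
proof -
  have hol: "zeta_rem K i holomorphic_on {s. Re s > 1 - real K}" for i
    unfolding zeta_rem_def
    by (intro holomorphic_intros holomorphic_gchoose) (auto simp del: of_nat_Suc)
  have bnd: "\<exists>g. summable g \<and>
     (\<forall>\<^sub>F i in sequentially. \<forall>s\<in>cball s0 d. norm (zeta_rem K i s) \<le> g i)"
    if d: "d > 0" "Re s0 - d > 1 - real K" for s0 d
  proof -
    define M where "M = norm (1 - s0) + d"
    have M: "M > 0" using d by (auto simp: M_def intro: add_nonneg_pos)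
    define S where "S = 2 ^ Suc K *
      (\<Sum>k. pochhammer M (k + Suc K) / fact (k + Suc K) * (1/2) ^ (k + Suc K))"
    have "summable (\<lambda>k. pochhammer M (k + Suc K) / fact (k + Suc K) * (1/2) ^ (k + Suc K))"
      using summable_poch_half[OF M] by (subst summable_iff_shift)
    then have "S \<ge> 0" unfolding S_def using M
      by (intro mult_nonneg_nonneg suminf_nonneg divide_nonneg_nonneg pochhammer_nonneg) auto
    show ?thesis
    proof (intro exI conjI eventually_sequentiallyI ballI)
      show "summable (\<lambda>i. real (Suc i) powr - (Re s0 - d + real K) * S)"
        by (intro summable_mult2 summable_powr_Suc) (use d in simp)
      fix i s assume i: "i \<ge> (1::nat)" and s: "s \<in> cball s0 d"
      have "norm (1 - s) \<le> M"
        using s norm_triangle_ineq[of "1 - s0" "s0 - s"] by (simp add: M_def dist_norm)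
      then have "norm (zeta_rem K i s) \<le> real (Suc i) powr - (Re s + real K) * S"
        unfolding S_def by (rule zeta_rem_bound[OF M _ i])
      also have "\<dots> \<le> real (Suc i) powr - (Re s0 - d + real K) * S"
        using cball_Re_ge[OF s] \<open>S \<ge> 0\<close> by (intro mult_right_mono powr_mono) auto
      finally show "norm (zeta_rem K i s) \<le> real (Suc i) powr - (Re s0 - d + real K) * S" .
    qed
  qed
  show "(\<lambda>s. \<Sum>i. zeta_rem K i s) holomorphic_on {s. Re s > 1 - real K}"
    by (rule holomorphic_suminf_Re_gt(1)[OF hol bnd])
  show "\<And>s. Re s > 1 - real K \<Longrightarrow> summable (\<lambda>i. zeta_rem K i s)"
    by (rule holomorphic_suminf_Re_gt(2)[OF hol bnd])
qed

definition zeta0 :: "complex \<Rightarrow> complex" where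
  "zeta0 s = (\<Sum>i. 1 / of_nat (Suc i) powr s)"

lemma zeta0_sums: "Re s > 1 \<Longrightarrow> (\<lambda>i. 1 / of_nat (Suc i) powr s) sums zeta0 s"
  unfolding zeta0_def by (rule summable_sums[OF zeta_series_summable])

lemma zeta0_recurrence:
  assumes s: "Re s > 1"
  shows "(s - 1) * zeta0 s = 1 -
    (\<Sum>k=2..Suc m. ((1 - s) gchoose (k - 1)) / of_nat k *
        ((s + of_nat (k - 1) - 1) * zeta0 (s + of_nat (k - 1)))) +
    (\<Sum>i. zeta_rem (Suc m) i s)"
proof -
  define K where "K = Suc m"
  define b :: "nat \<Rightarrow> complex" where "b i = of_nat (Suc i) powr (1 - s)" for i
  have "(\<lambda>i. complex_of_real (real (Suc i) powr (1 - Re s))) \<longlonglongrightarrow> of_real 0"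
    using s by (intro tendsto_of_real tendsto_neg_powr filterlim_compose[OF filterlim_real_sequentially filterlim_Suc]) auto
  then have "(\<lambda>i. norm (b i)) \<longlonglongrightarrow> 0"
    by (simp add: b_def norm_powr_real_powr tendsto_of_real_iff[where c = 0, simplified]
          del: of_nat_Suc)
  then have "b \<longlonglongrightarrow> 0" by (simp add: tendsto_norm_zero_iff)
  then have tele: "(\<lambda>i. b i - b (Suc i)) sums 1"
    using telescope_sums'[of b 0] by (simp add: b_def)
  have diff: "b i - b (Suc i) =
     - (\<Sum>k=1..K. ((1 - s) gchoose k) * (1 / of_nat (Suc i) powr (s + of_nat (k - 1))))
       - zeta_rem K i s" for i
  proof -
    have "(\<Sum>k\<le>K. ((1 - s) gchoose k) * of_nat (Suc i) powr (1 - s - of_nat k)) =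
       b i + (\<Sum>k=1..K. ((1 - s) gchoose k) * of_nat (Suc i) powr (1 - s - of_nat k))"
      by (simp add: atMost_atLeast0 sum.atLeast_Suc_atMost b_def del: of_nat_Suc)
    also have "(\<Sum>k=1..K. ((1 - s) gchoose k) * of_nat (Suc i) powr (1 - s - of_nat k)) =
       (\<Sum>k=1..K. ((1 - s) gchoose k) * (1 / of_nat (Suc i) powr (s + of_nat (k - 1))))"
    proof (rule sum.cong[OF refl])
      fix k assume "k \<in> {1..K}"
      then have "1 - s - of_nat k = - (s + of_nat (k - 1))" by (simp add: of_nat_diff)
      then show "((1 - s) gchoose k) * of_nat (Suc i) powr (1 - s - of_nat k) =
        ((1 - s) gchoose k) * (1 / of_nat (Suc i) powr (s + of_nat (k - 1)))"
        by (simp only: powr_minus_divide)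
    qed
    finally show ?thesis by (simp add: zeta_rem_def b_def del: of_nat_Suc)
  qed
  have "(\<lambda>i. - (\<Sum>k=1..K. ((1 - s) gchoose k) * (1 / of_nat (Suc i) powr (s + of_nat (k - 1))))
       - zeta_rem K i s) sums
     (- (\<Sum>k=1..K. ((1 - s) gchoose k) * zeta0 (s + of_nat (k - 1))) - (\<Sum>i. zeta_rem K i s))"
  proof (intro sums_diff sums_minus sums_sum sums_mult zeta0_sums summable_sums zeta_rem_summable)
    show "Re s > 1 - real K" using s by simp
    fix k
    show "1 < Re (s + of_nat (k - 1))" using s by simp
  qed
  with tele have "1 = - (\<Sum>k=1..K. ((1 - s) gchoose k) * zeta0 (s + of_nat (k - 1)))
      - (\<Sum>i. zeta_rem K i s)"
    unfolding diff by (rule sums_unique2)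
  also have "(\<Sum>k=1..K. ((1 - s) gchoose k) * zeta0 (s + of_nat (k - 1))) =
     (1 - s) * zeta0 s + (\<Sum>k=2..K. ((1 - s) gchoose k) * zeta0 (s + of_nat (k - 1)))"
    by (simp add: K_def sum.atLeast_Suc_atMost numeral_2_eq_2)
  also have "(\<Sum>k=2..K. ((1 - s) gchoose k) * zeta0 (s + of_nat (k - 1))) =
     - (\<Sum>k=2..K. ((1 - s) gchoose (k - 1)) / of_nat k *
        ((s + of_nat (k - 1) - 1) * zeta0 (s + of_nat (k - 1))))"
    unfolding sum_negf[symmetric]
  proof (rule sum.cong[OF refl])
    fix k assume "k \<in> {2..K}"
    then obtain j where k: "k = Suc j" by (cases k) auto
    have "of_nat (Suc j) * ((1 - s) gchoose Suc j) = (1 - s - of_nat j) * ((1 - s) gchoose j)"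
      using gbinomial_absorb_comp[of "1 - s" j] gbinomial_absorption[of j "1 - s"] by simp
    then have "((1 - s) gchoose k) = - (((1 - s) gchoose j) / of_nat k * (s + of_nat j - 1))"
      by (simp add: k divide_simps del: of_nat_Suc) (simp add: algebra_simps)
    then show "((1 - s) gchoose k) * zeta0 (s + of_nat (k - 1)) =
       - (((1 - s) gchoose (k - 1)) / of_nat k *
        ((s + of_nat (k - 1) - 1) * zeta0 (s + of_nat (k - 1))))"
      by (simp add: k)
  qed
  finally show ?thesis by (simp add: K_def algebra_simps)
qed

lemma zeta_continuation_halfplane:
  "\<exists>h. h holomorphic_on {s. Re s > 1 - real m} \<and> (\<forall>s. Re s > 1 \<longrightarrow> h s = (s - 1) * zeta0 s)"
proof (induction m)
  case 0
  have "(\<lambda>s. (s - 1) * zeta0 s) holomorphic_on {s. Re s > 1}"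
    unfolding zeta0_def by (intro holomorphic_intros zeta_series_holomorphic)
  then show ?case by auto
next
  case (Suc m)
  then obtain h where h: "h holomorphic_on {s. Re s > 1 - real m}"
      "\<And>s. Re s > 1 \<Longrightarrow> h s = (s - 1) * zeta0 s"
    by blast
  define h' where "h' s = 1 -
    (\<Sum>k=2..Suc m. ((1 - s) gchoose (k - 1)) / of_nat k * h (s + of_nat (k - 1))) +
    (\<Sum>i. zeta_rem (Suc m) i s)" for s
  have "(\<lambda>s. h (s + of_nat (k - 1))) holomorphic_on {s. Re s > 1 - real (Suc m)}"
    if "k \<in> {2..Suc m}" for k
  proof -
    have "(\<lambda>s. s + of_nat (k - 1)) holomorphic_on {s. Re s > 1 - real (Suc m)}"
      by (intro holomorphic_intros)
    moreover have "(\<lambda>s. s + of_nat (k - 1)) ` {s. Re s > 1 - real (Suc m)} \<subseteq> {s. Re s > 1 - real m}"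
      using that by (auto simp: of_nat_diff)
    ultimately show ?thesis
      using holomorphic_on_compose_gen[OF _ h(1)] by (simp only: o_def)
  qed
  then have "h' holomorphic_on {s. Re s > 1 - real (Suc m)}"
    unfolding h'_def
    by (intro holomorphic_intros holomorphic_gchoose zeta_rem_holomorphic) auto
  moreover have "h' s = (s - 1) * zeta0 s" if "Re s > 1" for s
    using zeta0_recurrence[OF that, of m] that by (simp add: h'_def h(2))
  ultimately show ?case by blast
qed

lemma is_riemann_zeta_unique:
  assumes "is_riemann_zeta f" "is_riemann_zeta g"
  shows "f = g"
proof
  fix s :: complex
  have eq: "f t = g t" if "Re t > 1" for t
    using assms that sums_unique2 unfolding is_riemann_zeta_def by blast
  show "f s = g s"
  proof (cases "s = 1")
    case False
    have "f s - g s = 0"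
    proof (rule analytic_continuation_open[of "{s. Re s > 1}" "- {1}" "\<lambda>s. f s - g s" "\<lambda>_. 0"])
      show "connected (- {1 :: complex})"
        by (rule connected_punctured_universe) simp
      show "{s :: complex. Re s > 1} \<noteq> {}"
        by (auto intro!: exI[of _ 2])
    qed (use assms False eq in
         \<open>auto simp: is_riemann_zeta_def open_Re_gt intro!: holomorphic_intros\<close>)
    then show ?thesis by simp
  qed (use assms in \<open>simp add: is_riemann_zeta_def\<close>)
qed

theorem ex1_is_riemann_zeta: "\<exists>!f. is_riemann_zeta f"
proof -
  obtain h where h: "\<And>m. h m holomorphic_on {s. Re s > 1 - real m}"
      "\<And>m s. Re s > 1 \<Longrightarrow> h m s = (s - 1) * zeta0 s"
    using zeta_continuation_halfplane by metis
  have agree: "h m s = h n s" if "m \<le> n" "Re s > 1 - real m" for m n s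
  proof (rule analytic_continuation_open[of "{s. Re s > 1}" "{s. Re s > 1 - real m}" "h m" "h n"])
    show "h n holomorphic_on {s. Re s > 1 - real m}"
      using h(1) by (rule holomorphic_on_subset) (use that in auto)
    show "{s :: complex. Re s > 1} \<noteq> {}"
      by (auto intro!: exI[of _ 2])
  qed (use that h in \<open>auto simp: open_Re_gt connected_Re_gt\<close>)
  define N where "N s = nat \<lceil>2 - Re s\<rceil>" for s
  define H where "H s = h (N s) s" for s
  have N: "Re s > 1 - real (N s)" for s
    unfolding N_def by linarith
  have H: "H s = h m s" if "Re s > 1 - real m" for s m
    unfolding H_def using agree[of m "N s" s] agree[of "N s" m s] that N[of s]
    by (metis nat_le_linear)
  have Hhol: "H holomorphic_on UNIV"
  proof -
    have "H field_differentiable at s" for s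
    proof -
      have "H holomorphic_on {t. Re t > 1 - real (N s)}"
        using h(1)[of "N s"] by (rule holomorphic_transform) (use H in auto)
      then show ?thesis
        using N[of s] by (auto intro: holomorphic_on_imp_differentiable_at[OF _ open_Re_gt])
    qed
    then show ?thesis
      by (auto simp: holomorphic_on_def intro: field_differentiable_at_within)
  qed
  define f where "f s = (if s = 1 then 0 else H s / (s - 1))" for s
  have "(\<lambda>s. H s / (s - 1)) holomorphic_on - {1}"
    by (intro holomorphic_intros holomorphic_on_subset[OF Hhol]) auto
  then have "f holomorphic_on - {1}"
    by (rule holomorphic_transform) (auto simp: f_def)
  moreover have "f s = zeta0 s" if "Re s > 1" for s
  proof -
    have "s \<noteq> 1" using that by auto
    moreover have "H s = (s - 1) * zeta0 s"
      using that by (simp add: H_def h(2))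
    ultimately show ?thesis by (simp add: f_def)
  qed
  ultimately have "is_riemann_zeta f"
    using zeta0_sums by (simp add: is_riemann_zeta_def f_def)
  then show ?thesis using is_riemann_zeta_unique by blast
qed

lemma is_riemann_zeta_riemann_zeta: "is_riemann_zeta riemann_zeta"
  unfolding riemann_zeta_def by (rule theI'[OF ex1_is_riemann_zeta])

end

theory Submission
  imports Defs "HOL-Probability.Sinc_Integral" "HOL-Number_Theory.Prime_Powers"
begin


text \<open>
  Write $L$ for the logarithmic derivative of $(s-1)\zeta(s)$ and $\Psi(x)$ for the integral of
  $\psi(t)-t$ over $[0,x]$. No information on the zeros beyond their location is used: under the
  Riemann Hypothesis $|\xi(\sigma+it)|$ increases with $\sigma \ge 1/2$, so $\Re(\xi'/\xi) \ge 0$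
  there, and $\Re L$ is nonnegative up to a small error. Poisson's formula on the line
  $\Re s = a > 1/2$ then bounds the mass of $|\Re L|$ near any height uniformly in $a$, although
  $L$ itself blows up as $a \to 1/2$. Since $\overline s = 2a - s$ on this line, Perron's formula
  expresses $\Psi(x)$ by $\Re L$ alone; letting $a \to 1/2$ gives $\Psi(x) = O(x^{3/2})$, and the
  same formula for the quotients $(\Psi((1+h)x)-\Psi(x))/(hx)$, with an exponential weight
  in $\log x$ and Fatou's lemma as $h \to 0$, gives the mean square bound. Passing from $\psi$ to $\theta$
  costs only $\psi(x)-\theta(x) \le 2\psi(\sqrt x)$.

  Conversely, $\Psi(x) = O(x^{3/2+\varepsilon})$, which follows from the mean square bound by the
  inequality of arithmetic and geometric means, makes
  the Dirichlet series with coefficients $\Lambda(n)-1$, summed twice by parts, converge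
  for $\Re s > 1/2+\varepsilon$. So $(s-1)\zeta(s)$ solves a linear differential equation with
  holomorphic coefficient there and has no zeros.
\<close>

section \<open>Integrals along vertical lines\<close>

text \<open>The difficulty is to reach the exponents 3/2 and 2 exactly, although the pointwise
  bounds for L on a line Re s = a deteriorate without limit as a tends to 1/2. Only one-sided
  information survives this limit: a lower bound for the real part with a constant independent of a,
  and the size of L on Re s = a + 1, where its Dirichlet series converges absolutely. The mass near
  height t may then grow like (1 + |t|)^(1/4); this power stands for a logarithm and leaves room
  under the kernel 1/(s(s + 1)), whose decay makes all line integrals converge absolutely.
  Monotonicity of |xi| comes from the maximum principle for xi(s - \<eta>)/xi(s + \<eta>). The
  polynomial growth which that principle demands is extracted from the zero-free half-plane for one
  fixed \<eta> at a time, and the resulting bound 1 is free of \<eta>. The mean square uses the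
  weight exp(-|u - U|) because its Fourier transform has modulus 2/(1 + v^2), which is again a
  Poisson kernel, so the same mass bound can be used a second time.\<close>

lemma nn_integral_even_real:
  fixes f :: "real \<Rightarrow> real"
  assumes [measurable]: "f \<in> borel_measurable borel"
  shows "(\<integral>\<^sup>+t. ennreal (f \<bar>t\<bar>) \<partial>lborel) \<le> 2 * (\<integral>\<^sup>+t. ennreal (f t) * indicator {0..} t \<partial>lborel)"
proof -
  have "(\<integral>\<^sup>+t. ennreal (f \<bar>t\<bar>) \<partial>lborel) \<le>
      (\<integral>\<^sup>+t. ennreal (f t) * indicator {0..} t + ennreal (f (-t)) * indicator {0..} (-t) \<partial>lborel)"
    by (intro nn_integral_mono) (auto simp: indicator_def abs_if)
  also have "\<dots> = (\<integral>\<^sup>+t. ennreal (f t) * indicator {0..} t \<partial>lborel) +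
      (\<integral>\<^sup>+t. ennreal (f (-t)) * indicator {0..} (-t) \<partial>lborel)"
    by (rule nn_integral_add) auto
  also have "(\<integral>\<^sup>+t. ennreal (f (-t)) * indicator {0..} (-t) \<partial>lborel) =
      (\<integral>\<^sup>+t. ennreal (f t) * indicator {0..} t \<partial>lborel)"
    using nn_integral_real_affine[of "\<lambda>t. ennreal (f t) * indicator {0..} t" "-1" 0] by simp
  finally show ?thesis by (simp add: mult_2)
qed

lemma integrable_decay:
  fixes p :: real
  assumes p: "p > 1"
  shows "integrable lborel (\<lambda>t::real. (1 + \<bar>t\<bar>) powr (-p))"
proof (rule integrableI_bounded)
  have "(\<integral>\<^sup>+t. ennreal ((1 + t) powr (-p)) * indicator {0..} t \<partial>lborel) =
      ennreal (0 - (1 + 0) powr (1 - p) / (1 - p))"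
  proof (rule nn_integral_FTC_atLeast)
    show "((\<lambda>t. (1 + t) powr (1 - p) / (1 - p)) has_real_derivative (1 + x) powr (-p)) (at x)"
      if "0 \<le> x" for x
    proof -
      have "((\<lambda>t. (1 + t) powr (1 - p) / (1 - p)) has_real_derivative (1 - p) * (1 + x) powr (1 - p - of_nat 1) * 1 / (1 - p)) (at x)"
        by (intro DERIV_cdivide DERIV_fun_powr) (use that in \<open>auto intro!: derivative_eq_intros\<close>)
      then show ?thesis using p by simp
    qed
    have "((\<lambda>t. (1 + t) powr (1 - p) / (1 - p)) \<longlongrightarrow> 0 / (1 - p)) at_top"
      using p by (intro tendsto_divide tendsto_neg_powr tendsto_const filterlim_tendsto_add_at_top[OF tendsto_const filterlim_ident]) auto
    then show "((\<lambda>t. (1 + t) powr (1 - p) / (1 - p)) \<longlongrightarrow> 0) at_top" by simp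
  qed auto
  then have fin: "(\<integral>\<^sup>+t. ennreal ((1 + t) powr (-p)) * indicator {0..} t \<partial>lborel) < \<infinity>" by simp
  have "(\<integral>\<^sup>+t. ennreal ((1 + \<bar>t\<bar>) powr (-p)) \<partial>lborel) \<le>
     2 * (\<integral>\<^sup>+t. ennreal ((1 + t) powr (-p)) * indicator {0..} t \<partial>lborel)"
    by (rule nn_integral_even_real) auto
  also have "\<dots> < \<infinity>" using fin by (simp add: ennreal_mult_less_top)
  finally show "(\<integral>\<^sup>+t. ennreal (norm ((1 + \<bar>t\<bar>) powr (-p))) \<partial>lborel) < \<infinity>" by simp
qed auto

lemma has_bochner_integral_inverse_quadratic:
  fixes e y :: real
  assumes e: "e > 0"
  shows "has_bochner_integral lborel (\<lambda>t. 1 / (e\<^sup>2 + (t - y)\<^sup>2)) (pi / e)"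
proof -
  have 1: "integrable lborel (\<lambda>x::real. inverse (1 + x\<^sup>2))"
    using integrable_inverse_1_plus_square by (simp add: set_integrable_def einterval_def)
  have 2: "integral\<^sup>L lborel (\<lambda>x::real. inverse (1 + x\<^sup>2)) = pi"
    using LBINT_inverse_1_plus_square
    by (simp add: interval_lebesgue_integral_def set_lebesgue_integral_def einterval_def)
  have "has_bochner_integral lborel (\<lambda>x::real. inverse (1 + x\<^sup>2)) pi"
    using 1 2 by (simp add: has_bochner_integral_iff)
  then have "has_bochner_integral lborel (\<lambda>x. inverse (1 + (- (y / e) + (1 / e) * x)\<^sup>2)) (pi /\<^sub>R \<bar>1 / e\<bar>)"
    using e by (subst lborel_has_bochner_integral_real_affine_iff[symmetric]) auto
  then have "has_bochner_integral lborel (\<lambda>x. (1 / e\<^sup>2) * inverse (1 + (- (y / e) + (1 / e) * x)\<^sup>2)) ((1 / e\<^sup>2) * (pi /\<^sub>R \<bar>1 / e\<bar>))"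
    by (rule has_bochner_integral_mult_right)
  moreover have "(1 / e\<^sup>2) * inverse (1 + (- (y / e) + (1 / e) * x)\<^sup>2) = 1 / (e\<^sup>2 + (x - y)\<^sup>2)" for x
  proof -
    have "- (y / e) + (1 / e) * x = (x - y) / e" by (simp add: diff_divide_distrib)
    then have "1 + (- (y / e) + (1 / e) * x)\<^sup>2 = (e\<^sup>2 + (x - y)\<^sup>2) / e\<^sup>2"
      using e by (simp add: power_divide add_divide_distrib)
    then show ?thesis using e by (simp add: divide_simps)
  qed
  moreover have "(1 / e\<^sup>2) * (pi /\<^sub>R \<bar>1 / e\<bar>) = pi / e"
    using e by (simp add: power2_eq_square)
  ultimately show ?thesis by simp
qed

text \<open>The measure is dt and not ds = i dt, so a residue enters with the factor 2 pi and
  without i.\<close>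

definition vline :: "(complex \<Rightarrow> complex) \<Rightarrow> real \<Rightarrow> complex" where
  "vline G c = (LINT t|lborel. G (Complex c t))"

lemma continuous_on_Complex_line: "continuous_on UNIV (\<lambda>t. Complex c t)"
proof -
  have "Complex c t = of_real c + \<i> * of_real t" for t by (simp add: complex_eq_iff)
  then show ?thesis by (simp add: continuous_intros)
qed

lemma borel_measurable_vline:
  assumes "G holomorphic_on S" "\<And>t. Complex c t \<in> S"
  shows "(\<lambda>t. G (Complex c t)) \<in> borel_measurable borel"
  by (intro borel_measurable_continuous_onI continuous_on_compose2[OF holomorphic_on_imp_continuous_on[OF assms(1)]]
      continuous_on_Complex_line) (use assms(2) in auto)

lemma integrable_vline:
  fixes G :: "complex \<Rightarrow> complex"
  assumes "(\<lambda>t. G (Complex c t)) \<in> borel_measurable borel"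
    and "\<And>t. norm (G (Complex c t)) \<le> K * (1 + \<bar>t\<bar>) powr (-p)" and "p > 1"
  shows "integrable lborel (\<lambda>t. G (Complex c t))"
proof (rule Bochner_Integration.integrable_bound)
  show "integrable lborel (\<lambda>t. \<bar>K\<bar> * (1 + \<bar>t\<bar>) powr (-p))"
    using integrable_decay[OF assms(3)] by simp
  show "AE t in lborel. norm (G (Complex c t)) \<le> norm (\<bar>K\<bar> * (1 + \<bar>t\<bar>) powr (-p))"
    using assms(2) by (intro AE_I2 order_trans[OF assms(2)]) (auto simp: abs_mult intro!: mult_right_mono)
qed (use assms in auto)

lemma Complex_line_derivative:
  assumes "(P has_field_derivative g) (at (Complex c t))"
  shows "((\<lambda>t. P (Complex c t)) has_vector_derivative \<i> * g) (at t within A)"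
proof -
  have *: "Complex c t = of_real c + \<i> * of_real t" for t by (simp add: complex_eq_iff)
  have "((\<lambda>t. of_real c + \<i> * of_real t) has_vector_derivative \<i>) (at t within A)"
    by (auto intro!: derivative_eq_intros)
  then have "((\<lambda>t. Complex c t) has_vector_derivative \<i>) (at t within A)"
    by (simp only: *)
  from field_vector_diff_chain_within[OF this, of P g] assms show ?thesis
    by (simp add: o_def has_field_derivative_at_within)
qed

text \<open>A primitive \<open>P\<close> of \<open>G\<close> exists on the convex set, so the part
  of each line with |t| <= n is a difference of values of \<open>P\<close>. The two differences
  disagree by the increments of \<open>P\<close> along the horizontal segments at heights n and -n,
  and the mean value inequality bounds these by the decay of \<open>G\<close> there. The exponent
  -3/2 makes the lines integrable as well as the segments negligible.\<close>

lemma vline_shift: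
  assumes S: "open S" "convex S" and G: "G holomorphic_on S"
    and bc: "b \<le> c" and sub: "\<And>s. b \<le> Re s \<Longrightarrow> Re s \<le> c \<Longrightarrow> s \<in> S"
    and bnd: "\<And>s. b \<le> Re s \<Longrightarrow> Re s \<le> c \<Longrightarrow> norm (G s) \<le> K * (1 + \<bar>Im s\<bar>) powr (-3/2)"
  shows "vline G b = vline G c"
proof -
  obtain P where P: "\<And>x. x \<in> S \<Longrightarrow> (P has_field_derivative G x) (at x)"
    using holomorphic_convex_primitive'[OF S(2,1) G] at_within_open[OF _ S(1)] by metis
  have int: "integrable lborel (\<lambda>t. G (Complex x t))" if "b \<le> x" "x \<le> c" for x
    by (rule integrable_vline[where K=K and p="3/2"])
       (use that sub bnd[of "Complex x _"] in \<open>auto intro!: borel_measurable_vline[OF G]\<close>)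
  define I where "I x n = (LINT t|lborel. indicator {- real n..real n} t *\<^sub>R G (Complex x t))" for x n
  have lim: "I x \<longlonglongrightarrow> vline G x" if x: "b \<le> x" "x \<le> c" for x
    unfolding I_def vline_def
  proof (rule integral_dominated_convergence)
    show "integrable lborel (\<lambda>t. norm (G (Complex x t)))" using int[OF x] by simp
    show "AE t in lborel. (\<lambda>n. indicator {- real n..real n} t *\<^sub>R G (Complex x t)) \<longlonglongrightarrow> G (Complex x t)"
    proof (rule AE_I2, rule tendsto_eventually)
      fix t :: real
      show "\<forall>\<^sub>F n in sequentially. indicator {- real n..real n} t *\<^sub>R G (Complex x t) = G (Complex x t)"
        using eventually_ge_at_top[of "nat \<lceil>\<bar>t\<bar>\<rceil>"]
      proof eventually_elim
        case (elim n)
        then have "\<bar>t\<bar> \<le> real n" by linarith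
        then show ?case by (auto simp: indicator_def)
      qed
    qed
  qed (use int[OF x] in \<open>auto simp: indicator_def intro!: borel_measurable_integrable\<close>)
  have FTC: "\<i> * I x n = P (Complex x (real n)) - P (Complex x (- real n))" if x: "b \<le> x" "x \<le> c" for x n
  proof -
    have "(LINT t|lborel. indicator {- real n..real n} t *\<^sub>R (\<i> * G (Complex x t))) =
        P (Complex x (real n)) - P (Complex x (- real n))"
    proof (rule integral_FTC_atLeastAtMost)
      show "((\<lambda>t. P (Complex x t)) has_vector_derivative \<i> * G (Complex x t)) (at t within {- real n..real n})" for t
        using x sub by (intro Complex_line_derivative P) auto
      show "continuous_on {- real n..real n} (\<lambda>t. \<i> * G (Complex x t))"
        using x sub by (intro continuous_intros continuous_on_compose2[OF holomorphic_on_imp_continuous_on[OF G]]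
          continuous_on_subset[OF continuous_on_Complex_line]) auto
    qed auto
    moreover have "(\<lambda>t. indicator {- real n..real n} t *\<^sub>R (\<i> * G (Complex x t))) =
        (\<lambda>t. \<i> * (indicator {- real n..real n} t *\<^sub>R G (Complex x t)))"
      by (auto simp: indicator_def)
    ultimately have "(LINT t|lborel. \<i> * (indicator {- real n..real n} t *\<^sub>R G (Complex x t))) =
        P (Complex x (real n)) - P (Complex x (- real n))" by (simp only:)
    then show ?thesis by (simp only: I_def integral_mult_right_zero)
  qed
  have hor: "norm (P (Complex c y) - P (Complex b y)) \<le> \<bar>K\<bar> * (1 + \<bar>y\<bar>) powr (-3/2) * (c - b)" for y
  proof -
    define T where "T = {s. b \<le> Re s \<and> Re s \<le> c \<and> Im s = y}"
    have "convex T"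
    proof -
      have "T = {s. Re s \<ge> b} \<inter> {s. Re s \<le> c} \<inter> ({s. Im s \<ge> y} \<inter> {s. Im s \<le> y})"
        by (auto simp: T_def)
      then show ?thesis
        by (simp only:) (intro convex_Int convex_halfspace_Re_ge convex_halfspace_Re_le
          convex_halfspace_Im_ge convex_halfspace_Im_le)
    qed
    then have "norm (P (Complex c y) - P (Complex b y)) \<le> \<bar>K\<bar> * (1 + \<bar>y\<bar>) powr (-3/2) * norm (Complex c y - Complex b y)"
    proof (rule field_differentiable_bound)
      fix s assume "s \<in> T"
      then show "(P has_field_derivative G s) (at s within T)"
        using sub by (intro has_field_derivative_at_within[OF P]) (auto simp: T_def)
      have "norm (G s) \<le> K * (1 + \<bar>Im s\<bar>) powr (-3/2)" using \<open>s \<in> T\<close> by (intro bnd) (auto simp: T_def)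
      also have "\<dots> \<le> \<bar>K\<bar> * (1 + \<bar>y\<bar>) powr (-3/2)" using \<open>s \<in> T\<close> by (auto simp: T_def intro!: mult_right_mono)
      finally show "norm (G s) \<le> \<bar>K\<bar> * (1 + \<bar>y\<bar>) powr (-3/2)" .
    qed (use bc in \<open>auto simp: T_def\<close>)
    moreover have "norm (Complex c y - Complex b y) = c - b"
      using bc by (simp add: cmod_def)
    ultimately show ?thesis by simp
  qed
  define E where "E n = \<bar>K\<bar> * (1 + real n) powr (-3/2) * (c - b)" for n
  have "norm (I c n - I b n) \<le> 2 * E n" for n
  proof -
    have "\<i> * (I c n - I b n) = (P (Complex c (real n)) - P (Complex b (real n))) -
       (P (Complex c (- real n)) - P (Complex b (- real n)))"
      using FTC[of c n] FTC[of b n] bc by (simp add: algebra_simps)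
    moreover have "norm (\<i> * (I c n - I b n)) = norm (I c n - I b n)" by (simp add: norm_mult)
    ultimately have "norm (I c n - I b n) = norm ((P (Complex c (real n)) - P (Complex b (real n))) -
       (P (Complex c (- real n)) - P (Complex b (- real n))))" by simp
    also have "\<dots> \<le> norm (P (Complex c (real n)) - P (Complex b (real n))) +
       norm (P (Complex c (- real n)) - P (Complex b (- real n)))"
      by (rule norm_triangle_ineq4)
    also have "\<dots> \<le> E n + E n" using hor[of "real n"] hor[of "- real n"] unfolding E_def by (intro add_mono) auto
    finally show ?thesis by simp
  qed
  moreover have "(\<lambda>n. 2 * E n) \<longlonglongrightarrow> 2 * (\<bar>K\<bar> * 0 * (c - b))" unfolding E_def
    by (intro tendsto_intros tendsto_neg_powr filterlim_tendsto_add_at_top[OF tendsto_const filterlim_real_sequentially]) auto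
  ultimately have "(\<lambda>n. I c n - I b n) \<longlonglongrightarrow> 0"
    using Lim_null_comparison[of "\<lambda>n. I c n - I b n" "\<lambda>n. 2 * E n" sequentially] by simp
  moreover have "(\<lambda>n. I c n - I b n) \<longlonglongrightarrow> vline G c - vline G b"
    using bc by (intro tendsto_diff lim) auto
  ultimately show ?thesis using LIMSEQ_unique by fastforce
qed

lemma abs_Im_le_norm_diff: "\<bar>Im s - Im p\<bar> \<le> norm (s - p)"
  using abs_Im_le_cmod[of "s - p"] by simp

text \<open>Here \<open>q\<close> is the mirror image of \<open>p\<close> in the line Re s = b, and
  \<open>r\<close> equals 1/(s - p) - 1/(s - q). On that line \<open>r\<close> is a negative
  multiple of a Cauchy density, so its integral is explicit; to the right of \<open>p\<close> it is
  holomorphic with quadratic decay, so the line can be moved to infinity. The pair is the model pole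
  from which \<open>vline_pole\<close> derives the residue theorem.\<close>

lemma vline_inverse_pair:
  assumes "d > 0" and p: "Re p = b + d" and q: "q = Complex (b - d) (Im p)" and c: "c > Re p"
  defines "r \<equiv> (\<lambda>s. of_real (2 * d) / ((s - p) * (s - q)))"
  shows "integrable lborel (\<lambda>t. r (Complex b t))" "vline r b = - of_real (2 * pi)"
    "integrable lborel (\<lambda>t. r (Complex c t))" "vline r c = 0"
proof -
  have b: "r (Complex b t) = of_real (- 2 * d * (1 / (d\<^sup>2 + (t - Im p)\<^sup>2)))" for t
  proof -
    have 1: "Complex b t - p = Complex (-d) (t - Im p)" "Complex b t - q = Complex d (t - Im p)"
      using p q by (auto simp: complex_eq_iff)
    have "Complex (-d) (t - Im p) * Complex d (t - Im p) = - of_real (d\<^sup>2 + (t - Im p)\<^sup>2)"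
      by (simp add: complex_eq_iff power2_eq_square)
    then have "r (Complex b t) = of_real (2 * d) / of_real (- (d\<^sup>2 + (t - Im p)\<^sup>2))"
      by (simp only: r_def 1 of_real_minus)
    also have "\<dots> = of_real (2 * d / (- (d\<^sup>2 + (t - Im p)\<^sup>2)))" by (simp only: of_real_divide)
    also have "2 * d / (- (d\<^sup>2 + (t - Im p)\<^sup>2)) = - 2 * d * (1 / (d\<^sup>2 + (t - Im p)\<^sup>2))"
      by (simp only: minus_divide_right[symmetric]) simp
    finally show ?thesis .
  qed
  have "has_bochner_integral lborel (\<lambda>t. complex_of_real (- 2 * d * (1 / (d\<^sup>2 + (t - Im p)\<^sup>2))))
       (of_real (- 2 * d * (pi / d)))"
    by (intro has_bochner_integral_of_real has_bochner_integral_mult_right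
        has_bochner_integral_inverse_quadratic) (use assms in auto)
  then show "integrable lborel (\<lambda>t. r (Complex b t))" "vline r b = - of_real (2 * pi)"
    using \<open>d > 0\<close> by (simp_all add: b has_bochner_integral_iff vline_def)
  have hol: "r holomorphic_on {s. Re s > Re p}"
    unfolding r_def using p q \<open>d > 0\<close> by (intro holomorphic_intros) auto
  have rb: "norm (r (Complex x t)) \<le> 2 * d * (1 / ((x - Re p)\<^sup>2 + (t - Im p)\<^sup>2))" if "x > Re p" for x t
  proof -
    have 1: "norm (Complex x t - p) ^ 2 = (x - Re p)\<^sup>2 + (t - Im p)\<^sup>2" by (simp add: cmod_def)
    have "norm (Complex x t - p) ^ 2 \<le> norm (Complex x t - q) ^ 2"
      using that p q \<open>d > 0\<close> by (simp add: cmod_def power_mono)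
    then have "norm (Complex x t - p) \<le> norm (Complex x t - q)" by (rule power2_le_imp_le) simp
    then have "norm (Complex x t - p) * norm (Complex x t - p) \<le> norm (Complex x t - p) * norm (Complex x t - q)"
      by (rule mult_left_mono) simp
    moreover have "norm (Complex x t - p) * norm (Complex x t - p) > 0"
      using that by (auto simp: complex_eq_iff)
    ultimately show ?thesis
      using \<open>d > 0\<close> unfolding 1[symmetric] r_def
      by (simp add: norm_divide norm_mult power2_eq_square frac_le)
  qed
  have int: "integrable lborel (\<lambda>t. r (Complex x t))" if x: "x > Re p" for x
  proof (rule Bochner_Integration.integrable_bound)
    show "integrable lborel (\<lambda>t. 2 * d * (1 / ((x - Re p)\<^sup>2 + (t - Im p)\<^sup>2)))"
      using has_bochner_integral_inverse_quadratic[of "x - Re p" "Im p"] x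
      by (intro integrable_mult_right) (auto simp: has_bochner_integral_iff)
    show "(\<lambda>t. r (Complex x t)) \<in> borel_measurable lborel"
      using x by (auto intro!: borel_measurable_vline[OF hol])
    show "AE t in lborel. norm (r (Complex x t)) \<le> norm (2 * d * (1 / ((x - Re p)\<^sup>2 + (t - Im p)\<^sup>2)))"
      using rb[OF x] \<open>d > 0\<close> by (intro AE_I2) (auto intro: order_trans)
  qed
  show "integrable lborel (\<lambda>t. r (Complex c t))" by (rule int[OF c])
  have nrm: "norm (vline r x) \<le> 2 * d * (pi / (x - Re p))" if x: "x > Re p" for x
  proof -
    have hi: "has_bochner_integral lborel (\<lambda>t. 2 * d * (1 / ((x - Re p)\<^sup>2 + (t - Im p)\<^sup>2))) (2 * d * (pi / (x - Re p)))"
      using x by (intro has_bochner_integral_mult_right has_bochner_integral_inverse_quadratic) auto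
    have "norm (vline r x) \<le> (LINT t|lborel. norm (r (Complex x t)))"
      unfolding vline_def by (rule integral_norm_bound)
    also have "\<dots> \<le> (LINT t|lborel. 2 * d * (1 / ((x - Re p)\<^sup>2 + (t - Im p)\<^sup>2)))"
      using hi int[OF x] rb[OF x] by (intro integral_mono) (auto simp: has_bochner_integral_iff)
    finally show ?thesis using hi by (simp add: has_bochner_integral_iff)
  qed
  have sh: "vline r c = vline r x" if x: "c \<le> x" for x
  proof (rule vline_shift[OF open_Re_gt convex_halfspace_Re_gt hol x])
    \<comment> \<open>On Re s >= c both |s - p| >= \<delta> and |s - p| >= |Im s - Im p| hold;
      combined they give a lower bound that is linear in 1 + |Im s|.\<close>
    define \<delta> where "\<delta> = min 1 (c - Re p)"
    have \<delta>: "0 < \<delta>" "\<delta> \<le> 1" "\<delta> \<le> c - Re p" using c by (auto simp: \<delta>_def)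
    fix s assume s: "c \<le> Re s" "Re s \<le> x"
    show "s \<in> {s. Re s > Re p}" using s c by simp
    define m where "m = (\<delta> / (2 + \<bar>Im p\<bar>))"
    have m: "m > 0" using \<delta> by (simp add: m_def add_pos_nonneg)
    have "m * (1 + \<bar>Im s\<bar>) \<le> norm (s - p)"
    proof -
      have "1 + \<bar>Im s\<bar> \<le> (1 + \<bar>Im p\<bar>) + \<bar>Im s - Im p\<bar>" by linarith
      then have "\<delta> * (1 + \<bar>Im s\<bar>) \<le> \<delta> * (1 + \<bar>Im p\<bar>) + \<delta> * \<bar>Im s - Im p\<bar>"
        using \<delta> by (simp add: distrib_left[symmetric])
      also have "\<dots> \<le> norm (s - p) * (1 + \<bar>Im p\<bar>) + 1 * norm (s - p)"
        using \<delta> s abs_Im_le_norm_diff[of s p] complex_Re_le_cmod[of "s - p"]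
        by (intro add_mono mult_mono) auto
      also have "\<dots> = norm (s - p) * (2 + \<bar>Im p\<bar>)" by (simp add: algebra_simps)
      finally have "\<delta> * (1 + \<bar>Im s\<bar>) / (2 + \<bar>Im p\<bar>) \<le> norm (s - p)"
        by (subst pos_divide_le_eq) (auto simp: add_pos_nonneg)
      then show ?thesis by (simp add: m_def)
    qed
    then have "m\<^sup>2 * (1 + \<bar>Im s\<bar>)\<^sup>2 \<le> (norm (s - p))\<^sup>2"
      using m power_mono[of "m * (1 + \<bar>Im s\<bar>)" "norm (s - p)" 2] by (simp add: power_mult_distrib)
    also have "\<dots> = (Re s - Re p)\<^sup>2 + (Im s - Im p)\<^sup>2" by (simp add: cmod_def)
    finally have 1: "m\<^sup>2 * (1 + \<bar>Im s\<bar>)\<^sup>2 \<le> (Re s - Re p)\<^sup>2 + (Im s - Im p)\<^sup>2" .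
    have "norm (r s) \<le> 2 * d * (1 / ((Re s - Re p)\<^sup>2 + (Im s - Im p)\<^sup>2))"
      using rb[of "Re s" "Im s"] s c by simp
    also have "\<dots> \<le> 2 * d * (1 / (m\<^sup>2 * (1 + \<bar>Im s\<bar>)\<^sup>2))"
      using 1 m \<open>d > 0\<close> by (intro mult_left_mono frac_le) auto
    also have "\<dots> = 2 * d / m\<^sup>2 * (1 + \<bar>Im s\<bar>) powr (-2)"
      by (simp add: powr_minus divide_simps)
    also have "\<dots> \<le> 2 * d / m\<^sup>2 * (1 + \<bar>Im s\<bar>) powr (-3/2)"
      using \<open>d > 0\<close> by (intro mult_left_mono powr_mono) auto
    finally show "norm (r s) \<le> 2 * d / m\<^sup>2 * (1 + \<bar>Im s\<bar>) powr (-3/2)" .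
  qed
  have "(\<lambda>n. 2 * d * (pi / (real n - Re p))) \<longlonglongrightarrow> 2 * d * 0"
    by (intro tendsto_mult tendsto_const real_tendsto_divide_at_top[OF tendsto_const])
       (use filterlim_tendsto_add_at_top[OF tendsto_const[of "- Re p"] filterlim_real_sequentially] in simp)
  moreover have "\<forall>\<^sub>F n in sequentially. norm (vline r c) \<le> 2 * d * (pi / (real n - Re p))"
    using eventually_ge_at_top[of "nat \<lceil>c\<rceil>"]
  proof eventually_elim
    case (elim n)
    then have "c \<le> real n" by linarith
    then show ?case using sh[of "real n"] nrm[of "real n"] c by simp
  qed
  ultimately have "norm (vline r c) \<le> 2 * d * 0"
    by (intro tendsto_lowerbound[where F = sequentially]) auto
  then show "vline r c = 0" by simp
qed

text \<open>The model pole is split off: P(s)/(s - p) = G(s) + P(p) r(s), where \<open>G\<close> has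
  a removable singularity at \<open>p\<close> because the numerator \<open>N\<close> vanishes there
  (p - q = 2d). The integrals of \<open>G\<close> over both lines agree by
  \<open>vline_shift\<close>, and those of \<open>r\<close> are -2 pi on the left and 0 on the
  right.\<close>

lemma vline_pole:
  assumes S: "open S" "convex S" and P: "P holomorphic_on S"
    and bc: "b < Re p" "Re p < c" and sub: "\<And>s. b \<le> Re s \<Longrightarrow> Re s \<le> c \<Longrightarrow> s \<in> S"
    and bnd: "\<And>s. b \<le> Re s \<Longrightarrow> Re s \<le> c \<Longrightarrow> norm (P s) \<le> K * (1 + \<bar>Im s\<bar>) powr (-1/2)"
  shows "vline (\<lambda>s. P s / (s - p)) c - vline (\<lambda>s. P s / (s - p)) b = of_real (2 * pi) * P p"
proof -
  define d where "d = Re p - b"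
  have d: "d > 0" using bc by (simp add: d_def)
  define q where "q = Complex (b - d) (Im p)"
  define S' where "S' = S \<inter> {s. Re s > b - d}"
  have S': "open S'" "convex S'" unfolding S'_def using S
    by (auto intro!: open_Int convex_Int open_halfspace_Re_gt convex_halfspace_Re_gt)
  have sub': "s \<in> S'" if "b \<le> Re s" "Re s \<le> c" for s using sub that d by (auto simp: S'_def)
  define N where "N s = P s - P p * of_real (2 * d) / (s - q)" for s
  have N: "N holomorphic_on S'" unfolding N_def
    using holomorphic_on_subset[OF P, of S'] by (intro holomorphic_intros) (auto simp: S'_def q_def)
  have pq: "p - q = of_real (2 * d)" by (simp add: q_def d_def complex_eq_iff)
  have Np: "N p = 0" using pq d by (simp add: N_def)
  define G where "G s = (if s = p then deriv N p else (N s - N p) / (s - p))" for s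
  have G: "G holomorphic_on S'" unfolding G_def by (rule pole_lemma_open[OF N S'(1)])
  define r where "r = (\<lambda>s. of_real (2 * d) / ((s - p) * (s - q)))"
  have pd: "Re p = b + d" by (simp add: d_def)
  have r: "integrable lborel (\<lambda>t. r (Complex b t))" "vline r b = - of_real (2 * pi)"
    "integrable lborel (\<lambda>t. r (Complex c t))" "vline r c = 0"
    unfolding r_def by (rule vline_inverse_pair[OF d pd q_def bc(2)])+
  have dec: "P s / (s - p) = G s + P p * r s" if "s \<noteq> p" "s \<noteq> q" for s
  proof -
    have "G s = N s / (s - p)" using that by (simp add: G_def Np)
    then show ?thesis by (simp add: N_def r_def diff_divide_distrib mult.commute)
  qed
  \<comment> \<open>Near \<open>p\<close> the quotient gives no usable bound, and compactness of the
    box \<open>C\<close> takes its place; where |Im s - Im p| > 1 the denominators are at least a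
    constant times 1 + |Im s|.\<close>
  define C where "C = {s. b \<le> Re s \<and> Re s \<le> c \<and> Im p - 1 \<le> Im s \<and> Im s \<le> Im p + 1}"
  have "C = cbox (Complex b (Im p - 1)) (Complex c (Im p + 1))"
    by (auto simp: C_def in_cbox_complex_iff)
  then have "compact C" by simp
  moreover have "C \<subseteq> S'" using sub' by (auto simp: C_def)
  ultimately have "bounded (G ` C)"
    by (intro compact_imp_bounded compact_continuous_image holomorphic_on_imp_continuous_on[OF holomorphic_on_subset[OF G]])
  then obtain M where M: "\<And>s. s \<in> C \<Longrightarrow> norm (G s) \<le> M" unfolding bounded_iff by auto
  define k where "k = 2 + \<bar>Im p\<bar>"
  have k: "k > 0" by (simp add: k_def add_pos_nonneg)
  define K' where "K' = max 0 M * k powr (3/2) + (\<bar>K\<bar> * k + norm (P p) * (2 * d) * k\<^sup>2)"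
  have Gb: "norm (G s) \<le> K' * (1 + \<bar>Im s\<bar>) powr (-3/2)" if s: "b \<le> Re s" "Re s \<le> c" for s
  proof (cases "\<bar>Im s - Im p\<bar> \<le> 1")
    case True
    then have "s \<in> C" using s by (auto simp: C_def)
    then have "norm (G s) \<le> max 0 M * 1" using M[of s] by simp
    also have "\<dots> \<le> max 0 M * (k powr (3/2) * (1 + \<bar>Im s\<bar>) powr (-3/2))"
    proof (rule mult_left_mono)
      have "1 + \<bar>Im s\<bar> \<le> k" using True by (simp add: k_def)
      then have "k powr (-3/2) \<le> (1 + \<bar>Im s\<bar>) powr (-3/2)" by (intro powr_mono2') auto
      then have "k powr (3/2) * k powr (-3/2) \<le> k powr (3/2) * (1 + \<bar>Im s\<bar>) powr (-3/2)"
        by (rule mult_left_mono) simp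
      then show "1 \<le> k powr (3/2) * (1 + \<bar>Im s\<bar>) powr (-3/2)"
        using k by (simp add: powr_add[symmetric])
    qed simp
    also have "\<dots> = max 0 M * k powr (3/2) * (1 + \<bar>Im s\<bar>) powr (-3/2)" by simp
    also have "\<dots> \<le> K' * (1 + \<bar>Im s\<bar>) powr (-3/2)" unfolding K'_def
      using k d by (intro mult_right_mono) auto
    finally show ?thesis .
  next
    case False
    define u where "u = 1 + \<bar>Im s\<bar>"
    have u: "u \<ge> 1" by (simp add: u_def)
    have nz: "s \<noteq> p" "s \<noteq> q" using False by (auto simp: q_def)
    have uk: "u \<le> k * \<bar>Im s - Im p\<bar>"
    proof -
      have "u \<le> (1 + \<bar>Im p\<bar>) * 1 + \<bar>Im s - Im p\<bar>" unfolding u_def mult_1_right by linarith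
      also have "\<dots> \<le> (1 + \<bar>Im p\<bar>) * \<bar>Im s - Im p\<bar> + \<bar>Im s - Im p\<bar>"
        using False by (intro add_mono mult_left_mono) auto
      finally show ?thesis by (simp add: k_def algebra_simps)
    qed
    have inv: "1 / norm (s - z) \<le> k / u" if "Im z = Im p" for z
    proof -
      have "u \<le> k * norm (s - z)"
        using uk abs_Im_le_norm_diff[of s z] k that by (auto intro: order_trans mult_left_mono)
      moreover have "norm (s - z) > 0" using False that by auto
      ultimately show ?thesis using u by (simp add: divide_simps mult.commute)
    qed
    have "G s = N s / (s - p)" using nz by (simp add: G_def Np)
    then have "norm (G s) = norm (P s - P p * of_real (2 * d) / (s - q)) * (1 / norm (s - p))"
      by (simp add: N_def norm_divide)
    also have "\<dots> \<le> (norm (P s) + norm (P p) * (2 * d) * (1 / norm (s - q))) * (1 / norm (s - p))"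
      using norm_triangle_ineq4[of "P s" "P p * of_real (2 * d) / (s - q)"] d
      by (intro mult_right_mono) (auto simp: norm_divide norm_mult)
    also have "\<dots> \<le> (\<bar>K\<bar> * u powr (-1/2) + norm (P p) * (2 * d) * (k / u)) * (k / u)"
    proof (intro mult_mono add_mono mult_left_mono inv)
      show "norm (P s) \<le> \<bar>K\<bar> * u powr (-1/2)"
        using bnd[OF s] unfolding u_def by (rule order_trans) (auto intro!: mult_right_mono)
    qed (use d k u in \<open>auto simp: q_def intro!: add_nonneg_nonneg\<close>)
    also have "\<dots> = \<bar>K\<bar> * k * (u powr (-1/2) / u) + norm (P p) * (2 * d) * k\<^sup>2 * (1 / u\<^sup>2)"
      by (simp add: algebra_simps power2_eq_square)
    also have "u powr (-1/2) / u = u powr (-3/2)"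
      using u powr_diff[of u "-1/2" 1] by simp
    finally have G1: "norm (G s) \<le> \<bar>K\<bar> * k * u powr (-3/2) + norm (P p) * (2 * d) * k\<^sup>2 * (1 / u\<^sup>2)" .
    have "1 / u\<^sup>2 \<le> u powr (-3/2)"
    proof -
      have "1 / u\<^sup>2 = u powr (-2)" using u by (simp add: powr_minus divide_simps)
      also have "\<dots> \<le> u powr (-3/2)" using u by (intro powr_mono) auto
      finally show ?thesis .
    qed
    then have "norm (P p) * (2 * d) * k\<^sup>2 * (1 / u\<^sup>2) \<le> norm (P p) * (2 * d) * k\<^sup>2 * u powr (-3/2)"
      using d k by (intro mult_left_mono) auto
    with G1 have "norm (G s) \<le> (\<bar>K\<bar> * k + norm (P p) * (2 * d) * k\<^sup>2) * u powr (-3/2)"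
      by (simp only: distrib_right)
    also have "\<dots> \<le> K' * u powr (-3/2)" unfolding K'_def by (intro mult_right_mono) auto
    finally show ?thesis by (simp add: u_def)
  qed
  have sh: "vline G b = vline G c"
    by (rule vline_shift[OF S' G _ sub' Gb]) (use bc in auto)
  have intG: "integrable lborel (\<lambda>t. G (Complex x t))" if "b \<le> x" "x \<le> c" for x
    by (rule integrable_vline[where K=K' and p="3/2"])
       (use that sub' Gb[of "Complex x _"] in \<open>auto intro!: borel_measurable_vline[OF G]\<close>)
  have *: "vline (\<lambda>s. P s / (s - p)) x = vline G x + P p * vline r x"
    if "x = b \<or> x = c" for x
  proof -
    have "P (Complex x t) / (Complex x t - p) = G (Complex x t) + P p * r (Complex x t)" for t
      using that bc d by (intro dec) (auto simp: q_def complex_eq_iff)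
    then show ?thesis
      unfolding vline_def using that r(1,3) intG[of x] bc by (auto simp: integral_add)
  qed
  show ?thesis using *[of b] *[of c] sh r by simp
qed

text \<open>Moving the line to the far left crosses 0 with residue F(0) and -1 with residue -F(-1),
  and the integrals over the far lines tend to 0. Since \<open>F\<close> may grow like (1 + |Im
  s|)^(1/4), the kernel 1/(s(s + 1)) leaves the decay exponent -7/4, which is weakened to
  -3/2.\<close>

lemma vline_two_poles:
  assumes F: "F holomorphic_on {s. Re s < a'}" and a: "0 < a" "a < a'"
    and bnd: "\<And>s. Re s \<le> a \<Longrightarrow> norm (F s) \<le> K * (1 + \<bar>Im s\<bar>) powr (1/4)"
  shows "integrable lborel (\<lambda>t. F (Complex a t) / (Complex a t * (Complex a t + 1)))"
    and "vline (\<lambda>s. F s / (s * (s + 1))) a = of_real (2 * pi) * (F 0 - F (-1))"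
proof -
  have K: "K \<ge> 0" using bnd[of 0] a norm_ge_zero[of "F 0"] by (simp del: norm_ge_zero)
  have div_bound: "norm (F s / z) \<le> (K / e) * (1 + \<bar>Im s\<bar>) powr (-1/2)"
    if "Re s \<le> a" "e > 0" "e * (1 + \<bar>Im s\<bar>) \<le> norm z" for s z e
  proof -
    have "norm (F s / z) \<le> K * (1 + \<bar>Im s\<bar>) powr (1/4) / (e * (1 + \<bar>Im s\<bar>))"
      unfolding norm_divide using that K by (intro frac_le bnd) (auto intro!: mult_pos_pos)
    also have "\<dots> = K / e * ((1 + \<bar>Im s\<bar>) powr (1/4) / (1 + \<bar>Im s\<bar>) powr 1)"
      by simp
    also have "(1 + \<bar>Im s\<bar>) powr (1/4) / (1 + \<bar>Im s\<bar>) powr 1 = (1 + \<bar>Im s\<bar>) powr (1/4 - 1)"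
      by (rule powr_diff[symmetric])
    also have "K / e * (1 + \<bar>Im s\<bar>) powr (1/4 - 1) \<le> K / e * (1 + \<bar>Im s\<bar>) powr (-1/2)"
      using K that by (intro mult_left_mono powr_mono) auto
    finally show ?thesis .
  qed
  have lower: "(e / (1 + e)) * (1 + \<bar>Im s\<bar>) \<le> norm (s - z)"
    if "e > 0" "e \<le> \<bar>Re s - Re z\<bar>" "Im z = 0" for s z e
  proof -
    have "e \<le> norm (s - z)" "\<bar>Im s\<bar> \<le> norm (s - z)"
      using that abs_Re_le_cmod[of "s - z"] abs_Im_le_cmod[of "s - z"] by auto
    then have "e * 1 + e * \<bar>Im s\<bar> \<le> 1 * norm (s - z) + e * norm (s - z)"
      using that by (intro add_mono mult_left_mono) auto
    then have "e * (1 + \<bar>Im s\<bar>) \<le> norm (s - z) * (1 + e)" by (simp add: algebra_simps)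
    then show ?thesis using that by (simp add: pos_divide_le_eq)
  qed
  have dom: "norm (F s / (s * (s + 1))) \<le> (K / (e / (1 + e)) / (e / (1 + e))) * (1 + \<bar>Im s\<bar>) powr (-3/2)"
    if "Re s \<le> a" "e > 0" "e \<le> \<bar>Re s\<bar>" "e \<le> \<bar>Re s + 1\<bar>" for s e
  proof -
    define e' where "e' = e / (1 + e)"
    have e': "e' > 0" using that by (simp add: e'_def)
    have 1: "e' * (1 + \<bar>Im s\<bar>) \<le> norm s" using lower[of e s 0] that by (simp add: e'_def)
    have 2: "e' * (1 + \<bar>Im s\<bar>) \<le> norm (s + 1)" using lower[of e s "-1"] that by (simp add: e'_def)
    have "norm (F s / (s * (s + 1))) = norm (F s / s) * (1 / norm (s + 1))"
      by (simp add: norm_divide norm_mult)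
    also have "\<dots> \<le> ((K / e') * (1 + \<bar>Im s\<bar>) powr (-1/2)) * (1 / (e' * (1 + \<bar>Im s\<bar>)))"
      using e' K 2 div_bound[OF that(1) e' 1]
      by (intro mult_mono frac_le) (auto intro!: mult_pos_pos)
    also have "\<dots> = K / e' / e' * ((1 + \<bar>Im s\<bar>) powr (-1/2) / (1 + \<bar>Im s\<bar>) powr 1)" by simp
    also have "(1 + \<bar>Im s\<bar>) powr (-1/2) / (1 + \<bar>Im s\<bar>) powr 1 = (1 + \<bar>Im s\<bar>) powr (-1/2 - 1)"
      by (rule powr_diff[symmetric])
    finally show ?thesis by (simp add: e'_def)
  qed
  have meas: "(\<lambda>t. F (Complex x t) / (Complex x t * (Complex x t + 1))) \<in> borel_measurable borel"
    if "x \<le> a" for x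
  proof -
    have [measurable]: "(\<lambda>t. Complex x t) \<in> borel_measurable borel"
      by (intro borel_measurable_continuous_onI continuous_on_Complex_line)
    have [measurable]: "(\<lambda>t. F (Complex x t)) \<in> borel_measurable borel"
      by (rule borel_measurable_vline[OF F]) (use that a in auto)
    show ?thesis by measurable
  qed
  show "integrable lborel (\<lambda>t. F (Complex a t) / (Complex a t * (Complex a t + 1)))"
  proof (rule integrable_vline[where G = "\<lambda>s. F s / (s * (s + 1))" and p = "3/2"])
    show "norm (F (Complex a t) / (Complex a t * (Complex a t + 1))) \<le>
        (K / (a / (1 + a)) / (a / (1 + a))) * (1 + \<bar>t\<bar>) powr (- (3/2))" for t
      using dom[of "Complex a t" a] a by simp
  qed (use meas[of a] in auto)
  \<comment> \<open>The line Re s = -1/2 separates the poles, so \<open>vline_pole\<close> applies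
    once on each side, with the other linear factor absorbed into the numerator.\<close>
  have 1: "vline (\<lambda>s. F s / (s + 1) / (s - 0)) a - vline (\<lambda>s. F s / (s + 1) / (s - 0)) (-1/2) =
      of_real (2 * pi) * (F 0 / (0 + 1))"
  proof (rule vline_pole[where S = "{s. Re s < a'} \<inter> {s. Re s > -3/4}"])
    show "(\<lambda>s. F s / (s + 1)) holomorphic_on {s. Re s < a'} \<inter> {s. Re s > -3/4}"
      by (intro holomorphic_intros holomorphic_on_subset[OF F]) (auto simp: complex_eq_iff)
    fix s assume s: "-1/2 \<le> Re s" "Re s \<le> a"
    have "(1/2) / (1 + 1/2) * (1 + \<bar>Im s\<bar>) \<le> norm (s - (-1))" using s by (intro lower) auto
    then show "norm (F s / (s + 1)) \<le> (K / ((1/2) / (1 + 1/2))) * (1 + \<bar>Im s\<bar>) powr (-1/2)"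
      using s by (intro div_bound) auto
  qed (use a in \<open>auto intro!: open_Int convex_Int open_halfspace_Re_gt convex_halfspace_Re_gt
        open_halfspace_Re_lt convex_halfspace_Re_lt\<close>)
  have 2: "vline (\<lambda>s. F s / s / (s - (-1))) (-1/2) - vline (\<lambda>s. F s / s / (s - (-1))) (-R) =
      of_real (2 * pi) * (F (-1) / (-1))" if R: "R \<ge> 2" for R
  proof (rule vline_pole[where S = "{s. Re s < -1/4}"])
    show "(\<lambda>s. F s / s) holomorphic_on {s. Re s < -1/4}"
      using a by (intro holomorphic_intros holomorphic_on_subset[OF F]) (auto simp: complex_eq_iff)
    fix s assume s: "-R \<le> Re s" "Re s \<le> -1/2"
    have "(1/2) / (1 + 1/2) * (1 + \<bar>Im s\<bar>) \<le> norm (s - 0)" using s by (intro lower) auto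
    then show "norm (F s / s) \<le> (K / ((1/2) / (1 + 1/2))) * (1 + \<bar>Im s\<bar>) powr (-1/2)"
      using s a by (intro div_bound) auto
  qed (use R in \<open>auto intro!: open_halfspace_Re_lt convex_halfspace_Re_lt\<close>)
  define G where "G = (\<lambda>s. F s / (s * (s + 1)))"
  have "vline G a - vline G (-R) = of_real (2 * pi) * (F 0 - F (-1))" if "R \<ge> 2" for R
    using arg_cong2[OF 1 2[OF that], of "(+)"] by (simp add: G_def algebra_simps)
  then have "\<forall>\<^sub>F n in sequentially. vline G a - of_real (2 * pi) * (F 0 - F (-1)) = vline G (- real n)"
    by (intro eventually_sequentiallyI[of 2]) (simp add: algebra_simps)
  \<comment> \<open>Starting at Re s = -2 keeps |Re s| and |Re s + 1| at least 1, so
    \<open>dom\<close> with e = 1 supplies one integrable majorant for all n.\<close>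
  moreover have "(\<lambda>n. vline G (- real (n + 2))) \<longlonglongrightarrow> (LINT t::real|lborel. 0)"
    unfolding vline_def
  proof (rule integral_dominated_convergence)
    show "integrable lborel (\<lambda>t. (K / (1 / (1 + 1)) / (1 / (1 + 1))) * (1 + \<bar>t\<bar>) powr (-3/2))"
      using integrable_decay[of "3/2"] by simp
    show "AE t in lborel. norm (G (Complex (- real (n + 2)) t)) \<le>
      (K / (1 / (1 + 1)) / (1 / (1 + 1))) * (1 + \<bar>t\<bar>) powr (-3/2)" for n
      using dom[of "Complex (- real (n + 2)) _" 1] a unfolding G_def by (intro AE_I2) auto
    show "(\<lambda>t. G (Complex (- real (n + 2)) t)) \<in> borel_measurable lborel" for n
      unfolding G_def using a meas[of "- real (n + 2)"] by simp
    show "AE t in lborel. (\<lambda>n. G (Complex (- real (n + 2)) t)) \<longlonglongrightarrow> 0"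
    proof (rule AE_I2)
      fix t :: real
      define B where "B = K * (1 + \<bar>t\<bar>) powr (1/4)"
      have "norm (G (Complex (- real (n + 2)) t)) \<le> B / (1 + real n)" for n
      proof -
        let ?s = "Complex (- real (n + 2)) t"
        have "1 \<le> norm ?s" "1 + real n \<le> norm (?s + 1)"
          using abs_Re_le_cmod[of ?s] abs_Re_le_cmod[of "?s + 1"] by auto
        then have "1 * (1 + real n) \<le> norm (?s * (?s + 1))" unfolding norm_mult
          by (intro mult_mono) auto
        then show ?thesis
          unfolding G_def norm_divide B_def using a bnd[of ?s] K by (intro frac_le) auto
      qed
      moreover have "(\<lambda>n. B / (1 + real n)) \<longlonglongrightarrow> 0"
        by (intro real_tendsto_divide_at_top[OF tendsto_const]
          filterlim_tendsto_add_at_top[OF tendsto_const filterlim_real_sequentially])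
      ultimately show "(\<lambda>n. G (Complex (- real (n + 2)) t)) \<longlonglongrightarrow> 0"
        using Lim_null_comparison[of "\<lambda>n. G (Complex (- real (n + 2)) t)" "\<lambda>n. B / (1 + real n)" sequentially]
        by simp
    qed
  qed simp
  then have "(\<lambda>n. vline G (- real n)) \<longlonglongrightarrow> 0"
    using LIMSEQ_offset[of "\<lambda>n. vline G (- real n)" 2 0] by simp
  ultimately have "(\<lambda>n. vline G a - of_real (2 * pi) * (F 0 - F (-1))) \<longlonglongrightarrow> 0"
    using tendsto_cong by fastforce
  then show "vline (\<lambda>s. F s / (s * (s + 1))) a = of_real (2 * pi) * (F 0 - F (-1))"
    using LIMSEQ_unique[OF tendsto_const] by (fastforce simp: G_def)
qed


section \<open>The entire function $(s-1)\zeta(s)$ and its growth\<close>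

text \<open>The value 1 at the pole is the residue of zeta. It makes the function entire and
  discards the conventional value \<open>riemann_zeta 1 = 0\<close>, so that the zeros are the
  genuine zeros of zeta.\<close>

definition zeta_reg :: "complex \<Rightarrow> complex" where
  "zeta_reg s = (if s = 1 then 1 else (s - 1) * riemann_zeta s)"

lemma riemann_zeta_holomorphic: "riemann_zeta holomorphic_on - {1}"
  using is_riemann_zeta_riemann_zeta by (simp add: is_riemann_zeta_def)

lemma riemann_zeta_sums: "Re s > 1 \<Longrightarrow> (\<lambda>n. 1 / of_nat (Suc n) powr s) sums riemann_zeta s"
  using is_riemann_zeta_riemann_zeta by (simp add: is_riemann_zeta_def)

lemma riemann_zeta_eq_zeta0: "Re s > 1 \<Longrightarrow> riemann_zeta s = zeta0 s"
  using riemann_zeta_sums zeta0_sums sums_unique2 by blast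

lemma zeta_rem_Suc_0:
  "zeta_rem (Suc 0) i s = of_nat (Suc (Suc i)) powr (1 - s) - of_nat (Suc i) powr (1 - s) -
     (1 - s) * of_nat (Suc i) powr (- s)"
  by (simp add: zeta_rem_def of_nat_Suc[of 0] del: of_nat_Suc)

lemma zeta_rem_1_1: "zeta_rem (Suc 0) i 1 = 0"
  by (simp add: zeta_rem_def del: of_nat_Suc)

lemma zeta_rem_2_1: "zeta_rem 2 i 1 = 0"
  by (simp add: zeta_rem_def numeral_2_eq_2 gbinomial_Suc del: of_nat_Suc)

text \<open>The identity theorem on the half-plane punctured at 1; the condition
  \<open>h 1 = 1\<close> fills the puncture. It turns each explicit series into a formula for
  \<open>zeta_reg\<close> on a larger half-plane.\<close>

lemma zeta_reg_continuation:
  assumes h: "h holomorphic_on {s. Re s > a}" and a: "a < 1" and h1: "h 1 = 1"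
    and eq: "\<And>s. Re s > 1 \<Longrightarrow> h s = (s - 1) * zeta0 s" and s: "Re s > a"
  shows "zeta_reg s = h s"
proof (cases "s = 1")
  case False
  have "(s - 1) * riemann_zeta s - h s = 0"
  proof (rule analytic_continuation_open[of "{s. Re s > 1}" "{s. Re s > a} - {1}" "\<lambda>s. (s - 1) * riemann_zeta s - h s" "\<lambda>_. 0"])
    show "connected ({s. Re s > a} - {1})"
      by (intro connected_open_delete open_Re_gt connected_Re_gt) simp
    show "open ({s. Re s > a} - {1})" by (intro open_Diff open_Re_gt) auto
    show "{s :: complex. Re s > 1} \<noteq> {}" by (auto intro!: exI[of _ 2])
    show "(\<lambda>s. (s - 1) * riemann_zeta s - h s) holomorphic_on {s. Re s > a} - {1}"
      by (intro holomorphic_intros holomorphic_on_subset[OF riemann_zeta_holomorphic]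
          holomorphic_on_subset[OF h]) auto
  qed (use a s False eq in \<open>auto simp: open_Re_gt riemann_zeta_eq_zeta0\<close>)
  then show ?thesis using False by (simp add: zeta_reg_def)
qed (use h1 in \<open>simp add: zeta_reg_def\<close>)

lemma zeta_reg_eq_rem_1:
  assumes "Re s > 0"
  shows "zeta_reg s = 1 + (\<Sum>i. zeta_rem (Suc 0) i s)"
proof (rule zeta_reg_continuation[where a = 0])
  show "(\<lambda>s. 1 + (\<Sum>i. zeta_rem (Suc 0) i s)) holomorphic_on {s. Re s > 0}"
    using zeta_rem_holomorphic[of 1] by (intro holomorphic_intros) simp
  show "1 + (\<Sum>i. zeta_rem (Suc 0) i s) = (s - 1) * zeta0 s" if "Re s > 1" for s
    using zeta0_recurrence[OF that, of 0] by simp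
qed (use assms in \<open>simp_all add: zeta_rem_1_1\<close>)

lemma zeta_reg_holomorphic: "zeta_reg holomorphic_on A"
proof -
  have 1: "zeta_reg holomorphic_on - {1}"
  proof (rule holomorphic_transform)
    show "(\<lambda>s. (s - 1) * riemann_zeta s) holomorphic_on - {1}"
      by (intro holomorphic_intros riemann_zeta_holomorphic)
  qed (auto simp: zeta_reg_def)
  have 2: "zeta_reg holomorphic_on {s. Re s > 0}"
  proof (rule holomorphic_transform)
    show "(\<lambda>s. 1 + (\<Sum>i. zeta_rem (Suc 0) i s)) holomorphic_on {s. Re s > 0}"
      using zeta_rem_holomorphic[of 1] by (intro holomorphic_intros) simp
  qed (auto simp: zeta_reg_eq_rem_1)
  have "zeta_reg holomorphic_on (- {1} \<union> {s. Re s > 0})"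
    by (intro holomorphic_on_Un 1 2 open_Re_gt open_Compl) auto
  moreover have "(- {1} \<union> {s. Re s > 0}) = (UNIV :: complex set)" by auto
  ultimately show ?thesis using holomorphic_on_subset by auto
qed

lemma zeta_reg_holomorphic_compose [holomorphic_intros]:
  assumes "f holomorphic_on A"
  shows "(\<lambda>s. zeta_reg (f s)) holomorphic_on A"
  using holomorphic_on_compose_gen[OF assms zeta_reg_holomorphic[of UNIV]] by (simp add: o_def)

text \<open>This is the recurrence with m = 1, in which s zeta(s + 1) is replaced in turn by its
  expansion of order one. The half-plane contains the interval -1 < x < 0 on which the functional
  equation is first proved.\<close>

lemma zeta_reg_eq_rem_2:
  assumes "Re s > -1"
  shows "zeta_reg s = 1 + (s - 1) / 2 * (1 + (\<Sum>i. zeta_rem (Suc 0) i (s + 1))) + (\<Sum>i. zeta_rem 2 i s)"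
proof (rule zeta_reg_continuation[where a = "-1"])
  have "(\<lambda>s. \<Sum>i. zeta_rem (Suc 0) i (s + 1)) holomorphic_on {s. Re s > -1}"
    using holomorphic_on_compose_gen[OF _ zeta_rem_holomorphic[of "Suc 0"], of "\<lambda>s. s + 1" "{s. Re s > -1}"]
    by (force simp: o_def intro!: holomorphic_intros)
  then show "(\<lambda>s. 1 + (s - 1) / 2 * (1 + (\<Sum>i. zeta_rem (Suc 0) i (s + 1))) + (\<Sum>i. zeta_rem 2 i s))
      holomorphic_on {s. Re s > -1}"
    using zeta_rem_holomorphic[of 2] by (intro holomorphic_intros) simp_all
  show "1 + (s - 1) / 2 * (1 + (\<Sum>i. zeta_rem (Suc 0) i (s + 1))) + (\<Sum>i. zeta_rem 2 i s) = (s - 1) * zeta0 s"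
    if s: "Re s > 1" for s
  proof -
    have 1: "s * zeta0 (s + 1) = 1 + (\<Sum>i. zeta_rem (Suc 0) i (s + 1))"
      using zeta0_recurrence[of "s + 1" 0] s by simp
    have "(s - 1) * zeta0 s = 1 - (1 - s) / 2 * (s * zeta0 (s + 1)) + (\<Sum>i. zeta_rem 2 i s)"
      using zeta0_recurrence[OF s, of 1] by (simp add: numeral_2_eq_2)
    moreover have "1 + (s - 1) / 2 * X + R = 1 - (1 - s) / 2 * X + R" for X R :: complex
      by (simp add: field_simps)
    ultimately show ?thesis unfolding 1 by (simp only:)
  qed
qed (use assms in \<open>simp_all add: zeta_rem_2_1\<close>)

text \<open>The constant in \<open>zeta_rem_bound\<close> grows exponentially with |1 - s|, too fast
  for growth estimates. Here the mean value inequality on the segment from n to n + 1 is used once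
  for z^(1 - s) with its linear part removed and once more for the derivative, which leaves
  polynomial dependence on s.\<close>

lemma norm_zeta_rem_1_le:
  assumes "Re s > -1"
  shows "norm (zeta_rem (Suc 0) i s) \<le> norm s * norm (1 - s) * real (Suc i) powr - (Re s + 1)"
proof -
  define n where "n = real (Suc i)"
  have n: "n \<ge> 1" by (simp add: n_def)
  define S where "S = closed_segment (of_real n) (of_real (n + 1) :: complex)"
  have S: "\<exists>v. z = of_real v \<and> n \<le> v \<and> v \<le> n + 1" if z: "z \<in> S" for z
    using z unfolding S_def closed_segment_of_real by (auto simp: closed_segment_eq_real_ivl)
  have cS: "convex S" by (simp add: S_def)
  have nS: "of_real n \<in> S" "of_real (n + 1) \<in> S" by (auto simp: S_def)
  define D where "D = norm s * n powr - (Re s + 1)"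
  have D0: "D \<ge> 0" by (simp add: D_def)
  have inner: "norm (z powr (-s) - of_real n powr (-s)) \<le> D" if z: "z \<in> S" for z
  proof -
    obtain v where v: "z = of_real v" "n \<le> v" "v \<le> n + 1" using S[OF z] by blast
    have "norm (z powr (-s) - of_real n powr (-s)) \<le> D * norm (z - of_real n)"
    proof (rule field_differentiable_bound[OF cS _ _ z nS(1)])
      fix w assume "w \<in> S"
      then obtain u where u: "w = of_real u" "n \<le> u" "u \<le> n + 1" using S by blast
      show "((\<lambda>z. z powr (-s)) has_field_derivative (-s) * w powr (-s - 1)) (at w within S)"
        using u n by (intro has_field_derivative_at_within[OF has_field_derivative_powr]) auto
      have "norm ((-s) * w powr (-s - 1)) = norm s * u powr (- (Re s + 1))"
        using u n by (simp add: norm_mult norm_powr_real_powr)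
      also have "\<dots> \<le> D" unfolding D_def using u n assms
        by (intro mult_left_mono powr_mono2') auto
      finally show "norm ((-s) * w powr (-s - 1)) \<le> D" .
    qed
    also have "D * norm (z - of_real n) \<le> D * 1"
      using v D0 by (intro mult_left_mono) (simp_all add: norm_of_real flip: of_real_diff)
    finally show ?thesis by simp
  qed
  define g where "g z = z powr (1 - s) - (1 - s) * of_real n powr (-s) * z" for z
  have "norm (g (of_real (n + 1)) - g (of_real n)) \<le> norm (1 - s) * D * norm (of_real (n + 1) - of_real n :: complex)"
  proof (rule field_differentiable_bound[OF cS _ _ nS(2,1)])
    fix w assume w: "w \<in> S"
    then obtain u where u: "w = of_real u" "n \<le> u" "u \<le> n + 1" using S by blast
    show "(g has_field_derivative (1 - s) * (w powr (-s) - of_real n powr (-s))) (at w within S)"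
      unfolding g_def using u n
      by (auto intro!: derivative_eq_intros simp: algebra_simps)
    show "norm ((1 - s) * (w powr (-s) - of_real n powr (-s))) \<le> norm (1 - s) * D"
      unfolding norm_mult using inner[OF w] by (intro mult_left_mono) auto
  qed
  also have "of_real (n + 1) - of_real n = (1 :: complex)" by simp
  finally have "norm (g (of_real (n + 1)) - g (of_real n)) \<le> norm (1 - s) * D" by simp
  moreover have "g (of_real (n + 1)) - g (of_real n) = zeta_rem (Suc 0) i s"
  proof -
    have alg: "(p - c * (m + 1)) - (q - c * m) = p - q - c" for p q c m :: complex
      by (simp add: algebra_simps)
    have N: "of_nat (Suc (Suc i)) = (of_real n + 1 :: complex)" "of_nat (Suc i) = (of_real n :: complex)"
      "of_real (n + 1) = (of_real n + 1 :: complex)"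
      by (simp_all add: n_def)
    show ?thesis unfolding g_def zeta_rem_Suc_0 N by (rule alg)
  qed
  ultimately show ?thesis by (simp add: D_def n_def algebra_simps)
qed

lemma zeta_reg_growth:
  assumes "\<sigma> > 0"
  obtains C where "C > 0" "\<And>s. Re s \<ge> \<sigma> \<Longrightarrow> norm (zeta_reg s) \<le> C * (1 + norm s)\<^sup>2"
proof
  define S where "S = (\<Sum>i. real (Suc i) powr - (\<sigma> + 1))"
  have sm: "summable (\<lambda>i. real (Suc i) powr - (\<sigma> + 1))" by (rule summable_powr_Suc) (use assms in simp)
  have S: "S \<ge> 0" unfolding S_def by (rule suminf_nonneg[OF sm]) simp
  then show "1 + S > 0" by simp
  fix s assume s: "Re s \<ge> \<sigma>"
  have "norm (\<Sum>i. zeta_rem (Suc 0) i s) \<le> (\<Sum>i. norm s * norm (1 - s) * real (Suc i) powr - (\<sigma> + 1))"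
  proof (rule norm_suminf_le)
    fix i
    have "norm (zeta_rem (Suc 0) i s) \<le> norm s * norm (1 - s) * real (Suc i) powr - (Re s + 1)"
      using s assms by (intro norm_zeta_rem_1_le) auto
    also have "\<dots> \<le> norm s * norm (1 - s) * real (Suc i) powr - (\<sigma> + 1)"
      using s by (intro mult_left_mono powr_mono) auto
    finally show "norm (zeta_rem (Suc 0) i s) \<le> norm s * norm (1 - s) * real (Suc i) powr - (\<sigma> + 1)" .
  qed (intro summable_mult sm)
  also have "\<dots> = norm s * norm (1 - s) * S" unfolding S_def by (rule suminf_mult[OF sm])
  finally have 1: "norm (\<Sum>i. zeta_rem (Suc 0) i s) \<le> norm s * norm (1 - s) * S" .
  have "norm (zeta_reg s) \<le> 1 + norm (\<Sum>i. zeta_rem (Suc 0) i s)"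
    using s assms norm_triangle_ineq[of 1 "\<Sum>i. zeta_rem (Suc 0) i s"] by (simp add: zeta_reg_eq_rem_1)
  also have "\<dots> \<le> 1 + norm s * (1 + norm s) * S"
  proof -
    have "norm s * norm (1 - s) * S \<le> norm s * (1 + norm s) * S"
      using norm_triangle_ineq4[of 1 s] S by (intro mult_right_mono mult_left_mono) auto
    then show ?thesis using 1 by linarith
  qed
  also have "\<dots> \<le> (1 + norm s)\<^sup>2 + (1 + norm s)\<^sup>2 * S"
    using S by (intro add_mono mult_right_mono) (auto simp: power2_eq_square algebra_simps)
  finally show "norm (zeta_reg s) \<le> (1 + S) * (1 + norm s)\<^sup>2" by (simp add: algebra_simps)
qed

section \<open>The functional equation\<close>

lemma sinh_product_real:
  fixes t :: real
  shows "(\<lambda>n. (t / 2) * (\<Prod>i<n. 1 + t\<^sup>2 / (2 * pi * real (Suc i))\<^sup>2)) \<longlonglongrightarrow> sinh (t / 2)"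
proof -
  define z where "z = \<i> * of_real (t / (2 * pi))"
  have "(\<lambda>n. Im (of_real pi * z * (\<Prod>k=1..n. 1 - z\<^sup>2 / (of_nat k)\<^sup>2))) \<longlonglongrightarrow> Im (sin (of_real pi * z))"
    by (intro tendsto_intros sin_product_formula_complex)
  also have "of_real pi * z = \<i> * of_real (t / 2)" by (simp add: z_def)
  also have "Im (sin (\<i> * of_real (t / 2))) = sinh (t / 2)"
    by (simp add: Im_sin sinh_field_def)
  also have "(\<lambda>n. Im (\<i> * of_real (t / 2) * (\<Prod>k=1..n. 1 - z\<^sup>2 / (of_nat k)\<^sup>2))) =
     (\<lambda>n. (t / 2) * (\<Prod>i<n. 1 + t\<^sup>2 / (2 * pi * real (Suc i))\<^sup>2))"
  proof
    fix n
    have "(\<Prod>k=1..n. 1 - z\<^sup>2 / (of_nat k)\<^sup>2) = (\<Prod>i<n. 1 - z\<^sup>2 / (of_nat (Suc i))\<^sup>2)"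
      by (rule prod.reindex_bij_witness[of _ Suc "\<lambda>k. k - 1"]) auto
    also have "\<dots> = (\<Prod>i<n. of_real (1 + t\<^sup>2 / (2 * pi * real (Suc i))\<^sup>2))"
      by (intro prod.cong refl) (simp add: z_def power_mult_distrib power_divide del: of_nat_Suc)
    also have "\<dots> = of_real (\<Prod>i<n. (1 + t\<^sup>2 / (2 * pi * real (Suc i))\<^sup>2))" by (rule of_real_prod[symmetric])
    finally show "Im (\<i> * of_real (t / 2) * (\<Prod>k=1..n. 1 - z\<^sup>2 / (of_nat k)\<^sup>2)) =
       (t / 2) * (\<Prod>i<n. 1 + t\<^sup>2 / (2 * pi * real (Suc i))\<^sup>2)"
      by (simp only: Im_i_times Re_complex_of_real mult.assoc of_real_mult[symmetric])
  qed
  finally show ?thesis .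
qed

lemma ln_sinh_sums:
  fixes t :: real
  assumes "t > 0"
  shows "(\<lambda>i. ln (1 + t\<^sup>2 / (2 * pi * real (Suc i))\<^sup>2)) sums ln (sinh (t / 2) / (t / 2))"
proof -
  have "(\<lambda>n. ((t / 2) * (\<Prod>i<n. 1 + t\<^sup>2 / (2 * pi * real (Suc i))\<^sup>2)) / (t / 2)) \<longlonglongrightarrow> sinh (t / 2) / (t / 2)"
    using assms by (intro tendsto_divide sinh_product_real tendsto_const) auto
  then have "(\<lambda>n. (\<Prod>i<n. 1 + t\<^sup>2 / (2 * pi * real (Suc i))\<^sup>2)) \<longlonglongrightarrow> sinh (t / 2) / (t / 2)"
    using assms by simp
  then have "(\<lambda>n. ln (\<Prod>i<n. 1 + t\<^sup>2 / (2 * pi * real (Suc i))\<^sup>2)) \<longlonglongrightarrow> ln (sinh (t / 2) / (t / 2))"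
    using assms by (intro tendsto_ln) auto
  moreover have nz: "1 + t\<^sup>2 / (2 * pi * real (Suc i))\<^sup>2 \<noteq> 0" for i
    using add_pos_nonneg[of 1 "t\<^sup>2 / (2 * pi * real (Suc i))\<^sup>2"] by (simp del: of_nat_Suc)
  have "ln (\<Prod>i<n. 1 + t\<^sup>2 / (2 * pi * real (Suc i))\<^sup>2) =
      (\<Sum>i<n. ln (1 + t\<^sup>2 / (2 * pi * real (Suc i))\<^sup>2))" for n
    by (rule ln_prod) (auto simp: nz simp del: of_nat_Suc)
  ultimately show ?thesis by (simp add: sums_def)
qed

text \<open>Logarithmic differentiation, term by term, of the product for sinh(t/2)/(t/2); the sum
  is (1/2) coth(t/2) - 1/t. Written as 1/2 + 1/(exp t - 1) - 1/t it is also the sum of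
  \<open>trapezoid_exp\<close>, and this coincidence is the source of the functional
  equation.\<close>

lemma coth_partial_fractions:
  fixes t :: real
  assumes t: "t > 0"
  shows "(\<lambda>i. 2 * t / (t\<^sup>2 + (2 * pi * real (Suc i))\<^sup>2)) sums (1 / 2 + 1 / (exp t - 1) - 1 / t)"
proof -
  define c where "c i = (2 * pi * real (Suc i))\<^sup>2" for i
  have c: "c i > 0" for i by (simp add: c_def)
  define f where "f i x = ln (1 + x\<^sup>2 / c i)" for i x
  define f' where "f' i x = 2 * x / (x\<^sup>2 + c i)" for i x
  \<comment> \<open>A bounded interval gives every term of the differentiated series the majorant
    2(t + 1)/c i.\<close>
  define A where "A = {0<..<t + 1}"
  have der: "(f i has_field_derivative f' i x) (at x within A)" for i x
  proof -
    have "1 + x\<^sup>2 / c i > 0" using c[of i] by (intro add_pos_nonneg) auto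
    moreover have "x\<^sup>2 + c i > 0" using c[of i] by (intro add_nonneg_pos) auto
    ultimately show ?thesis unfolding f_def f'_def using c[of i]
      by (auto intro!: derivative_eq_intros simp: divide_simps)
  qed
  have unif: "uniformly_convergent_on A (\<lambda>n x. \<Sum>i<n. f' i x)"
  proof (rule Weierstrass_m_test')
    fix i x assume x: "x \<in> A"
    have "norm (f' i x) = 2 * x / (x\<^sup>2 + c i)"
      unfolding f'_def using x c[of i] by (simp add: A_def add_pos_pos)
    also have "\<dots> \<le> 2 * (t + 1) / (c i)" using x c[of i] by (intro frac_le) (auto simp: A_def)
    finally show "norm (f' i x) \<le> 2 * (t + 1) / c i" .
  next
    have "summable (\<lambda>i. 1 / (2 * pi)\<^sup>2 * (2 * (t + 1) * real (Suc i) powr (-2)))"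
      by (intro summable_mult summable_powr_Suc) simp
    moreover have "1 / (2 * pi)\<^sup>2 * (2 * (t + 1) * real (Suc i) powr (-2)) = 2 * (t + 1) / c i" for i
      unfolding c_def by (simp add: powr_minus power_mult_distrib field_simps del: of_nat_Suc)
    ultimately show "summable (\<lambda>i. 2 * (t + 1) / c i)" by (simp only:)
  qed
  have sm: "summable (\<lambda>i. f i t)" using ln_sinh_sums[OF t] by (auto simp: f_def c_def sums_iff)
  have tA: "t \<in> A" "interior A = A" using t by (auto simp: A_def interior_open)
  have "convex A" by (simp add: A_def)
  note ser = has_field_derivative_series'[OF this der unif tA(1) sm]
  have D1: "((\<lambda>x. \<Sum>i. f i x) has_field_derivative (\<Sum>i. f' i t)) (at t)"
    using ser(2)[of t] tA by simp
  define g where "g x = ln (sinh (x / 2) / (x / 2))" for x :: real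
  have "((\<lambda>x. \<Sum>i. f i x) has_field_derivative (\<Sum>i. f' i t)) (at t) \<longleftrightarrow> (g has_field_derivative (\<Sum>i. f' i t)) (at t)"
  proof (rule DERIV_cong_ev)
    show "\<forall>\<^sub>F x in nhds t. (\<Sum>i. f i x) = g x"
    proof (rule eventually_mono[OF eventually_nhds_in_open[of "{0<..}" t]])
      show "(\<Sum>i. f i x) = g x" if "x \<in> {0<..}" for x
        unfolding f_def g_def c_def using ln_sinh_sums[of x] that by (simp only: sums_iff greaterThan_iff)
    qed (use t in auto)
  qed auto
  with D1 have D1': "(g has_field_derivative (\<Sum>i. f' i t)) (at t)" by blast
  have "(g has_field_derivative (1 / 2 + 1 / (exp t - 1) - 1 / t)) (at t)"
  proof -
    have "((\<lambda>x. ln (sinh (x / 2)) - ln (x / 2)) has_field_derivative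
       (cosh (t / 2) / 2 / sinh (t / 2) - 1 / t)) (at t)"
      using t by (auto intro!: derivative_eq_intros)
    moreover have "((\<lambda>x. ln (sinh (x / 2)) - ln (x / 2)) has_field_derivative
       (cosh (t / 2) / 2 / sinh (t / 2) - 1 / t)) (at t) \<longleftrightarrow>
       (g has_field_derivative (cosh (t / 2) / 2 / sinh (t / 2) - 1 / t)) (at t)"
    proof (rule DERIV_cong_ev)
      show "\<forall>\<^sub>F x in nhds t. ln (sinh (x / 2)) - ln (x / 2) = g x"
      proof (rule eventually_mono[OF eventually_nhds_in_open[of "{0<..}" t]])
        show "ln (sinh (x / 2)) - ln (x / 2) = g x" if "x \<in> {0<..}" for x
          unfolding g_def by (rule ln_divide_pos[symmetric]) (use that in auto)
      qed (use t in auto)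
    qed auto
    moreover have "cosh (t / 2) / 2 / sinh (t / 2) = 1 / 2 + 1 / (exp t - 1)"
    proof -
      define e where "e = exp (t / 2)"
      define B where "B = e * e - 1"
      have e: "e > 1" using t by (simp add: e_def)
      have B: "B > 0" using e by (simp add: B_def less_1_mult)
      have et: "exp t - 1 = B" by (simp add: e_def B_def flip: exp_add)
      have "exp (- (t / 2)) = 1 / e" by (simp add: e_def exp_minus inverse_eq_divide)
      then have cs: "cosh (t / 2) = (B + 2) / e / 2" "sinh (t / 2) = B / e / 2"
        using e unfolding cosh_field_def sinh_field_def e_def[symmetric] by (simp_all add: B_def field_simps)
      have "cosh (t / 2) / 2 / sinh (t / 2) = (B + 2) / (2 * B)" unfolding cs using e B by (simp add: field_simps)
      also have "\<dots> = 1 / 2 + 1 / B" using B by (simp add: field_simps)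
      finally show ?thesis by (simp only: et)
    qed
    ultimately show ?thesis by simp
  qed
  then have "(\<Sum>i. f' i t) = 1 / 2 + 1 / (exp t - 1) - 1 / t"
    using D1' DERIV_unique by blast
  moreover have "summable (\<lambda>i. f' i t)"
    using uniformly_convergent_imp_convergent[OF unif tA(1)] by (simp add: summable_iff_convergent)
  ultimately show ?thesis by (simp add: f'_def c_def sums_iff)
qed

section \<open>Mellin transforms of nonnegative functions\<close>

lemma nn_integral_Gamma_scaled:
  assumes "v > 0" "z > 0"
  shows "(\<integral>\<^sup>+t. ennreal (indicator {0..} t * (t powr (z - 1) * exp (- (v * t)))) \<partial>lborel) =
     ennreal (Gamma z * v powr - z)"
proof -
  let ?I = "\<integral>\<^sup>+t. ennreal (indicator {0..} t * (t powr (z - 1) * exp (- (v * t)))) \<partial>lborel"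
  have "ennreal (Gamma z) = ennreal \<bar>v\<bar> * (\<integral>\<^sup>+t. ennreal (indicator {0..} (0 + v * t) * (0 + v * t) powr (z - 1) / exp (0 + v * t)) \<partial>lborel)"
    unfolding Gamma_conv_nn_integral_real[OF assms(2)]
    by (rule nn_integral_real_affine) (use assms in auto)
  also have "(\<lambda>t. ennreal (indicator {0..} (0 + v * t) * (0 + v * t) powr (z - 1) / exp (0 + v * t))) =
      (\<lambda>t. ennreal (v powr (z - 1)) * ennreal (indicator {0..} t * (t powr (z - 1) * exp (- (v * t)))))"
    using assms by (auto simp: fun_eq_iff indicator_def zero_le_mult_iff powr_mult exp_minus field_simps
        simp flip: ennreal_mult')
  also have "(\<integral>\<^sup>+t. ennreal (v powr (z - 1)) * ennreal (indicator {0..} t * (t powr (z - 1) * exp (- (v * t)))) \<partial>lborel) =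
      ennreal (v powr (z - 1)) * ?I"
    by (rule nn_integral_cmult) auto
  finally have "ennreal (Gamma z) = ennreal (v powr z) * ?I"
    using assms by (simp add: mult.assoc[symmetric] powr_diff flip: ennreal_mult')
  then have "ennreal (v powr - z) * ennreal (Gamma z) = ennreal (v powr - z) * (ennreal (v powr z) * ?I)"
    by simp
  also have "\<dots> = ?I" using assms by (simp add: mult.assoc[symmetric] powr_minus flip: ennreal_mult')
  finally show ?thesis using assms by (simp add: mult.commute flip: ennreal_mult')
qed

text \<open>The substitution u = t^2 on each interval [0, n], followed by monotone
  convergence.\<close>

lemma nn_integral_square_substitution:
  fixes f :: "real \<Rightarrow> real"
  assumes [measurable]: "f \<in> borel_measurable borel"
  shows "(\<integral>\<^sup>+u. ennreal (indicator {0..} u * f u) \<partial>lborel) =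
         (\<integral>\<^sup>+t. ennreal (indicator {0..} t * (f (t\<^sup>2) * (2 * t))) \<partial>lborel)"
proof -
  have fin: "(\<integral>\<^sup>+u. ennreal (f u) * indicator {0..(real n)\<^sup>2} u \<partial>lborel) =
       (\<integral>\<^sup>+t. ennreal (f (t\<^sup>2) * (2 * t)) * indicator {0..real n} t \<partial>lborel)" for n
  proof -
    have "(\<integral>\<^sup>+u. ennreal (f u * indicator {0\<^sup>2..(real n)\<^sup>2} u) \<partial>lborel) =
       (\<integral>\<^sup>+t. ennreal (f (t\<^sup>2) * (2 * t) * indicator {0..real n} t) \<partial>lborel)"
      by (rule nn_integral_substitution)
         (auto intro!: derivative_eq_intros continuous_intros simp: set_borel_measurable_def)
    moreover have "ennreal (a * indicator A b) = ennreal a * indicator A b" for a b and A :: "real set"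
      by (simp add: indicator_def)
    ultimately show ?thesis by simp
  qed
  have lim: "(\<integral>\<^sup>+u. ennreal (h u) * indicator {0..} u \<partial>lborel) =
      (SUP n. \<integral>\<^sup>+u. ennreal (h u) * indicator {0..g n} u \<partial>lborel)"
    if [measurable]: "h \<in> borel_measurable borel" and g: "mono g" "\<And>x. \<exists>n::nat. x \<le> g n" for h g :: "_ \<Rightarrow> real"
  proof -
    have sup: "(SUP n. ennreal (h u) * indicator {0..g n} u) = ennreal (h u) * indicator {0..} u" for u
    proof (rule antisym)
      obtain n where "u \<le> g n" using g(2) by blast
      then show "ennreal (h u) * indicator {0..} u \<le> (SUP n. ennreal (h u) * indicator {0..g n} u)"
        by (intro SUP_upper2[of n]) (auto simp: indicator_def)
    qed (auto intro!: SUP_least simp: indicator_def)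
    have "(SUP n. \<integral>\<^sup>+u. ennreal (h u) * indicator {0..g n} u \<partial>lborel) =
        (\<integral>\<^sup>+u. (SUP n. ennreal (h u) * indicator {0..g n} u) \<partial>lborel)"
      by (rule nn_integral_monotone_convergence_SUP[symmetric])
         (auto simp: incseq_def le_fun_def indicator_def dest: monoD[OF g(1)] intro: order_trans)
    from this[symmetric] show ?thesis by (simp only: sup)
  qed
  have "(\<integral>\<^sup>+u. ennreal (indicator {0..} u * f u) \<partial>lborel) = (\<integral>\<^sup>+u. ennreal (f u) * indicator {0..} u \<partial>lborel)"
    by (intro nn_integral_cong) (auto simp: indicator_def)
  also have "\<dots> = (SUP n. \<integral>\<^sup>+u. ennreal (f u) * indicator {0..(real n)\<^sup>2} u \<partial>lborel)"
  proof (rule lim)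
    show "\<exists>n. x \<le> (real n)\<^sup>2" for x
    proof -
      define n where "n = nat \<lceil>\<bar>x\<bar>\<rceil>"
      have "x \<le> real n" unfolding n_def by linarith
      also have "\<dots> \<le> (real n)\<^sup>2" by (cases n) (auto simp: power2_eq_square)
      finally show ?thesis by blast
    qed
  qed (auto simp: mono_def intro!: power_mono)
  also have "\<dots> = (SUP n. \<integral>\<^sup>+t. ennreal (f (t\<^sup>2) * (2 * t)) * indicator {0..real n} t \<partial>lborel)"
    by (simp only: fin)
  also have "\<dots> = (\<integral>\<^sup>+t. ennreal (f (t\<^sup>2) * (2 * t)) * indicator {0..} t \<partial>lborel)"
    by (rule lim[symmetric]) (auto simp: mono_def real_arch_simple)
  also have "\<dots> = (\<integral>\<^sup>+t. ennreal (indicator {0..} t * (f (t\<^sup>2) * (2 * t))) \<partial>lborel)"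
    by (intro nn_integral_cong) (auto simp: indicator_def)
  finally show ?thesis .
qed

text \<open>With u = t^2 and z = (1 + x)/2 the integrand becomes u^(z - 1)/(u + c^2). Writing 1/(u +
  c^2) as the integral of exp(-(u + c^2)v) over v > 0 and exchanging the order leaves one Gamma
  integral in u and one in v.\<close>

lemma nn_integral_powr_over_quadratic:
  fixes x c :: real
  assumes x: "-1 < x" "x < 1" and c: "c > 0"
  shows "(\<integral>\<^sup>+t. ennreal (indicator {0..} t * (t powr (x - 1) * (2 * t / (t\<^sup>2 + c\<^sup>2)))) \<partial>lborel) =
     ennreal (Gamma ((1 + x) / 2) * Gamma ((1 - x) / 2) * c powr (x - 1))"
proof -
  define z where "z = (1 + x) / 2"
  have z: "0 < z" "z < 1" using x by (auto simp: z_def)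
  have "(\<integral>\<^sup>+t. ennreal (indicator {0..} t * (t powr (x - 1) * (2 * t / (t\<^sup>2 + c\<^sup>2)))) \<partial>lborel) =
     (\<integral>\<^sup>+t. ennreal (indicator {0..} t * ((t\<^sup>2) powr (z - 1) / (t\<^sup>2 + c\<^sup>2) * (2 * t))) \<partial>lborel)"
  proof (intro nn_integral_cong arg_cong[of _ _ ennreal])
    fix t :: real
    have "(t\<^sup>2) powr (z - 1) = t powr (x - 1)" if "t > 0"
    proof -
      have "2 * (z - 1) = x - 1" by (simp add: z_def field_simps)
      moreover have "(t\<^sup>2) powr (z - 1) = (t powr 2) powr (z - 1)" using that by simp
      ultimately have "(t\<^sup>2) powr (z - 1) = t powr (x - 1)" by (simp only: powr_powr)
      then show ?thesis .
    qed
    then show "indicator {0..} t * (t powr (x - 1) * (2 * t / (t\<^sup>2 + c\<^sup>2))) =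
       indicator {0..} t * ((t\<^sup>2) powr (z - 1) / (t\<^sup>2 + c\<^sup>2) * (2 * t))"
      by (cases "t > 0") (auto simp: indicator_def)
  qed
  also have "\<dots> = (\<integral>\<^sup>+u. ennreal (indicator {0..} u * (u powr (z - 1) / (u + c\<^sup>2))) \<partial>lborel)"
    by (rule nn_integral_square_substitution[symmetric]) auto
  also have "\<dots> = (\<integral>\<^sup>+u. (\<integral>\<^sup>+v. ennreal (indicator {0..} u * u powr (z - 1) *
      (indicator {0..} v * (v powr (1 - 1) * exp (- ((u + c\<^sup>2) * v))))) \<partial>lborel) \<partial>lborel)"
  proof (intro nn_integral_cong)
    fix u :: real
    show "ennreal (indicator {0..} u * (u powr (z - 1) / (u + c\<^sup>2))) = (\<integral>\<^sup>+v. ennreal (indicator {0..} u * u powr (z - 1) *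
      (indicator {0..} v * (v powr (1 - 1) * exp (- ((u + c\<^sup>2) * v))))) \<partial>lborel)"
    proof (cases "u \<ge> 0")
      case True
      then have p: "u + c\<^sup>2 > 0" using c by (simp add: add_nonneg_pos)
      have "(\<integral>\<^sup>+v. ennreal (indicator {0..} u * u powr (z - 1) *
          (indicator {0..} v * (v powr (1 - 1) * exp (- ((u + c\<^sup>2) * v))))) \<partial>lborel) =
          ennreal (u powr (z - 1)) * (\<integral>\<^sup>+v. ennreal (indicator {0..} v * (v powr (1 - 1) * exp (- ((u + c\<^sup>2) * v)))) \<partial>lborel)"
        using True by (subst nn_integral_cmult[symmetric]) (auto simp: ennreal_mult')
      also have "\<dots> = ennreal (u powr (z - 1)) * ennreal (Gamma 1 * (u + c\<^sup>2) powr - 1)"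
        by (subst nn_integral_Gamma_scaled[OF p]) auto
      finally show ?thesis using True p by (simp add: powr_minus divide_inverse flip: ennreal_mult')
    qed simp
  qed
  also have "\<dots> = (\<integral>\<^sup>+v. (\<integral>\<^sup>+u. ennreal (indicator {0..} u * u powr (z - 1) *
      (indicator {0..} v * (v powr (1 - 1) * exp (- ((u + c\<^sup>2) * v))))) \<partial>lborel) \<partial>lborel)"
    by (rule lborel_pair.Fubini') measurable
  also have "\<dots> = (\<integral>\<^sup>+v. ennreal (Gamma z) * ennreal (indicator {0..} v * (v powr ((1 - z) - 1) * exp (- (c\<^sup>2 * v)))) \<partial>lborel)"
  proof (intro nn_integral_cong_AE AE_I[where N = "{0}"] subsetI)
    fix v :: real assume v: "v \<in> {x \<in> space lborel. \<not> ((\<integral>\<^sup>+u. ennreal (indicator {0..} u * u powr (z - 1) *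
      (indicator {0..} x * (x powr (1 - 1) * exp (- ((u + c\<^sup>2) * x))))) \<partial>lborel) =
      ennreal (Gamma z) * ennreal (indicator {0..} x * (x powr ((1 - z) - 1) * exp (- (c\<^sup>2 * x)))))}"
    show "v \<in> {0}"
    proof (rule ccontr)
      assume "v \<notin> {0}"
      then consider "v < 0" | "v > 0" by fastforce
      then show False
      proof cases
        case 2
        have "(\<integral>\<^sup>+u. ennreal (indicator {0..} u * u powr (z - 1) *
          (indicator {0..} v * (v powr (1 - 1) * exp (- ((u + c\<^sup>2) * v))))) \<partial>lborel) =
          (\<integral>\<^sup>+u. ennreal (exp (- (c\<^sup>2 * v))) * ennreal (indicator {0..} u * (u powr (z - 1) * exp (- (v * u)))) \<partial>lborel)"
          using 2 by (intro nn_integral_cong) (auto simp: ennreal_mult'[symmetric] indicator_def algebra_simps exp_add[symmetric] mult_exp_exp)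
        also have "\<dots> = ennreal (exp (- (c\<^sup>2 * v))) * ennreal (Gamma z * v powr - z)"
          by (subst nn_integral_cmult) (auto simp: nn_integral_Gamma_scaled[OF 2 z(1)])
        also have "\<dots> = ennreal (Gamma z) * ennreal (indicator {0..} v * (v powr ((1 - z) - 1) * exp (- (c\<^sup>2 * v))))"
          using 2 z by (simp add: mult_ac flip: ennreal_mult')
        finally show False using v by simp
      qed (use v in simp)
    qed
  qed auto
  also have "\<dots> = ennreal (Gamma z) * ennreal (Gamma (1 - z) * (c\<^sup>2) powr - (1 - z))"
    by (subst nn_integral_cmult, simp, subst nn_integral_Gamma_scaled) (use z c in auto)
  also have "\<dots> = ennreal (Gamma z * Gamma (1 - z) * (c\<^sup>2) powr - (1 - z))"
    using z by (simp add: mult.assoc flip: ennreal_mult')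
  also have "(c\<^sup>2) powr - (1 - z) = c powr (x - 1)"
  proof -
    have "2 * (- (1 - z)) = x - 1" by (simp add: z_def field_simps)
    moreover have "(c\<^sup>2) powr - (1 - z) = (c powr 2) powr - (1 - z)" using c by simp
    ultimately have "(c\<^sup>2) powr - (1 - z) = c powr (x - 1)" by (simp only: powr_powr)
    then show ?thesis .
  qed
  also have "1 - z = (1 - x) / 2" by (simp add: z_def field_simps)
  finally show ?thesis by (simp add: z_def)
qed

text \<open>The error of the trapezoidal rule on [n, n + 1] for the function exp(-tv) of v: mean of
  the end values minus the integral.\<close>

definition trapezoid_exp :: "nat \<Rightarrow> real \<Rightarrow> real" where
  "trapezoid_exp n t = (exp (- (real n * t)) + exp (- (real (Suc n) * t))) / 2 -
     (exp (- (real n * t)) - exp (- (real (Suc n) * t))) / t"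

text \<open>Peano's kernel form of the trapezoidal error: half the integral of (v - n)(n + 1 - v)
  times the second derivative, here t^2 exp(-tv). It exhibits the error as an integral of a
  nonnegative function, so that later sums and integrals may be exchanged freely.\<close>

lemma trapezoid_exp_nn_integral:
  assumes t: "t > 0"
  shows "(\<integral>\<^sup>+v. ennreal (indicator {real n..real (Suc n)} v *
      ((v - real n) * (real (Suc n) - v) * (t\<^sup>2 * exp (- (t * v))) / 2)) \<partial>lborel) = ennreal (trapezoid_exp n t)"
    and "trapezoid_exp n t \<ge> 0"
proof -
  \<comment> \<open>The primitive obtained by integrating by parts until the quadratic factor is
    exhausted.\<close>
  define F where "F v = - t * ((v - real n) * (real (Suc n) - v)) * exp (- (t * v)) / 2
      - (real n + real (Suc n) - 2 * v) * exp (- (t * v)) / 2 + exp (- (t * v)) / t" for v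
  have "((\<lambda>v. (v - real n) * (real (Suc n) - v) * (t\<^sup>2 * exp (- (t * v))) / 2) has_integral
      (F (real (Suc n)) - F (real n))) {real n..real (Suc n)}"
  proof (rule fundamental_theorem_of_calculus)
    fix v assume "v \<in> {real n..real (Suc n)}"
    show "(F has_vector_derivative (v - real n) * (real (Suc n) - v) * (t\<^sup>2 * exp (- (t * v))) / 2)
        (at v within {real n..real (Suc n)})"
      unfolding F_def has_real_derivative_iff_has_vector_derivative[symmetric] using t
      by (auto intro!: derivative_eq_intros simp: field_simps power2_eq_square simp del: of_nat_Suc)
  qed simp
  moreover have "F (real (Suc n)) - F (real n) = trapezoid_exp n t"
    using t unfolding F_def trapezoid_exp_def by (simp add: field_simps)
  ultimately have I: "((\<lambda>v. (v - real n) * (real (Suc n) - v) * (t\<^sup>2 * exp (- (t * v))) / 2) has_integral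
      trapezoid_exp n t) {real n..real (Suc n)}" by simp
  have nn: "(v - real n) * (real (Suc n) - v) * (t\<^sup>2 * exp (- (t * v))) / 2 \<ge> 0"
    if "v \<in> {real n..real (Suc n)}" for v
    using that by (intro divide_nonneg_pos mult_nonneg_nonneg) auto
  show "trapezoid_exp n t \<ge> 0" using I nn by (rule has_integral_nonneg)
  show "(\<integral>\<^sup>+v. ennreal (indicator {real n..real (Suc n)} v *
      ((v - real n) * (real (Suc n) - v) * (t\<^sup>2 * exp (- (t * v))) / 2)) \<partial>lborel) = ennreal (trapezoid_exp n t)"
    by (rule nn_integral_has_integral_lebesgue[OF nn I])
qed

text \<open>The same trapezoidal error for v^(-x). The case n = 0 is written out with 0^(-x) = 0,
  which is the right value for the negative x considered below. The sum over n is zeta(x) by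
  Euler-Maclaurin summation, see \<open>zeta_trapezoid_sums\<close>.\<close>

definition zeta_trapezoid :: "nat \<Rightarrow> real \<Rightarrow> real" where
  "zeta_trapezoid n x = (if n = 0 then 1 / 2 + 1 / (x - 1) else
     (real n powr - x + real (Suc n) powr - x) / 2 +
     (real n powr (1 - x) - real (Suc n) powr (1 - x)) / (1 - x))"

text \<open>Peano's kernel for v^(-x), whose second derivative x(x + 1)v^(-x-2) is negative in this
  range. For n = 0 the kernel vanishes to first order at v = 0 and leaves v^(-x-1), which is
  integrable there since x < 0.\<close>

lemma has_integral_zeta_trapezoid:
  assumes x: "-1 < x" "x < 0"
  shows "((\<lambda>v. (v - real n) * (real (Suc n) - v) * v powr - (x + 2)) has_integral
      (2 / (x * (x + 1)) * zeta_trapezoid n x)) {real n..real (Suc n)}"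
proof -
  define F where "F v = - (v powr (1 - x)) / (1 - x) + (real n + real (Suc n)) * (v powr - x / - x)
     - real n * real (Suc n) * (v powr (- x - 1) / (- x - 1))" for v
  have "((\<lambda>v. (v - real n) * (real (Suc n) - v) * v powr - (x + 2)) has_integral
      (F (real (Suc n)) - F (real n))) {real n..real (Suc n)}"
  \<comment> \<open>For n = 0 the integrand is unbounded at 0, and the primitive is only continuous
    at that end.\<close>
  proof (rule fundamental_theorem_of_calculus_interior)
    fix v assume v: "v \<in> {real n<..<real (Suc n)}"
    then have v0: "v > 0" by (metis greaterThanLessThan_iff le_less_trans of_nat_0_le_iff)
    have pw: "v powr - (x + 2) * v = v powr (- x - 1)" "v powr - (x + 2) * v * v = v powr (-x)"
    proof -
      have "v powr - (x + 2) * v = v powr (- (x + 2)) * v powr 1" using v0 by simp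
      also have "\<dots> = v powr (- (x + 2) + 1)" by (simp only: powr_add)
      also have "- (x + 2) + 1 = - x - 1" by simp
      finally show 1: "v powr - (x + 2) * v = v powr (- x - 1)" .
      have "v powr (- x - 1) * v = v powr (- x - 1) * v powr 1" using v0 by simp
      also have "\<dots> = v powr (- x - 1 + 1)" by (simp only: powr_add)
      finally show "v powr - (x + 2) * v * v = v powr (-x)" unfolding 1 by simp
    qed
    have d: "((\<lambda>v. v powr r) has_real_derivative r * v powr (r - 1)) (at v)" for r
      using v0 by (auto intro!: derivative_eq_intros)
    have "(F has_real_derivative - ((1 - x) * v powr (1 - x - 1)) / (1 - x)
        + (real n + real (Suc n)) * (- x * v powr (- x - 1) / - x)
        - real n * real (Suc n) * ((- x - 1) * v powr (- x - 1 - 1) / (- x - 1))) (at v)"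
      unfolding F_def by (intro DERIV_diff DERIV_add DERIV_cmult DERIV_cdivide DERIV_minus d)
    moreover have "- ((1 - x) * v powr (1 - x - 1)) / (1 - x)
        + (real n + real (Suc n)) * (- x * v powr (- x - 1) / - x)
        - real n * real (Suc n) * ((- x - 1) * v powr (- x - 1 - 1) / (- x - 1)) =
        (v - real n) * (real (Suc n) - v) * v powr - (x + 2)"
    proof -
      have e: "1 - x - 1 = - x" "- x - 1 - 1 = - (x + 2)" by simp_all
      have "- ((1 - x) * v powr (1 - x - 1)) / (1 - x)
        + (real n + real (Suc n)) * (- x * v powr (- x - 1) / - x)
        - real n * real (Suc n) * ((- x - 1) * v powr (- x - 1 - 1) / (- x - 1)) =
        - (v powr - x) + (real n + real (Suc n)) * (v powr (- x - 1)) - real n * real (Suc n) * v powr - (x + 2)"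
        unfolding e using x by simp
      also have "\<dots> = (v - real n) * (real (Suc n) - v) * v powr - (x + 2)"
        unfolding pw[symmetric] by (simp add: algebra_simps)
      finally show ?thesis .
    qed
    ultimately show "(F has_vector_derivative (v - real n) * (real (Suc n) - v) * v powr - (x + 2)) (at v)"
      by (simp only: has_real_derivative_iff_has_vector_derivative)
  next
    show "continuous_on {real n..real (Suc n)} F"
    proof (cases "n = 0")
      case True
      then show ?thesis unfolding F_def using x
        by (auto intro!: continuous_intros continuous_on_powr')
    next
      case False
      then show ?thesis unfolding F_def using x
        by (intro continuous_intros) auto
    qed
  qed simp
  moreover have "F (real (Suc n)) - F (real n) = 2 / (x * (x + 1)) * zeta_trapezoid n x"
  proof -
    have xs: "x \<noteq> 0" "x + 1 \<noteq> 0" "1 - x \<noteq> 0" "- x - 1 \<noteq> 0" "x - 1 \<noteq> 0" using x by auto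
    show ?thesis
    proof (cases "n = 0")
      case True
      have "F (real (Suc n)) - F (real n) = - 1 / (1 - x) - 1 / x"
        using True x by (simp add: F_def)
      also have "\<dots> = 2 / (x * (x + 1)) * (1 / 2 + 1 / (x - 1))"
        using xs by (simp add: divide_simps) (simp add: algebra_simps)
      finally show ?thesis using True by (simp add: zeta_trapezoid_def)
    next
      case False
      define N where "N = real (Suc n)"
      define m where "m = real n"
      have mN: "N = m + 1" "m > 0" using False by (auto simp: m_def N_def)
      define p q where "p = m powr - x" and "q = N powr - x"
      have pw: "m powr (1 - x) = m * p" "N powr (1 - x) = N * q"
        "m powr (- x - 1) = p / m" "N powr (- x - 1) = q / N"
        using mN by (simp_all add: p_def q_def powr_diff powr_minus divide_simps)
      have "F N - F m = - (N * q) / (1 - x) + (m + N) * (q / - x) - m * N * (q / N / (- x - 1))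
         - (- (m * p) / (1 - x) + (m + N) * (p / - x) - m * N * (p / m / (- x - 1)))"
        by (simp only: F_def m_def[symmetric] N_def[symmetric] pw p_def[symmetric] q_def[symmetric])
      also have "\<dots> = q * (- N / (1 - x) - (m + N) / x + m / (x + 1)) - p * (- m / (1 - x) - (m + N) / x + N / (x + 1))"
      proof -
        have y: "- x - 1 = - (x + 1)" by simp
        have "a / (- x - 1) = - (a / (x + 1))" for a unfolding y by (rule minus_divide_right[symmetric])
        moreover have "m * N * (q / N / (- x - 1)) = m * q / (- x - 1)" "m * N * (p / m / (- x - 1)) = N * p / (- x - 1)"
          using mN by simp_all
        ultimately have "m * N * (q / N / (- x - 1)) = - (m * q / (x + 1))" "m * N * (p / m / (- x - 1)) = - (N * p / (x + 1))"
          by (simp_all only:)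
        then show ?thesis by (simp only:) (simp add: algebra_simps add_divide_distrib diff_divide_distrib)
      qed
      also have "- N / (1 - x) - (m + N) / x + m / (x + 1) = 2 / (x * (x + 1)) * (1 / 2 - N / (1 - x))"
        using xs unfolding mN by (simp add: divide_simps) (simp add: algebra_simps)
      also have "- m / (1 - x) - (m + N) / x + N / (x + 1) = 2 / (x * (x + 1)) * (- (1 / 2) - m / (1 - x))"
        using xs unfolding mN by (simp add: divide_simps) (simp add: algebra_simps)
      also have "q * (2 / (x * (x + 1)) * (1 / 2 - N / (1 - x))) - p * (2 / (x * (x + 1)) * (- (1 / 2) - m / (1 - x)))
         = 2 / (x * (x + 1)) * ((p + q) / 2 + (m * p - N * q) / (1 - x))"
      proof -
        have "q * (K * (1 / 2 - N * J)) - p * (K * (- (1 / 2) - m * J)) = K * ((p + q) / 2 + (m * p - N * q) * J)" for K J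
          by (simp add: algebra_simps)
        from this[of "2 / (x * (x + 1))" "1 / (1 - x)"] show ?thesis by simp
      qed
      also have "(p + q) / 2 + (m * p - N * q) / (1 - x) = zeta_trapezoid n x"
        by (simp only: zeta_trapezoid_def False if_False m_def[symmetric] N_def[symmetric] pw p_def[symmetric] q_def[symmetric])
      finally show ?thesis by (simp only: m_def N_def)
    qed
  qed
  ultimately show ?thesis by (simp only:)
qed

text \<open>The Mellin integral of a single exponential diverges at 0 when x < 0. In Peano's form
  the factor t^2 shifts the exponent: Tonelli's theorem gives Gamma(x + 2)v^(-x-2) under the
  integral over v, and Gamma(x + 2) = x(x + 1)Gamma(x) restores the trapezoidal error. Both
  \<open>Gamma x\<close> and \<open>zeta_trapezoid n x\<close> are nonpositive here, so it is their
  product that is nonnegative.\<close>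

lemma nn_integral_trapezoid:
  assumes x: "-1 < x" "x < 0"
  shows "(\<integral>\<^sup>+t. ennreal (indicator {0..} t * (t powr (x - 1) * trapezoid_exp n t)) \<partial>lborel) =
     ennreal (Gamma x * zeta_trapezoid n x)"
    and "Gamma x * zeta_trapezoid n x \<ge> 0"
proof -
  have Gx: "Gamma (x + 2) = x * (x + 1) * Gamma x"
  proof -
    have n: "x \<notin> \<int>\<^sub>\<le>\<^sub>0" "x + 1 \<notin> \<int>\<^sub>\<le>\<^sub>0"
      using x by (auto elim!: nonpos_Ints_cases)
    have "x + 2 = x + 1 + 1" by simp
    then have "Gamma (x + 2) = (x + 1) * Gamma (x + 1)" using Gamma_plus1[OF n(2)] by (simp only:)
    then show ?thesis using Gamma_plus1[OF n(1)] by simp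
  qed
  define q where "q v = (v - real n) * (real (Suc n) - v)" for v
  have q0: "q v \<ge> 0" if "v \<in> {real n..real (Suc n)}" for v using that by (auto simp: q_def simp del: of_nat_Suc)
  have qm [measurable]: "q \<in> borel_measurable borel" unfolding q_def by measurable
  let ?h = "\<lambda>t v. ennreal (indicator {0<..} t * t powr (x - 1) *
      (indicator {real n..real (Suc n)} v * (q v * (t\<^sup>2 * exp (- (t * v))) / 2)))"
  have "(\<integral>\<^sup>+t. ennreal (indicator {0..} t * (t powr (x - 1) * trapezoid_exp n t)) \<partial>lborel) =
     (\<integral>\<^sup>+t. (\<integral>\<^sup>+v. ?h t v \<partial>lborel) \<partial>lborel)"
  proof (intro nn_integral_cong)
    fix t :: real
    show "ennreal (indicator {0..} t * (t powr (x - 1) * trapezoid_exp n t)) = (\<integral>\<^sup>+v. ?h t v \<partial>lborel)"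
    proof (cases "t > 0")
      case True
      have "(\<integral>\<^sup>+v. ?h t v \<partial>lborel) = (\<integral>\<^sup>+v. ennreal (t powr (x - 1)) *
          ennreal (indicator {real n..real (Suc n)} v * (q v * (t\<^sup>2 * exp (- (t * v))) / 2)) \<partial>lborel)"
        using True by (intro nn_integral_cong) (simp add: ennreal_mult'[symmetric] del: of_nat_Suc)
      also have "\<dots> = ennreal (t powr (x - 1)) * ennreal (trapezoid_exp n t)"
        unfolding trapezoid_exp_nn_integral(1)[OF True, symmetric] q_def[symmetric]
        by (rule nn_integral_cmult) measurable
      finally show ?thesis using True by (simp flip: ennreal_mult')
    next
      case False
      then show ?thesis by (cases "t = 0") auto
    qed
  qed
  also have "\<dots> = (\<integral>\<^sup>+v. (\<integral>\<^sup>+t. ?h t v \<partial>lborel) \<partial>lborel)"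
    by (rule lborel_pair.Fubini') measurable
  also have "\<dots> = (\<integral>\<^sup>+v. ennreal (Gamma (x + 2) / 2) * ennreal (indicator {real n..real (Suc n)} v * (q v * v powr - (x + 2))) \<partial>lborel)"
  proof (intro nn_integral_cong)
    fix v :: real
    show "(\<integral>\<^sup>+t. ?h t v \<partial>lborel) = ennreal (Gamma (x + 2) / 2) * ennreal (indicator {real n..real (Suc n)} v * (q v * v powr - (x + 2)))"
    proof (cases "v \<in> {real n..real (Suc n)} \<and> v \<noteq> 0")
      case True
      have v: "v > 0" using True by (metis atLeastAtMost_iff of_nat_0_le_iff order_le_imp_less_or_eq order_trans)
      have "?h t v = ennreal (q v / 2) * ennreal (indicator {0..} t * (t powr ((x + 2) - 1) * exp (- (v * t))))" for t
      proof (cases "t > 0")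
        case t: True
        have "t powr ((x + 2) - 1) = t powr (x - 1 + 2)" by (simp add: algebra_simps)
        also have "\<dots> = t powr (x - 1) * t\<^sup>2" using t by (subst powr_add) simp
        finally show ?thesis using t True q0[of v] by (simp add: ennreal_mult'[symmetric] mult_ac del: of_nat_Suc)
      next
        case False
        then show ?thesis by (cases "t = 0") auto
      qed
      then have "(\<integral>\<^sup>+t. ?h t v \<partial>lborel) = ennreal (q v / 2) * ennreal (Gamma (x + 2) * v powr - (x + 2))"
        using v x by (simp only:) (subst nn_integral_cmult, measurable, subst nn_integral_Gamma_scaled, auto)
      then show ?thesis using True q0[of v] x by (simp add: ennreal_mult'[symmetric] mult_ac del: of_nat_Suc)
    next
      case False
      then show ?thesis
      proof (cases "v = 0")
        case v0: True
        have "real n = 0 \<or> v \<notin> {real n..real (Suc n)}" using v0 by auto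
        then show ?thesis using v0 by (auto simp: q_def)
      qed (use False in auto)
    qed
  qed
  also have "\<dots> = ennreal (Gamma (x + 2) / 2) * (\<integral>\<^sup>+v. ennreal (indicator {real n..real (Suc n)} v * (q v * v powr - (x + 2))) \<partial>lborel)"
    by (rule nn_integral_cmult) measurable
  also have "(\<integral>\<^sup>+v. ennreal (indicator {real n..real (Suc n)} v * (q v * v powr - (x + 2))) \<partial>lborel) =
     ennreal (2 / (x * (x + 1)) * zeta_trapezoid n x)"
    using has_integral_zeta_trapezoid[OF x, of n] q0 unfolding q_def
    by (intro nn_integral_has_integral_lebesgue) auto
  also have "ennreal (Gamma (x + 2) / 2) * ennreal (2 / (x * (x + 1)) * zeta_trapezoid n x) =
     ennreal (Gamma (x + 2) / 2 * (2 / (x * (x + 1)) * zeta_trapezoid n x))"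
    using x by (intro ennreal_mult'[symmetric]) auto
  also have "Gamma (x + 2) / 2 * (2 / (x * (x + 1)) * zeta_trapezoid n x) = Gamma x * zeta_trapezoid n x"
    unfolding Gx using x by simp
  finally show "(\<integral>\<^sup>+t. ennreal (indicator {0..} t * (t powr (x - 1) * trapezoid_exp n t)) \<partial>lborel) =
     ennreal (Gamma x * zeta_trapezoid n x)" .
  have "2 / (x * (x + 1)) * zeta_trapezoid n x \<ge> 0"
    by (rule has_integral_nonneg[OF has_integral_zeta_trapezoid[OF x, of n]])
       (use q0 in \<open>auto simp: q_def intro!: mult_nonneg_nonneg\<close>)
  then have "Gamma (x + 2) / 2 * (2 / (x * (x + 1)) * zeta_trapezoid n x) \<ge> 0"
    by (rule mult_nonneg_nonneg[rotated]) (use x Gamma_real_pos[of "x + 2"] in auto)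
  then show "Gamma x * zeta_trapezoid n x \<ge> 0" unfolding Gx using x by simp
qed

text \<open>Two geometric series in exp(-t). The total is the same function as in
  \<open>coth_partial_fractions\<close>.\<close>

lemma trapezoid_exp_sums:
  assumes t: "t > 0"
  shows "(\<lambda>n. trapezoid_exp n t) sums (1 / 2 + 1 / (exp t - 1) - 1 / t)"
proof -
  define r where "r = exp (- t)"
  have r: "0 < r" "r < 1" using t by (auto simp: r_def)
  have e: "exp (- (real n * t)) = r ^ n" for n by (simp add: r_def exp_of_nat_mult[symmetric])
  have "(\<lambda>n. (1 + r) / 2 * r ^ n - (1 - r) / t * r ^ n) sums ((1 + r) / 2 * (1 / (1 - r)) - (1 - r) / t * (1 / (1 - r)))"
    using r by (intro sums_diff sums_mult geometric_sums) auto
  moreover have "(1 + r) / 2 * r ^ n - (1 - r) / t * r ^ n = trapezoid_exp n t" for n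
    unfolding trapezoid_exp_def e using t by (simp add: field_simps)
  moreover have "(1 + r) / 2 * (1 / (1 - r)) - (1 - r) / t * (1 / (1 - r)) = 1 / 2 + 1 / (exp t - 1) - 1 / t"
  proof -
    have "exp t = 1 / r" by (simp add: r_def exp_minus divide_simps)
    moreover have "1 / r - 1 \<noteq> 0" using r by simp
    ultimately show ?thesis using r t by (simp add: divide_simps) (simp add: algebra_simps)?
  qed
  ultimately show ?thesis by (simp only:)
qed


lemma zeta_rem_2:
  "zeta_rem 2 i s = of_nat (Suc (Suc i)) powr (1 - s) - of_nat (Suc i) powr (1 - s) -
     (1 - s) * of_nat (Suc i) powr (- s) + (1 - s) * s / 2 * of_nat (Suc i) powr (- s - 1)"
proof -
  have 1: "((1 - s) gchoose Suc (Suc 0)) = - ((1 - s) * s / 2)"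
    by (simp add: gbinomial_Suc atMost_Suc atLeast0AtMost numeral_2_eq_2 fact_numeral field_simps)
  have "zeta_rem 2 i s = of_nat (Suc (Suc i)) powr (1 - s) - (of_nat (Suc i) powr (1 - s) +
     (1 - s) * of_nat (Suc i) powr (1 - s - 1) + ((1 - s) gchoose Suc (Suc 0)) * of_nat (Suc i) powr (1 - s - 2))"
    by (simp add: zeta_rem_def numeral_2_eq_2 of_nat_Suc[of 0] of_nat_Suc[of "Suc 0"] del: of_nat_Suc)
  moreover have "1 - s - 1 = - s" "1 - s - 2 = - s - 1" by simp_all
  ultimately show ?thesis unfolding 1 by simp
qed

text \<open>For n = i + 1 the term is one half of the first-order remainder at s + 1 plus 1/(s - 1)
  times the second-order remainder at s. These are the two series of
  \<open>zeta_reg_eq_rem_2\<close>; the term n = 0 supplies the rest, 1/2 + 1/(s - 1).\<close>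

lemma zeta_trapezoid_sums:
  assumes x: "-1 < x" "x < 0"
  shows "(\<lambda>n. complex_of_real (zeta_trapezoid n x)) sums riemann_zeta (of_real x)"
proof -
  define s where "s = complex_of_real x"
  have s1: "s \<noteq> 1" "1 - s \<noteq> 0" "s - 1 \<noteq> 0" using x by (auto simp: s_def)
  define S1 S2 where "S1 = (\<Sum>i. zeta_rem (Suc 0) i (s + 1))" and "S2 = (\<Sum>i. zeta_rem 2 i s)"
  have trm: "complex_of_real (zeta_trapezoid (Suc i) x) = 1 / 2 * zeta_rem (Suc 0) i (s + 1) + 1 / (s - 1) * zeta_rem 2 i s" for i
  proof -
    define n N where "n = real (Suc i)" and "N = real (Suc (Suc i))"
    have nN: "n > 0" "N > 0" by (auto simp: n_def N_def)
    define p q p' q' c where "p = complex_of_real n powr - s" and "q = complex_of_real N powr - s"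
      and "p' = complex_of_real n powr (1 - s)" and "q' = complex_of_real N powr (1 - s)"
      and "c = complex_of_real n powr (- s - 1)"
    have e: "of_nat (Suc i) = complex_of_real n" "of_nat (Suc (Suc i)) = complex_of_real N"
      by (simp_all add: n_def N_def)
    have e2: "1 - (s + 1) = - s" "- (s + 1) = - s - 1" by simp_all
    have "complex_of_real (zeta_trapezoid (Suc i) x) =
       (of_real (n powr - x) + of_real (N powr - x)) / 2 + (of_real (n powr (1 - x)) - of_real (N powr (1 - x))) / (1 - s)"
      by (simp add: zeta_trapezoid_def n_def N_def s_def)
    also have "\<dots> = (p + q) / 2 + (p' - q') / (1 - s)"
      using nN by (simp add: p_def q_def p'_def q'_def s_def powr_of_real[symmetric])
    also have "\<dots> = 1 / 2 * (q - p - (1 - (s + 1)) * c) + 1 / (s - 1) * (q' - p' - (1 - s) * p + (1 - s) * s / 2 * c)"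
      using s1 by (simp add: divide_simps) (simp add: algebra_simps)
    finally show ?thesis unfolding zeta_rem_Suc_0 zeta_rem_2 e e2 p_def q_def p'_def q'_def c_def by simp
  qed
  have "(\<lambda>i. 1 / 2 * zeta_rem (Suc 0) i (s + 1) + 1 / (s - 1) * zeta_rem 2 i s) sums (1 / 2 * S1 + 1 / (s - 1) * S2)"
    unfolding S1_def S2_def using zeta_rem_summable[of "Suc 0" "s + 1"] zeta_rem_summable[of 2 s] x
    by (intro sums_add sums_mult summable_sums) (auto simp: s_def)
  then have "(\<lambda>i. complex_of_real (zeta_trapezoid (Suc i) x)) sums (1 / 2 * S1 + 1 / (s - 1) * S2)"
    by (simp only: trm)
  then have "(\<lambda>n. complex_of_real (zeta_trapezoid n x)) sums (1 / 2 * S1 + 1 / (s - 1) * S2 + of_real (zeta_trapezoid 0 x))"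
    by (subst (asm) sums_Suc_iff) simp
  moreover have "1 / 2 * S1 + 1 / (s - 1) * S2 + of_real (zeta_trapezoid 0 x) = riemann_zeta s"
  proof -
    have "(s - 1) * riemann_zeta s = 1 + (s - 1) / 2 * (1 + S1) + S2"
      using zeta_reg_eq_rem_2[of s] x s1 by (simp add: s_def S1_def S2_def zeta_reg_def)
    then have "riemann_zeta s = (1 + (s - 1) / 2 * (1 + S1) + S2) / (s - 1)"
      using s1 by (simp add: field_simps)
    moreover have gen: "(1 + d / 2 * (1 + A) + B) / d = 1 / 2 * A + 1 / d * B + (1 / 2 + 1 / d)"
      if "d \<noteq> 0" for d A B :: complex using that by (simp add: field_simps)
    moreover have "1 / 2 + 1 / (s - 1) = of_real (zeta_trapezoid 0 x)"
      by (simp add: zeta_trapezoid_def s_def)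
    ultimately show ?thesis using gen[OF s1(3), of S1 S2] by (simp only:)
  qed
  ultimately show ?thesis by (simp add: s_def)
qed

text \<open>The function \<open>Q\<close> behaves like t/12 at 0 and tends to 1/2 at infinity, so
  its Mellin transform converges exactly for -1 < x < 0. It is evaluated twice: the sum of
  \<open>trapezoid_exp\<close> gives Gamma(x) zeta(x), and the partial fractions give the other
  side. All terms are nonnegative, so both exchanges of sum and integral are instances of monotone
  convergence.\<close>

lemma zeta_functional_equation_real:
  assumes x: "-1 < x" "x < 0"
  shows "complex_of_real (Gamma x) * riemann_zeta (of_real x) =
    of_real (Gamma ((1 + x) / 2) * Gamma ((1 - x) / 2) * (2 * pi) powr (x - 1)) * riemann_zeta (1 - of_real x)"
    and "riemann_zeta (of_real x) \<in> \<real>" and "riemann_zeta (1 - of_real x) \<in> \<real>"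
proof -
  define a where "a = Re (riemann_zeta (of_real x))"
  define b where "b = Re (riemann_zeta (1 - of_real x))"
  have sa: "(\<lambda>n. zeta_trapezoid n x) sums a"
    using sums_Re[OF zeta_trapezoid_sums[OF x]] by (simp add: a_def)
  have za: "riemann_zeta (of_real x) = of_real a"
    by (rule sums_unique2[OF zeta_trapezoid_sums[OF x] sums_of_real[OF sa]])
  have "(\<lambda>n. 1 / of_nat (Suc n) powr (1 - of_real x)) sums riemann_zeta (1 - of_real x)"
    using x by (intro riemann_zeta_sums) auto
  moreover have "1 / of_nat (Suc n) powr (1 - of_real x) = complex_of_real (real (Suc n) powr (x - 1))" for n
  proof -
    have "real (Suc n) powr (x - 1) = real (Suc n) powr - (1 - x)" by simp
    also have "\<dots> = 1 / (real (Suc n) powr (1 - x))" by (simp only: powr_minus_divide)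
    finally have "complex_of_real (real (Suc n) powr (x - 1)) = 1 / (complex_of_real (real (Suc n) powr (1 - x)))" by simp
    also have "complex_of_real (real (Suc n) powr (1 - x)) = of_nat (Suc n) powr (1 - of_real x)"
      by (subst powr_of_real[symmetric]) (simp_all del: of_nat_Suc)
    finally show ?thesis ..
  qed
  ultimately have zb0: "(\<lambda>n. complex_of_real (real (Suc n) powr (x - 1))) sums riemann_zeta (1 - of_real x)"
    by (simp only:)
  have sb: "(\<lambda>n. real (Suc n) powr (x - 1)) sums b"
    using sums_Re[OF zb0] by (simp only: b_def Re_complex_of_real)
  have zb: "riemann_zeta (1 - of_real x) = of_real b"
    by (rule sums_unique2[OF zb0 sums_of_real[OF sb]])
  define K where "K = Gamma ((1 + x) / 2) * Gamma ((1 - x) / 2)"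
  have K: "K > 0" unfolding K_def using x by (intro mult_pos_pos Gamma_real_pos) auto
  define Q where "Q t = 1 / 2 + 1 / (exp t - 1) - 1 / t" for t :: real
  have "(\<integral>\<^sup>+t. ennreal (indicator {0..} t * (t powr (x - 1) * Q t)) \<partial>lborel) =
    (\<integral>\<^sup>+t. (\<Sum>n. ennreal (indicator {0..} t * (t powr (x - 1) * trapezoid_exp n t))) \<partial>lborel)"
  proof (intro nn_integral_cong)
    fix t :: real
    show "ennreal (indicator {0..} t * (t powr (x - 1) * Q t)) =
        (\<Sum>n. ennreal (indicator {0..} t * (t powr (x - 1) * trapezoid_exp n t)))"
    proof (cases "t > 0")
      case True
      then show ?thesis unfolding Q_def
        by (intro suminf_ennreal_eq[symmetric] sums_mult trapezoid_exp_sums)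
          (auto intro!: mult_nonneg_nonneg trapezoid_exp_nn_integral(2))
    next
      case False
      then show ?thesis by (cases "t = 0") auto
    qed
  qed
  also have "\<dots> = (\<Sum>n. \<integral>\<^sup>+t. ennreal (indicator {0..} t * (t powr (x - 1) * trapezoid_exp n t)) \<partial>lborel)"
    by (rule nn_integral_suminf) (auto simp: trapezoid_exp_def)
  also have "\<dots> = (\<Sum>n. ennreal (Gamma x * zeta_trapezoid n x))"
    by (simp only: nn_integral_trapezoid(1)[OF x])
  also have "\<dots> = ennreal (Gamma x * a)"
    by (intro suminf_ennreal_eq sums_mult sa nn_integral_trapezoid(2)[OF x])
  finally have A: "(\<integral>\<^sup>+t. ennreal (indicator {0..} t * (t powr (x - 1) * Q t)) \<partial>lborel) = ennreal (Gamma x * a)" .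
  have "(\<integral>\<^sup>+t. ennreal (indicator {0..} t * (t powr (x - 1) * Q t)) \<partial>lborel) =
    (\<integral>\<^sup>+t. (\<Sum>n. ennreal (indicator {0..} t * (t powr (x - 1) * (2 * t / (t\<^sup>2 + (2 * pi * real (Suc n))\<^sup>2))))) \<partial>lborel)"
  proof (intro nn_integral_cong)
    fix t :: real
    show "ennreal (indicator {0..} t * (t powr (x - 1) * Q t)) =
        (\<Sum>n. ennreal (indicator {0..} t * (t powr (x - 1) * (2 * t / (t\<^sup>2 + (2 * pi * real (Suc n))\<^sup>2)))))"
    proof (cases "t > 0")
      case True
      then show ?thesis unfolding Q_def
        by (intro suminf_ennreal_eq[symmetric] sums_mult coth_partial_fractions) auto
    next
      case False
      then show ?thesis by (cases "t = 0") auto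
    qed
  qed
  also have "\<dots> = (\<Sum>n. \<integral>\<^sup>+t. ennreal (indicator {0..} t * (t powr (x - 1) * (2 * t / (t\<^sup>2 + (2 * pi * real (Suc n))\<^sup>2)))) \<partial>lborel)"
    by (rule nn_integral_suminf) auto
  also have "\<dots> = (\<Sum>n. ennreal (K * (2 * pi) powr (x - 1) * real (Suc n) powr (x - 1)))"
  proof (rule arg_cong[of _ _ suminf], rule ext)
    fix n
    have "(\<integral>\<^sup>+t. ennreal (indicator {0..} t * (t powr (x - 1) * (2 * t / (t\<^sup>2 + (2 * pi * real (Suc n))\<^sup>2)))) \<partial>lborel) =
       ennreal (K * (2 * pi * real (Suc n)) powr (x - 1))"
      unfolding K_def using x by (intro nn_integral_powr_over_quadratic) auto
    also have "(2 * pi * real (Suc n)) powr (x - 1) = (2 * pi) powr (x - 1) * real (Suc n) powr (x - 1)"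
      by (rule powr_mult)
    finally show "(\<integral>\<^sup>+t. ennreal (indicator {0..} t * (t powr (x - 1) * (2 * t / (t\<^sup>2 + (2 * pi * real (Suc n))\<^sup>2)))) \<partial>lborel) =
       ennreal (K * (2 * pi) powr (x - 1) * real (Suc n) powr (x - 1))" by (simp only: mult.assoc)
  qed
  also have "\<dots> = ennreal (K * (2 * pi) powr (x - 1) * b)"
    using K by (intro suminf_ennreal_eq sums_mult sb) auto
  finally have "ennreal (Gamma x * a) = ennreal (K * (2 * pi) powr (x - 1) * b)" using A by simp
  moreover have "Gamma x * a \<ge> 0"
    by (rule sums_le[OF nn_integral_trapezoid(2)[OF x] sums_zero sums_mult[OF sa]])
  moreover have "b \<ge> 0" by (rule sums_le[OF _ sums_zero sb]) simp
  ultimately have "Gamma x * a = K * (2 * pi) powr (x - 1) * b"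
    using K by (subst (asm) ennreal_inj) auto
  then have "complex_of_real (Gamma x * a) = complex_of_real (K * (2 * pi) powr (x - 1) * b)" by (simp only:)
  then show "complex_of_real (Gamma x) * riemann_zeta (of_real x) =
    of_real (Gamma ((1 + x) / 2) * Gamma ((1 - x) / 2) * (2 * pi) powr (x - 1)) * riemann_zeta (1 - of_real x)"
    unfolding za zb by (simp only: K_def of_real_mult)
  show "riemann_zeta (of_real x) \<in> \<real>" "riemann_zeta (1 - of_real x) \<in> \<real>" by (simp_all add: za zb)
qed

text \<open>With reciprocal Gamma factors both sides are entire, so the identity on the real
  interval (-1, 0) extends to the plane. Legendre's duplication formula replaces Gamma(x) by
  Gamma(x/2) Gamma((1 + x)/2) up to elementary factors; the second Gamma factor cancels against the
  one in \<open>zeta_functional_equation_real\<close>, and the symmetric form remains.\<close>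

lemma zeta_reg_functional_equation:
  "- s * of_real pi powr (- s / 2) * zeta_reg s * rGamma ((1 - s) / 2) =
   (s - 1) * of_real pi powr (- (1 - s) / 2) * zeta_reg (1 - s) * rGamma (s / 2)"
proof -
  define D where "D s = - s * of_real pi powr (- s / 2) * zeta_reg s * rGamma ((1 - s) / 2) -
   (s - 1) * of_real pi powr (- (1 - s) / 2) * zeta_reg (1 - s) * rGamma (s / 2)" for s
  define U where "U = complex_of_real ` {-1<..<0}"
  have D0: "D z = 0" if zU: "z \<in> U" for z
  proof -
    obtain x where x: "-1 < x" "x < 0" and z: "z = of_real x" using zU by (auto simp: U_def)
    obtain a b where a: "riemann_zeta (of_real x) = of_real a" and b: "riemann_zeta (1 - of_real x) = of_real b"
      using zeta_functional_equation_real(2,3)[OF x] by (auto elim!: Reals_cases)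
    define g1 g2 g3 where "g1 = Gamma (x / 2)" and "g2 = Gamma ((1 + x) / 2)" and "g3 = Gamma ((1 - x) / 2)"
    have ni: "x / 2 \<notin> \<int>\<^sub>\<le>\<^sub>0" "x \<notin> \<int>\<^sub>\<le>\<^sub>0" using x by (auto elim!: nonpos_Ints_cases)
    have g: "g1 \<noteq> 0" "g2 > 0" "g3 > 0"
      unfolding g1_def Gamma_eq_zero_iff g2_def g3_def using x ni(1) by (blast, simp_all add: Gamma_real_pos)
    have fe: "Gamma x * a = g2 * g3 * (2 * pi) powr (x - 1) * b"
      using zeta_functional_equation_real(1)[OF x] unfolding a b g2_def g3_def
      by (simp only: of_real_mult[symmetric] of_real_eq_iff)
    have dup: "g1 * g2 = exp ((1 - x) * ln 2) * sqrt pi * Gamma x"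
    proof -
      have "complex_of_real (x / 2) \<notin> \<int>\<^sub>\<le>\<^sub>0" unfolding of_real_in_nonpos_Ints_iff by (rule ni(1))
      moreover have "complex_of_real (x / 2 + 1 / 2) \<notin> \<int>\<^sub>\<le>\<^sub>0"
        unfolding of_real_in_nonpos_Ints_iff using x by (auto elim!: nonpos_Ints_cases)
      then have "complex_of_real (x / 2) + 1 / 2 \<notin> \<int>\<^sub>\<le>\<^sub>0" by simp
      ultimately have "Gamma (complex_of_real (x / 2)) * Gamma (complex_of_real (x / 2) + 1 / 2) =
         exp ((1 - 2 * complex_of_real (x / 2)) * of_real (ln 2)) * of_real (sqrt pi) * Gamma (2 * complex_of_real (x / 2))"
        by (rule Gamma_legendre_duplication)
      moreover have "complex_of_real (x / 2) + 1 / 2 = of_real ((1 + x) / 2)" by (simp add: field_simps)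
      moreover have "(1 - complex_of_real x) * of_real (ln 2) = of_real ((1 - x) * ln 2)"
        "2 * complex_of_real (x / 2) = of_real x" by simp_all
      ultimately have "Gamma (complex_of_real (x / 2)) * Gamma (of_real ((1 + x) / 2)) =
         exp (of_real ((1 - x) * ln 2)) * of_real (sqrt pi) * Gamma (of_real x)"
        by (simp only:)
      then have "complex_of_real (g1 * g2) = of_real (exp ((1 - x) * ln 2) * sqrt pi * Gamma x)"
        unfolding g1_def g2_def Gamma_complex_of_real exp_of_real of_real_mult[symmetric] .
      then show ?thesis by (simp only: of_real_eq_iff)
    qed
    have key: "g1 * a = pi powr (x - 1 / 2) * g3 * b"
    proof -
      have e1: "exp ((1 - x) * ln 2) * (2 * pi) powr (x - 1) = pi powr (x - 1)"
        by (simp add: powr_def ln_mult exp_add[symmetric] algebra_simps)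
      have e2: "sqrt pi * pi powr (x - 1) = pi powr (x - 1 / 2)"
        by (simp add: powr_half_sqrt[symmetric] powr_add[symmetric])
      have "g1 * a * g2 = exp ((1 - x) * ln 2) * sqrt pi * (Gamma x * a)" using dup by (simp add: mult_ac)
      also have "\<dots> = sqrt pi * (exp ((1 - x) * ln 2) * (2 * pi) powr (x - 1)) * g3 * b * g2"
        unfolding fe by (simp add: mult_ac)
      also have "\<dots> = pi powr (x - 1 / 2) * g3 * b * g2" unfolding e1 e2 ..
      finally show ?thesis using g by simp
    qed
    have zr: "zeta_reg z = of_real ((x - 1) * a)" "zeta_reg (1 - z) = of_real (- x * b)"
      using x a b by (simp_all add: zeta_reg_def z)
    have pw: "of_real pi powr (- z / 2) = complex_of_real (pi powr (- x / 2))"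
      "of_real pi powr (- (1 - z) / 2) = complex_of_real (pi powr (- (1 - x) / 2))"
      unfolding z by (subst powr_of_real[symmetric]; simp)+
    have rg: "rGamma ((1 - z) / 2) = complex_of_real (1 / g3)" "rGamma (z / 2) = complex_of_real (1 / g1)"
    proof -
      have "rGamma (complex_of_real y) = of_real (1 / Gamma y)" for y
        by (simp only: rGamma_complex_of_real) (simp only: rGamma_inverse_Gamma inverse_eq_divide)
      then have "rGamma (complex_of_real ((1 - x) / 2)) = of_real (1 / g3)" "rGamma (complex_of_real (x / 2)) = of_real (1 / g1)"
        unfolding g1_def g3_def by blast+
      then show "rGamma ((1 - z) / 2) = complex_of_real (1 / g3)" "rGamma (z / 2) = complex_of_real (1 / g1)"
        by (simp_all add: z)
    qed
    have pp: "pi powr (- x / 2) * pi powr (x - 1 / 2) = pi powr (- (1 - x) / 2)"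
    proof -
      have "- x / 2 + (x - 1 / 2) = - (1 - x) / 2" by (simp add: field_simps)
      then show ?thesis by (simp only: powr_add[symmetric])
    qed
    have "- x * pi powr (- x / 2) * ((x - 1) * a) * (1 / g3) = (x - 1) * pi powr (- (1 - x) / 2) * (- x * b) * (1 / g1)"
    proof -
      have "- x * pi powr (- x / 2) * ((x - 1) * a) * (1 / g3) = - x * (x - 1) * pi powr (- x / 2) * (g1 * a) / (g1 * g3)"
        using g by simp
      also have "\<dots> = - x * (x - 1) * (pi powr (- x / 2) * pi powr (x - 1 / 2)) * b * g3 / (g1 * g3)"
        unfolding key by (simp add: mult_ac)
      also have "\<dots> = (x - 1) * pi powr (- (1 - x) / 2) * (- x * b) * (1 / g1)"
        unfolding pp using g by simp
      finally show ?thesis .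
    qed
    then have "complex_of_real (- x * pi powr (- x / 2) * ((x - 1) * a) * (1 / g3)) =
       of_real ((x - 1) * pi powr (- (1 - x) / 2) * (- x * b) * (1 / g1))" by (simp only:)
    moreover have "D z = complex_of_real (- x * pi powr (- x / 2) * ((x - 1) * a) * (1 / g3)) -
       of_real ((x - 1) * pi powr (- (1 - x) / 2) * (- x * b) * (1 / g1))"
      unfolding D_def zr pw rg by (simp add: z)
    ultimately show ?thesis by simp
  qed
  have "D s = 0"
  proof (rule analytic_continuation[of D UNIV U "of_real (- 1 / 2)"])
    show "D holomorphic_on UNIV" unfolding D_def by (intro holomorphic_intros) auto
    show "complex_of_real (- 1 / 2) islimpt U" unfolding islimpt_approachable
    proof (intro allI impI)
      fix e :: real assume e: "e > 0"
      define y where "y = - 1 / 2 + min (e / 2) (1 / 4)"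
      have "y \<in> {-1<..<0}" "y \<noteq> - 1 / 2" "\<bar>y - (- 1 / 2)\<bar> < e" using e by (auto simp: y_def)
      then show "\<exists>x'\<in>U. x' \<noteq> complex_of_real (- 1 / 2) \<and> dist x' (complex_of_real (- 1 / 2)) < e"
        by (intro bexI[of _ "of_real y"]) (simp_all only: U_def imageI of_real_eq_iff dist_of_real dist_real_def simp_thms)
    qed
  qed (use D0 in \<open>auto simp: connected_UNIV\<close>)
  then show ?thesis by (simp add: D_def)
qed

text \<open>Twice Riemann's xi function in its usual normalisation. It is considered for Re s > 0,
  where \<open>s * Gamma (s / 2)\<close> has neither zeros nor poles, so that its zeros there are
  those of \<open>zeta_reg\<close>.\<close>

definition xi :: "complex \<Rightarrow> complex" where
  "xi s = of_real pi powr (- s / 2) * (s * Gamma (s / 2)) * zeta_reg s"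

lemma half_not_nonpos_Int: "Re s > 0 \<Longrightarrow> s / 2 \<notin> (\<int>\<^sub>\<le>\<^sub>0 :: complex set)"
  by (auto elim!: nonpos_Ints_cases simp: complex_eq_iff)

lemma xi_holomorphic: "xi holomorphic_on {s. Re s > 0}"
  unfolding xi_def by (intro holomorphic_intros) (auto dest: half_not_nonpos_Int)

lemma xi_symmetric:
  assumes "0 < Re s" "Re s < 1"
  shows "xi (1 - s) = xi s"
proof -
  define g h where "g = Gamma (s / 2)" and "h = Gamma ((1 - s) / 2)"
  have "g \<noteq> 0" "h \<noteq> 0" unfolding g_def h_def
    using half_not_nonpos_Int[of s] half_not_nonpos_Int[of "1 - s"] assms by (auto simp: Gamma_eq_zero_iff)
  moreover have "rGamma (s / 2) = 1 / g" "rGamma ((1 - s) / 2) = 1 / h"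
    by (simp_all add: g_def h_def rGamma_inverse_Gamma inverse_eq_divide)
  moreover have "X * g = Y * h" if "X * (1 / h) = Y * (1 / g)" "g \<noteq> 0" "h \<noteq> 0" for X Y
    using that by (simp add: frac_eq_eq)
  moreover have "- s * of_real pi powr (- s / 2) * zeta_reg s * (1 / h) =
     (s - 1) * of_real pi powr (- (1 - s) / 2) * zeta_reg (1 - s) * (1 / g)"
    if "rGamma (s / 2) = 1 / g" "rGamma ((1 - s) / 2) = 1 / h"
    using zeta_reg_functional_equation[of s] by (simp only: that)
  ultimately have "(- s * of_real pi powr (- s / 2) * zeta_reg s) * g =
     ((s - 1) * of_real pi powr (- (1 - s) / 2) * zeta_reg (1 - s)) * h" by blast
  then have "of_real pi powr (- (1 - s) / 2) * ((1 - s) * h) * zeta_reg (1 - s) =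
     of_real pi powr (- s / 2) * (s * g) * zeta_reg s"
    by (simp add: algebra_simps)
  then show ?thesis unfolding xi_def g_def h_def .
qed


section \<open>The logarithmic derivative and zero-free regions\<close>

lemma norm_inverse_nat_powr:
  "norm (1 / of_nat n powr s :: complex) = (if n = 0 then 0 else real n powr - Re s)"
  by (simp add: norm_divide norm_powr_real_powr powr_minus divide_simps)

lemma ln_mult_powr_le:
  assumes "\<sigma> > 1"
  shows "ln (real n) * real n powr - \<sigma> \<le> 2 / (\<sigma> - 1) * real n powr (- (\<sigma> + 1) / 2)"
proof (cases "n = 0")
  case False
  define e where "e = (\<sigma> - 1) / 2"
  have e: "e > 0" using assms by (simp add: e_def)
  have "ln (real n) * real n powr - \<sigma> \<le> (real n powr e / e) * real n powr - \<sigma>"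
    using False e by (intro mult_right_mono ln_powr_bound) auto
  also have "\<dots> = 1 / e * real n powr (e + - \<sigma>)" by (simp only: powr_add) simp
  also have "e + - \<sigma> = - (\<sigma> + 1) / 2" by (simp add: e_def field_simps)
  also have "1 / e = 2 / (\<sigma> - 1)" by (simp add: e_def)
  finally show ?thesis .
qed simp

lemma summable_ln_powr:
  assumes "\<sigma> > 1"
  shows "summable (\<lambda>n. ln (real n) * real n powr - \<sigma>)"
proof (rule summable_comparison_test')
  show "summable (\<lambda>n. 2 / (\<sigma> - 1) * real n powr (- (\<sigma> + 1) / 2))"
    using assms by (intro summable_mult) (simp add: summable_real_powr_iff)
  show "norm (ln (real n) * real n powr - \<sigma>) \<le> 2 / (\<sigma> - 1) * real n powr (- (\<sigma> + 1) / 2)" if "n \<ge> 1" for n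
    using ln_mult_powr_le[OF assms, of n] that by simp
qed

definition vonMangoldt_series :: "complex \<Rightarrow> complex" where
  "vonMangoldt_series s = (\<Sum>n. mangoldt n / of_nat n powr s)"

lemma norm_mangoldt_powr:
  "norm (mangoldt n / of_nat n powr s :: complex) = mangoldt n * real n powr - Re s"
  by (cases "n = 0") (simp_all add: norm_divide norm_powr_real_powr powr_minus divide_simps)

lemma mangoldt_powr_le_ln: "mangoldt n * real n powr x \<le> ln (real n) * real n powr x"
  by (cases "n = 0") (auto intro!: mult_right_mono mangoldt_le)

lemma summable_mangoldt_powr:
  assumes "\<sigma> > 1"
  shows "summable (\<lambda>n. mangoldt n * real n powr - \<sigma>)"
  by (rule summable_comparison_test'[OF summable_ln_powr[OF assms], of 0])
     (use mangoldt_powr_le_ln mangoldt_nonneg in \<open>auto simp: abs_mult\<close>)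

lemma summable_vonMangoldt: "Re s > 1 \<Longrightarrow> summable (\<lambda>n. norm (mangoldt n / of_nat n powr s :: complex))"
  unfolding norm_mangoldt_powr by (rule summable_mangoldt_powr)

lemma vonMangoldt_sums: "Re s > 1 \<Longrightarrow> (\<lambda>n. mangoldt n / of_nat n powr s) sums vonMangoldt_series s"
  unfolding vonMangoldt_series_def by (intro summable_sums summable_norm_cancel[OF summable_vonMangoldt])

lemma vonMangoldt_bound:
  assumes "\<sigma> > 1" "Re s \<ge> \<sigma>"
  shows "norm (vonMangoldt_series s) \<le> (\<Sum>n. mangoldt n * real n powr - \<sigma>)"
  unfolding vonMangoldt_series_def
proof (rule norm_suminf_le[OF _ summable_mangoldt_powr[OF assms(1)]])
  fix n
  show "norm (mangoldt n / of_nat n powr s :: complex) \<le> mangoldt n * real n powr - \<sigma>"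
    unfolding norm_mangoldt_powr using assms
    by (cases "n = 0") (auto intro!: mult_left_mono powr_mono mangoldt_nonneg)
qed

lemma vonMangoldt_holomorphic: "vonMangoldt_series holomorphic_on {s. Re s > 1}"
proof -
  have "(\<lambda>s. \<Sum>n. mangoldt n / of_nat n powr s :: complex) holomorphic_on {s. Re s > 1}"
  proof (rule holomorphic_suminf_Re_gt(1))
    show "(\<lambda>s. mangoldt n / of_nat n powr s :: complex) holomorphic_on {s. Re s > 1}" for n
      by (cases "n = 0") (auto intro!: holomorphic_intros)
    fix s0 d assume d: "d > 0" "Re s0 - d > 1"
    show "\<exists>g. summable g \<and> (\<forall>\<^sub>F i in sequentially. \<forall>s\<in>cball s0 d. norm (mangoldt i / of_nat i powr s :: complex) \<le> g i)"
    proof (intro exI conjI always_eventually allI ballI)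
      show "summable (\<lambda>n. mangoldt n * real n powr - (Re s0 - d))" by (rule summable_mangoldt_powr[OF d(2)])
      fix n s assume s: "s \<in> cball s0 d"
      show "norm (mangoldt n / of_nat n powr s :: complex) \<le> mangoldt n * real n powr - (Re s0 - d)"
        unfolding norm_mangoldt_powr using cball_Re_ge[OF s]
        by (cases "n = 0") (auto intro!: mult_left_mono powr_mono mangoldt_nonneg)
    qed
  qed
  then show ?thesis by (simp add: vonMangoldt_series_def[abs_def])
qed

lemma riemann_zeta_sums': "Re s > 1 \<Longrightarrow> (\<lambda>n. 1 / of_nat n powr s) sums riemann_zeta s"
  by (rule sums_Suc_imp[OF _ riemann_zeta_sums]) auto

lemma deriv_riemann_zeta:
  assumes s: "Re s > 1"
  shows "(riemann_zeta has_field_derivative (\<Sum>n. - of_real (ln (real n)) / of_nat n powr s)) (at s)"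
proof -
  define c where "c = (1 + Re s) / 2"
  have c: "c > 1" "c < Re s" using s by (auto simp: c_def)
  define A where "A = {s. Re s > c}"
  define f' where "f' n s = - of_real (ln (real n)) / (of_nat n powr s :: complex)" for n s
  have der: "((\<lambda>s. 1 / of_nat n powr s) has_field_derivative f' n z) (at z within A)" for n z
  proof (cases "n = 0")
    case False
    have "((\<lambda>s. of_nat n powr (- s)) has_field_derivative Ln (of_nat n) * of_nat n powr (- z) * (- 1)) (at z within A)"
      by (rule DERIV_chain2[OF has_field_derivative_powr_right]) (use False in \<open>auto intro!: derivative_eq_intros\<close>)
    moreover have "Ln (of_nat n) * of_nat n powr (- z) * (- 1) = f' n z"
      using False by (simp add: f'_def powr_minus Ln_of_nat divide_inverse)
    moreover have "of_nat n powr (- s) = 1 / of_nat n powr s" for s :: complex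
      by (simp add: powr_minus divide_inverse)
    ultimately show ?thesis by (simp only:)
  qed (simp add: f'_def)
  have unif: "uniformly_convergent_on A (\<lambda>n z. \<Sum>i<n. f' i z)"
  proof (rule Weierstrass_m_test'[OF _ summable_ln_powr[OF c(1)]])
    fix n z assume z: "z \<in> A"
    show "norm (f' n z) \<le> ln (real n) * real n powr - c"
    proof (cases "n = 0")
      case False
      then have "norm (f' n z) = ln (real n) * real n powr - Re z"
        by (simp add: f'_def norm_divide norm_powr_real_powr powr_minus divide_simps)
      also have "\<dots> \<le> ln (real n) * real n powr - c"
        using False z by (intro mult_left_mono powr_mono) (auto simp: A_def)
      finally show ?thesis .
    qed (simp add: f'_def)
  qed
  have A: "convex A" "open A" "s \<in> A" using c by (auto simp: A_def convex_halfspace_Re_gt open_halfspace_Re_gt)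
  have sm: "summable (\<lambda>n. 1 / of_nat n powr s :: complex)" using riemann_zeta_sums'[OF s] by (auto simp: sums_iff)
  have "((\<lambda>z. \<Sum>n. 1 / of_nat n powr z) has_field_derivative (\<Sum>n. f' n s)) (at s)"
    by (rule has_field_derivative_series'(2)[OF A(1) der unif A(3) sm]) (use A in \<open>auto simp: interior_open\<close>)
  then have "(riemann_zeta has_field_derivative (\<Sum>n. f' n s)) (at s)"
  proof (rule has_field_derivative_transform_within_open[OF _ A(2,3)])
    fix z assume "z \<in> A"
    then show "(\<Sum>n. 1 / of_nat n powr z) = riemann_zeta z"
      using riemann_zeta_sums'[of z] c by (auto simp: A_def sums_iff)
  qed
  then show ?thesis by (simp add: f'_def)
qed

text \<open>The convolution identity: the von Mangoldt function summed over the divisors of n gives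
  log n. Both series converge absolutely, so their product may be summed along n = kd.\<close>

lemma zeta_times_vonMangoldt:
  assumes s: "Re s > 1"
  shows "(\<lambda>n. of_real (ln (real n)) / of_nat n powr s) sums (riemann_zeta s * vonMangoldt_series s)"
proof -
  define a where "a k = 1 / (of_nat k powr s :: complex)" for k :: nat
  define b where "b d = mangoldt d / (of_nat d powr s :: complex)" for d :: nat
  have na: "summable (\<lambda>k. norm (a k))"
  proof -
    have "summable (\<lambda>k. real k powr - Re s)" using s by (simp add: summable_real_powr_iff)
    moreover have "norm (a k) = real k powr - Re s" for k by (simp add: a_def norm_inverse_nat_powr)
    ultimately show ?thesis by simp
  qed
  have nb: "summable (\<lambda>k. norm (b k))" unfolding b_def by (rule summable_vonMangoldt[OF s])
  have ha: "(a has_sum riemann_zeta s) UNIV"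
    unfolding a_def by (rule norm_summable_imp_has_sum[OF na[unfolded a_def] riemann_zeta_sums'[OF s]])
  have hb: "(b has_sum vonMangoldt_series s) UNIV"
    unfolding b_def by (rule norm_summable_imp_has_sum[OF nb[unfolded b_def] vonMangoldt_sums[OF s]])
  have nah: "(\<lambda>k. norm (a k)) summable_on UNIV"
    using na norm_summable_imp_summable_on[of "\<lambda>k. norm (a k)"] by simp
  have nbh: "(\<lambda>k. norm (b k)) summable_on UNIV"
    using nb norm_summable_imp_summable_on[of "\<lambda>k. norm (b k)"] by simp
  define f where "f = (\<lambda>(k, d). a k * b d)"
  have "Infinite_Sum.abs_summable_on f (UNIV \<times> UNIV)"
    unfolding Infinite_Sum.abs_summable_on_Sigma_iff
  proof (intro conjI ballI)
    fix k :: nat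
    show "Infinite_Sum.abs_summable_on (\<lambda>d. f (k, d)) UNIV"
      using summable_on_cmult_right[OF nbh, of "norm (a k)"] by (simp add: f_def norm_mult)
  next
    have "(\<lambda>k. norm (a k) * (\<Sum>\<^sub>\<infinity>d. norm (b d))) summable_on UNIV"
      by (rule summable_on_cmult_left[OF nah])
    moreover have "norm (\<Sum>\<^sub>\<infinity>d. norm (f (k, d))) = norm (a k) * (\<Sum>\<^sub>\<infinity>d. norm (b d))" for k
      by (simp add: f_def norm_mult infsum_cmult_right' infsum_nonneg abs_mult)
    ultimately show "Infinite_Sum.abs_summable_on (\<lambda>k. \<Sum>\<^sub>\<infinity>d. norm (f (k, d))) UNIV" by simp
  qed
  then have "f summable_on (UNIV \<times> UNIV)" by (rule abs_summable_summable)
  then obtain S where S: "(f has_sum S) (UNIV \<times> UNIV)" by (auto simp: summable_on_def)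
  have "((\<lambda>k. a k * vonMangoldt_series s) has_sum S) UNIV"
    by (rule has_sum_SigmaD[OF S]) (auto simp: f_def intro!: has_sum_cmult_right hb)
  moreover have "((\<lambda>k. a k * vonMangoldt_series s) has_sum (riemann_zeta s * vonMangoldt_series s)) UNIV"
    by (rule has_sum_cmult_left[OF ha])
  ultimately have S_eq: "S = riemann_zeta s * vonMangoldt_series s" using has_sum_unique by blast
  \<comment> \<open>Terms with a zero index vanish, as division by 0 gives 0. Without them (k, d) ->
    (kd, d) is a bijection onto the pairs (n, d) with n positive and d dividing n.\<close>
  have "(f has_sum S) ({1..} \<times> {1..})"
  proof (rule has_sum_cong_neutral[THEN iffD1, OF _ _ _ S])
    fix x assume "x \<in> UNIV \<times> UNIV - {1::nat..} \<times> {1::nat..}"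
    then show "f x = 0" by (cases x) (auto simp: f_def a_def b_def not_le)
  qed auto
  moreover have "(f has_sum S) ({1..} \<times> {1..}) \<longleftrightarrow>
     ((\<lambda>(n, d). f (n div d, d)) has_sum S) (Sigma {1..} (\<lambda>n. {d. d dvd n}))"
    by (rule has_sum_reindex_bij_witness[of _ "\<lambda>(n, d). (n div d, d)" "\<lambda>(k, d). (k * d, d)"])
       (auto elim!: dvdE simp: Suc_le_eq intro!: Nat.gr0I)
  ultimately have S2: "((\<lambda>(n, d). f (n div d, d)) has_sum S) (Sigma {1..} (\<lambda>n. {d. d dvd n}))" by blast
  have "((\<lambda>n. of_real (ln (real n)) / of_nat n powr s) has_sum S) {1..}"
  proof (rule has_sum_SigmaD[OF S2])
    fix n :: nat assume n: "n \<in> {1..}"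
    have fin: "finite {d. d dvd n}" using n by auto
    have "(\<Sum>d | d dvd n. f (n div d, d)) = (\<Sum>d | d dvd n. mangoldt d / of_nat n powr s)"
    proof (rule sum.cong[OF refl])
      fix d assume "d \<in> {d. d dvd n}"
      then have "d dvd n" by simp
      then obtain k where "n = d * k" by (rule dvdE)
      then have k: "n = k * d" by (simp add: mult.commute)
      have d: "d > 0" "k > 0" using k n by (auto intro!: Nat.gr0I)
      have "(of_nat n :: complex) powr s = of_nat k powr s * of_nat d powr s"
        unfolding k of_nat_mult by (rule powr_times_real) auto
      then show "f (n div d, d) = mangoldt d / of_nat n powr s"
        using k d by (simp add: f_def a_def b_def)
    qed
    also have "\<dots> = of_real (ln (real n)) / of_nat n powr s"
      using n by (simp add: sum_divide_distrib[symmetric] mangoldt_sum)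
    finally show "((\<lambda>d. case (n, d) of (n, d) \<Rightarrow> f (n div d, d)) has_sum of_real (ln (real n)) / of_nat n powr s) {d. d dvd n}"
      using has_sum_finite[OF fin, of "\<lambda>d. f (n div d, d)"] by simp
  qed
  then have "((\<lambda>n. of_real (ln (real n)) / of_nat n powr s) has_sum S) UNIV"
    by (rule has_sum_cong_neutral[THEN iffD1, rotated -1]) (auto simp: not_le)
  then show ?thesis unfolding S_eq by (rule has_sum_imp_sums)
qed

lemma deriv_riemann_zeta_eq:
  assumes s: "Re s > 1"
  shows "(riemann_zeta has_field_derivative - vonMangoldt_series s * riemann_zeta s) (at s)"
proof -
  have "(\<Sum>n. - of_real (ln (real n)) / of_nat n powr s) = - (riemann_zeta s * vonMangoldt_series s)"
    using sums_minus[OF zeta_times_vonMangoldt[OF s]] by (simp add: sums_iff)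
  then show ?thesis using deriv_riemann_zeta[OF s] by (simp add: mult.commute)
qed

text \<open>For a primitive q of \<open>Q\<close> the function f exp(-q) is constant, so a single
  zero would force f to vanish identically. Zero-freeness is obtained in this way twice: from the
  von Mangoldt series for Re s > 1, and at the end from its continuation to the left.\<close>

lemma linear_ode_nonzero:
  assumes S: "convex S" "open S" and Q: "Q holomorphic_on S"
    and f: "\<And>s. s \<in> S \<Longrightarrow> (f has_field_derivative Q s * f s) (at s)"
    and w: "w \<in> S" "f w \<noteq> 0" and z: "z \<in> S"
  shows "f z \<noteq> 0"
proof -
  obtain q where q: "\<And>x. x \<in> S \<Longrightarrow> (q has_field_derivative Q x) (at x)"
    using holomorphic_convex_primitive'[OF S Q] at_within_open[OF _ S(2)] by metis
  have "\<exists>c. \<forall>x\<in>S. f x * exp (- q x) = c"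
  proof (rule has_field_derivative_zero_constant[OF S(1)])
    fix x assume x: "x \<in> S"
    show "((\<lambda>x. f x * exp (- q x)) has_field_derivative 0) (at x within S)"
      by (rule has_field_derivative_at_within)
         (use f[OF x] q[OF x] in \<open>auto intro!: derivative_eq_intros simp: algebra_simps\<close>)
  qed
  then obtain c where c: "\<And>x. x \<in> S \<Longrightarrow> f x * exp (- q x) = c" by blast
  then have "c \<noteq> 0" using c[OF w(1)] w(2) by auto
  then show ?thesis using c[OF z] by auto
qed

text \<open>The terms n >= 2 contribute at most 3/4: the term n = 2 gives 1/4, and for n >= 3 the
  comparison 1/n^2 <= 1/(n - 1) - 1/n telescopes to 1/2.\<close>

lemma norm_riemann_zeta_ge:
  assumes s: "Re s \<ge> 2"
  shows "norm (riemann_zeta s) \<ge> 1 / 4"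
proof -
  have z: "(\<lambda>n. 1 / of_nat (Suc (Suc n)) powr s) sums (riemann_zeta s - 1)"
    using riemann_zeta_sums[of s] s by (subst sums_Suc_iff) simp
  define g where "g n = (if n = 0 then 1 / 4 else 1 / real (Suc n) - 1 / real (Suc (Suc n)))" for n
  have "(\<lambda>n. g (Suc n)) sums (1 / real (Suc (Suc 0)) - 0)"
  proof -
    have "(\<lambda>n. (1 / real (Suc (Suc n))) - 1 / real (Suc (Suc (Suc n)))) sums (1 / real (Suc (Suc 0)) - 0)"
      by (rule telescope_sums') (intro LIMSEQ_Suc lim_1_over_n)
    then show ?thesis by (simp add: g_def)
  qed
  then have g: "g sums (1 / 2 + 1 / 4)"
    by (subst (asm) sums_Suc_iff) (simp add: g_def)
  have b: "norm (1 / of_nat (Suc (Suc n)) powr s :: complex) \<le> g n" for n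
  proof -
    have "norm (1 / of_nat (Suc (Suc n)) powr s :: complex) = real (Suc (Suc n)) powr - Re s"
      by (subst norm_inverse_nat_powr) simp
    also have "\<dots> \<le> real (Suc (Suc n)) powr - 2" using s by (intro powr_mono) auto
    also have "\<dots> = 1 / (real (Suc (Suc n)))\<^sup>2" by (simp add: powr_minus divide_inverse del: of_nat_Suc)
    also have "\<dots> \<le> g n"
    proof (cases "n = 0")
      case False
      have "1 / (real (Suc (Suc n)))\<^sup>2 \<le> 1 / (real (Suc n) * real (Suc (Suc n)))"
        unfolding power2_eq_square by (intro frac_le mult_right_mono) auto
      also have "\<dots> = 1 / real (Suc n) - 1 / real (Suc (Suc n))" by (simp add: field_simps)
      finally show ?thesis using False by (simp add: g_def)
    qed (simp add: g_def)
    finally show ?thesis .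
  qed
  have "norm (riemann_zeta s - 1) \<le> 1 / 2 + 1 / 4"
    using norm_suminf_le[OF b sums_summable[OF g]] sums_unique[OF z] sums_unique[OF g] by (simp only:)
  then show ?thesis using norm_triangle_ineq2[of 1 "1 - riemann_zeta s"] by (simp add: norm_minus_commute)
qed

lemma riemann_zeta_nonzero_Re_gt_1:
  assumes "Re s > 1"
  shows "riemann_zeta s \<noteq> 0"
proof (rule linear_ode_nonzero[of "{s. Re s > 1}" "\<lambda>s. - vonMangoldt_series s" riemann_zeta 2 s])
  show "(\<lambda>s. - vonMangoldt_series s) holomorphic_on {s. Re s > 1}"
    by (intro holomorphic_intros vonMangoldt_holomorphic)
  show "riemann_zeta 2 \<noteq> 0" using norm_riemann_zeta_ge[of 2] by auto
  show "(riemann_zeta has_field_derivative - vonMangoldt_series z * riemann_zeta z) (at z)"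
    if "z \<in> {s. Re s > 1}" for z using that by (intro deriv_riemann_zeta_eq) simp
qed (use assms in \<open>auto simp: convex_halfspace_Re_gt open_halfspace_Re_gt\<close>)

definition zeta_logderiv :: "complex \<Rightarrow> complex" where
  "zeta_logderiv s = deriv zeta_reg s / zeta_reg s"

lemma zeta_logderiv_Re_gt_1:
  assumes s: "Re s > 1"
  shows "zeta_logderiv s = 1 / (s - 1) - vonMangoldt_series s"
proof -
  have s1: "s \<noteq> 1" using s by auto
  have "((\<lambda>s. (s - 1) * riemann_zeta s) has_field_derivative
      riemann_zeta s + (s - 1) * (- vonMangoldt_series s * riemann_zeta s)) (at s)"
    by (auto intro!: derivative_eq_intros deriv_riemann_zeta_eq s)
  then have "(zeta_reg has_field_derivative
      riemann_zeta s + (s - 1) * (- vonMangoldt_series s * riemann_zeta s)) (at s)"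
    by (rule has_field_derivative_transform_within_open[where S = "- {1}"])
       (use s1 in \<open>auto simp: zeta_reg_def\<close>)
  then have "deriv zeta_reg s = riemann_zeta s + (s - 1) * (- vonMangoldt_series s * riemann_zeta s)"
    by (rule DERIV_imp_deriv)
  moreover have "(z + d * (- V * z)) / (d * z) = 1 / d - V" if "d \<noteq> 0" "z \<noteq> 0" for z d V :: complex
    using that by (simp add: field_simps)
  moreover have "zeta_reg s = (s - 1) * riemann_zeta s" using s1 by (simp add: zeta_reg_def)
  ultimately show ?thesis
    using s1 riemann_zeta_nonzero_Re_gt_1[OF s] by (simp add: zeta_logderiv_def)
qed

section \<open>Non-vanishing on the line Re s = 1\<close>

lemma norm_decreasing_of_logderiv:
  fixes g :: "real \<Rightarrow> complex"
  assumes "a \<le> b" and g: "\<And>x. a \<le> x \<Longrightarrow> x \<le> b \<Longrightarrow> (g has_vector_derivative g x * w x) (at x)"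
    and w: "\<And>x. a \<le> x \<Longrightarrow> x \<le> b \<Longrightarrow> Re (w x) \<le> 0"
  shows "norm (g b) \<le> norm (g a)"
proof -
  have "(Re (g b))\<^sup>2 + (Im (g b))\<^sup>2 \<le> (Re (g a))\<^sup>2 + (Im (g a))\<^sup>2"
  proof (rule DERIV_nonpos_imp_nonincreasing[OF assms(1)])
    fix x assume x: "a \<le> x" "x \<le> b"
    have R: "((\<lambda>x. Re (g x)) has_real_derivative Re (g x * w x)) (at x)"
      "((\<lambda>x. Im (g x)) has_real_derivative Im (g x * w x)) (at x)"
      using bounded_linear.has_vector_derivative[OF bounded_linear_Re g[OF x]]
        bounded_linear.has_vector_derivative[OF bounded_linear_Im g[OF x]]
      by (auto simp: has_real_derivative_iff_has_vector_derivative)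
    have "((\<lambda>x. (Re (g x))\<^sup>2 + (Im (g x))\<^sup>2) has_real_derivative
        2 * Re (g x) * Re (g x * w x) + 2 * Im (g x) * Im (g x * w x)) (at x)"
      by (rule DERIV_cong[OF DERIV_add[OF DERIV_power[OF R(1), of 2] DERIV_power[OF R(2), of 2]]])
         (simp del: times_complex.sel)
    moreover have "2 * Re (g x) * Re (g x * w x) + 2 * Im (g x) * Im (g x * w x) =
        2 * ((Re (g x))\<^sup>2 + (Im (g x))\<^sup>2) * Re (w x)"
      by (simp add: algebra_simps power2_eq_square)
    moreover have "2 * ((Re (g x))\<^sup>2 + (Im (g x))\<^sup>2) * Re (w x) \<le> 0"
      using w[OF x] by (intro mult_nonneg_nonpos) auto
    ultimately show "\<exists>y. ((\<lambda>x. (Re (g x))\<^sup>2 + (Im (g x))\<^sup>2) has_real_derivative y) (at x) \<and> y \<le> 0"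
      by auto
  qed
  then have "(norm (g b))\<^sup>2 \<le> (norm (g a))\<^sup>2" by (simp add: cmod_power2)
  then show ?thesis by (rule power2_le_imp_le) simp
qed

text \<open>The identity 3 + 4 cos y + cos 2y = 2(1 + cos y)^2 is applied to the logarithmic
  derivative of the product: its real part is nonpositive, so the modulus cannot decrease as
  \<sigma> moves from 2 towards 1, and the value at 2 is a lower bound.\<close>

lemma zeta_3_4_1:
  fixes t \<sigma> :: real
  assumes \<sigma>: "1 < \<sigma>" "\<sigma> \<le> 2"
  shows "norm (riemann_zeta 2 ^ 3 * riemann_zeta (Complex 2 t) ^ 4 * riemann_zeta (Complex 2 (2 * t)))
     \<le> norm (riemann_zeta (of_real \<sigma>) ^ 3 * riemann_zeta (Complex \<sigma> t) ^ 4 * riemann_zeta (Complex \<sigma> (2 * t)))"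
proof -
  define z where "z u x = riemann_zeta (Complex x u)" for u x
  define V where "V u x = - vonMangoldt_series (Complex x u)" for u x
  define g where "g x = z 0 x ^ 3 * z t x ^ 4 * z (2 * t) x" for x
  have cx: "Complex x u = of_real x + \<i> * of_real u" for x u by (simp add: complex_eq_iff)
  have dz: "(z u has_vector_derivative (z u x * V u x)) (at x)" if "x > 1" for u x
  proof -
    have "((\<lambda>x. of_real x + \<i> * of_real u) has_vector_derivative 1) (at x)"
      by (auto intro!: derivative_eq_intros)
    from field_vector_diff_chain_at[OF this, of riemann_zeta "V u x * z u x"]
    show ?thesis using deriv_riemann_zeta_eq[of "Complex x u"] that
      by (simp add: o_def z_def[abs_def] V_def cx mult.commute)
  qed
  have "norm (g 2) \<le> norm (g \<sigma>)"
  proof (rule norm_decreasing_of_logderiv[OF \<sigma>(2), where w = "\<lambda>x. 3 * V 0 x + 4 * V t x + V (2 * t) x"])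
    fix x assume x: "\<sigma> \<le> x" "x \<le> 2"
    then have x1: "x > 1" using \<sigma> by simp
    have D: "((\<lambda>x. F x ^ n) has_vector_derivative (of_nat n * F x ^ (n - 1) * F')) (at x)"
      if "(F has_vector_derivative F') (at x)" for F :: "real \<Rightarrow> complex" and F' n
    proof -
      have "((\<lambda>w. w ^ n) has_field_derivative of_nat n * F x ^ (n - 1)) (at (F x))"
        by (auto intro!: derivative_eq_intros)
      from field_vector_diff_chain_at[OF that this] show ?thesis by (simp add: o_def mult_ac)
    qed
    have "(g has_vector_derivative
       (z 0 x ^ 3 * z t x ^ 4 * (z (2 * t) x * V (2 * t) x) +
         (z 0 x ^ 3 * (of_nat 4 * z t x ^ (4 - 1) * (z t x * V t x)) +
          of_nat 3 * z 0 x ^ (3 - 1) * (z 0 x * V 0 x) * z t x ^ 4) * z (2 * t) x)) (at x)"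
      unfolding g_def[abs_def]
      by (intro has_vector_derivative_mult D dz x1)
    moreover have "(z 0 x ^ 3 * z t x ^ 4 * (z (2 * t) x * V (2 * t) x) +
         (z 0 x ^ 3 * (of_nat 4 * z t x ^ (4 - 1) * (z t x * V t x)) +
          of_nat 3 * z 0 x ^ (3 - 1) * (z 0 x * V 0 x) * z t x ^ 4) * z (2 * t) x) =
        g x * (3 * V 0 x + 4 * V t x + V (2 * t) x)"
      unfolding g_def by (simp add: algebra_simps power_numeral_reduce)
    ultimately show "(g has_vector_derivative g x * (3 * V 0 x + 4 * V t x + V (2 * t) x)) (at x)" by simp
    define c where "c n u = Re (mangoldt n / of_nat n powr (Complex x u) :: complex)" for n :: nat and u
    have sc: "(\<lambda>n. c n u) sums (- Re (V u x))" for u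
      using sums_Re[OF vonMangoldt_sums[of "Complex x u"]] x1 by (simp add: c_def V_def)
    have sm: "(\<lambda>n. 3 * c n 0 + 4 * c n t + c n (2 * t)) sums (3 * (- Re (V 0 x)) + 4 * (- Re (V t x)) + (- Re (V (2 * t) x)))"
      by (intro sums_add sums_mult sc)
    have nn: "0 \<le> 3 * c n 0 + 4 * c n t + c n (2 * t)" for n
    proof (cases "n = 0")
      case False
      have ce: "c n u = mangoldt n * real n powr - x * cos (u * ln (real n))" for u
      proof -
        have "1 / of_nat n powr (Complex x u) = of_real (real n powr - x) * cis (- (u * ln (real n)))"
        proof -
          have "1 / of_nat n powr (Complex x u) = exp (- (Complex x u * of_real (ln (real n))))"
            using False by (simp add: powr_def exp_minus divide_inverse Ln_of_nat)
          also have "- (Complex x u * of_real (ln (real n))) = Complex (- x * ln (real n)) (- (u * ln (real n)))"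
            by (simp add: complex_eq_iff)
          also have "exp \<dots> = of_real (exp (- x * ln (real n))) * cis (- (u * ln (real n)))"
            by (simp add: exp_eq_polar)
          also have "exp (- x * ln (real n)) = real n powr - x" using False by (simp add: powr_def)
          finally show ?thesis .
        qed
        moreover have "c n u = mangoldt n * Re (1 / of_nat n powr (Complex x u))"
        proof -
          have "mangoldt n / of_nat n powr (Complex x u) = of_real (mangoldt n) * (1 / of_nat n powr (Complex x u) :: complex)"
            by simp
          then show ?thesis unfolding c_def by (simp only:) (simp only: times_complex.sel Re_complex_of_real Im_complex_of_real mult_zero_left diff_zero)
        qed
        ultimately show ?thesis by simp
      qed
      have "3 * c n 0 + 4 * c n t + c n (2 * t) = mangoldt n * real n powr - x * (3 + 4 * cos (t * ln (real n)) + cos (2 * (t * ln (real n))))"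
        unfolding ce by (simp add: algebra_simps)
      also have "3 + 4 * cos (t * ln (real n)) + cos (2 * (t * ln (real n))) = 2 * (1 + cos (t * ln (real n)))\<^sup>2"
        unfolding cos_double_cos by (simp add: power2_eq_square algebra_simps)
      also have "mangoldt n * real n powr - x * (2 * (1 + cos (t * ln (real n)))\<^sup>2) \<ge> 0"
        by (intro mult_nonneg_nonneg mangoldt_nonneg) auto
      finally show ?thesis .
    qed (simp add: c_def)
    have "0 \<le> 3 * (- Re (V 0 x)) + 4 * (- Re (V t x)) + (- Re (V (2 * t) x))"
      by (rule sums_le[OF nn sums_zero sm])
    then show "Re (3 * V 0 x + 4 * V t x + V (2 * t) x) \<le> 0" by simp
  qed
  moreover have "Complex x 0 = of_real x" for x by (simp add: complex_of_real_def)
  ultimately show ?thesis by (simp add: g_def z_def)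
qed

text \<open>If zeta(1 + it) = 0 with t nonzero, the product of \<open>zeta_3_4_1\<close> has a zero
  of order at least 4 at 1 against a pole of order 3, so it tends to 0 and contradicts the positive
  lower bound. The line matters because the Riemann Hypothesis speaks of the open strip, whereas
  zero-freeness is used in all of Re s > 1/2.\<close>

lemma zeta_reg_nonzero_Re_1:
  assumes "Re s = 1"
  shows "zeta_reg s \<noteq> 0"
proof (cases "Im s = 0")
  case True
  then have "s = 1" using assms by (simp add: complex_eq_iff)
  then show ?thesis by (simp add: zeta_reg_def)
next
  case False
  define t where "t = Im s"
  have t: "t \<noteq> 0" "s = Complex 1 t" using False assms by (auto simp: t_def complex_eq_iff)
  show ?thesis
  proof
    assume "zeta_reg s = 0"
    then have z0: "riemann_zeta s = 0" using False by (auto simp: zeta_reg_def split: if_splits)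
    define c where "c = norm (riemann_zeta 2 ^ 3 * riemann_zeta (Complex 2 t) ^ 4 * riemann_zeta (Complex 2 (2 * t)))"
    have c: "c > 0" unfolding c_def using riemann_zeta_nonzero_Re_gt_1 by auto
    define q where "q z = (if z = s then deriv riemann_zeta s else (riemann_zeta z - riemann_zeta s) / (z - s))" for z
    have q: "q holomorphic_on - {1}" unfolding q_def by (rule pole_lemma_open[OF riemann_zeta_holomorphic]) auto
    have cl: "isCont (\<lambda>x. Complex x u) 1" for u
    proof -
      have "Complex x u = of_real x + \<i> * of_real u" for x by (simp add: complex_eq_iff)
      then show ?thesis by (auto intro!: continuous_intros)
    qed
    have ct: "isCont (\<lambda>x. F (Complex x u)) 1" if "F holomorphic_on A" "open A" "Complex 1 u \<in> A" for F A u
      by (rule isCont_o2[OF cl])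
         (use continuous_on_eq_continuous_at[OF that(2)] holomorphic_on_imp_continuous_on[OF that(1)] that(3) in auto)
    \<comment> \<open>The product after the powers of x - 1 have been cancelled between zero and
      pole; a single factor x - 1 remains, and the rest is continuous at 1.\<close>
    define M where "M x = (x - 1) * (norm (zeta_reg (of_real x)) ^ 3 * norm (q (Complex x t)) ^ 4 * norm (riemann_zeta (Complex x (2 * t))))" for x
    have "isCont M 1" unfolding M_def
      using ct[OF q, of t] ct[OF zeta_reg_holomorphic[of UNIV], of 0] ct[OF riemann_zeta_holomorphic, of "2 * t"] t
      by (intro continuous_intros) (auto simp: complex_eq_iff complex_of_real_def)
    then have lim: "(M \<longlongrightarrow> M 1) (at_right 1)"
      by (simp add: isCont_def filterlim_at_split)
    have "\<forall>\<^sub>F x in at_right 1. c \<le> M x"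
      unfolding eventually_at_right_field
    proof (intro exI[of _ 2] conjI allI impI)
      fix x :: real assume x: "1 < x" "x < 2"
      have "c \<le> norm (riemann_zeta (of_real x) ^ 3 * riemann_zeta (Complex x t) ^ 4 * riemann_zeta (Complex x (2 * t)))"
        unfolding c_def using x by (intro zeta_3_4_1) auto
      also have "riemann_zeta (of_real x) = zeta_reg (of_real x) / (of_real (x - 1))"
        using x by (simp add: zeta_reg_def)
      also have "riemann_zeta (Complex x t) = of_real (x - 1) * q (Complex x t)"
      proof -
        have "Complex x t - s = of_real (x - 1)" "Complex x t \<noteq> s" using t x by (auto simp: complex_eq_iff)
        then show ?thesis using x z0 by (simp add: q_def)
      qed
      also have "norm ((zeta_reg (of_real x) / of_real (x - 1)) ^ 3 * (of_real (x - 1) * q (Complex x t)) ^ 4 * riemann_zeta (Complex x (2 * t))) = M x"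
      proof -
        have "norm (complex_of_real (x - 1)) = x - 1" using x by (simp only: norm_of_real)
        then have "norm ((zeta_reg (of_real x) / of_real (x - 1)) ^ 3 * (of_real (x - 1) * q (Complex x t)) ^ 4 * riemann_zeta (Complex x (2 * t))) =
          (norm (zeta_reg (of_real x)) / (x - 1)) ^ 3 * ((x - 1) * norm (q (Complex x t))) ^ 4 * norm (riemann_zeta (Complex x (2 * t)))"
          by (simp only: norm_mult norm_power norm_divide)
        moreover have "(A / y) ^ 3 * (y * B) ^ 4 * C = y * (A ^ 3 * B ^ 4 * C)" if "y \<noteq> 0" for A B C y :: real
          using that by (simp add: field_simps eval_nat_numeral)
        ultimately show ?thesis using x unfolding M_def by simp
      qed
      finally show "c \<le> M x" .
    qed simp
    then have "c \<le> M 1" using lim by (intro tendsto_lowerbound[OF lim]) auto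
    then show False using c by (simp add: M_def)
  qed
qed

lemma zeta_reg_nonzero_Re_ge_1: "Re s \<ge> 1 \<Longrightarrow> zeta_reg s \<noteq> 0"
  using zeta_reg_nonzero_Re_1[of s] riemann_zeta_nonzero_Re_gt_1[of s]
  by (cases "Re s = 1") (auto simp: zeta_reg_def)

section \<open>Conjugation and the half-plane form of the hypothesis\<close>

lemma riemann_zeta_cnj: "riemann_zeta (cnj s) = cnj (riemann_zeta s)"
proof -
  have "is_riemann_zeta (\<lambda>s. cnj (riemann_zeta (cnj s)))"
    unfolding is_riemann_zeta_def
  proof (intro conjI allI impI)
    have "cnj ` (- {1}) \<subseteq> - {1}" by auto
    then have "cnj \<circ> riemann_zeta \<circ> cnj holomorphic_on (- {1})"
      by (intro holomorphic_on_compose_cnj_cnj holomorphic_on_subset[OF riemann_zeta_holomorphic]) auto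
    then show "(\<lambda>s. cnj (riemann_zeta (cnj s))) holomorphic_on - {1}" by (simp add: o_def)
    fix s assume s: "1 < Re s"
    have "(\<lambda>n. cnj (1 / of_nat (Suc n) powr (cnj s))) sums cnj (riemann_zeta (cnj s))"
      unfolding sums_cnj using s by (intro riemann_zeta_sums) simp
    moreover have "cnj (1 / of_nat (Suc n) powr (cnj s)) = 1 / of_nat (Suc n) powr s" for n
      by (simp add: cnj_powr del: of_nat_Suc)
    ultimately show "(\<lambda>n. 1 / of_nat (Suc n) powr s) sums cnj (riemann_zeta (cnj s))" by simp
  qed (use is_riemann_zeta_riemann_zeta in \<open>auto simp: is_riemann_zeta_def\<close>)
  then have "(\<lambda>s. cnj (riemann_zeta (cnj s))) = riemann_zeta"
    by (rule is_riemann_zeta_unique[OF _ is_riemann_zeta_riemann_zeta])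
  from fun_cong[OF this, of "cnj s"] show ?thesis by simp
qed

lemma zeta_reg_cnj: "zeta_reg (cnj s) = cnj (zeta_reg s)"
  by (auto simp: zeta_reg_def riemann_zeta_cnj)

lemma zeta_logderiv_cnj: "zeta_logderiv (cnj s) = cnj (zeta_logderiv s)"
proof -
  have "(zeta_reg has_field_derivative deriv zeta_reg (cnj s)) (at (cnj s))"
    using holomorphic_derivI[OF zeta_reg_holomorphic[of UNIV]] by simp
  from has_field_derivative_cnj_cnj[OF this]
  have "(cnj \<circ> zeta_reg \<circ> cnj has_field_derivative cnj (deriv zeta_reg (cnj s))) (at s)"
    by (simp add: o_def)
  then have "deriv (cnj \<circ> zeta_reg \<circ> cnj) s = cnj (deriv zeta_reg (cnj s))" by (rule DERIV_imp_deriv)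
  also have "cnj \<circ> zeta_reg \<circ> cnj = zeta_reg" by (auto simp: fun_eq_iff zeta_reg_cnj)
  finally have "deriv zeta_reg (cnj s) = cnj (deriv zeta_reg s)" by simp
  then show ?thesis by (simp add: zeta_logderiv_def zeta_reg_cnj)
qed

text \<open>A zero with Re s < 1/2 is carried into Re s > 1/2 by \<open>xi_symmetric\<close>, since
  the Gamma factor at 1 - s does not vanish; for Re s >= 1 there are no zeros by
  \<open>zeta_reg_nonzero_Re_ge_1\<close>.\<close>

lemma RH_iff_zeta_reg_nonzero: "Riemann_Hypothesis \<longleftrightarrow> (\<forall>s. Re s > 1 / 2 \<longrightarrow> zeta_reg s \<noteq> 0)"
proof
  assume RH: Riemann_Hypothesis
  show "\<forall>s. Re s > 1 / 2 \<longrightarrow> zeta_reg s \<noteq> 0"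
  proof (intro allI impI)
    fix s assume s: "Re s > 1 / 2"
    show "zeta_reg s \<noteq> 0"
    proof (cases "Re s \<ge> 1")
      case False
      then have "riemann_zeta s \<noteq> 0" using RH s unfolding Riemann_Hypothesis_def by force
      then show ?thesis using False by (auto simp: zeta_reg_def)
    qed (rule zeta_reg_nonzero_Re_ge_1)
  qed
next
  assume nz: "\<forall>s. Re s > 1 / 2 \<longrightarrow> zeta_reg s \<noteq> 0"
  show Riemann_Hypothesis unfolding Riemann_Hypothesis_def
  proof (intro allI impI)
    fix s assume s: "0 < Re s \<and> Re s < 1 \<and> riemann_zeta s = 0"
    then have z: "zeta_reg s = 0" by (auto simp: zeta_reg_def)
    then have "Re s \<le> 1 / 2" using nz by force
    moreover have "Re s \<ge> 1 / 2"
    proof (rule ccontr)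
      assume "\<not> Re s \<ge> 1 / 2"
      then have "zeta_reg (1 - s) \<noteq> 0" using nz by simp
      moreover have "xi (1 - s) = 0" using xi_symmetric[of s] s z by (simp add: xi_def)
      moreover have "Gamma ((1 - s) / 2) \<noteq> 0"
        using half_not_nonpos_Int[of "1 - s"] s by (simp add: Gamma_eq_zero_iff)
      ultimately show False using s by (auto simp: xi_def)
    qed
    ultimately show "Re s = 1 / 2" by simp
  qed
qed


section \<open>Growth and positivity of the logarithmic derivative\<close>

text \<open>The map w -> w/(2A - w) takes the half-plane Re w < A into the unit disc and fixes 0, so
  Schwarz's lemma applies to its composition with \<open>f\<close> on the rescaled disc.\<close>

lemma Borel_Caratheodory:
  assumes f: "f holomorphic_on ball z0 R" and f0: "f z0 = 0" and A: "A > 0"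
    and Re: "\<And>z. z \<in> ball z0 R \<Longrightarrow> Re (f z) < A"
    and r: "r < R" and z: "dist z0 z \<le> r"
  shows "norm (f z) \<le> 2 * A * r / (R - r)"
proof -
  have rR: "0 \<le> r" "0 < R" using z r zero_le_dist[of z0 z] by linarith+
  define F where "F w = f (z0 + of_real R * w)" for w
  have inb: "z0 + of_real R * w \<in> ball z0 R" if "norm w < 1" for w
    using that rR by (simp add: dist_norm norm_mult)
  have F: "F holomorphic_on ball 0 1"
    unfolding F_def using inb
    by (intro holomorphic_on_compose_gen[OF _ f, unfolded o_def] holomorphic_intros) auto
  have lt: "norm (F w) < norm (2 * of_real A - F w)" if "norm w < 1" for w
  proof (rule power2_less_imp_less)
    have "Re (F w) < A" unfolding F_def using inb[OF that] by (rule Re)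
    then have "A * Re (F w) < A * A" using A by simp
    then show "(norm (F w))\<^sup>2 < (norm (2 * of_real A - F w))\<^sup>2"
      unfolding cmod_power2 by (simp add: power2_eq_square algebra_simps)
  qed simp
  define g where "g w = F w / (2 * of_real A - F w)" for w
  have ne: "2 * of_real A - F w \<noteq> 0" if "norm w < 1" for w using lt[OF that] norm_ge_zero[of "F w"] by fastforce
  have "g holomorphic_on ball 0 1" unfolding g_def using ne by (intro holomorphic_intros F) auto
  moreover have "g 0 = 0" by (simp add: g_def F_def f0)
  moreover have "norm (g w) < 1" if "norm w < 1" for w
    using lt[OF that] ne[OF that] by (simp add: g_def norm_divide)
  moreover define \<xi> where "\<xi> = (z - z0) / of_real R"
  have nx: "norm \<xi> = dist z0 z / R" using rR by (simp add: \<xi>_def norm_divide dist_norm norm_minus_commute)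
  then have x1: "norm \<xi> < 1" using z r rR by simp
  ultimately have "norm (g \<xi>) \<le> norm \<xi>" using Schwarz_Lemma(1) by blast
  then have "norm (F \<xi>) \<le> norm \<xi> * norm (2 * of_real A - F \<xi>)"
    using ne[OF x1] by (simp add: g_def norm_divide divide_le_eq)
  also have "\<dots> \<le> norm \<xi> * (2 * A + norm (F \<xi>))"
    using norm_triangle_ineq4[of "2 * of_real A" "F \<xi>"] A by (intro mult_left_mono) (auto simp: norm_mult)
  also have "F \<xi> = f z" using rR by (simp add: F_def \<xi>_def)
  finally have "norm (f z) \<le> dist z0 z / R * (2 * A + norm (f z))" unfolding nx .
  also have "\<dots> \<le> r / R * (2 * A + norm (f z))"
    using z rR A by (intro mult_right_mono divide_right_mono) auto
  finally have "norm (f z) * R \<le> r * (2 * A + norm (f z))" using rR by (simp add: field_simps)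
  then have "norm (f z) * (R - r) \<le> 2 * A * r" by (simp add: algebra_simps)
  then show ?thesis using r by (simp add: pos_le_divide_eq)
qed

lemma norm_zeta_reg_ge:
  assumes "Re s \<ge> 2"
  shows "norm (zeta_reg s) \<ge> 1 / 4"
proof -
  have "s \<noteq> 1" using assms by auto
  have "1 \<le> norm (s - 1)" using assms complex_Re_le_cmod[of "s - 1"] by simp
  then have "1 * (1 / 4) \<le> norm (s - 1) * norm (riemann_zeta s)"
    using norm_riemann_zeta_ge[OF assms] by (intro mult_mono) auto
  then show ?thesis using \<open>s \<noteq> 1\<close> by (simp add: zeta_reg_def norm_mult)
qed

lemma zeta_logderiv_bounded:
  obtains M where "\<And>s. Re s \<ge> 3 / 2 \<Longrightarrow> norm (zeta_logderiv s) \<le> M"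
proof
  fix s assume s: "Re s \<ge> 3 / 2"
  have "1 / 2 \<le> norm (s - 1)" using s complex_Re_le_cmod[of "s - 1"] by simp
  then have "norm (1 / (s - 1)) \<le> 1 / (1 / 2)" unfolding norm_divide by (intro frac_le) auto
  moreover have "norm (vonMangoldt_series s) \<le> (\<Sum>n. mangoldt n * real n powr - (3 / 2))"
    using s by (intro vonMangoldt_bound) auto
  ultimately show "norm (zeta_logderiv s) \<le> 2 + (\<Sum>n. mangoldt n * real n powr - (3 / 2))"
    using zeta_logderiv_Re_gt_1[of s] s norm_triangle_ineq4[of "1 / (s - 1)" "vonMangoldt_series s"] by simp
qed

text \<open>In the zero-free half-plane \<open>zeta_reg\<close> has a holomorphic logarithm.
  Normalised at 2 + it, where |zeta_reg| >= 1/4, its real part is bounded above by the polynomial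
  growth of \<open>zeta_reg\<close>. Then \<open>Borel_Caratheodory\<close> bounds its modulus,
  which gives the lower bound for \<open>zeta_reg\<close>, and Cauchy's inequality bounds its
  derivative.\<close>

lemma zeta_reg_log_bounds:
  assumes nz: "\<And>s. Re s > 1 / 2 \<Longrightarrow> zeta_reg s \<noteq> 0" and \<eta>: "0 < \<eta>" "\<eta> \<le> 1 / 2"
  obtains C where "C \<ge> 1"
    "\<And>s. 1 / 2 + \<eta> \<le> Re s \<Longrightarrow> Re s \<le> 2 \<Longrightarrow>
        norm (zeta_logderiv s) \<le> 24 / \<eta>\<^sup>2 * ln (C * (5 + \<bar>Im s\<bar>)\<^sup>2)"
    "\<And>s. 1 / 2 + \<eta> \<le> Re s \<Longrightarrow> Re s \<le> 2 \<Longrightarrow>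
        norm (zeta_reg s) \<ge> 1 / 4 * exp (- (12 / \<eta> * ln (C * (5 + \<bar>Im s\<bar>)\<^sup>2)))"
proof -
  obtain C0 where C0: "C0 > 0" "\<And>s. Re s \<ge> 1 / 2 \<Longrightarrow> norm (zeta_reg s) \<le> C0 * (1 + norm s)\<^sup>2"
    using zeta_reg_growth[of "1 / 2"] by auto
  define C where "C = 4 * C0 + 1"
  have C: "C \<ge> 1" "4 * C0 < C" using C0 by (auto simp: C_def)
  define H where "H = {s::complex. Re s > 1 / 2}"
  have H: "open H" "convex H" unfolding H_def by (rule open_halfspace_Re_gt convex_halfspace_Re_gt)+
  obtain g where g: "g holomorphic_on H" "\<And>x. x \<in> H \<Longrightarrow> exp (g x) = zeta_reg x"
    using holomorphic_logarithm_exists[OF H(2,1) zeta_reg_holomorphic[of H], of 1] nz by (auto simp: H_def)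
  have "norm (zeta_logderiv s) \<le> 24 / \<eta>\<^sup>2 * ln (C * (5 + \<bar>Im s\<bar>)\<^sup>2) \<and>
      norm (zeta_reg s) \<ge> 1 / 4 * exp (- (12 / \<eta> * ln (C * (5 + \<bar>Im s\<bar>)\<^sup>2)))"
    if s: "1 / 2 + \<eta> \<le> Re s" "Re s \<le> 2" for s
  proof -
    define t where "t = Im s"
    define A where "A = ln (C * (5 + \<bar>t\<bar>)\<^sup>2)"
    have big: "25 \<le> C * (5 + \<bar>t\<bar>)\<^sup>2"
    proof -
      have "1 * 5\<^sup>2 \<le> C * (5 + \<bar>t\<bar>)\<^sup>2" using C by (intro mult_mono power_mono) auto
      then show ?thesis by simp
    qed
    then have A: "A > 0" unfolding A_def by (intro ln_gt_zero) simp
    define z0 where "z0 = Complex 2 t"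
    \<comment> \<open>The larger disc about 2 + it stays inside Re s > 1/2, and the smaller one
      contains the disc of radius \<eta>/2 about \<open>s\<close>. The gap R - r = \<eta>/4 with r
      <= 3/2 produces 12/\<eta>, and division by \<eta>/2 then produces 24/\<eta>^2.\<close>
    define R where "R = 3 / 2 - \<eta> / 4"
    define r where "r = 3 / 2 - \<eta> / 2"
    have sub: "ball z0 R \<subseteq> H"
    proof
      fix z assume "z \<in> ball z0 R"
      then have "Re z0 - Re z < R" using complex_Re_le_cmod[of "z0 - z"] by (simp add: dist_norm)
      then show "z \<in> H" using \<eta> by (simp add: H_def R_def z0_def)
    qed
    have z0H: "z0 \<in> H" by (simp add: z0_def H_def)
    define f where "f z = g z - g z0" for z
    have f: "f holomorphic_on ball z0 R" unfolding f_def
      by (intro holomorphic_intros holomorphic_on_subset[OF g(1) sub])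
    have ef: "norm (zeta_reg z) = norm (zeta_reg z0) * exp (Re (f z))" if "z \<in> H" for z
      unfolding g(2)[OF that, symmetric] g(2)[OF z0H, symmetric] by (simp add: f_def norm_exp_eq_Re exp_diff)
    have z04: "norm (zeta_reg z0) \<ge> 1 / 4" by (rule norm_zeta_reg_ge) (simp add: z0_def)
    have Ref: "Re (f z) < A" if z: "z \<in> ball z0 R" for z
    proof -
      have "norm z \<le> norm z0 + norm (z - z0)" by (rule norm_triangle_sub)
      also have "norm z0 \<le> 2 + \<bar>t\<bar>" using cmod_le[of z0] by (simp add: z0_def)
      also have "norm (z - z0) \<le> 2" using z \<eta> by (simp add: dist_norm norm_minus_commute R_def)
      finally have nz: "1 + norm z \<le> 5 + \<bar>t\<bar>" by simp
      have "1 / 4 * exp (Re (f z)) \<le> norm (zeta_reg z0) * exp (Re (f z))"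
        using z04 by (intro mult_right_mono) auto
      also have "\<dots> = norm (zeta_reg z)" using ef[of z] z sub by auto
      also have "\<dots> \<le> C0 * (1 + norm z)\<^sup>2" using z sub by (intro C0) (auto simp: H_def)
      also have "\<dots> \<le> C0 * (5 + \<bar>t\<bar>)\<^sup>2" using nz C0 by (intro mult_left_mono power_mono) auto
      finally have "exp (Re (f z)) \<le> 4 * C0 * (5 + \<bar>t\<bar>)\<^sup>2" by simp
      also have "\<dots> < C * (5 + \<bar>t\<bar>)\<^sup>2" using C by (intro mult_strict_right_mono) auto
      finally have "exp (Re (f z)) < exp A" using big by (simp add: A_def)
      then show ?thesis by simp
    qed
    have bc: "norm (f z) \<le> 12 / \<eta> * A" if "dist z0 z \<le> r" for z
    proof -
      have "norm (f z) \<le> 2 * A * r / (R - r)"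
        by (rule Borel_Caratheodory[OF f _ A Ref _ that]) (use \<eta> in \<open>auto simp: f_def R_def r_def\<close>)
      also have "\<dots> = 8 * r * A / \<eta>" by (simp add: R_def r_def field_simps)
      also have "\<dots> \<le> 12 * A / \<eta>" using A \<eta> by (intro divide_right_mono mult_right_mono) (auto simp: r_def)
      finally show ?thesis by simp
    qed
    have ds: "dist z0 s \<le> 3 / 2 - \<eta>"
    proof -
      have "z0 - s = of_real (2 - Re s)" by (simp add: z0_def t_def complex_eq_iff)
      then have "dist z0 s = 2 - Re s" using s by (simp add: dist_norm del: of_real_diff)
      then show ?thesis using s by simp
    qed
    have sH: "s \<in> H" using s \<eta> by (simp add: H_def)
    have lower: "norm (zeta_reg s) \<ge> 1 / 4 * exp (- (12 / \<eta> * A))"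
    proof -
      have "- (12 / \<eta> * A) \<le> Re (f s)"
        using bc[of s] ds \<eta> abs_Re_le_cmod[of "f s"] by (simp add: r_def)
      then have "1 / 4 * exp (- (12 / \<eta> * A)) \<le> norm (zeta_reg z0) * exp (Re (f s))"
        using z04 by (intro mult_mono) auto
      then show ?thesis using ef[OF sH] by simp
    qed
    have cb: "cball s (\<eta> / 2) \<subseteq> cball z0 r"
    proof
      fix z assume "z \<in> cball s (\<eta> / 2)"
      then show "z \<in> cball z0 r" using dist_triangle[of z0 z s] ds by (simp add: r_def)
    qed
    have cbR: "cball z0 r \<subseteq> ball z0 R" using \<eta> by (auto simp: r_def R_def)
    have "norm ((deriv ^^ 1) f s) \<le> fact 1 * (12 / \<eta> * A) / (\<eta> / 2) ^ 1"
    proof (rule Cauchy_inequality)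
      show "f holomorphic_on ball s (\<eta> / 2)"
        using ball_subset_cball[of s "\<eta> / 2"] cb cbR by (intro holomorphic_on_subset[OF f]) blast
      show "continuous_on (cball s (\<eta> / 2)) f"
        using cb cbR by (intro holomorphic_on_imp_continuous_on holomorphic_on_subset[OF f]) blast
      show "norm (f x) \<le> 12 / \<eta> * A" if "norm (s - x) = \<eta> / 2" for x
        using cb that by (intro bc) (auto simp: dist_norm subset_iff)
    qed (use \<eta> in auto)
    also have "(deriv ^^ 1) f s = zeta_logderiv s"
    proof -
      have gd: "(g has_field_derivative deriv g s) (at s)" using holomorphic_derivI[OF g(1) H(1) sH] .
      have "(f has_field_derivative deriv g s) (at s)" unfolding f_def using gd by (auto intro!: derivative_eq_intros)
      then have 1: "deriv f s = deriv g s" by (rule DERIV_imp_deriv)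
      have "((\<lambda>z. exp (g z)) has_field_derivative exp (g s) * deriv g s) (at s)"
        using gd by (auto intro!: derivative_eq_intros)
      then have "(zeta_reg has_field_derivative exp (g s) * deriv g s) (at s)"
        by (rule has_field_derivative_transform_within_open[OF _ H(1) sH]) (simp add: g(2))
      then have "deriv zeta_reg s = zeta_reg s * deriv g s" using g(2)[OF sH] by (simp add: DERIV_imp_deriv)
      then show ?thesis using nz[of s] sH 1 by (simp add: zeta_logderiv_def H_def)
    qed
    also have "fact 1 * (12 / \<eta> * A) / (\<eta> / 2) ^ 1 = 24 / \<eta>\<^sup>2 * A" by (simp add: power2_eq_square)
    finally show ?thesis using lower by (simp add: A_def t_def)
  qed
  then show ?thesis using that[of C] C by blast
qed

text \<open>A logarithm is covered by the power 1/4, which fits \<open>vline_two_poles\<close>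
  directly and \<open>vline_pole\<close> and \<open>vline_shift\<close> after division by one or two
  linear factors. The constant obtained is of order 1/\<eta>^2: the bound justifies moving lines at
  fixed a but must stay out of every estimate that is to survive a -> 1/2.\<close>

lemma zeta_logderiv_growth:
  assumes nz: "\<And>s. Re s > 1 / 2 \<Longrightarrow> zeta_reg s \<noteq> 0" and \<eta>: "0 < \<eta>" "\<eta> \<le> 1 / 2"
  obtains K where "K \<ge> 0" "\<And>s. 1 / 2 + \<eta> \<le> Re s \<Longrightarrow> norm (zeta_logderiv s) \<le> K * (1 + \<bar>Im s\<bar>) powr (1 / 4)"
proof -
  obtain C where C: "C \<ge> 1" "\<And>s. 1 / 2 + \<eta> \<le> Re s \<Longrightarrow> Re s \<le> 2 \<Longrightarrow>
        norm (zeta_logderiv s) \<le> 24 / \<eta>\<^sup>2 * ln (C * (5 + \<bar>Im s\<bar>)\<^sup>2)"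
    using zeta_reg_log_bounds[OF nz \<eta>] by metis
  obtain M where M: "\<And>s. Re s \<ge> 3 / 2 \<Longrightarrow> norm (zeta_logderiv s) \<le> M" using zeta_logderiv_bounded by blast
  define B where "B = ln C + 2 * ln 5 + 8"
  have B: "B \<ge> 0" using C by (simp add: B_def)
  define K where "K = \<bar>M\<bar> + 24 / \<eta>\<^sup>2 * B"
  have K: "K \<ge> 0" using B by (simp add: K_def)
  have "norm (zeta_logderiv s) \<le> K * (1 + \<bar>Im s\<bar>) powr (1 / 4)" if s: "1 / 2 + \<eta> \<le> Re s" for s
  proof -
    define u where "u = (1 + \<bar>Im s\<bar>) powr (1 / 4)"
    have u: "u \<ge> 1" unfolding u_def by (rule ge_one_powr_ge_zero) auto
    show ?thesis
    proof (cases "Re s \<le> 2")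
      case True
      have l: "ln (C * (5 + \<bar>Im s\<bar>)\<^sup>2) \<le> B * u"
      proof -
        have "ln (C * (5 + \<bar>Im s\<bar>)\<^sup>2) = ln C + 2 * ln (5 + \<bar>Im s\<bar>)"
          using C by (simp add: ln_mult ln_realpow)
        also have "ln (5 + \<bar>Im s\<bar>) \<le> ln (5 * (1 + \<bar>Im s\<bar>))" by (subst ln_le_cancel_iff) auto
        also have "\<dots> = ln 5 + ln (1 + \<bar>Im s\<bar>)" by (rule ln_mult_pos) auto
        also have "ln (1 + \<bar>Im s\<bar>) \<le> u / (1 / 4)" unfolding u_def by (intro ln_powr_bound) auto
        finally have "ln (C * (5 + \<bar>Im s\<bar>)\<^sup>2) \<le> (ln C + 2 * ln 5) * 1 + 8 * u" by simp
        also have "\<dots> \<le> (ln C + 2 * ln 5) * u + 8 * u" using u C by (intro add_right_mono mult_left_mono) auto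
        finally show ?thesis by (simp add: B_def algebra_simps)
      qed
      have "norm (zeta_logderiv s) \<le> 24 / \<eta>\<^sup>2 * ln (C * (5 + \<bar>Im s\<bar>)\<^sup>2)" using C(2)[OF s True] .
      also have "\<dots> \<le> 24 / \<eta>\<^sup>2 * (B * u)" using l by (intro mult_left_mono) auto
      also have "\<dots> \<le> K * u"
      proof -
        have "K * u = \<bar>M\<bar> * u + 24 / \<eta>\<^sup>2 * (B * u)" by (simp add: K_def distrib_right mult.assoc)
        moreover have "\<bar>M\<bar> * u \<ge> 0" using u by simp
        ultimately show ?thesis by linarith
      qed
      finally show ?thesis by (simp add: u_def)
    next
      case False
      then have "norm (zeta_logderiv s) \<le> M" by (intro M) auto
      also have "M \<le> K * 1" using B by (simp add: K_def add_increasing2)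
      also have "\<dots> \<le> K * u" using u K by (intro mult_left_mono) auto
      finally show ?thesis by (simp add: u_def)
    qed
  qed
  then show ?thesis using that K by blast
qed

text \<open>The lower bound of \<open>zeta_reg_log_bounds\<close> is a multiple of X^(-12/\<eta>),
  so the reciprocal of \<open>zeta_reg\<close> grows at most polynomially. This feeds the growth
  condition of \<open>Phragmen_Lindelof_halfplane\<close> for the quotient of shifted xi
  functions.\<close>

lemma inverse_zeta_reg_growth:
  assumes nz: "\<And>s. Re s > 1 / 2 \<Longrightarrow> zeta_reg s \<noteq> 0" and \<eta>: "0 < \<eta>" "\<eta> \<le> 1 / 2"
  obtains K N where "K \<ge> 0" "\<And>s. 1 / 2 + \<eta> \<le> Re s \<Longrightarrow> 1 \<le> K * (1 + norm s) ^ N * norm (zeta_reg s)"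
proof -
  obtain C where C: "C \<ge> 1" "\<And>s. 1 / 2 + \<eta> \<le> Re s \<Longrightarrow> Re s \<le> 2 \<Longrightarrow>
        norm (zeta_reg s) \<ge> 1 / 4 * exp (- (12 / \<eta> * ln (C * (5 + \<bar>Im s\<bar>)\<^sup>2)))"
    using zeta_reg_log_bounds[OF nz \<eta>] by metis
  define n where "n = nat \<lceil>12 / \<eta>\<rceil>"
  have n: "12 / \<eta> \<le> real n" unfolding n_def by linarith
  define K where "K = 4 * (25 * C) ^ n"
  have "1 \<le> (25 * C) ^ n" using C by (intro one_le_power) auto
  then have K4: "K \<ge> 4" unfolding K_def by linarith
  have "1 \<le> K * (1 + norm s) ^ (2 * n) * norm (zeta_reg s)" if s: "1 / 2 + \<eta> \<le> Re s" for s
  proof (cases "Re s \<le> 2")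
    case True
    define X where "X = C * (5 + \<bar>Im s\<bar>)\<^sup>2"
    have "1 * 1\<^sup>2 \<le> X" unfolding X_def using C by (intro mult_mono power_mono) auto
    then have X: "X \<ge> 1" by simp
    have "12 / \<eta> * ln X \<le> real n * ln X" using n X by (intro mult_right_mono) auto
    then have "exp (12 / \<eta> * ln X) \<le> exp (real n * ln X)" by (simp only: exp_le_cancel_iff)
    also have "\<dots> = X ^ n" using X by (simp add: exp_of_nat_mult)
    also have "\<dots> \<le> (25 * C * (1 + norm s)\<^sup>2) ^ n"
    proof (intro power_mono)
      have "(5 + \<bar>Im s\<bar>)\<^sup>2 \<le> (5 * (1 + norm s))\<^sup>2" using abs_Im_le_cmod[of s] by (intro power_mono) auto
      then have "X \<le> C * (5 * (1 + norm s))\<^sup>2" unfolding X_def using C by (intro mult_left_mono) auto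
      also have "C * (5 * (1 + norm s))\<^sup>2 = 25 * C * (1 + norm s)\<^sup>2" by (simp only: power_mult_distrib) simp
      finally show "X \<le> 25 * C * (1 + norm s)\<^sup>2" .
    qed (use X in auto)
    also have "\<dots> = (25 * C) ^ n * (1 + norm s) ^ (2 * n)" by (simp only: power_mult_distrib power_mult)
    finally have e: "exp (12 / \<eta> * ln X) \<le> (25 * C) ^ n * (1 + norm s) ^ (2 * n)" .
    have "1 = 4 * exp (12 / \<eta> * ln X) * (1 / 4 * exp (- (12 / \<eta> * ln X)))"
      by (simp add: exp_minus)
    also have "\<dots> \<le> 4 * ((25 * C) ^ n * (1 + norm s) ^ (2 * n)) * norm (zeta_reg s)"
      using e C(2)[OF s True] C(1) unfolding X_def[symmetric] by (intro mult_mono mult_left_mono) auto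
    finally show ?thesis by (simp add: K_def mult_ac)
  next
    case False
    have "1 = 4 * 1 * (1 / 4 :: real)" by simp
    also have "\<dots> \<le> K * (1 + norm s) ^ (2 * n) * norm (zeta_reg s)"
      using K4 False norm_zeta_reg_ge[of s] by (intro mult_mono one_le_power) auto
    finally show ?thesis .
  qed
  then show ?thesis using that[of K "2 * n"] K4 by auto
qed

text \<open>The function \<open>B\<close> is divided by (1 + \<epsilon>(s - a))^(N + 1), whose
  modulus is at least 1 in the half-plane and outgrows the polynomial bound of degree
  \<open>N\<close>. The maximum principle on a large half-disc bounds the quotient by 1, and
  \<epsilon> -> 0 removes the damping.\<close>

lemma Phragmen_Lindelof_halfplane:
  fixes a :: real
  assumes B: "B holomorphic_on {s. Re s > a'}" and a': "a' < a"
    and b1: "\<And>s. Re s = a \<Longrightarrow> norm (B s) \<le> 1"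
    and bp: "\<And>s. Re s \<ge> a \<Longrightarrow> norm (B s) \<le> K * (1 + norm s) ^ N"
    and s: "Re s \<ge> a"
  shows "norm (B s) \<le> 1"
proof (cases "Re s = a")
  case False
  define d :: "real \<Rightarrow> complex \<Rightarrow> complex" where "d \<epsilon> z = 1 + of_real \<epsilon> * (z - of_real a)" for \<epsilon> z
  have d1: "1 \<le> norm (d \<epsilon> z)" if "Re z \<ge> a" "\<epsilon> > 0" for z \<epsilon>
  proof -
    have "1 \<le> Re (d \<epsilon> z)" using that by (simp add: d_def)
    then show ?thesis using complex_Re_le_cmod order_trans by blast
  qed
  have d2: "\<epsilon> * norm (z - of_real a) \<le> norm (d \<epsilon> z)" if "Re z \<ge> a" "\<epsilon> > 0" for z \<epsilon>
  proof (rule power2_le_imp_le)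
    have "(norm (d \<epsilon> z))\<^sup>2 = (\<epsilon> * norm (z - of_real a))\<^sup>2 + (1 + 2 * (\<epsilon> * (Re z - a)))"
      by (simp add: d_def cmod_power2 power_mult_distrib) (simp add: power2_eq_square algebra_simps)
    then show "(\<epsilon> * norm (z - of_real a))\<^sup>2 \<le> (norm (d \<epsilon> z))\<^sup>2" using that by simp
  qed simp
  have main: "norm (B s) \<le> norm (d \<epsilon> s) ^ (N + 1)" if \<epsilon>: "\<epsilon> > 0" for \<epsilon>
  proof -
    \<comment> \<open>The last summand makes |K| (2R)^N at most (\<epsilon> R)^(N + 1) on the arc,
      where 1 + |z| <= 2R; the other summands put \<open>s\<close> inside the disc and dominate
      |a|.\<close>
    define R where "R = 1 + \<bar>a\<bar> + norm (s - of_real a) + \<bar>K\<bar> * 2 ^ N / \<epsilon> ^ (N + 1)"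
    have R: "R > norm (s - of_real a)" "R \<ge> 1 + \<bar>a\<bar>" "\<bar>K\<bar> * 2 ^ N / \<epsilon> ^ (N + 1) \<le> R"
      using \<epsilon> by (auto simp: R_def intro!: add_pos_nonneg)
    define S where "S = {z. Re z > a} \<inter> ball (of_real a) R"
    have oS: "open S" unfolding S_def by (intro open_Int open_halfspace_Re_gt open_ball)
    have clS: "closure S \<subseteq> {z. Re z \<ge> a} \<inter> cball (of_real a) R"
      by (rule closure_minimal) (auto simp: S_def intro!: closed_Int closed_halfspace_Re_ge closed_cball)
    define h where "h z = B z / d \<epsilon> z ^ (N + 1)" for z
    have dn: "d \<epsilon> z \<noteq> 0" if "Re z \<ge> a" for z using d1[OF that \<epsilon>] by auto
    have hol: "h holomorphic_on {z. Re z > a}"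
      unfolding h_def using dn a' by (intro holomorphic_intros holomorphic_on_subset[OF B]) (auto simp: d_def intro!: holomorphic_intros)
    have cont: "continuous_on {z. Re z \<ge> a} h"
    proof -
      have "continuous_on {z. Re z \<ge> a} B"
        using a' by (intro continuous_on_subset[OF holomorphic_on_imp_continuous_on[OF B]]) auto
      then show ?thesis unfolding h_def using dn by (intro continuous_intros) (auto simp: d_def intro!: continuous_intros)
    qed
    have "norm (h s) \<le> 1"
    proof (rule maximum_modulus_frontier[of h S])
      show "h holomorphic_on interior S" unfolding interior_open[OF oS] by (intro holomorphic_on_subset[OF hol]) (auto simp: S_def)
      show "continuous_on (closure S) h" using clS by (intro continuous_on_subset[OF cont]) auto
      show "bounded S" by (rule bounded_subset[OF bounded_ball[of "of_real a" R]]) (auto simp: S_def)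
      show "s \<in> S" using R(1) s False by (simp add: S_def dist_norm norm_minus_commute)
      fix z assume z: "z \<in> frontier S"
      then have zc: "Re z \<ge> a" "norm (z - of_real a) \<le> R"
        using clS by (auto simp: frontier_def dist_norm norm_minus_commute)
      have "z \<notin> S" using z oS by (simp add: frontier_def interior_open)
      then consider "Re z = a" | "norm (z - of_real a) = R"
        using zc by (force simp: S_def dist_norm norm_minus_commute)
      then show "norm (h z) \<le> 1"
      proof cases
        case 1
        have "norm (h z) = norm (B z) / norm (d \<epsilon> z) ^ (N + 1)" by (simp add: h_def norm_divide norm_power norm_mult)
        also have "\<dots> \<le> 1 / 1"
          using b1[OF 1] d1[OF zc(1) \<epsilon>] by (intro frac_le one_le_power) auto
        finally show ?thesis by simp
      next
        case 2
        have R0: "R > 0" using R(2) by linarith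
        have "norm z \<le> norm (z - of_real a) + \<bar>a\<bar>" using norm_triangle_sub[of z "of_real a"] by simp
        then have nz: "1 + norm z \<le> 2 * R" using 2 R(2) by simp
        have "norm (B z) \<le> \<bar>K\<bar> * (1 + norm z) ^ N"
          using bp[OF zc(1)] by (rule order_trans) (auto intro!: mult_right_mono)
        also have "\<dots> \<le> \<bar>K\<bar> * (2 * R) ^ N" using nz by (intro mult_left_mono power_mono) auto
        also have "\<dots> = (\<bar>K\<bar> * 2 ^ N / \<epsilon> ^ (N + 1)) * (\<epsilon> ^ (N + 1) * R ^ N)"
          using \<epsilon> by (simp add: power_mult_distrib)
        also have "\<dots> \<le> R * (\<epsilon> ^ (N + 1) * R ^ N)" using R(3) R0 \<epsilon> by (intro mult_right_mono) auto
        also have "\<dots> = (\<epsilon> * norm (z - of_real a)) ^ (N + 1)" unfolding 2 by (simp add: power_mult_distrib)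
        also have "\<dots> \<le> norm (d \<epsilon> z) ^ (N + 1)" using d2[OF zc(1) \<epsilon>] \<epsilon> by (intro power_mono) auto
        finally have le: "norm (B z) \<le> norm (d \<epsilon> z) ^ (N + 1)" .
        have "norm (h z) = norm (B z) / norm (d \<epsilon> z) ^ (N + 1)" by (simp add: h_def norm_divide norm_power norm_mult)
        also have "\<dots> \<le> 1" using le dn[OF zc(1)] by (simp add: divide_le_eq)
        finally show ?thesis .
      qed
    qed
    then show ?thesis using dn[OF s] by (simp add: h_def norm_divide norm_power norm_mult divide_le_eq)
  qed
  have "((\<lambda>\<epsilon>. norm (d \<epsilon> s) ^ (N + 1)) \<longlongrightarrow> norm (d 0 s) ^ (N + 1)) (at_right 0)"
    unfolding d_def by (intro tendsto_intros)
  moreover have "\<forall>\<^sub>F \<epsilon> in at_right 0. norm (B s) \<le> norm (d \<epsilon> s) ^ (N + 1)"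
    using main by (auto simp: eventually_at_right_field intro!: exI[of _ 1])
  ultimately have "norm (B s) \<le> norm (d 0 s) ^ (N + 1)" by (intro tendsto_lowerbound) auto
  then show ?thesis by (simp add: d_def)
qed (rule b1)

text \<open>Equivalently |Gamma(z - e)/Gamma(z + e)| <= Gamma(x - e)/Gamma(x + e) with x = Re z. In
  Euler's limit for Gamma this becomes one inequality per factor: after squaring, the two sides
  differ by (Im z)^2 ((x + e + k)^2 - (x - e + k)^2).\<close>

lemma norm_Gamma_shift_le:
  assumes e: "0 < e" "e < Re z"
  shows "norm (Gamma (z - of_real e)) * Gamma (Re z + e) \<le> norm (Gamma (z + of_real e)) * Gamma (Re z - e)"
proof -
  define x where "x = Re z"
  have gs: "norm (Gamma_series w n) = fact n * exp (Re w * ln (real n)) / norm (pochhammer w (n + 1))" for w :: complex and n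
    by (simp add: Gamma_series_def norm_divide norm_mult norm_exp_eq_Re)
  have gr: "Gamma_series y n = fact n * exp (y * ln (real n)) / pochhammer y (n + 1)" for y :: real and n
    by (simp add: Gamma_series_def)
  have le: "norm (Gamma_series (z - of_real e) n) * Gamma_series (x + e) n \<le>
      norm (Gamma_series (z + of_real e) n) * Gamma_series (x - e) n" for n
  proof -
    have *: "norm (pochhammer (z + of_real e) (n + 1)) * pochhammer (x - e) (n + 1) \<le>
        norm (pochhammer (z - of_real e) (n + 1)) * pochhammer (x + e) (n + 1)"
      unfolding pochhammer_prod prod_norm[symmetric] prod.distrib[symmetric]
    proof (rule prod_mono, intro conjI)
      fix k
      have u: "x + real k > e" using e by (simp add: x_def)
      then show "0 \<le> norm (z + of_real e + of_nat k) * (x - e + of_nat k)" by (intro mult_nonneg_nonneg) auto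
      have n2: "(norm (z + of_real e + of_nat k))\<^sup>2 = (x + e + real k)\<^sup>2 + (Im z)\<^sup>2"
        "(norm (z - of_real e + of_nat k))\<^sup>2 = (x - e + real k)\<^sup>2 + (Im z)\<^sup>2"
        by (simp_all add: cmod_power2 x_def)
      have "(x - e + real k)\<^sup>2 \<le> (x + e + real k)\<^sup>2" using u e by (intro power_mono) auto
      then have "(Im z)\<^sup>2 * (x - e + real k)\<^sup>2 \<le> (Im z)\<^sup>2 * (x + e + real k)\<^sup>2" by (rule mult_left_mono) simp
      then have "(norm (z + of_real e + of_nat k) * (x - e + of_nat k))\<^sup>2 \<le> (norm (z - of_real e + of_nat k) * (x + e + of_nat k))\<^sup>2"
        unfolding power_mult_distrib n2 by (simp add: algebra_simps)
      then show "norm (z + of_real e + of_nat k) * (x - e + of_nat k) \<le> norm (z - of_real e + of_nat k) * (x + e + of_nat k)"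
        by (rule power2_le_imp_le) (use u e in \<open>auto intro!: mult_nonneg_nonneg\<close>)
    qed
    have nz: "pochhammer w m \<noteq> 0" if "Re w > 0" for w :: complex and m
      using that by (force simp: pochhammer_eq_0_iff)
    have pos: "0 < norm (pochhammer (z + of_real e) (n + 1))" "0 < pochhammer (x - e) (n + 1)"
      "0 < norm (pochhammer (z - of_real e) (n + 1))" "0 < pochhammer (x + e) (n + 1)"
      using e by (auto intro!: pochhammer_pos nz simp: x_def)
    define F where "F = fact n * exp ((x - e) * ln (real n)) * (fact n * exp ((x + e) * ln (real n)))"
    have F: "F \<ge> 0" by (simp add: F_def)
    have "norm (Gamma_series (z - of_real e) n) * Gamma_series (x + e) n =
        F / (norm (pochhammer (z - of_real e) (n + 1)) * pochhammer (x + e) (n + 1))"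
      unfolding gs gr F_def by (simp add: x_def)
    also have "\<dots> \<le> F / (norm (pochhammer (z + of_real e) (n + 1)) * pochhammer (x - e) (n + 1))"
      using * pos F by (intro divide_left_mono) auto
    also have "\<dots> = norm (Gamma_series (z + of_real e) n) * Gamma_series (x - e) n"
      unfolding gs gr F_def by (simp add: x_def)
    finally show ?thesis .
  qed
  have "(\<lambda>n. norm (Gamma_series (z - of_real e) n) * Gamma_series (x + e) n) \<longlonglongrightarrow> norm (Gamma (z - of_real e)) * Gamma (x + e)"
    by (intro tendsto_intros Gamma_series_LIMSEQ)
  moreover have "(\<lambda>n. norm (Gamma_series (z + of_real e) n) * Gamma_series (x - e) n) \<longlonglongrightarrow> norm (Gamma (z + of_real e)) * Gamma (x - e)"
    by (intro tendsto_intros Gamma_series_LIMSEQ)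
  ultimately have "norm (Gamma (z - of_real e)) * Gamma (x + e) \<le> norm (Gamma (z + of_real e)) * Gamma (x - e)"
    by (rule LIMSEQ_le) (use le in auto)
  then show ?thesis by (simp add: x_def)
qed

text \<open>The real quotient Gamma(x - e)/Gamma(x + e) equals Beta(x - e, 2e)/Gamma(2e), which
  decreases in x, so its value at \<open>x0\<close> bounds the complex quotient on the whole
  half-plane.\<close>

lemma norm_Gamma_shift_bound:
  assumes e: "0 < e" "e < x0"
  obtains G where "G \<ge> 0" "\<And>z. Re z \<ge> x0 \<Longrightarrow> norm (Gamma (z - of_real e)) \<le> G * norm (Gamma (z + of_real e))"
proof
  define G where "G = Beta (x0 - e) (2 * e) / Gamma (2 * e)"
  show "G \<ge> 0" using e unfolding G_def Beta_def by (intro divide_nonneg_nonneg mult_nonneg_nonneg) (auto intro!: less_imp_le Gamma_real_pos)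
  fix z assume z: "Re z \<ge> x0"
  define x where "x = Re z"
  have p: "Gamma (2 * e) > 0" "Gamma (x + e) > 0" using e z by (auto intro!: Gamma_real_pos simp: x_def)
  have "Beta (x - e) (2 * e) \<le> Beta (x0 - e) (2 * e)"
    using e z by (intro Beta_real_mono) (auto simp: x_def)
  then have "Gamma (x - e) * Gamma (2 * e) / Gamma (x + e) \<le> G * Gamma (2 * e)"
    using p by (simp add: Beta_def G_def algebra_simps)
  then have "Gamma (x - e) \<le> G * Gamma (x + e)" using p by (simp add: divide_le_eq mult_ac)
  then have "norm (Gamma (z + of_real e)) * Gamma (x - e) \<le> norm (Gamma (z + of_real e)) * (G * Gamma (x + e))"
    by (intro mult_left_mono) auto
  moreover have "norm (Gamma (z - of_real e)) * Gamma (x + e) \<le> norm (Gamma (z + of_real e)) * Gamma (x - e)"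
    using norm_Gamma_shift_le[of e z] e z by (simp add: x_def)
  ultimately have "norm (Gamma (z - of_real e)) * Gamma (x + e) \<le> norm (Gamma (z + of_real e)) * (G * Gamma (x + e))"
    by (rule order_trans[rotated])
  then have "norm (Gamma (z - of_real e)) * Gamma (x + e) \<le> (G * norm (Gamma (z + of_real e))) * Gamma (x + e)"
    by (simp only: mult_ac)
  then show "norm (Gamma (z - of_real e)) \<le> G * norm (Gamma (z + of_real e))"
    using p(2) by (rule mult_right_le_imp_le)
qed

text \<open>Factor by factor: the power of pi contributes pi^\<eta>, |s - \<eta>| <= |s + \<eta>|
  since Re s > 0, the Gamma quotient is bounded, and \<open>zeta_reg\<close> contributes polynomial
  growth on one side and a polynomial lower bound on the other. The size of the constant is
  immaterial, as the sharp bound 1 will come from the critical line.\<close>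

lemma xi_shift_bound:
  assumes nz: "\<And>s. Re s > 1 / 2 \<Longrightarrow> zeta_reg s \<noteq> 0" and \<eta>: "0 < \<eta>" "\<eta> < 1 / 4"
  obtains K N where "K \<ge> 0"
    "\<And>s. Re s \<ge> 1 / 2 \<Longrightarrow> norm (xi (s - of_real \<eta>)) \<le> K * (1 + norm s) ^ N * norm (xi (s + of_real \<eta>))"
proof -
  obtain C where C: "C > 0" "\<And>s. Re s \<ge> 1 / 4 \<Longrightarrow> norm (zeta_reg s) \<le> C * (1 + norm s)\<^sup>2"
    using zeta_reg_growth[of "1 / 4"] by auto
  obtain K N where K: "K \<ge> 0" "\<And>s. 1 / 2 + \<eta> \<le> Re s \<Longrightarrow> 1 \<le> K * (1 + norm s) ^ N * norm (zeta_reg s)"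
    using inverse_zeta_reg_growth[OF nz \<eta>(1)] \<eta> by auto
  obtain G where G: "G \<ge> 0" "\<And>z. Re z \<ge> 1 / 4 \<Longrightarrow> norm (Gamma (z - of_real (\<eta> / 2))) \<le> G * norm (Gamma (z + of_real (\<eta> / 2)))"
    using norm_Gamma_shift_bound[of "\<eta> / 2" "1 / 4"] \<eta> by auto
  define M where "M = pi powr \<eta> * G * (C * 2\<^sup>2) * (K * 2 ^ N)"
  have M: "M \<ge> 0" unfolding M_def using G K C by (intro mult_nonneg_nonneg) auto
  have "norm (xi (s - of_real \<eta>)) \<le> M * (1 + norm s) ^ (2 + N) * norm (xi (s + of_real \<eta>))"
    if s: "Re s \<ge> 1 / 2" for s
  proof -
    define u where "u = 1 + norm s"
    have u: "u \<ge> 1" by (simp add: u_def)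
    have pp: "norm (of_real pi powr (- (s - of_real \<eta>) / 2)) = pi powr \<eta> * norm (of_real pi powr (- (s + of_real \<eta>) / 2))"
    proof -
      have "norm (of_real pi powr (- (s - of_real \<eta>) / 2)) = pi powr (- (Re s - \<eta>) / 2)"
        by (subst norm_powr_real_powr) auto
      also have "- (Re s - \<eta>) / 2 = \<eta> + (- (Re s + \<eta>) / 2)" by (simp add: field_simps)
      also have "pi powr (\<eta> + (- (Re s + \<eta>) / 2)) = pi powr \<eta> * pi powr (- (Re s + \<eta>) / 2)" by (rule powr_add)
      also have "pi powr (- (Re s + \<eta>) / 2) = norm (of_real pi powr (- (s + of_real \<eta>) / 2))"
        by (subst norm_powr_real_powr) auto
      finally show ?thesis .
    qed
    have lin: "norm (s - of_real \<eta>) \<le> norm (s + of_real \<eta>)"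
    proof (rule power2_le_imp_le)
      have "0 \<le> 4 * (Re s * \<eta>)" using s \<eta> by simp
      then show "(norm (s - of_real \<eta>))\<^sup>2 \<le> (norm (s + of_real \<eta>))\<^sup>2"
        unfolding cmod_power2 by (simp add: power2_eq_square algebra_simps)
    qed simp
    have ga: "norm (Gamma ((s - of_real \<eta>) / 2)) \<le> G * norm (Gamma ((s + of_real \<eta>) / 2))"
      using G(2)[of "s / 2"] s by (simp add: diff_divide_distrib add_divide_distrib)
    have n1: "1 + norm (s - of_real \<eta>) \<le> 2 * u" "1 + norm (s + of_real \<eta>) \<le> 2 * u"
    proof -
      have "norm (s - of_real \<eta>) \<le> norm s + \<eta>" "norm (s + of_real \<eta>) \<le> norm s + \<eta>"
        using norm_triangle_ineq4[of s "of_real \<eta>"] norm_triangle_ineq[of s "of_real \<eta>"] \<eta> by auto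
      moreover have "1 + A \<le> 2 * (1 + n)" if "A \<le> n + \<eta>" "n \<ge> 0" for A n using that \<eta> by argo
      ultimately show "1 + norm (s - of_real \<eta>) \<le> 2 * u" "1 + norm (s + of_real \<eta>) \<le> 2 * u"
        unfolding u_def by (simp_all del: mult_2 distrib_left_numeral)
    qed
    have "norm (zeta_reg (s - of_real \<eta>)) \<le> C * (1 + norm (s - of_real \<eta>))\<^sup>2"
      using s \<eta> by (intro C(2)) auto
    also have "\<dots> \<le> C * (2 * u)\<^sup>2" using n1 C by (intro mult_left_mono power_mono) auto
    also have "\<dots> = (C * 2\<^sup>2) * u\<^sup>2 * 1" by (simp add: power_mult_distrib)
    also have "\<dots> \<le> (C * 2\<^sup>2) * u\<^sup>2 * (K * (2 * u) ^ N * norm (zeta_reg (s + of_real \<eta>)))"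
    proof (intro mult_left_mono)
      have "1 \<le> K * (1 + norm (s + of_real \<eta>)) ^ N * norm (zeta_reg (s + of_real \<eta>))"
        using s by (intro K(2)) auto
      also have "\<dots> \<le> K * (2 * u) ^ N * norm (zeta_reg (s + of_real \<eta>))"
        using n1 K by (intro mult_right_mono mult_left_mono power_mono) auto
      finally show "1 \<le> K * (2 * u) ^ N * norm (zeta_reg (s + of_real \<eta>))" .
    qed (use C in auto)
    also have "\<dots> = (C * 2\<^sup>2) * (K * 2 ^ N) * u ^ (2 + N) * norm (zeta_reg (s + of_real \<eta>))"
      by (simp add: power_mult_distrib power_add power2_eq_square)
    finally have ze: "norm (zeta_reg (s - of_real \<eta>)) \<le> (C * 2\<^sup>2) * (K * 2 ^ N) * u ^ (2 + N) * norm (zeta_reg (s + of_real \<eta>))" .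
    have "norm (xi (s - of_real \<eta>)) = norm (of_real pi powr (- (s - of_real \<eta>) / 2)) *
       (norm (s - of_real \<eta>) * norm (Gamma ((s - of_real \<eta>) / 2))) * norm (zeta_reg (s - of_real \<eta>))"
      by (simp add: xi_def norm_mult)
    also have "\<dots> \<le> (pi powr \<eta> * norm (of_real pi powr (- (s + of_real \<eta>) / 2))) *
       (norm (s + of_real \<eta>) * (G * norm (Gamma ((s + of_real \<eta>) / 2)))) *
       ((C * 2\<^sup>2) * (K * 2 ^ N) * u ^ (2 + N) * norm (zeta_reg (s + of_real \<eta>)))"
      unfolding pp using lin ga ze G by (intro mult_mono) (auto intro!: mult_nonneg_nonneg)
    also have "\<dots> = M * u ^ (2 + N) * norm (xi (s + of_real \<eta>))"
      by (simp add: xi_def norm_mult M_def)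
    finally show ?thesis by (simp add: u_def)
  qed
  then show ?thesis using that M by blast
qed

text \<open>
  Monotonicity of $|\xi(\sigma+it)|$ in $\sigma$: on the critical line the quotient has modulus 1
  by the functional equation, and it has no poles to the right because $\xi$ has no zeros there.
\<close>

lemma xi_shift_mono:
  assumes nz: "\<And>s. Re s > 1 / 2 \<Longrightarrow> zeta_reg s \<noteq> 0" and \<eta>: "0 < \<eta>" "\<eta> < 1 / 4" and s: "Re s \<ge> 1 / 2"
  shows "norm (xi (s - of_real \<eta>)) \<le> norm (xi (s + of_real \<eta>))"
proof -
  obtain K N where K: "K \<ge> 0"
    "\<And>s. Re s \<ge> 1 / 2 \<Longrightarrow> norm (xi (s - of_real \<eta>)) \<le> K * (1 + norm s) ^ N * norm (xi (s + of_real \<eta>))"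
    using xi_shift_bound[OF nz \<eta>] by metis
  have xnz: "xi (z + of_real \<eta>) \<noteq> 0" if "Re z > 1 / 2 - \<eta>" for z
  proof -
    have "Re (z + of_real \<eta>) > 1 / 2" using that by simp
    then show ?thesis using nz[of "z + of_real \<eta>"] half_not_nonpos_Int[of "z + of_real \<eta>"]
      by (auto simp: xi_def Gamma_eq_zero_iff)
  qed
  define B where "B z = xi (z - of_real \<eta>) / xi (z + of_real \<eta>)" for z
  have "norm (B s) \<le> 1"
  proof (rule Phragmen_Lindelof_halfplane[where B = B and s = s and a = "1 / 2" and a' = "1 / 2 - \<eta>" and K = K and N = N])
    have "(\<lambda>z. xi (z - of_real \<eta>)) holomorphic_on {s. Re s > 1 / 2 - \<eta>}"
      by (rule holomorphic_on_compose_gen[OF _ xi_holomorphic, unfolded o_def])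
         (use \<eta> in \<open>auto intro!: holomorphic_intros\<close>)
    moreover have "(\<lambda>z. xi (z + of_real \<eta>)) holomorphic_on {s. Re s > 1 / 2 - \<eta>}"
      by (rule holomorphic_on_compose_gen[OF _ xi_holomorphic, unfolded o_def])
         (use \<eta> in \<open>auto intro!: holomorphic_intros\<close>)
    ultimately show "B holomorphic_on {s. Re s > 1 / 2 - \<eta>}"
      unfolding B_def using xnz by (intro holomorphic_on_divide) auto
    show "norm (B z) \<le> 1" if "Re z = 1 / 2" for z
    proof -
      have "xi (1 - (z - of_real \<eta>)) = xi (z - of_real \<eta>)" using that \<eta> by (intro xi_symmetric) auto
      \<comment> \<open>This is where Re z = 1/2 enters: the reflection of one shifted point is the
        conjugate of the other.\<close>
      moreover have "1 - (z - of_real \<eta>) = cnj (z + of_real \<eta>)" using that by (simp add: complex_eq_iff)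
      moreover have "xi (cnj w) = cnj (xi w)" for w
        by (simp add: xi_def zeta_reg_cnj cnj_Gamma cnj_powr)
      ultimately have "norm (xi (z - of_real \<eta>)) = norm (xi (z + of_real \<eta>))" by (metis complex_mod_cnj)
      then show ?thesis by (simp add: B_def norm_divide)
    qed
    show "norm (B z) \<le> K * (1 + norm z) ^ N" if "Re z \<ge> 1 / 2" for z
      using K(2)[OF that] xnz[of z] that \<eta> by (simp add: B_def norm_divide divide_le_eq)
  qed (use \<eta> s in auto)
  then show ?thesis using xnz[of s] s \<eta> by (simp add: B_def norm_divide divide_le_eq)
qed

lemma norm_square_derivative:
  fixes g :: "real \<Rightarrow> complex"
  assumes g: "(g has_vector_derivative g x * w) (at x)"
  shows "((\<lambda>x. (norm (g x))\<^sup>2) has_real_derivative 2 * (norm (g x))\<^sup>2 * Re w) (at x)"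
proof -
  have R: "((\<lambda>x. Re (g x)) has_real_derivative Re (g x * w)) (at x)"
    "((\<lambda>x. Im (g x)) has_real_derivative Im (g x * w)) (at x)"
    using bounded_linear.has_vector_derivative[OF bounded_linear_Re g]
      bounded_linear.has_vector_derivative[OF bounded_linear_Im g]
    by (auto simp: has_real_derivative_iff_has_vector_derivative)
  have "((\<lambda>x. (Re (g x))\<^sup>2 + (Im (g x))\<^sup>2) has_real_derivative
      2 * Re (g x) * Re (g x * w) + 2 * Im (g x) * Im (g x * w)) (at x)"
    by (rule DERIV_cong[OF DERIV_add[OF DERIV_power[OF R(1), of 2] DERIV_power[OF R(2), of 2]]])
       (simp del: times_complex.sel)
  moreover have "2 * Re (g x) * Re (g x * w) + 2 * Im (g x) * Im (g x * w) =
      2 * ((Re (g x))\<^sup>2 + (Im (g x))\<^sup>2) * Re w"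
    by (simp add: algebra_simps power2_eq_square)
  ultimately show ?thesis by (simp add: cmod_power2)
qed

text \<open>The expression is xi'/xi at \<open>s\<close>. If its real part were negative, the
  function |xi(s + h)|^2 - |xi(s - h)|^2, which vanishes at h = 0, would have the negative
  derivative 4 |xi(s)|^2 Re(xi'/xi) there, contrary to \<open>xi_shift_mono\<close> for small h >
  0.\<close>

lemma xi_logderiv_nonneg:
  assumes nz: "\<And>s. Re s > 1 / 2 \<Longrightarrow> zeta_reg s \<noteq> 0" and s: "Re s > 1 / 2"
  shows "Re (- of_real (ln pi) / 2 + 1 / s + Digamma (s / 2) / 2 + zeta_logderiv s) \<ge> 0"
proof (rule ccontr)
  define w where "w = - of_real (ln pi) / 2 + 1 / s + Digamma (s / 2) / 2 + zeta_logderiv s"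
  assume "\<not> ?thesis"
  then have w: "Re w < 0" by (simp add: w_def)
  have s0: "s \<noteq> 0" "s / 2 \<notin> \<int>\<^sub>\<le>\<^sub>0" using s half_not_nonpos_Int[of s] by auto
  have xs: "xi s \<noteq> 0" using nz[OF s] s0 by (simp add: xi_def Gamma_eq_zero_iff)
  have zd: "(zeta_reg has_field_derivative zeta_logderiv s * zeta_reg s) (at s)"
    using holomorphic_derivI[OF zeta_reg_holomorphic[of UNIV]] nz[OF s] by (simp add: zeta_logderiv_def)
  have d: "(xi has_field_derivative xi s * w) (at s)"
  proof -
    have 1: "((\<lambda>s. of_real pi powr (- s / 2)) has_field_derivative (of_real pi powr (- s / 2) * (- of_real (ln pi) / 2))) (at s)"
    proof -
      have "((\<lambda>s. of_real pi powr (- s / 2)) has_field_derivative (Ln (of_real pi) * of_real pi powr (- s / 2)) * (- 1 / 2)) (at s)"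
        by (rule DERIV_chain2[OF has_field_derivative_powr_right]) (auto intro!: derivative_eq_intros)
      then show ?thesis by (simp add: Ln_of_real mult_ac)
    qed
    have 2: "((\<lambda>s. Gamma (s / 2)) has_field_derivative (Gamma (s / 2) * Digamma (s / 2) * (1 / 2))) (at s)"
      using s0 by (auto intro!: derivative_eq_intros)
    have "(xi has_field_derivative
        (of_real pi powr (- s / 2) * (s * Gamma (s / 2))) * (zeta_logderiv s * zeta_reg s) +
        (of_real pi powr (- s / 2) * (s * (Gamma (s / 2) * Digamma (s / 2) * (1 / 2)) + 1 * Gamma (s / 2)) +
         of_real pi powr (- s / 2) * (- of_real (ln pi) / 2) * (s * Gamma (s / 2))) * zeta_reg s) (at s)"
      unfolding xi_def[abs_def] by (intro DERIV_mult' 1 2 zd DERIV_ident)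
    also have "(of_real pi powr (- s / 2) * (s * Gamma (s / 2))) * (zeta_logderiv s * zeta_reg s) +
        (of_real pi powr (- s / 2) * (s * (Gamma (s / 2) * Digamma (s / 2) * (1 / 2)) + 1 * Gamma (s / 2)) +
         of_real pi powr (- s / 2) * (- of_real (ln pi) / 2) * (s * Gamma (s / 2))) * zeta_reg s = xi s * w"
      using s0 unfolding xi_def w_def by (simp add: field_simps)
    finally show ?thesis .
  qed
  have vd: "((\<lambda>x. xi (s + of_real (c * x))) has_vector_derivative xi (s + of_real (c * 0)) * (of_real c * w)) (at 0)" for c :: real
  proof -
    have "((\<lambda>x. s + of_real (c * x)) has_vector_derivative of_real c) (at 0)"
      by (auto intro!: derivative_eq_intros)
    from field_vector_diff_chain_at[OF this, of xi "xi s * w"] d show ?thesis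
      by (simp add: o_def mult_ac)
  qed
  define \<phi> where "\<phi> x = (norm (xi (s + of_real (1 * x))))\<^sup>2 - (norm (xi (s + of_real ((- 1) * x))))\<^sup>2" for x
  have "(\<phi> has_real_derivative 2 * (norm (xi (s + of_real (1 * 0))))\<^sup>2 * Re (of_real 1 * w) -
      2 * (norm (xi (s + of_real ((- 1) * 0))))\<^sup>2 * Re (of_real (- 1) * w)) (at 0)"
    unfolding \<phi>_def[abs_def] by (intro DERIV_diff norm_square_derivative vd)
  then have D: "(\<phi> has_real_derivative 4 * (norm (xi s))\<^sup>2 * Re w) (at 0)" by (simp add: mult_ac)
  have "4 * (norm (xi s))\<^sup>2 * Re w < 0" using w xs by (intro mult_pos_neg) auto
  then obtain e where e: "e > 0" "\<And>h. 0 < h \<Longrightarrow> h < e \<Longrightarrow> \<phi> (0 + h) < \<phi> 0"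
    using DERIV_neg_dec_right[OF D] by blast
  define h where "h = min (e / 2) (1 / 8)"
  have h: "0 < h" "h < e" "h < 1 / 4" using e by (auto simp: h_def)
  have "norm (xi (s - of_real h)) \<le> norm (xi (s + of_real h))"
    using xi_shift_mono[OF nz h(1,3)] s by simp
  then have "(norm (xi (s - of_real h)))\<^sup>2 \<le> (norm (xi (s + of_real h)))\<^sup>2" by (intro power_mono) auto
  then have "\<phi> h \<ge> 0" by (simp add: \<phi>_def)
  moreover have "\<phi> 0 = 0" by (simp add: \<phi>_def)
  ultimately show False using e(2)[OF h(1,2)] by simp
qed

text \<open>Each term of the series for Digamma obeys the two bounds 4u/n^2 and 5/n, where u = 1 +
  |Im z|. Their geometric mean with weights 1/4 and 3/4 is a multiple of u^(1/4) n^(-5/4): summable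
  in n at the cost of a quarter power of the height.\<close>

lemma norm_Digamma_le:
  obtains C where "C \<ge> 0" "\<And>z::complex. 1 / 4 \<le> Re z \<Longrightarrow> Re z \<le> 1 \<Longrightarrow> norm (Digamma z) \<le> C * (1 + \<bar>Im z\<bar>) powr (1 / 4)"
proof -
  define S where "S = (\<Sum>k. real (Suc k) powr - (5 / 4))"
  have sm: "summable (\<lambda>k. real (Suc k) powr - (5 / 4))" by (rule summable_powr_Suc) simp
  have S: "S \<ge> 0" unfolding S_def by (rule suminf_nonneg[OF sm]) simp
  define C where "C = 4 powr (1 / 4) * 5 powr (3 / 4) * S + norm (euler_mascheroni :: complex)"
  have "norm (Digamma z) \<le> C * (1 + \<bar>Im z\<bar>) powr (1 / 4)" if z: "1 / 4 \<le> Re z" "Re z \<le> 1" for z :: complex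
  proof -
    define u where "u = 1 + \<bar>Im z\<bar>"
    have u: "u \<ge> 1" by (simp add: u_def)
    define f where "f k = inverse (of_nat (Suc k)) - inverse (z + of_nat k)" for k
    have fb: "norm (f k) \<le> 4 powr (1 / 4) * 5 powr (3 / 4) * u powr (1 / 4) * real (Suc k) powr - (5 / 4)" for k
    proof -
      define n where "n = real (Suc k)"
      have n: "n \<ge> 1" by (simp add: n_def)
      have "n / 4 \<le> Re (z + of_nat k)" using z by (simp add: n_def field_simps)
      also have "\<dots> \<le> norm (z + of_nat k)" by (rule complex_Re_le_cmod)
      finally have ge: "n / 4 \<le> norm (z + of_nat k)" .
      then have zk: "z + of_nat k \<noteq> 0" using n by auto
      have i4: "1 / norm (z + of_nat k) \<le> 4 / n"
        using ge n zk by (simp add: divide_simps mult.commute)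
      have b: "norm (f k) \<le> 5 / n"
      proof -
        have "norm (f k) \<le> 1 / n + 1 / norm (z + of_nat k)"
          unfolding f_def by (rule order_trans[OF norm_triangle_ineq4]) (simp add: norm_divide n_def inverse_eq_divide del: of_nat_Suc)
        also have "\<dots> \<le> 1 / n + 4 / n" using i4 by simp
        finally show ?thesis by simp
      qed
      have a: "norm (f k) \<le> 4 * u / n\<^sup>2"
      proof -
        have "f k = (z - 1) / (of_nat (Suc k) * (z + of_nat k))"
          unfolding f_def using zk by (simp add: field_simps del: of_nat_Suc) (simp add: algebra_simps)
        then have "norm (f k) = norm (z - 1) * (1 / n) * (1 / norm (z + of_nat k))"
          by (simp add: norm_divide norm_mult n_def del: of_nat_Suc)
        also have "\<dots> \<le> u * (1 / n) * (4 / n)"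
          using cmod_le[of "z - 1"] z i4 n u by (intro mult_mono) (auto simp: u_def)
        finally show ?thesis by (simp add: power2_eq_square mult.commute)
      qed
      show ?thesis
      proof (cases "f k = 0")
        case False
        then have fp: "norm (f k) > 0" by simp
        have "norm (f k) = norm (f k) powr (1 / 4) * norm (f k) powr (3 / 4)"
          using fp by (simp add: powr_add[symmetric])
        also have "\<dots> \<le> (4 * u / n\<^sup>2) powr (1 / 4) * (5 / n) powr (3 / 4)"
          using a b by (intro mult_mono powr_mono2) auto
        also have "\<dots> = 4 powr (1 / 4) * 5 powr (3 / 4) * u powr (1 / 4) * ((1 / n\<^sup>2) powr (1 / 4) * (1 / n) powr (3 / 4))"
          using powr_mult[of "4 * u" "1 / n\<^sup>2" "1 / 4"] powr_mult[of 4 u "1 / 4"] powr_mult[of 5 "1 / n" "3 / 4"] by simp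
        also have "(1 / n\<^sup>2) powr (1 / 4) * (1 / n) powr (3 / 4) = n powr - (5 / 4)"
        proof -
          have 1: "1 / n\<^sup>2 = n powr (- 2)" "1 / n = n powr (- 1)" using n by (simp_all add: powr_minus divide_inverse)
          show ?thesis unfolding 1 powr_powr powr_add[symmetric] by simp
        qed
        finally show ?thesis by (simp add: n_def)
      qed simp
    qed
    have "norm (\<Sum>k. f k) \<le> (\<Sum>k. 4 powr (1 / 4) * 5 powr (3 / 4) * u powr (1 / 4) * real (Suc k) powr - (5 / 4))"
      by (rule norm_suminf_le[OF fb summable_mult[OF sm]])
    also have "\<dots> = 4 powr (1 / 4) * 5 powr (3 / 4) * u powr (1 / 4) * S"
      unfolding S_def by (rule suminf_mult[OF sm])
    finally have 1: "norm (\<Sum>k. f k) \<le> 4 powr (1 / 4) * 5 powr (3 / 4) * S * u powr (1 / 4)" by (simp add: mult_ac)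
    have "norm (Digamma z) \<le> norm (\<Sum>k. f k) + norm (euler_mascheroni :: complex) * 1"
      unfolding Digamma_def f_def using norm_triangle_ineq4 by (rule order_trans) simp
    also have "\<dots> \<le> 4 powr (1 / 4) * 5 powr (3 / 4) * S * u powr (1 / 4) + norm (euler_mascheroni :: complex) * u powr (1 / 4)"
      using 1 u by (intro add_mono mult_left_mono) (auto intro: ge_one_powr_ge_zero)
    finally show ?thesis by (simp add: C_def u_def distrib_right)
  qed
  moreover have "C \<ge> 0" using S by (simp add: C_def)
  ultimately show ?thesis using that by blast
qed

text \<open>In contrast to \<open>zeta_logderiv_growth\<close> the constant is the same up to the
  critical line: the other terms of xi'/xi are at most a multiple of (1 + |Im s|)^(1/4) there, and
  the real part of the whole is nonnegative.\<close>

lemma Re_zeta_logderiv_lower: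
  assumes nz: "\<And>s. Re s > 1 / 2 \<Longrightarrow> zeta_reg s \<noteq> 0"
  obtains C where "C \<ge> 0"
    "\<And>s. 1 / 2 < Re s \<Longrightarrow> Re s \<le> 3 / 4 \<Longrightarrow> Re (zeta_logderiv s) \<ge> - C * (1 + \<bar>Im s\<bar>) powr (1 / 4)"
proof -
  obtain D where D: "D \<ge> 0" "\<And>z::complex. 1 / 4 \<le> Re z \<Longrightarrow> Re z \<le> 1 \<Longrightarrow> norm (Digamma z) \<le> D * (1 + \<bar>Im z\<bar>) powr (1 / 4)"
    using norm_Digamma_le by blast
  have "Re (zeta_logderiv s) \<ge> - (2 + D) * (1 + \<bar>Im s\<bar>) powr (1 / 4)" if s: "1 / 2 < Re s" "Re s \<le> 3 / 4" for s
  proof -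
    define u where "u = (1 + \<bar>Im s\<bar>) powr (1 / 4)"
    have u: "u \<ge> 1" unfolding u_def by (rule ge_one_powr_ge_zero) auto
    have "norm (1 / s) \<le> 1 / (1 / 2)"
      unfolding norm_divide using complex_Re_le_cmod[of s] s by (intro frac_le) auto
    then have 1: "Re (1 / s) \<le> 2" using complex_Re_le_cmod[of "1 / s"] by simp
    have "norm (Digamma (s / 2)) \<le> D * (1 + \<bar>Im (s / 2)\<bar>) powr (1 / 4)" using s by (intro D) auto
    also have "\<dots> \<le> D * u" unfolding u_def using D by (intro mult_left_mono powr_mono2) auto
    finally have 2: "Re (Digamma (s / 2)) \<le> D * u" using complex_Re_le_cmod[of "Digamma (s / 2)"] by simp
    have "0 \<le> Re (- of_real (ln pi) / 2 + 1 / s + Digamma (s / 2) / 2 + zeta_logderiv s)"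
      by (rule xi_logderiv_nonneg[OF nz s(1)])
    also have "\<dots> = - ln pi / 2 + Re (1 / s) + Re (Digamma (s / 2)) / 2 + Re (zeta_logderiv s)" by simp
    finally have "0 \<le> - ln pi / 2 + Re (1 / s) + Re (Digamma (s / 2)) / 2 + Re (zeta_logderiv s)" .
    moreover have "ln pi \<ge> 0" using pi_gt3 by simp
    moreover have "D * u \<ge> 0" using D u by simp
    ultimately have "0 \<le> 2 + D * u + Re (zeta_logderiv s)" using 1 2 by linarith
    also have "\<dots> \<le> 2 * u + D * u + Re (zeta_logderiv s)" using u by simp
    finally show ?thesis by (simp add: u_def algebra_simps)
  qed
  then show ?thesis using that[of "2 + D"] D by auto
qed


section \<open>Chebyshev functions as step functions\<close>

definition step_sum :: "(nat \<Rightarrow> real) \<Rightarrow> real \<Rightarrow> real" where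
  "step_sum c x = (\<Sum>n | 1 \<le> n \<and> real n \<le> x. c n)"

lemma finite_nat_le_real: "finite {n. 1 \<le> n \<and> real n \<le> x}"
  by (rule finite_subset[of _ "{..nat \<lfloor>x\<rfloor>}"]) (auto simp: le_nat_floor)

lemma chebyshev_theta_eq: "chebyshev_theta x = step_sum (\<lambda>n. if prime n then ln (real n) else 0) x"
proof -
  have "step_sum (\<lambda>n. if prime n then ln (real n) else 0) x =
      (\<Sum>n\<in>{n \<in> {n. 1 \<le> n \<and> real n \<le> x}. prime n}. ln (real n))"
    unfolding step_sum_def by (rule sum.inter_filter[symmetric, OF finite_nat_le_real])
  also have "{n \<in> {n. 1 \<le> n \<and> real n \<le> x}. prime n} = {p. prime p \<and> real p \<le> x}"
    by (auto simp: Suc_le_eq prime_gt_0_nat)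
  finally show ?thesis by (simp add: chebyshev_theta_def)
qed

text \<open>By unique factorisation (p, m) -> p^m is a bijection from the pairs in the sum onto the
  prime powers up to x.\<close>

lemma chebyshev_psi_eq: "chebyshev_psi x = step_sum mangoldt x"
proof -
  define A where "A = {(p, m). prime p \<and> 1 \<le> m \<and> real (p ^ m) \<le> x}"
  have inj: "inj_on (\<lambda>(p, m). p ^ m) A"
  proof (rule inj_onI)
    fix u v assume uv: "u \<in> A" "v \<in> A" "(\<lambda>(p, m). p ^ m) u = (\<lambda>(p, m). p ^ m) v"
    obtain p k q l where u: "u = (p, k)" and v: "v = (q, l)" by (cases u, cases v)
    have p: "prime p" "prime q" "k > 0" "l > 0" and eq: "p ^ k = q ^ l" using uv by (auto simp: A_def u v)
    have "p = q" using p eq by (metis aprimedivisor_prime_power)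
    moreover from this have "k = l" using p eq prime_gt_1_nat[of p] by (simp add: power_inject_exp)
    ultimately show "u = v" by (simp add: u v)
  qed
  have img: "(\<lambda>(p, m). p ^ m) ` A = {n. primepow n \<and> real n \<le> x}"
  proof (intro equalityI subsetI)
    fix n assume "n \<in> (\<lambda>(p, m). p ^ m) ` A"
    then obtain p m where "prime p" "1 \<le> m" "real (p ^ m) \<le> x" "n = p ^ m" by (auto simp: A_def)
    moreover from this have "\<exists>p k. prime p \<and> 0 < k \<and> n = p ^ k"
      by (intro exI[of "\<lambda>p. \<exists>k. prime p \<and> 0 < k \<and> n = p ^ k" p] exI[of "\<lambda>k. prime p \<and> 0 < k \<and> n = p ^ k" m]) auto
    ultimately show "n \<in> {n. primepow n \<and> real n \<le> x}"
      by (simp add: primepow_def)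
  next
    fix n assume n: "n \<in> {n. primepow n \<and> real n \<le> x}"
    then obtain p k where "prime p" "k > 0" "n = p ^ k" by (auto simp: primepow_def)
    then show "n \<in> (\<lambda>(p, m). p ^ m) ` A" using n by (intro image_eqI[of _ _ "(p, k)"]) (auto simp: A_def)
  qed
  have "chebyshev_psi x = (\<Sum>z\<in>A. mangoldt ((\<lambda>(p, m). p ^ m) z))"
    unfolding chebyshev_psi_def A_def by (rule sum.cong) (auto simp: mangoldt_primepow)
  also have "\<dots> = (\<Sum>n\<in>(\<lambda>(p, m). p ^ m) ` A. mangoldt n)"
    by (subst sum.reindex[OF inj]) (simp add: o_def)
  also have "\<dots> = step_sum mangoldt x"
    unfolding step_sum_def img
    by (rule sum.mono_neutral_left[OF finite_nat_le_real]) (auto simp: mangoldt_def dest: primepow_gt_Suc_0)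
  finally show ?thesis .
qed

lemma step_sum_mono:
  assumes "\<And>n. c n \<ge> 0" "x \<le> y"
  shows "step_sum c x \<le> step_sum c y"
  unfolding step_sum_def using assms by (intro sum_mono2 finite_nat_le_real) auto

lemma step_sum_nonneg: "(\<And>n. c n \<ge> 0) \<Longrightarrow> step_sum c x \<ge> 0"
  unfolding step_sum_def by (intro sum_nonneg) auto

lemma step_sum_measurable:
  assumes "\<And>n. c n \<ge> 0"
  shows "step_sum c \<in> borel_measurable borel"
  by (rule borel_measurable_mono) (auto simp: mono_def intro: step_sum_mono assms)

text \<open>The integral of \<open>step_sum\<close> over [0, x] in closed form, see
  \<open>has_integral_step_sum\<close>. Divided by x it is the first Riesz mean, which is what the
  kernel 1/(s(s + 1)) produces in Perron's formula.\<close>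

definition step_integral :: "(nat \<Rightarrow> real) \<Rightarrow> real \<Rightarrow> real" where
  "step_integral c x = (\<Sum>n | 1 \<le> n \<and> real n \<le> x. c n * (x - real n))"

lemma chebyshev_psi_measurable [measurable]: "chebyshev_psi \<in> borel_measurable borel"
  unfolding chebyshev_psi_eq[abs_def] using step_sum_measurable[OF mangoldt_nonneg] by simp

lemma step_integral_mono:
  assumes c: "\<And>n. c n \<ge> 0" and xy: "x \<le> y"
  shows "step_integral c x \<le> step_integral c y"
proof -
  have "step_integral c x \<le> (\<Sum>n | 1 \<le> n \<and> real n \<le> x. c n * (y - real n))"
    unfolding step_integral_def using xy by (intro sum_mono mult_left_mono c) auto
  also have "\<dots> \<le> step_integral c y"
    unfolding step_integral_def using xy
    by (intro sum_mono2 finite_nat_le_real) (auto intro!: mult_nonneg_nonneg c)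
  finally show ?thesis .
qed

lemma has_integral_step_sum:
  assumes x: "x \<ge> 0"
  shows "(step_sum c has_integral step_integral c x) {0..x}"
proof -
  define F where "F = {n. 1 \<le> n \<and> real n \<le> x}"
  have fin: "finite F" unfolding F_def by (rule finite_nat_le_real)
  have "((\<lambda>t. \<Sum>n\<in>F. if t \<in> {real n..x} then c n else 0) has_integral (\<Sum>n\<in>F. c n * (x - real n))) {0..x}"
  proof (intro has_integral_sum[OF fin])
    fix n assume n: "n \<in> F"
    have "((\<lambda>t. c n) has_integral (x - real n) *\<^sub>R c n) {real n..x}"
      using n has_integral_const_real[of "c n" "real n" x] by (auto simp: F_def)
    then have "((\<lambda>t. if t \<in> {real n..x} then c n else 0) has_integral (x - real n) *\<^sub>R c n) {0..x}"
      by (subst has_integral_restrict) auto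
    then show "((\<lambda>t. if t \<in> {real n..x} then c n else 0) has_integral c n * (x - real n)) {0..x}"
      by (simp add: mult.commute)
  qed
  moreover have "(\<Sum>n\<in>F. if t \<in> {real n..x} then c n else 0) = step_sum c t" if "t \<in> {0..x}" for t
  proof -
    have "(\<Sum>n\<in>F. if t \<in> {real n..x} then c n else 0) = (\<Sum>n\<in>{n \<in> F. real n \<le> t}. c n)"
      using that by (subst sum.inter_filter[OF fin]) (auto intro!: sum.cong)
    also have "{n \<in> F. real n \<le> t} = {n. 1 \<le> n \<and> real n \<le> t}" using that by (auto simp: F_def)
    finally show ?thesis by (simp add: step_sum_def)
  qed
  ultimately show ?thesis
    unfolding step_integral_def F_def[symmetric] by (subst has_integral_cong[symmetric]) auto
qed

text \<open>Given in closed form because differences of it are computed algebraically;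
  \<open>has_integral_psi_error\<close> identifies it with the integral of psi(t) - t.\<close>

definition psi_error_integral :: "real \<Rightarrow> real" where
  "psi_error_integral x = step_integral mangoldt x - x\<^sup>2 / 2"

lemma has_integral_ident_0: "x \<ge> 0 \<Longrightarrow> ((\<lambda>t. t) has_integral x\<^sup>2 / 2) {0..x::real}"
  using ident_has_integral[of 0 x] by simp

lemma has_integral_psi_error:
  "x \<ge> 0 \<Longrightarrow> ((\<lambda>t. chebyshev_psi t - t) has_integral psi_error_integral x) {0..x}"
  unfolding psi_error_integral_def chebyshev_psi_eq
  by (intro has_integral_diff has_integral_step_sum has_integral_ident_0)

section \<open>An explicit formula without zeros\<close>

lemma norm_Complex_ge:
  assumes "c \<ge> 1 / 2"
  shows "(1 + \<bar>t\<bar>) / 3 \<le> norm (Complex c t)"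
proof -
  have "1 / 2 \<le> norm (Complex c t)" "\<bar>t\<bar> \<le> norm (Complex c t)"
    using abs_Re_le_cmod[of "Complex c t"] abs_Im_le_cmod[of "Complex c t"] assms by auto
  then show ?thesis by argo
qed

lemma Perron_kernel_measurable [measurable]:
  "(\<lambda>t. Complex c t) \<in> borel_measurable borel"
  by (intro borel_measurable_continuous_onI continuous_on_Complex_line)

lemma norm_Perron_denominator:
  assumes "Re s \<ge> 1 / 2"
  shows "norm (1 / (s * (s + 1))) \<le> 9 * (1 + \<bar>Im s\<bar>) powr - 2"
proof -
  have 1: "(1 + \<bar>Im s\<bar>) / 3 \<le> norm s" using norm_Complex_ge[of "Re s" "Im s"] assms by simp
  have 2: "(1 + \<bar>Im s\<bar>) / 3 \<le> norm (s + 1)" using norm_Complex_ge[of "Re s + 1" "Im s"] assms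
    by (simp add: complex_eq_iff) (metis complex_surj one_complex.sel plus_complex.sel add.right_neutral)
  have "((1 + \<bar>Im s\<bar>) / 3) * ((1 + \<bar>Im s\<bar>) / 3) \<le> norm (s * (s + 1))"
    unfolding norm_mult using 1 2 by (intro mult_mono) auto
  then have "1 / norm (s * (s + 1)) \<le> 1 / (((1 + \<bar>Im s\<bar>) / 3) * ((1 + \<bar>Im s\<bar>) / 3))"
    by (intro frac_le) (auto intro!: mult_pos_pos)
  also have "\<dots> = 9 * (1 + \<bar>Im s\<bar>) powr - 2"
  proof -
    have "1 / ((u / 3) * (u / 3)) = 9 * u powr - 2" if "u > 0" for u :: real
    proof -
      have "u powr - 2 = 1 / (u * u)" using that by (simp add: powr_minus_divide power2_eq_square)
      then show ?thesis by simp
    qed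
    then show ?thesis by simp
  qed
  finally show ?thesis by (simp add: norm_divide)
qed

text \<open>For y >= 1 the line is moved to the far left past the poles at 0 and -1, with residues 1
  and -1/y. For y < 1 it is moved to the far right, where the integral over Re s = R is at most
  pi/R.\<close>

lemma Perron_kernel:
  assumes y: "y > 0"
  shows "vline (\<lambda>s. of_real y powr s / (s * (s + 1))) 2 = of_real (2 * pi * (if y \<ge> 1 then 1 - 1 / y else 0))"
proof (cases "y \<ge> 1")
  case True
  have "vline (\<lambda>s. of_real y powr s / (s * (s + 1))) 2 = of_real (2 * pi) * (of_real y powr 0 - of_real y powr (-1))"
  proof (rule vline_two_poles(2)[where F = "\<lambda>s. of_real y powr s" and a' = 3 and K = "y\<^sup>2"])
    show "(\<lambda>s. complex_of_real y powr s) holomorphic_on {s. Re s < 3}"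
      using y by (intro holomorphic_intros) auto
    fix s :: complex assume s: "Re s \<le> 2"
    have "norm (of_real y powr s) = y powr Re s" using y by (subst norm_powr_real_powr) auto
    also have "\<dots> \<le> y powr 2" using True s by (intro powr_mono) auto
    also have "\<dots> = y\<^sup>2 * 1" using y by simp
    also have "\<dots> \<le> y\<^sup>2 * (1 + \<bar>Im s\<bar>) powr (1 / 4)" by (intro mult_left_mono ge_one_powr_ge_zero) auto
    finally show "norm (of_real y powr s) \<le> y\<^sup>2 * (1 + \<bar>Im s\<bar>) powr (1 / 4)" .
  qed auto
  also have "of_real y powr 0 - of_real y powr (-1) = complex_of_real (1 - 1 / y)"
    using y by (simp add: powr_minus divide_inverse)
  finally show ?thesis using True by simp
next
  case False
  define G :: "complex \<Rightarrow> complex" where "G = (\<lambda>s. of_real y powr s / (s * (s + 1)))"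
  have hol: "G holomorphic_on {s. Re s > 1}"
    unfolding G_def using y by (intro holomorphic_intros) (auto simp: add_eq_0_iff2)
  have Gb: "norm (G s) \<le> norm (1 / (s * (s + 1)))" if "Re s > 0" for s
  proof -
    have "norm (of_real y powr s) = y powr Re s" using y by (subst norm_powr_real_powr) auto
    also have "\<dots> \<le> 1" using y False that by (intro powr_le1) auto
    finally show ?thesis unfolding G_def norm_divide by (intro divide_right_mono) auto
  qed
  have sh: "vline G 2 = vline G R" if R: "R \<ge> 2" for R
  proof (rule vline_shift[OF open_Re_gt convex_halfspace_Re_gt hol R])
    fix s assume s: "2 \<le> Re s" "Re s \<le> R"
    have "norm (G s) \<le> 9 * (1 + \<bar>Im s\<bar>) powr - 2" using Gb[of s] norm_Perron_denominator[of s] s by auto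
    also have "\<dots> \<le> 9 * (1 + \<bar>Im s\<bar>) powr (-3/2)" by (intro mult_left_mono powr_mono) auto
    finally show "norm (G s) \<le> 9 * (1 + \<bar>Im s\<bar>) powr (-3/2)" .
  qed auto
  have nb: "norm (vline G R) \<le> pi / R" if R: "R \<ge> 2" for R
  proof -
    have b: "norm (G (Complex R t)) \<le> 1 / (R\<^sup>2 + (t - 0)\<^sup>2)" for t
    proof -
      have "norm (Complex R t) * norm (Complex R t) \<le> norm (Complex R t) * norm (Complex R t + 1)"
      proof (rule mult_left_mono)
        have "(norm (Complex R t))\<^sup>2 \<le> (norm (Complex R t + 1))\<^sup>2" unfolding cmod_power2 using R by (simp add: power2_eq_square algebra_simps)
        then show "norm (Complex R t) \<le> norm (Complex R t + 1)" by (rule power2_le_imp_le) simp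
      qed simp
      moreover have "norm (Complex R t) * norm (Complex R t) = R\<^sup>2 + (t - 0)\<^sup>2"
        by (simp add: cmod_power2 flip: power2_eq_square)
      moreover have "R\<^sup>2 + (t - 0)\<^sup>2 > 0" using R by (intro add_pos_nonneg) auto
      ultimately have "norm (1 / (Complex R t * (Complex R t + 1))) \<le> 1 / (R\<^sup>2 + (t - 0)\<^sup>2)"
        unfolding norm_divide norm_mult norm_one by (intro frac_le) auto
      then show ?thesis using Gb[of "Complex R t"] R by simp
    qed
    have hi: "has_bochner_integral lborel (\<lambda>t. 1 / (R\<^sup>2 + (t - 0)\<^sup>2)) (pi / R)"
      using R by (intro has_bochner_integral_inverse_quadratic) auto
    have "norm (vline G R) \<le> (LINT t|lborel. norm (G (Complex R t)))" unfolding vline_def by (rule integral_norm_bound)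
    also have "\<dots> \<le> (LINT t|lborel. 1 / (R\<^sup>2 + (t - 0)\<^sup>2))"
    proof (rule integral_mono_AE')
      show "integrable lborel (\<lambda>t. 1 / (R\<^sup>2 + (t - 0)\<^sup>2))" using hi by (auto simp: has_bochner_integral_iff)
    qed (use b in auto)
    finally show ?thesis using hi by (simp add: has_bochner_integral_iff)
  qed
  have "(\<lambda>n. pi / real n) \<longlonglongrightarrow> 0"
    by (intro real_tendsto_divide_at_top[OF tendsto_const] filterlim_real_sequentially)
  moreover have "\<forall>\<^sub>F n in sequentially. norm (vline G 2) \<le> pi / real n"
  proof (rule eventually_sequentiallyI[of 2])
    fix n :: nat assume "2 \<le> n"
    then have R: "2 \<le> real n" by simp
    show "norm (vline G 2) \<le> pi / real n" unfolding sh[OF R] by (rule nb[OF R])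
  qed
  ultimately have "norm (vline G 2) \<le> 0" by (intro tendsto_lowerbound[where F = sequentially]) auto
  then show ?thesis using False by (simp add: G_def)
qed

lemma Perron_kernel_integrable:
  assumes y: "y > 0"
  shows "integrable lborel (\<lambda>t. of_real y powr Complex 2 t / (Complex 2 t * (Complex 2 t + 1)))"
    and "norm (of_real y powr Complex 2 t / (Complex 2 t * (Complex 2 t + 1))) \<le> y\<^sup>2 * (9 * (1 + \<bar>t\<bar>) powr - 2)"
proof -
  have b: "norm (of_real y powr Complex 2 t / (Complex 2 t * (Complex 2 t + 1))) \<le> y\<^sup>2 * (9 * (1 + \<bar>t\<bar>) powr - 2)" for t
  proof -
    have "norm (of_real y powr Complex 2 t) = y\<^sup>2" using y by (subst norm_powr_real_powr) auto
    then have "norm (of_real y powr Complex 2 t / (Complex 2 t * (Complex 2 t + 1))) =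
       y\<^sup>2 * norm (1 / (Complex 2 t * (Complex 2 t + 1)))" by (simp add: norm_divide)
    also have "\<dots> \<le> y\<^sup>2 * (9 * (1 + \<bar>t\<bar>) powr - 2)"
      using norm_Perron_denominator[of "Complex 2 t"] by (intro mult_left_mono) auto
    finally show ?thesis .
  qed
  then show "norm (of_real y powr Complex 2 t / (Complex 2 t * (Complex 2 t + 1))) \<le> y\<^sup>2 * (9 * (1 + \<bar>t\<bar>) powr - 2)" .
  show "integrable lborel (\<lambda>t. of_real y powr Complex 2 t / (Complex 2 t * (Complex 2 t + 1)))"
  proof (rule integrable_vline[where G = "\<lambda>s. of_real y powr s / (s * (s + 1))" and K = "y\<^sup>2 * 9" and p = 2])
    show "norm (of_real y powr Complex 2 t / (Complex 2 t * (Complex 2 t + 1))) \<le> y\<^sup>2 * 9 * (1 + \<bar>t\<bar>) powr - 2" for t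
      using b[of t] by (simp only: mult.assoc)
  qed auto
qed

text \<open>The Dirichlet series is integrated term by term against the kernel with y = x/n; on Re s
  = 2 the absolute values are dominated by a multiple of the sum of mangoldt(n)/n^2. Terms with n >
  x vanish, which leaves a finite sum.\<close>

lemma Perron_vonMangoldt:
  assumes x: "x \<ge> 1"
  shows "integrable lborel (\<lambda>t. vonMangoldt_series (Complex 2 t) * of_real x powr Complex 2 t / (Complex 2 t * (Complex 2 t + 1)))"
    and "vline (\<lambda>s. vonMangoldt_series s * of_real x powr s / (s * (s + 1))) 2 =
      of_real (2 * pi * step_integral mangoldt x / x)"
proof -
  define f where "f n t = mangoldt n * (of_real (x / real n) powr Complex 2 t / (Complex 2 t * (Complex 2 t + 1)))" for n t
  have fint: "integrable lborel (f n)" for n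
  proof (cases "n = 0")
    case False
    then show ?thesis unfolding f_def[abs_def] using x by (intro integrable_mult_right Perron_kernel_integrable) auto
  qed (simp add: f_def[abs_def])
  have fb: "norm (f n t) \<le> mangoldt n * real n powr - 2 * (x\<^sup>2 * (9 * (1 + \<bar>t\<bar>) powr - 2))" for n t
  proof (cases "n = 0")
    case False
    then have "norm (f n t) \<le> mangoldt n * ((x / real n)\<^sup>2 * (9 * (1 + \<bar>t\<bar>) powr - 2))"
      unfolding f_def norm_mult norm_mangoldt using x
      by (intro mult_left_mono Perron_kernel_integrable(2) mangoldt_nonneg) auto
    also have "\<dots> = mangoldt n * real n powr - 2 * (x\<^sup>2 * (9 * (1 + \<bar>t\<bar>) powr - 2))"
    proof -
      have "real n powr - 2 = 1 / (real n)\<^sup>2" using False by (simp add: powr_minus divide_inverse)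
      then show ?thesis by (simp add: power_divide)
    qed
    finally show ?thesis .
  qed (simp add: f_def)
  have sm2: "summable (\<lambda>n. mangoldt n * real n powr - 2)" by (rule summable_mangoldt_powr) simp
  have AEs: "AE t in lborel. summable (\<lambda>n. norm (f n t))"
  proof (rule AE_I2)
    fix t
    show "summable (\<lambda>n. norm (f n t))"
      by (rule summable_comparison_test'[OF summable_mult2[OF sm2, of "x\<^sup>2 * (9 * (1 + \<bar>t\<bar>) powr - 2)"], of 0])
         (use fb in auto)
  qed
  have sI: "summable (\<lambda>n. LINT t|lborel. norm (f n t))"
  proof (rule summable_comparison_test'[OF summable_mult2[OF sm2, of "LINT t|lborel. x\<^sup>2 * (9 * (1 + \<bar>t\<bar>) powr - 2)"], of 0])
    fix n :: nat
    have i: "integrable lborel (\<lambda>t. x\<^sup>2 * (9 * (1 + \<bar>t\<bar>) powr - (2::real)))"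
      by (intro integrable_mult_right integrable_decay) auto
    have "(LINT t|lborel. norm (f n t)) \<le> (LINT t|lborel. mangoldt n * real n powr - 2 * (x\<^sup>2 * (9 * (1 + \<bar>t\<bar>) powr - 2)))"
      using fint[of n] i fb by (intro integral_mono) auto
    then show "norm (LINT t|lborel. norm (f n t)) \<le> mangoldt n * real n powr - 2 * (LINT t|lborel. x\<^sup>2 * (9 * (1 + \<bar>t\<bar>) powr - 2))"
      by simp
  qed
  have fsum: "(\<Sum>n. f n t) = vonMangoldt_series (Complex 2 t) * of_real x powr Complex 2 t / (Complex 2 t * (Complex 2 t + 1))" for t
  proof -
    have "f n t = mangoldt n / of_nat n powr Complex 2 t * (of_real x powr Complex 2 t / (Complex 2 t * (Complex 2 t + 1)))" for n
    proof (cases "n = 0")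
      case False
      have "complex_of_real x = of_real (x / real n) * of_real (real n)" using False by simp
      then have "complex_of_real x powr Complex 2 t = of_real (x / real n) powr Complex 2 t * of_real (real n) powr Complex 2 t"
        using x by (simp only:) (rule powr_times_real, auto)
      then show ?thesis using False by (simp add: f_def)
    qed (simp add: f_def)
    moreover have "(\<lambda>n. mangoldt n / of_nat n powr Complex 2 t * (of_real x powr Complex 2 t / (Complex 2 t * (Complex 2 t + 1)))) sums
      (vonMangoldt_series (Complex 2 t) * (of_real x powr Complex 2 t / (Complex 2 t * (Complex 2 t + 1))))"
      by (intro sums_mult2 vonMangoldt_sums) simp
    ultimately show ?thesis by (simp add: sums_iff)
  qed
  show "integrable lborel (\<lambda>t. vonMangoldt_series (Complex 2 t) * of_real x powr Complex 2 t / (Complex 2 t * (Complex 2 t + 1)))"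
    using integrable_suminf[OF fint AEs sI] by (simp add: fsum)
  have "vline (\<lambda>s. vonMangoldt_series s * of_real x powr s / (s * (s + 1))) 2 = (LINT t|lborel. (\<Sum>n. f n t))"
    by (simp add: vline_def fsum)
  also have "\<dots> = (\<Sum>n. LINT t|lborel. f n t)" by (rule integral_suminf[OF fint AEs sI])
  also have "\<dots> = (\<Sum>n. of_real (if n \<in> {n. 1 \<le> n \<and> real n \<le> x} then 2 * pi * (mangoldt n * (x - real n)) / x else 0))"
  proof (rule suminf_cong)
    fix n
    show "(LINT t|lborel. f n t) = of_real (if n \<in> {n. 1 \<le> n \<and> real n \<le> x} then 2 * pi * (mangoldt n * (x - real n)) / x else 0)"
    proof (cases "n = 0")
      case False
      have "(LINT t|lborel. f n t) = mangoldt n * vline (\<lambda>s. of_real (x / real n) powr s / (s * (s + 1))) 2"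
        unfolding f_def vline_def by (rule integral_mult_right_zero)
      also have "\<dots> = of_real (mangoldt n * (2 * pi * (if x / real n \<ge> 1 then 1 - 1 / (x / real n) else 0)))"
        using False x by (subst Perron_kernel) auto
      also have "mangoldt n * (2 * pi * (if x / real n \<ge> 1 then 1 - 1 / (x / real n) else 0)) =
         (if n \<in> {n. 1 \<le> n \<and> real n \<le> x} then 2 * pi * (mangoldt n * (x - real n)) / x else 0)"
        using False x by (auto simp: field_simps)
      finally show ?thesis .
    qed (simp add: f_def)
  qed
  also have "\<dots> = (\<Sum>n | 1 \<le> n \<and> real n \<le> x. of_real (if n \<in> {n. 1 \<le> n \<and> real n \<le> x} then 2 * pi * (mangoldt n * (x - real n)) / x else 0))"
    by (rule suminf_finite[OF finite_nat_le_real]) auto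
  also have "\<dots> = of_real (\<Sum>n | 1 \<le> n \<and> real n \<le> x. 2 * pi * (mangoldt n * (x - real n)) / x)"
    unfolding of_real_sum by (rule sum.cong) auto
  also have "(\<Sum>n | 1 \<le> n \<and> real n \<le> x. 2 * pi * (mangoldt n * (x - real n)) / x) = 2 * pi * step_integral mangoldt x / x"
    by (simp add: step_integral_def sum_distrib_left sum_divide_distrib)
  finally show "vline (\<lambda>s. vonMangoldt_series s * of_real x powr s / (s * (s + 1))) 2 =
      of_real (2 * pi * step_integral mangoldt x / x)" .
qed

text \<open>The three summands are the residues at 1, 0 and -1. The first is picked up between Re s
  = 2 and Re s = 1/2, the other two by \<open>vline_two_poles\<close> from there.\<close>

lemma Perron_pole_at_1:
  assumes x: "x \<ge> 1"
  shows "integrable lborel (\<lambda>t. 1 / (Complex 2 t - 1) * of_real x powr Complex 2 t / (Complex 2 t * (Complex 2 t + 1)))"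
    and "vline (\<lambda>s. 1 / (s - 1) * of_real x powr s / (s * (s + 1))) 2 =
      of_real (2 * pi * (x / 2 - 1 + 1 / (2 * x)))"
proof -
  have xp: "x > 0" using x by simp
  have nx: "norm (of_real x powr s) = x powr Re s" for s :: complex
    using xp by (subst norm_powr_real_powr) auto
  show "integrable lborel (\<lambda>t. 1 / (Complex 2 t - 1) * of_real x powr Complex 2 t / (Complex 2 t * (Complex 2 t + 1)))"
  proof (rule Bochner_Integration.integrable_bound[OF Perron_kernel_integrable(1)[OF xp]])
    show "AE t in lborel. norm (1 / (Complex 2 t - 1) * of_real x powr Complex 2 t / (Complex 2 t * (Complex 2 t + 1))) \<le>
        norm (of_real x powr Complex 2 t / (Complex 2 t * (Complex 2 t + 1)))"
    proof (rule AE_I2)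
      fix t
      have "1 \<le> norm (Complex 2 t - 1)" using complex_Re_le_cmod[of "Complex 2 t - 1"] by simp
      then have "norm (1 / (Complex 2 t - 1)) \<le> 1" by (simp add: norm_divide divide_le_eq)
      then have "norm (1 / (Complex 2 t - 1)) * norm (of_real x powr Complex 2 t / (Complex 2 t * (Complex 2 t + 1)))
          \<le> 1 * norm (of_real x powr Complex 2 t / (Complex 2 t * (Complex 2 t + 1)))" by (rule mult_right_mono) simp
      then show "norm (1 / (Complex 2 t - 1) * of_real x powr Complex 2 t / (Complex 2 t * (Complex 2 t + 1))) \<le>
        norm (of_real x powr Complex 2 t / (Complex 2 t * (Complex 2 t + 1)))"
        by (simp only: norm_mult[symmetric] mult_1 times_divide_eq_right)
    qed
  qed measurable
  define P :: "complex \<Rightarrow> complex" where "P = (\<lambda>s. of_real x powr s / (s * (s + 1)))"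
  have 1: "vline (\<lambda>s. P s / (s - 1)) 2 - vline (\<lambda>s. P s / (s - 1)) (1 / 2) = of_real (2 * pi) * P 1"
  proof (rule vline_pole[where S = "{s. Re s > 0}" and K = "x\<^sup>2 * 9"])
    show "P holomorphic_on {s. Re s > 0}" unfolding P_def using xp by (intro holomorphic_intros) (auto simp: add_eq_0_iff2)
    fix s assume s: "1 / 2 \<le> Re s" "Re s \<le> 2"
    have "norm (P s) = x powr Re s * norm (1 / (s * (s + 1)))" by (simp add: P_def norm_divide nx)
    also have "\<dots> \<le> x powr 2 * (9 * (1 + \<bar>Im s\<bar>) powr - 2)"
      using s x by (intro mult_mono powr_mono norm_Perron_denominator) auto
    also have "\<dots> \<le> x powr 2 * (9 * (1 + \<bar>Im s\<bar>) powr (-1/2))"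
      by (intro mult_left_mono powr_mono) auto
    finally show "norm (P s) \<le> x\<^sup>2 * 9 * (1 + \<bar>Im s\<bar>) powr (-1/2)" using xp by simp
  qed (auto simp: open_halfspace_Re_gt convex_halfspace_Re_gt)
  have 2: "vline (\<lambda>s. (of_real x powr s / (s - 1)) / (s * (s + 1))) (1 / 2) =
      of_real (2 * pi) * (of_real x powr 0 / (0 - 1) - of_real x powr (- 1) / (- 1 - 1))"
  proof (rule vline_two_poles(2)[where a' = 1 and K = "2 * x"])
    show "(\<lambda>s. of_real x powr s / (s - 1)) holomorphic_on {s. Re s < 1}"
      using xp by (intro holomorphic_intros) auto
    fix s :: complex assume s: "Re s \<le> 1 / 2"
    have "1 / 2 \<le> norm (s - 1)" using abs_Re_le_cmod[of "s - 1"] s by simp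
    then have "norm (of_real x powr s / (s - 1)) \<le> x powr Re s / (1 / 2)"
      unfolding norm_divide nx by (intro frac_le) auto
    also have "\<dots> \<le> x powr 1 / (1 / 2)" using s x by (intro divide_right_mono powr_mono) auto
    also have "\<dots> = 2 * x * 1" using xp by simp
    also have "\<dots> \<le> 2 * x * (1 + \<bar>Im s\<bar>) powr (1 / 4)" using xp by (intro mult_left_mono ge_one_powr_ge_zero) auto
    finally show "norm (of_real x powr s / (s - 1)) \<le> 2 * x * (1 + \<bar>Im s\<bar>) powr (1 / 4)" .
  qed auto
  have e1: "(\<lambda>s. 1 / (s - 1) * of_real x powr s / (s * (s + 1))) = (\<lambda>s. P s / (s - 1))"
    by (simp add: fun_eq_iff P_def)
  have e2: "(\<lambda>s. (of_real x powr s / (s - 1)) / (s * (s + 1))) = (\<lambda>s. P s / (s - 1))"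
    by (simp add: fun_eq_iff P_def)
  have "vline (\<lambda>s. P s / (s - 1)) 2 = of_real (2 * pi) * P 1 +
      of_real (2 * pi) * (of_real x powr 0 / (0 - 1) - of_real x powr (- 1) / (- 1 - 1))"
    using 1 2 unfolding e2 by (simp add: algebra_simps)
  also have "\<dots> = of_real (2 * pi * (x / 2 - 1 + 1 / (2 * x)))"
  proof -
    have p1: "P 1 = of_real (x / 2)" using xp by (simp add: P_def)
    have p2: "of_real x powr 0 / (0 - 1) - of_real x powr (- 1) / (- 1 - 1) = complex_of_real (- 1 + 1 / (2 * x))"
      using xp by (simp add: powr_minus_divide)
    have "2 * pi * (x / 2) + 2 * pi * (- 1 + 1 / (2 * x)) = 2 * pi * (x / 2 - 1 + 1 / (2 * x))"
      by (simp add: algebra_simps)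
    then show ?thesis unfolding p1 p2 by (simp only: of_real_mult[symmetric] of_real_add[symmetric])
  qed
  finally show "vline (\<lambda>s. 1 / (s - 1) * of_real x powr s / (s * (s + 1))) 2 =
      of_real (2 * pi * (x / 2 - 1 + 1 / (2 * x)))" unfolding e1 .
qed

text \<open>Combines the two preceding integrals through \<open>zeta_logderiv_Re_gt_1\<close>; the
  residue x/2 at 1 is the main term that \<open>psi_error_integral\<close> subtracts.\<close>

lemma Perron_zeta_logderiv:
  assumes x: "x \<ge> 1"
  shows "vline (\<lambda>s. zeta_logderiv s * of_real x powr s / (s * (s + 1))) 2 =
     of_real (- 2 * pi * (psi_error_integral x / x + 1 - 1 / (2 * x)))"
proof -
  have "vline (\<lambda>s. zeta_logderiv s * of_real x powr s / (s * (s + 1))) 2 =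
     (LINT t|lborel. 1 / (Complex 2 t - 1) * of_real x powr Complex 2 t / (Complex 2 t * (Complex 2 t + 1)) -
        vonMangoldt_series (Complex 2 t) * of_real x powr Complex 2 t / (Complex 2 t * (Complex 2 t + 1)))"
    unfolding vline_def by (subst zeta_logderiv_Re_gt_1) (simp_all add: left_diff_distrib diff_divide_distrib)
  also have "\<dots> = of_real (2 * pi * (x / 2 - 1 + 1 / (2 * x))) - of_real (2 * pi * step_integral mangoldt x / x)"
    using Perron_pole_at_1[OF x] Perron_vonMangoldt[OF x] by (subst Bochner_Integration.integral_diff) (auto simp: vline_def)
  also have "\<dots> = of_real (2 * pi * (x / 2 - 1 + 1 / (2 * x)) - 2 * pi * step_integral mangoldt x / x)"
    by (simp only: of_real_diff)
  also have "2 * pi * (x / 2 - 1 + 1 / (2 * x)) - 2 * pi * step_integral mangoldt x / x =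
      - 2 * pi * (psi_error_integral x / x + 1 - 1 / (2 * x))"
    using x by (simp add: psi_error_integral_def field_simps power2_eq_square)
  finally show ?thesis .
qed

text \<open>
  On the line $\Re s = a$ we have $2a - s = \overline s$, so $L(s) = 2 \Re L(s) - L(2a - s)$ for the
  logarithmic derivative $L$; the integral of the second summand can be moved to the far left.
\<close>

lemma explicit_formula:
  assumes nz: "\<And>s. Re s > 1 / 2 \<Longrightarrow> zeta_reg s \<noteq> 0" and a: "1 / 2 < a" "a \<le> 3 / 4" and x: "x \<ge> 1"
  shows "integrable lborel (\<lambda>t. of_real (Re (zeta_logderiv (Complex a t))) * of_real x powr Complex a t /
      (Complex a t * (Complex a t + 1)))"
    and "complex_of_real (psi_error_integral x) =
      - of_real (x / pi) * (LINT t|lborel. of_real (Re (zeta_logderiv (Complex a t))) * of_real x powr Complex a t /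
          (Complex a t * (Complex a t + 1))) +
      (zeta_logderiv (of_real (2 * a)) - 1) * of_real x + (1 / 2 - zeta_logderiv (of_real (2 * a + 1)))"
proof -
  have xp: "x > 0" using x by simp
  have nx: "norm (of_real x powr s) = x powr Re s" for s :: complex
    using xp by (subst norm_powr_real_powr) auto
  obtain K where K: "K \<ge> 0" "\<And>s. a \<le> Re s \<Longrightarrow> norm (zeta_logderiv s) \<le> K * (1 + \<bar>Im s\<bar>) powr (1 / 4)"
    using zeta_logderiv_growth[OF nz, of "a - 1 / 2"] a by (auto simp: algebra_simps)
  have Lhol: "zeta_logderiv holomorphic_on {s. Re s > 1 / 2}"
    unfolding zeta_logderiv_def[abs_def] using nz
    by (intro holomorphic_intros holomorphic_deriv[OF zeta_reg_holomorphic] open_Re_gt) auto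
  define F where "F = (\<lambda>s. zeta_logderiv s * of_real x powr s / (s * (s + 1)))"
  have Fb: "norm (F s) \<le> (K * x\<^sup>2 * 9) * (1 + \<bar>Im s\<bar>) powr (-3/2)" if s: "a \<le> Re s" "Re s \<le> 2" for s
  proof -
    have "norm (F s) = norm (zeta_logderiv s) * x powr Re s * norm (1 / (s * (s + 1)))"
      by (simp add: F_def norm_divide norm_mult nx)
    also have "\<dots> \<le> (K * (1 + \<bar>Im s\<bar>) powr (1 / 4)) * x powr 2 * (9 * (1 + \<bar>Im s\<bar>) powr - 2)"
      using s a x K by (intro mult_mono powr_mono norm_Perron_denominator) auto
    also have "\<dots> = (K * x\<^sup>2 * 9) * ((1 + \<bar>Im s\<bar>) powr (1 / 4) * (1 + \<bar>Im s\<bar>) powr - 2)"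
      using xp by simp
    also have "(1 + \<bar>Im s\<bar>) powr (1 / 4) * (1 + \<bar>Im s\<bar>) powr - 2 = (1 + \<bar>Im s\<bar>) powr (1 / 4 + - 2)"
      by (rule powr_add[symmetric])
    also have "(K * x\<^sup>2 * 9) * (1 + \<bar>Im s\<bar>) powr (1 / 4 + - 2) \<le> (K * x\<^sup>2 * 9) * (1 + \<bar>Im s\<bar>) powr (-3/2)"
      using K by (intro mult_left_mono powr_mono) auto
    finally show ?thesis .
  qed
  have Fhol: "F holomorphic_on {s. Re s > 1 / 2}"
    unfolding F_def using xp by (intro holomorphic_intros Lhol) (auto simp: add_eq_0_iff2)
  \<comment> \<open>No residue appears between the lines: in \<open>zeta_reg\<close> the pole of
    zeta at 1 is removed, and by assumption it has no zeros in Re s > 1/2.\<close>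
  have shift: "vline F a = vline F 2"
    by (rule vline_shift[OF open_Re_gt convex_halfspace_Re_gt Fhol _ _ Fb]) (use a in auto)
  have Fint: "integrable lborel (\<lambda>t. F (Complex a t))"
  proof (rule integrable_vline[where p = "3/2"])
    show "norm (F (Complex a t)) \<le> (K * x\<^sup>2 * 9) * (1 + \<bar>t\<bar>) powr - (3/2)" for t
      using Fb[of "Complex a t"] a by simp
  qed (use a in \<open>auto intro!: borel_measurable_vline[OF Fhol]\<close>)
  \<comment> \<open>On Re s = a this is the conjugate of \<open>zeta_logderiv\<close> times x^s. It
    is holomorphic to the left of 2a - 1/2 > a, so only the poles of the kernel at 0 and -1
    contribute to its integral.\<close>
  define G where "G = (\<lambda>s. zeta_logderiv (of_real (2 * a) - s) * of_real x powr s)"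
  have Ghol: "G holomorphic_on {s. Re s < 2 * a - 1 / 2}"
    unfolding G_def using xp
    by (intro holomorphic_intros holomorphic_on_compose_gen[OF _ Lhol, unfolded o_def]) auto
  have Gb: "norm (G s) \<le> (K * x) * (1 + \<bar>Im s\<bar>) powr (1 / 4)" if s: "Re s \<le> a" for s
  proof -
    have "norm (G s) \<le> (K * (1 + \<bar>Im (of_real (2 * a) - s)\<bar>) powr (1 / 4)) * x powr 1"
      unfolding G_def norm_mult nx using s a x K by (intro mult_mono K(2) powr_mono) auto
    then show ?thesis using xp by (simp add: mult_ac)
  qed
  have a2: "0 < a" "a < 2 * a - 1 / 2" using a by auto
  note G2 = vline_two_poles[OF Ghol a2 Gb]
  have sum: "F (Complex a t) + G (Complex a t) / (Complex a t * (Complex a t + 1)) =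
      2 * (of_real (Re (zeta_logderiv (Complex a t))) * of_real x powr Complex a t / (Complex a t * (Complex a t + 1)))" for t
  proof -
    have "of_real (2 * a) - Complex a t = cnj (Complex a t)" by (simp add: complex_eq_iff)
    then have "zeta_logderiv (of_real (2 * a) - Complex a t) = cnj (zeta_logderiv (Complex a t))"
      by (simp only: zeta_logderiv_cnj)
    then have "F (Complex a t) + G (Complex a t) / (Complex a t * (Complex a t + 1)) =
      (zeta_logderiv (Complex a t) + cnj (zeta_logderiv (Complex a t))) * of_real x powr Complex a t / (Complex a t * (Complex a t + 1))"
      by (simp add: F_def G_def distrib_right add_divide_distrib)
    then show ?thesis by (simp add: complex_add_cnj)
  qed
  have "integrable lborel (\<lambda>t. F (Complex a t) + G (Complex a t) / (Complex a t * (Complex a t + 1)))"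
    by (intro Bochner_Integration.integrable_add Fint G2(1))
  then have "integrable lborel (\<lambda>t. 2 * (of_real (Re (zeta_logderiv (Complex a t))) * of_real x powr Complex a t / (Complex a t * (Complex a t + 1))))"
    by (simp only: sum)
  then have "integrable lborel (\<lambda>t. (1 / 2) * (2 * (of_real (Re (zeta_logderiv (Complex a t))) * of_real x powr Complex a t / (Complex a t * (Complex a t + 1)))))"
    by (rule integrable_mult_right)
  then show int1: "integrable lborel (\<lambda>t. of_real (Re (zeta_logderiv (Complex a t))) * of_real x powr Complex a t / (Complex a t * (Complex a t + 1)))"
    by simp
  define I where "I = (LINT t|lborel. of_real (Re (zeta_logderiv (Complex a t))) * of_real x powr Complex a t / (Complex a t * (Complex a t + 1)))"
  have "2 * I = (LINT t|lborel. F (Complex a t) + G (Complex a t) / (Complex a t * (Complex a t + 1)))"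
    unfolding I_def sum by (rule integral_mult_right_zero[symmetric])
  also have "\<dots> = vline F a + vline (\<lambda>s. G s / (s * (s + 1))) a"
    unfolding vline_def by (rule Bochner_Integration.integral_add[OF Fint G2(1)])
  also have "vline (\<lambda>s. G s / (s * (s + 1))) a = of_real (2 * pi) * (zeta_logderiv (of_real (2 * a)) - zeta_logderiv (of_real (2 * a + 1)) / of_real x)"
  proof -
    have "G 0 = zeta_logderiv (of_real (2 * a))" "G (- 1) = zeta_logderiv (of_real (2 * a + 1)) / of_real x"
      using xp by (simp_all add: G_def powr_minus divide_inverse)
    then show ?thesis using G2(2) by (simp only:)
  qed
  also have "vline F a = of_real (- 2 * pi * (psi_error_integral x / x + 1 - 1 / (2 * x)))"
    unfolding shift using Perron_zeta_logderiv[OF x] by (simp add: F_def)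
  finally have I2: "2 * I = of_real (- 2 * pi * (psi_error_integral x / x + 1 - 1 / (2 * x))) +
     of_real (2 * pi) * (zeta_logderiv (of_real (2 * a)) - zeta_logderiv (of_real (2 * a + 1)) / of_real x)" .
  have gen: "p = - (y / q) * i + (l1 - 1) * y + (1 / 2 - l2)"
    if "2 * i = (- 2 * q * (p / y + 1 - 1 / (2 * y))) + (2 * q) * (l1 - l2 / y)" "y \<noteq> 0" "q \<noteq> 0" for p y q i l1 l2 :: complex
  proof -
    have "i = q * (f - e)" if "2 * i = - 2 * q * e + 2 * q * f" for i q e f :: complex
    proof -
      have "2 * i = 2 * (q * (f - e))" using that by (simp add: algebra_simps)
      then show ?thesis by simp
    qed
    from this[OF that(1)] have "i = q * (- (p / y + 1 - 1 / (2 * y)) + l1 - l2 / y)" by (simp add: algebra_simps)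
    then have "- (y / q) * i = - y * (- (p / y + 1 - 1 / (2 * y)) + l1 - l2 / y)" using that(3) by simp
    also have "\<dots> = p + y - 1 / 2 - l1 * y + l2" using that(2) by (simp add: field_simps)
    finally show ?thesis by (simp add: algebra_simps)
  qed
  have "complex_of_real (psi_error_integral x) = - (of_real x / of_real pi) * I +
      (zeta_logderiv (of_real (2 * a)) - 1) * of_real x + (1 / 2 - zeta_logderiv (of_real (2 * a + 1)))"
    by (rule gen) (use I2 xp in simp_all)
  then show "complex_of_real (psi_error_integral x) =
      - of_real (x / pi) * (LINT t|lborel. of_real (Re (zeta_logderiv (Complex a t))) * of_real x powr Complex a t /
          (Complex a t * (Complex a t + 1))) +
      (zeta_logderiv (of_real (2 * a)) - 1) * of_real x + (1 / 2 - zeta_logderiv (of_real (2 * a + 1)))"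
    by (simp add: I_def)
qed


section \<open>Uniform bounds near the critical line\<close>

lemma norm_inverse_shift_le:
  assumes "Re s - Re q \<ge> 1"
  shows "(1 + \<bar>Im s\<bar>) / (2 + \<bar>Im q\<bar>) \<le> norm (s - q)"
proof -
  have 1: "1 \<le> norm (s - q)" using assms complex_Re_le_cmod[of "s - q"] by simp
  have "1 + \<bar>Im s\<bar> \<le> (1 + \<bar>Im q\<bar>) * 1 + 1 * \<bar>Im s - Im q\<bar>" by simp
  also have "\<dots> \<le> (1 + \<bar>Im q\<bar>) * norm (s - q) + 1 * norm (s - q)"
    using 1 abs_Im_le_norm_diff[of s q] by (intro add_mono mult_left_mono) auto
  finally have "1 + \<bar>Im s\<bar> \<le> norm (s - q) * (2 + \<bar>Im q\<bar>)" by (simp add: algebra_simps)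
  then show ?thesis by (subst pos_divide_le_eq) (auto simp: add_pos_nonneg)
qed

text \<open>The integral of zeta_logderiv(s)/((s - p)(s - q)) is moved from Re s = a to the far
  right, where it tends to 0, across the pole p = a + 1 + iy. The point \<open>q\<close> is the
  mirror image of \<open>p\<close> in the line Re s = a, on which (s - p)(s - q) = -(1 + (t - y)^2).
  The value at \<open>p\<close> is bounded uniformly in a because Re p > 3/2.\<close>

lemma Poisson_zeta_logderiv:
  assumes nz: "\<And>s. Re s > 1 / 2 \<Longrightarrow> zeta_reg s \<noteq> 0" and a: "1 / 2 < a" "a \<le> 3 / 4"
  shows "integrable lborel (\<lambda>t. zeta_logderiv (Complex a t) / of_real (1 + (t - y)\<^sup>2))"
    and "(LINT t|lborel. zeta_logderiv (Complex a t) / of_real (1 + (t - y)\<^sup>2)) =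
      of_real pi * zeta_logderiv (Complex (a + 1) y)"
proof -
  obtain K where K: "K \<ge> 0" "\<And>s. a \<le> Re s \<Longrightarrow> norm (zeta_logderiv s) \<le> K * (1 + \<bar>Im s\<bar>) powr (1 / 4)"
    using zeta_logderiv_growth[OF nz, of "a - 1 / 2"] a by (auto simp: algebra_simps)
  obtain M where M: "\<And>s. Re s \<ge> 3 / 2 \<Longrightarrow> norm (zeta_logderiv s) \<le> M" using zeta_logderiv_bounded by blast
  have Lhol: "zeta_logderiv holomorphic_on {s. Re s > 1 / 2}"
    unfolding zeta_logderiv_def[abs_def] using nz
    by (intro holomorphic_intros holomorphic_deriv[OF zeta_reg_holomorphic] open_Re_gt) auto
  define p q where "p = Complex (a + 1) y" and "q = Complex (a - 1) y"
  define P where "P s = zeta_logderiv s / (s - q)" for s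
  have Phol: "P holomorphic_on {s. Re s > 1 / 2}"
    unfolding P_def using a by (intro holomorphic_intros Lhol) (auto simp: q_def)
  define k where "k = 2 + \<bar>y\<bar>"
  have k: "k > 0" by (simp add: k_def add_pos_nonneg)
  have Pb: "norm (P s) \<le> (K * k) * (1 + \<bar>Im s\<bar>) powr (-1/2)" if s: "a \<le> Re s" for s
  proof -
    define u where "u = 1 + \<bar>Im s\<bar>"
    have u: "u \<ge> 1" by (simp add: u_def)
    have "u / k \<le> norm (s - q)" using norm_inverse_shift_le[where s = s and q = q] s by (simp add: u_def k_def q_def)
    then have "norm (P s) \<le> K * u powr (1 / 4) / (u / k)"
      unfolding P_def norm_divide using K(2)[OF s] K(1) u k by (intro frac_le) (auto simp: u_def)
    also have "\<dots> = (K * k) * (u powr (1 / 4) / u powr 1)" using u by simp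
    also have "u powr (1 / 4) / u powr 1 = u powr (1 / 4 - 1)" by (rule powr_diff[symmetric])
    also have "(K * k) * u powr (1 / 4 - 1) \<le> (K * k) * u powr (-1/2)"
      using K k u by (intro mult_left_mono powr_mono) auto
    finally show ?thesis by (simp add: u_def)
  qed
  have on_line: "P (Complex a t) / (Complex a t - p) = - (zeta_logderiv (Complex a t) / of_real (1 + (t - y)\<^sup>2))" for t
  proof -
    have "(Complex a t - q) * (Complex a t - p) = - of_real (1 + (t - y)\<^sup>2)"
      by (simp add: p_def q_def complex_eq_iff power2_eq_square algebra_simps)
    then show ?thesis unfolding P_def divide_divide_eq_left by (simp only: minus_divide_right[symmetric])
  qed
  show "integrable lborel (\<lambda>t. zeta_logderiv (Complex a t) / of_real (1 + (t - y)\<^sup>2))"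
  proof -
    have "integrable lborel (\<lambda>t. P (Complex a t) / (Complex a t - p))"
    proof (rule integrable_vline[where G = "\<lambda>s. P s / (s - p)" and p = "3/2" and K = "K * k * k"])
      show "(\<lambda>t. P (Complex a t) / (Complex a t - p)) \<in> borel_measurable borel"
      proof -
        have [measurable]: "(\<lambda>t. P (Complex a t)) \<in> borel_measurable borel"
          by (rule borel_measurable_vline[OF Phol]) (use a in auto)
        show ?thesis by measurable
      qed
      fix t :: real
      define u where "u = 1 + \<bar>t\<bar>"
      have u: "u \<ge> 1" by (simp add: u_def)
      have "u / k \<le> norm (Complex (a + 2) t - p)" using norm_inverse_shift_le[where q = p and s = "Complex (a + 2) t"]
        by (simp add: u_def k_def p_def)
      also have "\<dots> = norm (Complex a t - p)" by (simp add: p_def cmod_def)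
      finally have "norm (P (Complex a t) / (Complex a t - p)) \<le> ((K * k) * u powr (-1/2)) / (u / k)"
        unfolding norm_divide using Pb[of "Complex a t"] u k K by (intro frac_le) (auto simp: u_def)
      also have "\<dots> = (K * k * k) * (u powr (-1/2) / u powr 1)" using u by simp
      also have "u powr (-1/2) / u powr 1 = u powr (-1/2 - 1)" by (rule powr_diff[symmetric])
      finally show "norm (P (Complex a t) / (Complex a t - p)) \<le> (K * k * k) * (1 + \<bar>t\<bar>) powr - (3/2)"
        by (simp add: u_def)
    qed auto
    then show ?thesis unfolding on_line by simp
  qed
  define I where "I = (LINT t|lborel. zeta_logderiv (Complex a t) / of_real (1 + (t - y)\<^sup>2))"
  have va: "vline (\<lambda>s. P s / (s - p)) a = - I" unfolding vline_def on_line I_def by simp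
  have pq: "p - q = 2" by (simp add: p_def q_def complex_eq_iff)
  have eq: "vline (\<lambda>s. P s / (s - p)) R = of_real pi * zeta_logderiv p - I" if R: "R > a + 1" for R
  proof -
    have "vline (\<lambda>s. P s / (s - p)) R - vline (\<lambda>s. P s / (s - p)) a = of_real (2 * pi) * P p"
      by (rule vline_pole[OF open_Re_gt convex_halfspace_Re_gt Phol _ _ _ Pb]) (use R a in \<open>auto simp: p_def\<close>)
    moreover have "P p = zeta_logderiv p / 2" by (simp add: P_def pq)
    ultimately show ?thesis unfolding va by (simp add: algebra_simps)
  qed
  have nb: "norm (vline (\<lambda>s. P s / (s - p)) R) \<le> \<bar>M\<bar> * (pi / (R - a - 1))" if R: "R > a + 1" for R
  proof -
    define e where "e = R - a - 1"
    have e: "e > 0" using R by (simp add: e_def)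
    have b: "norm (P (Complex R t) / (Complex R t - p)) \<le> \<bar>M\<bar> * (1 / (e\<^sup>2 + (t - y)\<^sup>2))" for t
    proof -
      have d: "(norm (Complex R t - p))\<^sup>2 = e\<^sup>2 + (t - y)\<^sup>2" by (simp add: cmod_power2 p_def e_def algebra_simps)
      have pos: "e\<^sup>2 + (t - y)\<^sup>2 > 0" using e by (intro add_pos_nonneg) auto
      have "(norm (Complex R t - p))\<^sup>2 \<le> (norm (Complex R t - q))\<^sup>2"
        using R a by (simp add: cmod_power2 p_def q_def power_mono)
      then have "norm (Complex R t - p) \<le> norm (Complex R t - q)" by (rule power2_le_imp_le) simp
      then have "norm (Complex R t - p) * norm (Complex R t - p) \<le> norm (Complex R t - q) * norm (Complex R t - p)"
        by (rule mult_right_mono) simp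
      then have dd: "e\<^sup>2 + (t - y)\<^sup>2 \<le> norm (Complex R t - q) * norm (Complex R t - p)"
        using d by (simp add: power2_eq_square)
      have "norm (P (Complex R t) / (Complex R t - p)) = norm (zeta_logderiv (Complex R t)) / (norm (Complex R t - q) * norm (Complex R t - p))"
        by (simp add: P_def norm_divide norm_mult)
      also have "\<dots> \<le> \<bar>M\<bar> / (e\<^sup>2 + (t - y)\<^sup>2)"
        using M[of "Complex R t"] R a dd pos by (intro frac_le) auto
      finally show ?thesis by simp
    qed
    have hi: "has_bochner_integral lborel (\<lambda>t. \<bar>M\<bar> * (1 / (e\<^sup>2 + (t - y)\<^sup>2))) (\<bar>M\<bar> * (pi / e))"
      by (intro has_bochner_integral_mult_right has_bochner_integral_inverse_quadratic e)
    have "norm (vline (\<lambda>s. P s / (s - p)) R) \<le> (LINT t|lborel. norm (P (Complex R t) / (Complex R t - p)))"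
      unfolding vline_def by (rule integral_norm_bound)
    also have "\<dots> \<le> (LINT t|lborel. \<bar>M\<bar> * (1 / (e\<^sup>2 + (t - y)\<^sup>2)))"
      by (rule integral_mono_AE') (use hi b in \<open>auto simp: has_bochner_integral_iff\<close>)
    also have "\<dots> = \<bar>M\<bar> * (pi / e)" using hi by (simp add: has_bochner_integral_iff)
    finally show ?thesis by (simp add: e_def)
  qed
  have "(\<lambda>n. \<bar>M\<bar> * (pi / (- a - 1 + real n))) \<longlonglongrightarrow> \<bar>M\<bar> * 0"
    by (intro tendsto_mult tendsto_const real_tendsto_divide_at_top[OF tendsto_const]
        filterlim_tendsto_add_at_top[OF tendsto_const filterlim_real_sequentially])
  moreover have "\<forall>\<^sub>F n in sequentially. norm (of_real pi * zeta_logderiv p - I) \<le> \<bar>M\<bar> * (pi / (- a - 1 + real n))"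
  proof (rule eventually_sequentiallyI[of 2])
    fix n :: nat assume n: "n \<ge> 2"
    then have "real n \<ge> 2" by simp
    then have R: "real n > a + 1" using a by linarith
    have "real n - a - 1 = - a - 1 + real n" by simp
    then show "norm (of_real pi * zeta_logderiv p - I) \<le> \<bar>M\<bar> * (pi / (- a - 1 + real n))"
      using nb[OF R] unfolding eq[OF R] by (simp only:)
  qed
  ultimately have "norm (of_real pi * zeta_logderiv p - I) \<le> \<bar>M\<bar> * 0"
    by (intro tendsto_lowerbound[where F = sequentially]) auto
  then show "(LINT t|lborel. zeta_logderiv (Complex a t) / of_real (1 + (t - y)\<^sup>2)) =
      of_real pi * zeta_logderiv (Complex (a + 1) y)"
    by (simp add: I_def p_def)
qed

lemma zeta_logderiv_line_measurable:
  assumes nz: "\<And>s. Re s > 1 / 2 \<Longrightarrow> zeta_reg s \<noteq> 0" and a: "1 / 2 < a"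
  shows "(\<lambda>t. zeta_logderiv (Complex a t)) \<in> borel_measurable borel"
proof (rule borel_measurable_vline)
  show "zeta_logderiv holomorphic_on {s. Re s > 1 / 2}"
    unfolding zeta_logderiv_def[abs_def] using nz
    by (intro holomorphic_intros holomorphic_deriv[OF zeta_reg_holomorphic] open_Re_gt) auto
qed (use a in auto)

lemma one_plus_square_ge: "(1 + \<bar>t\<bar>)\<^sup>2 / 2 \<le> 1 + (t::real)\<^sup>2"
proof -
  have "0 \<le> (1 - \<bar>t\<bar>)\<^sup>2" by simp
  then show ?thesis by (simp add: power2_eq_square algebra_simps)
qed

lemma powr_quarter_over_quadratic: "(1 + \<bar>t\<bar>) powr (1 / 4) / (1 + t\<^sup>2) \<le> 2 * (1 + \<bar>t\<bar>) powr - (7 / 4)" for t :: real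
proof -
  define u where "u = 1 + \<bar>t\<bar>"
  have u: "u \<ge> 1" by (simp add: u_def)
  have "u powr (1 / 4) / (1 + t\<^sup>2) \<le> u powr (1 / 4) / (u\<^sup>2 / 2)"
    using one_plus_square_ge[of t] u by (intro frac_le) (auto simp: u_def)
  also have "\<dots> = 2 * (u powr (1 / 4) / u powr 2)" using u by simp
  also have "u powr (1 / 4) / u powr 2 = u powr (1 / 4 - 2)" by (rule powr_diff[symmetric])
  finally show ?thesis by (simp add: u_def)
qed

text \<open>If v >= -m with m >= 0 then |v| <= v + 2m. With the lower bound of
  \<open>Re_zeta_logderiv_lower\<close> this replaces the absolute value by the signed integral,
  which \<open>Poisson_zeta_logderiv\<close> evaluates, plus an explicit majorant. Neither part
  depends on a in its constants.\<close>

lemma Poisson_bound: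
  assumes nz: "\<And>s. Re s > 1 / 2 \<Longrightarrow> zeta_reg s \<noteq> 0"
  obtains C where "C \<ge> 0"
    "\<And>a y. 1 / 2 < a \<Longrightarrow> a \<le> 3 / 4 \<Longrightarrow>
      (\<integral>\<^sup>+t. ennreal (\<bar>Re (zeta_logderiv (Complex a t))\<bar> / (1 + (t - y)\<^sup>2)) \<partial>lborel) \<le> ennreal (C * (1 + \<bar>y\<bar>) powr (1 / 4))"
proof -
  obtain M where M: "\<And>s. Re s \<ge> 3 / 2 \<Longrightarrow> norm (zeta_logderiv s) \<le> M" using zeta_logderiv_bounded by blast
  obtain C where C: "C \<ge> 0"
    "\<And>s. 1 / 2 < Re s \<Longrightarrow> Re s \<le> 3 / 4 \<Longrightarrow> Re (zeta_logderiv s) \<ge> - C * (1 + \<bar>Im s\<bar>) powr (1 / 4)"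
    using Re_zeta_logderiv_lower[OF nz] by blast
  define J where "J = (LINT t|lborel. (1 + \<bar>t\<bar>) powr - (7 / 4 :: real))"
  have J: "J \<ge> 0" unfolding J_def by (rule integral_nonneg_AE) auto
  define C3 where "C3 = pi * \<bar>M\<bar> + 4 * C * J"
  have "(\<integral>\<^sup>+t. ennreal (\<bar>Re (zeta_logderiv (Complex a t))\<bar> / (1 + (t - y)\<^sup>2)) \<partial>lborel) \<le> ennreal (C3 * (1 + \<bar>y\<bar>) powr (1 / 4))"
    if a: "1 / 2 < a" "a \<le> 3 / 4" for a y
  proof -
    define v where "v = (1 + \<bar>y\<bar>) powr (1 / 4)"
    have v: "v \<ge> 1" unfolding v_def by (rule ge_one_powr_ge_zero) auto
    define g1 where "g1 t = Re (zeta_logderiv (Complex a t) / of_real (1 + (t - y)\<^sup>2))" for t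
    define g2 where "g2 t = 4 * C * v * (1 + \<bar>- y + 1 * t\<bar>) powr - (7 / 4)" for t
    have i1: "integrable lborel g1" unfolding g1_def[abs_def]
      by (intro integrable_Re Poisson_zeta_logderiv(1)[OF nz a])
    have i2: "integrable lborel g2" unfolding g2_def[abs_def]
      by (intro integrable_mult_right lborel_integrable_real_affine integrable_decay) auto
    have le: "\<bar>Re (zeta_logderiv (Complex a t))\<bar> / (1 + (t - y)\<^sup>2) \<le> g1 t + g2 t" for t
    proof -
      define L where "L = Re (zeta_logderiv (Complex a t))"
      have L: "L \<ge> - C * (1 + \<bar>t\<bar>) powr (1 / 4)" using C(2)[of "Complex a t"] a by (simp add: L_def)
      have pos: "1 + (t - y)\<^sup>2 > 0" by (intro add_pos_nonneg) auto
      have g1: "g1 t = L / (1 + (t - y)\<^sup>2)" unfolding g1_def L_def by (simp only: Re_divide_of_real)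
      \<comment> \<open>Translation changes the weight 1 + |t| at most by the factor 1 + |y|, so the
        height y splits off and the remaining integral is centred at t = y.\<close>
      have "(1 + \<bar>t\<bar>) powr (1 / 4) \<le> ((1 + \<bar>y\<bar>) * (1 + \<bar>t - y\<bar>)) powr (1 / 4)"
      proof (rule powr_mono2)
        have "0 \<le> \<bar>y\<bar> * \<bar>t - y\<bar>" by simp
        then have "1 + \<bar>t\<bar> \<le> 1 + \<bar>y\<bar> + \<bar>t - y\<bar> + \<bar>y\<bar> * \<bar>t - y\<bar>" by argo
        then show "1 + \<bar>t\<bar> \<le> (1 + \<bar>y\<bar>) * (1 + \<bar>t - y\<bar>)" by (simp add: algebra_simps)
      qed auto
      also have "\<dots> = v * (1 + \<bar>t - y\<bar>) powr (1 / 4)" unfolding v_def by (rule powr_mult)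
      finally have m: "(1 + \<bar>t\<bar>) powr (1 / 4) \<le> v * (1 + \<bar>t - y\<bar>) powr (1 / 4)" .
      have "\<bar>L\<bar> \<le> L + 2 * C * (1 + \<bar>t\<bar>) powr (1 / 4)" using L mult_nonneg_nonneg[OF C(1), of "(1 + \<bar>t\<bar>) powr (1 / 4)"] by (simp add: abs_le_iff)
      also have "\<dots> \<le> L + 2 * C * (v * (1 + \<bar>t - y\<bar>) powr (1 / 4))"
        using m C(1) by (intro add_left_mono mult_left_mono) auto
      finally have "\<bar>L\<bar> / (1 + (t - y)\<^sup>2) \<le> (L + 2 * C * (v * (1 + \<bar>t - y\<bar>) powr (1 / 4))) / (1 + (t - y)\<^sup>2)"
        using pos by (intro divide_right_mono) auto
      also have "\<dots> = g1 t + 2 * C * v * ((1 + \<bar>t - y\<bar>) powr (1 / 4) / (1 + (t - y)\<^sup>2))"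
        unfolding g1 by (simp add: add_divide_distrib)
      also have "\<dots> \<le> g1 t + 2 * C * v * (2 * (1 + \<bar>t - y\<bar>) powr - (7 / 4))"
        using C(1) v by (intro add_left_mono mult_left_mono powr_quarter_over_quadratic) auto
      also have "\<dots> = g1 t + g2 t" by (simp add: g2_def)
      finally show ?thesis by (simp add: L_def)
    qed
    have nn: "0 \<le> g1 t + g2 t" for t
      by (rule order_trans[OF _ le[of t]]) (auto intro!: divide_nonneg_nonneg add_nonneg_nonneg)
    have "(\<integral>\<^sup>+t. ennreal (\<bar>Re (zeta_logderiv (Complex a t))\<bar> / (1 + (t - y)\<^sup>2)) \<partial>lborel) \<le> (\<integral>\<^sup>+t. ennreal (g1 t + g2 t) \<partial>lborel)"
      by (intro nn_integral_mono ennreal_leI le)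
    also have "\<dots> = ennreal (LINT t|lborel. g1 t + g2 t)"
      by (rule nn_integral_eq_integral) (use i1 i2 nn in auto)
    also have "(LINT t|lborel. g1 t + g2 t) = (LINT t|lborel. g1 t) + (LINT t|lborel. g2 t)"
      by (rule Bochner_Integration.integral_add[OF i1 i2])
    also have "(LINT t|lborel. g1 t) = pi * Re (zeta_logderiv (Complex (a + 1) y))"
    proof -
      have p1: "integrable lborel (\<lambda>t. zeta_logderiv (Complex a t) / of_real (1 + (t - y)\<^sup>2))"
        by (rule Poisson_zeta_logderiv(1)[OF nz a])
      have p2: "(LINT t|lborel. zeta_logderiv (Complex a t) / of_real (1 + (t - y)\<^sup>2)) =
          of_real pi * zeta_logderiv (Complex (a + 1) y)"
        by (rule Poisson_zeta_logderiv(2)[OF nz a])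
      show ?thesis unfolding g1_def integral_Re[OF p1] p2 by simp
    qed
    also have "(LINT t|lborel. g2 t) = 4 * C * v * J"
      unfolding g2_def J_def using lborel_integral_real_affine[of 1 "\<lambda>t. (1 + \<bar>t\<bar>) powr - (7 / 4)" "- y"] by simp
    also have "pi * Re (zeta_logderiv (Complex (a + 1) y)) + 4 * C * v * J \<le> C3 * v"
    proof -
      have "Re (zeta_logderiv (Complex (a + 1) y)) \<le> \<bar>M\<bar>"
        using M[of "Complex (a + 1) y"] complex_Re_le_cmod[of "zeta_logderiv (Complex (a + 1) y)"] a by simp
      then have "pi * Re (zeta_logderiv (Complex (a + 1) y)) \<le> pi * \<bar>M\<bar> * 1" by simp
      also have "\<dots> \<le> pi * \<bar>M\<bar> * v" using v by (intro mult_left_mono) auto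
      finally show ?thesis by (simp add: C3_def algebra_simps)
    qed
    finally show ?thesis by (simp add: v_def ennreal_leI)
  qed
  moreover have "C3 \<ge> 0" using C J by (simp add: C3_def)
  ultimately show ?thesis using that by blast
qed

text \<open>The part of the integral with t <= y <= t + 1 suffices: there the kernel is at least 1/2
  and the weight changes by a bounded factor.\<close>

lemma Poisson_smoothing_lower:
  "ennreal ((1 + \<bar>t\<bar>) powr - (7 / 4)) \<le>
     ennreal (2 * 2 powr (7 / 4)) * (\<integral>\<^sup>+y. ennreal ((1 + \<bar>y\<bar>) powr - (7 / 4) / (1 + (t - y)\<^sup>2)) \<partial>lborel)" for t :: real
proof -
  define c where "c = (2 * (1 + \<bar>t\<bar>)) powr - (7 / 4) / 2"
  have c: "c \<ge> 0" by (simp add: c_def)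
  have "ennreal c = (\<integral>\<^sup>+y. ennreal c * indicator {t..t + 1} y \<partial>lborel)"
    by (subst nn_integral_cmult_indicator) auto
  also have "\<dots> \<le> (\<integral>\<^sup>+y. ennreal ((1 + \<bar>y\<bar>) powr - (7 / 4) / (1 + (t - y)\<^sup>2)) \<partial>lborel)"
  proof (rule nn_integral_mono)
    fix y :: real
    show "ennreal c * indicator {t..t + 1} y \<le> ennreal ((1 + \<bar>y\<bar>) powr - (7 / 4) / (1 + (t - y)\<^sup>2))"
    proof (cases "y \<in> {t..t + 1}")
      case True
      have "(2 * (1 + \<bar>t\<bar>)) powr - (7 / 4) \<le> (1 + \<bar>y\<bar>) powr - (7 / 4)"
        using True by (intro powr_mono2') auto
      moreover have "(t - y)\<^sup>2 \<le> 1" using True by (simp add: abs_square_le_1)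
      ultimately have "c \<le> (1 + \<bar>y\<bar>) powr - (7 / 4) / (1 + (t - y)\<^sup>2)"
        unfolding c_def by (intro frac_le) (auto intro!: add_pos_nonneg)
      then show ?thesis using True by (simp add: ennreal_leI)
    qed simp
  qed
  finally have "ennreal (2 * 2 powr (7 / 4)) * ennreal c \<le> ennreal (2 * 2 powr (7 / 4)) *
      (\<integral>\<^sup>+y. ennreal ((1 + \<bar>y\<bar>) powr - (7 / 4) / (1 + (t - y)\<^sup>2)) \<partial>lborel)" by (rule mult_left_mono) simp
  moreover have "ennreal (2 * 2 powr (7 / 4)) * ennreal c = ennreal ((1 + \<bar>t\<bar>) powr - (7 / 4))"
  proof -
    have "(2 * (1 + \<bar>t\<bar>)) powr - (7 / 4) = 2 powr - (7 / 4) * (1 + \<bar>t\<bar>) powr - (7 / 4)" by (rule powr_mult)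
    then have "2 * 2 powr (7 / 4) * c = (2 powr (7 / 4) * 2 powr - (7 / 4)) * (1 + \<bar>t\<bar>) powr - (7 / 4)" by (simp add: c_def)
    also have "2 powr (7 / 4) * 2 powr - (7 / 4) = (1 :: real)" by (simp add: powr_add[symmetric])
    finally show ?thesis using c by (simp flip: ennreal_mult')
  qed
  ultimately show ?thesis by simp
qed

text \<open>Integrating \<open>Poisson_bound\<close> over y against (1 + |y|)^(-7/4) leaves (1 +
  |y|)^(-3/2), which is integrable; Tonelli's theorem and \<open>Poisson_smoothing_lower\<close>
  then recover the weighted mass. Since 7/4 < 2, the weight lies above the decay of the Perron
  kernel.\<close>

lemma weighted_mass_bound:
  assumes nz: "\<And>s. Re s > 1 / 2 \<Longrightarrow> zeta_reg s \<noteq> 0"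
  obtains C where "C \<ge> 0"
    "\<And>a. 1 / 2 < a \<Longrightarrow> a \<le> 3 / 4 \<Longrightarrow>
      (\<integral>\<^sup>+t. ennreal (\<bar>Re (zeta_logderiv (Complex a t))\<bar> * (1 + \<bar>t\<bar>) powr - (7 / 4)) \<partial>lborel) \<le> ennreal C"
proof -
  obtain C3 where C3: "C3 \<ge> 0"
    "\<And>a y. 1 / 2 < a \<Longrightarrow> a \<le> 3 / 4 \<Longrightarrow>
      (\<integral>\<^sup>+t. ennreal (\<bar>Re (zeta_logderiv (Complex a t))\<bar> / (1 + (t - y)\<^sup>2)) \<partial>lborel) \<le> ennreal (C3 * (1 + \<bar>y\<bar>) powr (1 / 4))"
    using Poisson_bound[OF nz] by blast
  define J where "J = (LINT y|lborel. C3 * (1 + \<bar>y\<bar>) powr - (3 / 2 :: real))"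
  have J: "J \<ge> 0" unfolding J_def using C3 by (intro integral_nonneg_AE) auto
  define k :: real where "k = 2 * 2 powr (7 / 4)"
  have k: "k \<ge> 0" by (simp add: k_def)
  have "(\<integral>\<^sup>+t. ennreal (\<bar>Re (zeta_logderiv (Complex a t))\<bar> * (1 + \<bar>t\<bar>) powr - (7 / 4)) \<partial>lborel) \<le> ennreal (k * J)"
    if a: "1 / 2 < a" "a \<le> 3 / 4" for a
  proof -
    define r where "r t = \<bar>Re (zeta_logderiv (Complex a t))\<bar>" for t
    have [measurable]: "r \<in> borel_measurable borel" unfolding r_def
      using zeta_logderiv_line_measurable[OF nz a(1)] by measurable
    have r: "r t \<ge> 0" for t by (simp add: r_def)
    have "(\<integral>\<^sup>+t. ennreal (r t * (1 + \<bar>t\<bar>) powr - (7 / 4)) \<partial>lborel) =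
        (\<integral>\<^sup>+t. ennreal (r t) * ennreal ((1 + \<bar>t\<bar>) powr - (7 / 4)) \<partial>lborel)"
      by (simp add: ennreal_mult' r)
    also have "\<dots> \<le> (\<integral>\<^sup>+t. ennreal (r t) * (ennreal k * (\<integral>\<^sup>+y. ennreal ((1 + \<bar>y\<bar>) powr - (7 / 4) / (1 + (t - y)\<^sup>2)) \<partial>lborel)) \<partial>lborel)"
      unfolding k_def by (intro nn_integral_mono mult_left_mono Poisson_smoothing_lower) auto
    also have "\<dots> = (\<integral>\<^sup>+t. ennreal k * (\<integral>\<^sup>+y. ennreal (r t * ((1 + \<bar>y\<bar>) powr - (7 / 4) / (1 + (t - y)\<^sup>2))) \<partial>lborel) \<partial>lborel)"
    proof (intro nn_integral_cong)
      fix t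
      have "(\<integral>\<^sup>+y. ennreal (r t * ((1 + \<bar>y\<bar>) powr - (7 / 4) / (1 + (t - y)\<^sup>2))) \<partial>lborel) =
        (\<integral>\<^sup>+y. ennreal (r t) * ennreal ((1 + \<bar>y\<bar>) powr - (7 / 4) / (1 + (t - y)\<^sup>2)) \<partial>lborel)"
        by (intro nn_integral_cong ennreal_mult' r)
      also have "\<dots> = ennreal (r t) * (\<integral>\<^sup>+y. ennreal ((1 + \<bar>y\<bar>) powr - (7 / 4) / (1 + (t - y)\<^sup>2)) \<partial>lborel)"
        by (rule nn_integral_cmult) measurable
      finally show "ennreal (r t) * (ennreal k * (\<integral>\<^sup>+y. ennreal ((1 + \<bar>y\<bar>) powr - (7 / 4) / (1 + (t - y)\<^sup>2)) \<partial>lborel)) =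
        ennreal k * (\<integral>\<^sup>+y. ennreal (r t * ((1 + \<bar>y\<bar>) powr - (7 / 4) / (1 + (t - y)\<^sup>2))) \<partial>lborel)"
        by (simp only: mult.left_commute)
    qed
    also have "\<dots> = ennreal k * (\<integral>\<^sup>+t. (\<integral>\<^sup>+y. ennreal (r t * ((1 + \<bar>y\<bar>) powr - (7 / 4) / (1 + (t - y)\<^sup>2))) \<partial>lborel) \<partial>lborel)"
      by (rule nn_integral_cmult) measurable
    also have "(\<integral>\<^sup>+t. (\<integral>\<^sup>+y. ennreal (r t * ((1 + \<bar>y\<bar>) powr - (7 / 4) / (1 + (t - y)\<^sup>2))) \<partial>lborel) \<partial>lborel) =
       (\<integral>\<^sup>+y. (\<integral>\<^sup>+t. ennreal (r t * ((1 + \<bar>y\<bar>) powr - (7 / 4) / (1 + (t - y)\<^sup>2))) \<partial>lborel) \<partial>lborel)"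
      by (rule lborel_pair.Fubini') measurable
    also have "\<dots> = (\<integral>\<^sup>+y. ennreal ((1 + \<bar>y\<bar>) powr - (7 / 4)) * (\<integral>\<^sup>+t. ennreal (r t / (1 + (t - y)\<^sup>2)) \<partial>lborel) \<partial>lborel)"
    proof (intro nn_integral_cong)
      fix y :: real
      have "(\<integral>\<^sup>+t. ennreal (r t * ((1 + \<bar>y\<bar>) powr - (7 / 4) / (1 + (t - y)\<^sup>2))) \<partial>lborel) =
        (\<integral>\<^sup>+t. ennreal ((1 + \<bar>y\<bar>) powr - (7 / 4)) * ennreal (r t / (1 + (t - y)\<^sup>2)) \<partial>lborel)"
        by (intro nn_integral_cong) (subst ennreal_mult'[symmetric], simp, simp add: mult_ac)
      also have "\<dots> = ennreal ((1 + \<bar>y\<bar>) powr - (7 / 4)) * (\<integral>\<^sup>+t. ennreal (r t / (1 + (t - y)\<^sup>2)) \<partial>lborel)"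
        by (rule nn_integral_cmult) measurable
      finally show "(\<integral>\<^sup>+t. ennreal (r t * ((1 + \<bar>y\<bar>) powr - (7 / 4) / (1 + (t - y)\<^sup>2))) \<partial>lborel) =
        ennreal ((1 + \<bar>y\<bar>) powr - (7 / 4)) * (\<integral>\<^sup>+t. ennreal (r t / (1 + (t - y)\<^sup>2)) \<partial>lborel)" .
    qed
    also have "\<dots> \<le> (\<integral>\<^sup>+y. ennreal ((1 + \<bar>y\<bar>) powr - (7 / 4)) * ennreal (C3 * (1 + \<bar>y\<bar>) powr (1 / 4)) \<partial>lborel)"
      unfolding r_def by (intro nn_integral_mono mult_left_mono C3 a) auto
    also have "\<dots> = (\<integral>\<^sup>+y. ennreal (C3 * (1 + \<bar>y\<bar>) powr - (3 / 2)) \<partial>lborel)"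
    proof (intro nn_integral_cong)
      fix y :: real
      have "(1 + \<bar>y\<bar>) powr - (7 / 4) * (1 + \<bar>y\<bar>) powr (1 / 4) = (1 + \<bar>y\<bar>) powr (- (7 / 4) + 1 / 4)"
        by (rule powr_add[symmetric])
      also have "- (7 / 4) + 1 / 4 = - (3 / 2 :: real)" by simp
      finally have "C3 * ((1 + \<bar>y\<bar>) powr - (7 / 4) * (1 + \<bar>y\<bar>) powr (1 / 4)) = C3 * (1 + \<bar>y\<bar>) powr - (3 / 2)" by (simp only:)
      then have "(1 + \<bar>y\<bar>) powr - (7 / 4) * (C3 * (1 + \<bar>y\<bar>) powr (1 / 4)) = C3 * (1 + \<bar>y\<bar>) powr - (3 / 2)" by (simp only: mult_ac)
      then show "ennreal ((1 + \<bar>y\<bar>) powr - (7 / 4)) * ennreal (C3 * (1 + \<bar>y\<bar>) powr (1 / 4)) = ennreal (C3 * (1 + \<bar>y\<bar>) powr - (3 / 2))"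
        by (simp only: ennreal_mult'[OF powr_ge_zero, symmetric])
    qed
    also have "\<dots> = ennreal J" unfolding J_def
      using C3 by (intro nn_integral_eq_integral integrable_mult_right integrable_decay) auto
    also have "ennreal k * ennreal J = ennreal (k * J)" using k by (simp add: ennreal_mult')
    finally show ?thesis by (simp add: r_def mult_left_mono)
  qed
  then show ?thesis using that[of "k * J"] k J by auto
qed

text \<open>With u = 1/(1 + |t|) and v = 1/(1 + |t'|), the inequality uv <= u^2 + v^2 splits the
  integrand into two pieces exchanged by swapping the variables. In each piece the variable without
  weight is integrated first by \<open>Poisson_bound\<close>, which costs a quarter power, and 2 -
  1/4 = 7/4 is the weight of \<open>weighted_mass_bound\<close>.\<close>

lemma double_mass_bound:
  assumes nz: "\<And>s. Re s > 1 / 2 \<Longrightarrow> zeta_reg s \<noteq> 0"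
  obtains C where "C \<ge> 0"
    "\<And>a. 1 / 2 < a \<Longrightarrow> a \<le> 3 / 4 \<Longrightarrow>
      (\<integral>\<^sup>+t. (\<integral>\<^sup>+t'. ennreal (\<bar>Re (zeta_logderiv (Complex a t))\<bar> / (1 + \<bar>t\<bar>) * (\<bar>Re (zeta_logderiv (Complex a t'))\<bar> / (1 + \<bar>t'\<bar>)) / (1 + (t - t')\<^sup>2)) \<partial>lborel) \<partial>lborel) \<le> ennreal C"
proof -
  obtain C3 where C3: "C3 \<ge> 0"
    "\<And>a y. 1 / 2 < a \<Longrightarrow> a \<le> 3 / 4 \<Longrightarrow>
      (\<integral>\<^sup>+t. ennreal (\<bar>Re (zeta_logderiv (Complex a t))\<bar> / (1 + (t - y)\<^sup>2)) \<partial>lborel) \<le> ennreal (C3 * (1 + \<bar>y\<bar>) powr (1 / 4))"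
    using Poisson_bound[OF nz] by blast
  obtain C4 where C4: "C4 \<ge> 0"
    "\<And>a. 1 / 2 < a \<Longrightarrow> a \<le> 3 / 4 \<Longrightarrow>
      (\<integral>\<^sup>+t. ennreal (\<bar>Re (zeta_logderiv (Complex a t))\<bar> * (1 + \<bar>t\<bar>) powr - (7 / 4)) \<partial>lborel) \<le> ennreal C4"
    using weighted_mass_bound[OF nz] by blast
  have "(\<integral>\<^sup>+t. (\<integral>\<^sup>+t'. ennreal (\<bar>Re (zeta_logderiv (Complex a t))\<bar> / (1 + \<bar>t\<bar>) * (\<bar>Re (zeta_logderiv (Complex a t'))\<bar> / (1 + \<bar>t'\<bar>)) / (1 + (t - t')\<^sup>2)) \<partial>lborel) \<partial>lborel) \<le> ennreal (2 * (C3 * C4))"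
    if a: "1 / 2 < a" "a \<le> 3 / 4" for a
  proof -
    define r where "r t = \<bar>Re (zeta_logderiv (Complex a t))\<bar>" for t
    have [measurable]: "r \<in> borel_measurable borel" unfolding r_def
      using zeta_logderiv_line_measurable[OF nz a(1)] by measurable
    have r: "r t \<ge> 0" for t by (simp add: r_def)
    define g where "g t t' = r t * (1 / (1 + \<bar>t\<bar>)\<^sup>2) * (r t' / (1 + (t' - t)\<^sup>2))" for t t'
    have [measurable]: "(\<lambda>(t, t'). g t t') \<in> borel_measurable (lborel \<Otimes>\<^sub>M lborel)"
      unfolding g_def by measurable
    have g0: "g t t' \<ge> 0" for t t' unfolding g_def using r by (auto intro!: mult_nonneg_nonneg divide_nonneg_nonneg add_nonneg_nonneg)
    have gI: "(\<integral>\<^sup>+t. (\<integral>\<^sup>+t'. ennreal (g t t') \<partial>lborel) \<partial>lborel) \<le> ennreal (C3 * C4)"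
    proof -
      have "(\<integral>\<^sup>+t. (\<integral>\<^sup>+t'. ennreal (g t t') \<partial>lborel) \<partial>lborel) =
         (\<integral>\<^sup>+t. ennreal (r t * (1 / (1 + \<bar>t\<bar>)\<^sup>2)) * (\<integral>\<^sup>+t'. ennreal (r t' / (1 + (t' - t)\<^sup>2)) \<partial>lborel) \<partial>lborel)"
      proof (intro nn_integral_cong)
        fix t
        have "(\<integral>\<^sup>+t'. ennreal (g t t') \<partial>lborel) = (\<integral>\<^sup>+t'. ennreal (r t * (1 / (1 + \<bar>t\<bar>)\<^sup>2)) * ennreal (r t' / (1 + (t' - t)\<^sup>2)) \<partial>lborel)"
          unfolding g_def using r by (intro nn_integral_cong ennreal_mult') auto
        also have "\<dots> = ennreal (r t * (1 / (1 + \<bar>t\<bar>)\<^sup>2)) * (\<integral>\<^sup>+t'. ennreal (r t' / (1 + (t' - t)\<^sup>2)) \<partial>lborel)"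
          by (rule nn_integral_cmult) measurable
        finally show "(\<integral>\<^sup>+t'. ennreal (g t t') \<partial>lborel) = ennreal (r t * (1 / (1 + \<bar>t\<bar>)\<^sup>2)) * (\<integral>\<^sup>+t'. ennreal (r t' / (1 + (t' - t)\<^sup>2)) \<partial>lborel)" .
      qed
      also have "\<dots> \<le> (\<integral>\<^sup>+t. ennreal (r t * (1 / (1 + \<bar>t\<bar>)\<^sup>2)) * ennreal (C3 * (1 + \<bar>t\<bar>) powr (1 / 4)) \<partial>lborel)"
        unfolding r_def by (intro nn_integral_mono mult_left_mono C3 a) auto
      also have "\<dots> = (\<integral>\<^sup>+t. ennreal C3 * ennreal (r t * (1 + \<bar>t\<bar>) powr - (7 / 4)) \<partial>lborel)"
      proof (intro nn_integral_cong)
        fix t :: real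
        define u where "u = 1 + \<bar>t\<bar>"
        have u: "u > 0" by (simp add: u_def add_pos_nonneg)
        have "1 / u\<^sup>2 * u powr (1 / 4) = u powr (1 / 4) / u powr 2" using u by simp
        also have "\<dots> = u powr (1 / 4 - 2)" by (rule powr_diff[symmetric])
        finally have e: "1 / u\<^sup>2 * u powr (1 / 4) = u powr - (7 / 4)" by simp
        have "r t * (1 / u\<^sup>2) * (C3 * u powr (1 / 4)) = C3 * (r t * (1 / u\<^sup>2 * u powr (1 / 4)))" by simp
        then show "ennreal (r t * (1 / (1 + \<bar>t\<bar>)\<^sup>2)) * ennreal (C3 * (1 + \<bar>t\<bar>) powr (1 / 4)) =
          ennreal C3 * ennreal (r t * (1 + \<bar>t\<bar>) powr - (7 / 4))"
          unfolding u_def[symmetric] e using r C3 u by (simp flip: ennreal_mult')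
      qed
      also have "\<dots> = ennreal C3 * (\<integral>\<^sup>+t. ennreal (r t * (1 + \<bar>t\<bar>) powr - (7 / 4)) \<partial>lborel)"
        by (rule nn_integral_cmult) measurable
      also have "\<dots> \<le> ennreal C3 * ennreal C4" unfolding r_def by (intro mult_left_mono C4 a) auto
      also have "\<dots> = ennreal (C3 * C4)" using C3 by (simp add: ennreal_mult')
      finally show ?thesis .
    qed
    have "(\<integral>\<^sup>+t. (\<integral>\<^sup>+t'. ennreal (r t / (1 + \<bar>t\<bar>) * (r t' / (1 + \<bar>t'\<bar>)) / (1 + (t - t')\<^sup>2)) \<partial>lborel) \<partial>lborel) \<le>
        (\<integral>\<^sup>+t. (\<integral>\<^sup>+t'. ennreal (g t t') + ennreal (g t' t) \<partial>lborel) \<partial>lborel)"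
    proof (intro nn_integral_mono)
      fix t t' :: real
      define u v where "u = 1 / (1 + \<bar>t\<bar>)" and "v = 1 / (1 + \<bar>t'\<bar>)"
      define k where "k = r t * r t' / (1 + (t - t')\<^sup>2)"
      have k: "k \<ge> 0" unfolding k_def using r by (auto intro!: mult_nonneg_nonneg divide_nonneg_nonneg add_nonneg_nonneg)
      have "0 \<le> u * v" by (simp add: u_def v_def)
      then have "u * v \<le> u\<^sup>2 + v\<^sup>2" using sum_squares_bound[of u v] by argo
      then have "k * (u * v) \<le> k * (u\<^sup>2 + v\<^sup>2)" using k by (rule mult_left_mono)
      moreover have "r t / (1 + \<bar>t\<bar>) * (r t' / (1 + \<bar>t'\<bar>)) / (1 + (t - t')\<^sup>2) = k * (u * v)"
        by (simp add: k_def u_def v_def)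
      moreover have "g t t' + g t' t = k * (u\<^sup>2 + v\<^sup>2)"
        unfolding g_def power2_commute[of t' t] by (simp add: k_def u_def v_def power_divide algebra_simps)
      ultimately show "ennreal (r t / (1 + \<bar>t\<bar>) * (r t' / (1 + \<bar>t'\<bar>)) / (1 + (t - t')\<^sup>2)) \<le> ennreal (g t t') + ennreal (g t' t)"
        using g0 by (simp add: ennreal_leI flip: ennreal_plus)
    qed
    also have "\<dots> = (\<integral>\<^sup>+t. (\<integral>\<^sup>+t'. ennreal (g t t') \<partial>lborel) + (\<integral>\<^sup>+t'. ennreal (g t' t) \<partial>lborel) \<partial>lborel)"
      by (intro nn_integral_cong nn_integral_add) measurable
    also have "\<dots> = (\<integral>\<^sup>+t. (\<integral>\<^sup>+t'. ennreal (g t t') \<partial>lborel) \<partial>lborel) + (\<integral>\<^sup>+t. (\<integral>\<^sup>+t'. ennreal (g t' t) \<partial>lborel) \<partial>lborel)"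
      by (intro nn_integral_add) measurable
    also have "(\<integral>\<^sup>+t. (\<integral>\<^sup>+t'. ennreal (g t' t) \<partial>lborel) \<partial>lborel) = (\<integral>\<^sup>+t'. (\<integral>\<^sup>+t. ennreal (g t' t) \<partial>lborel) \<partial>lborel)"
      by (rule lborel_pair.Fubini') measurable
    also have "(\<integral>\<^sup>+t. (\<integral>\<^sup>+t'. ennreal (g t t') \<partial>lborel) \<partial>lborel) + (\<integral>\<^sup>+t'. (\<integral>\<^sup>+t. ennreal (g t' t) \<partial>lborel) \<partial>lborel) \<le>
        ennreal (C3 * C4) + ennreal (C3 * C4)"
      by (intro add_mono gI)
    also have "\<dots> = ennreal (2 * (C3 * C4))" using C3 C4 by (simp flip: ennreal_plus)
    finally show ?thesis by (simp add: r_def)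
  qed
  then show ?thesis using that[of "2 * (C3 * C4)"] C3 C4 by auto
qed

text \<open>The residue terms of \<open>explicit_formula\<close> stay bounded as a -> 1/2: the
  points 2a lie in [1, 3/2], a compact set on which \<open>zeta_logderiv\<close> is holomorphic
  because the pole of zeta at 1 has been removed.\<close>

lemma zeta_logderiv_real_bound:
  assumes nz: "\<And>s. Re s > 1 / 2 \<Longrightarrow> zeta_reg s \<noteq> 0"
  obtains M where "M \<ge> 0"
    "\<And>a. 1 / 2 < a \<Longrightarrow> a \<le> 3 / 4 \<Longrightarrow> norm (zeta_logderiv (of_real (2 * a)) - 1) \<le> M"
    "\<And>a. 1 / 2 < a \<Longrightarrow> a \<le> 3 / 4 \<Longrightarrow> norm (1 / 2 - zeta_logderiv (of_real (2 * a + 1))) \<le> M"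
proof -
  obtain M where M: "\<And>s. Re s \<ge> 3 / 2 \<Longrightarrow> norm (zeta_logderiv s) \<le> M" using zeta_logderiv_bounded by blast
  have Lhol: "zeta_logderiv holomorphic_on {s. Re s > 1 / 2}"
    unfolding zeta_logderiv_def[abs_def] using nz
    by (intro holomorphic_intros holomorphic_deriv[OF zeta_reg_holomorphic] open_Re_gt) auto
  have "continuous_on {1..3/2::real} (\<lambda>x. zeta_logderiv (of_real x))"
    by (rule continuous_on_compose2[OF holomorphic_on_imp_continuous_on[OF Lhol]]) (auto intro!: continuous_intros)
  then have "compact ((\<lambda>x. zeta_logderiv (of_real x)) ` {1..3/2::real})" by (intro compact_continuous_image) auto
  then have "bounded ((\<lambda>x. zeta_logderiv (of_real x)) ` {1..3/2::real})" by (rule compact_imp_bounded)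
  then obtain B where B: "\<And>x. x \<in> {1..3/2} \<Longrightarrow> norm (zeta_logderiv (of_real x)) \<le> B"
    by (fastforce simp: bounded_iff)
  show ?thesis
  proof (rule that[of "\<bar>B\<bar> + \<bar>M\<bar> + 1"])
    fix a :: real assume a: "1 / 2 < a" "a \<le> 3 / 4"
    show "norm (zeta_logderiv (of_real (2 * a)) - 1) \<le> \<bar>B\<bar> + \<bar>M\<bar> + 1"
      using B[of "2 * a"] a norm_triangle_ineq4[of "zeta_logderiv (of_real (2 * a))" 1] by simp
    show "norm (1 / 2 - zeta_logderiv (of_real (2 * a + 1))) \<le> \<bar>B\<bar> + \<bar>M\<bar> + 1"
      using M[of "of_real (2 * a + 1)"] a norm_triangle_ineq4[of "1 / 2" "zeta_logderiv (of_real (2 * a + 1))"] by simp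
  qed auto
qed

text \<open>Bounds found on the lines Re s = a > 1/2 for a quantity independent of a pass to the
  exponent at a = 1/2; on the line Re s = 1/2 itself \<open>zeta_logderiv\<close> may have
  poles.\<close>

lemma tendsto_bound_half:
  fixes f :: "real \<Rightarrow> real"
  assumes "isCont f (1 / 2)" "\<And>a. 1 / 2 < a \<Longrightarrow> a \<le> 3 / 4 \<Longrightarrow> x \<le> f a"
  shows "x \<le> f (1 / 2)"
proof (rule tendsto_lowerbound[where F = "at_right (1 / 2)"])
  show "(f \<longlongrightarrow> f (1 / 2)) (at_right (1 / 2))" using assms(1) by (simp add: isCont_def filterlim_at_split)
  show "\<forall>\<^sub>F a in at_right (1 / 2). x \<le> f a"
    using assms(2) by (auto simp: eventually_at_right_field intro!: exI[of _ "3 / 4"])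
qed simp

lemma psi_error_integral_bound:
  assumes nz: "\<And>s. Re s > 1 / 2 \<Longrightarrow> zeta_reg s \<noteq> 0"
  obtains C where "C \<ge> 0" "\<And>x. x \<ge> 1 \<Longrightarrow> \<bar>psi_error_integral x\<bar> \<le> C * x powr (3 / 2)"
proof -
  obtain C4 where C4: "C4 \<ge> 0"
    "\<And>a. 1 / 2 < a \<Longrightarrow> a \<le> 3 / 4 \<Longrightarrow>
      (\<integral>\<^sup>+t. ennreal (\<bar>Re (zeta_logderiv (Complex a t))\<bar> * (1 + \<bar>t\<bar>) powr - (7 / 4)) \<partial>lborel) \<le> ennreal C4"
    using weighted_mass_bound[OF nz] by blast
  obtain M where M: "M \<ge> 0"
    "\<And>a. 1 / 2 < a \<Longrightarrow> a \<le> 3 / 4 \<Longrightarrow> norm (zeta_logderiv (of_real (2 * a)) - 1) \<le> M"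
    "\<And>a. 1 / 2 < a \<Longrightarrow> a \<le> 3 / 4 \<Longrightarrow> norm (1 / 2 - zeta_logderiv (of_real (2 * a + 1))) \<le> M"
    using zeta_logderiv_real_bound[OF nz] by blast
  have "\<bar>psi_error_integral x\<bar> \<le> (9 * C4 + 2 * M) * x powr (3 / 2)" if x: "x \<ge> 1" for x
  proof -
    have "\<bar>psi_error_integral x\<bar> \<le> x * (9 * x powr a * C4) + 2 * M * x" if a: "1 / 2 < a" "a \<le> 3 / 4" for a
    proof -
      define f where "f t = of_real (Re (zeta_logderiv (Complex a t))) * of_real x powr Complex a t / (Complex a t * (Complex a t + 1))" for t
      have fi: "integrable lborel f" unfolding f_def[abs_def] by (rule explicit_formula(1)[OF nz a x])
      have "ennreal (norm (LINT t|lborel. f t)) \<le> (\<integral>\<^sup>+t. ennreal (norm (f t)) \<partial>lborel)"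
        by (rule integral_norm_bound_ennreal[OF fi])
      also have "\<dots> \<le> (\<integral>\<^sup>+t. ennreal (9 * x powr a) * ennreal (\<bar>Re (zeta_logderiv (Complex a t))\<bar> * (1 + \<bar>t\<bar>) powr - (7 / 4)) \<partial>lborel)"
      proof (rule nn_integral_mono)
        fix t
        have "norm (f t) = \<bar>Re (zeta_logderiv (Complex a t))\<bar> * x powr a * norm (1 / (Complex a t * (Complex a t + 1)))"
          unfolding f_def norm_divide norm_mult using x by (subst norm_powr_real_powr) auto
        also have "\<dots> \<le> \<bar>Re (zeta_logderiv (Complex a t))\<bar> * x powr a * (9 * (1 + \<bar>t\<bar>) powr - 2)"
          using norm_Perron_denominator[of "Complex a t"] a by (intro mult_left_mono) auto
        also have "\<dots> \<le> \<bar>Re (zeta_logderiv (Complex a t))\<bar> * x powr a * (9 * (1 + \<bar>t\<bar>) powr - (7 / 4))"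
          by (intro mult_left_mono powr_mono) auto
        finally show "ennreal (norm (f t)) \<le> ennreal (9 * x powr a) * ennreal (\<bar>Re (zeta_logderiv (Complex a t))\<bar> * (1 + \<bar>t\<bar>) powr - (7 / 4))"
          by (simp add: ennreal_leI mult_ac flip: ennreal_mult')
      qed
      also have "\<dots> = ennreal (9 * x powr a) * (\<integral>\<^sup>+t. ennreal (\<bar>Re (zeta_logderiv (Complex a t))\<bar> * (1 + \<bar>t\<bar>) powr - (7 / 4)) \<partial>lborel)"
      proof (rule nn_integral_cmult)
        note [measurable] = zeta_logderiv_line_measurable[OF nz a(1)]
        show "(\<lambda>t. ennreal (\<bar>Re (zeta_logderiv (Complex a t))\<bar> * (1 + \<bar>t\<bar>) powr - (7 / 4))) \<in> borel_measurable lborel"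
          by measurable
      qed
      also have "\<dots> \<le> ennreal (9 * x powr a) * ennreal C4" by (intro mult_left_mono C4 a) auto
      also have "\<dots> = ennreal (9 * x powr a * C4)" by (simp add: ennreal_mult')
      finally have n1: "norm (LINT t|lborel. f t) \<le> 9 * x powr a * C4" using C4 by (simp add: ennreal_le_iff)
      have n2: "x / pi \<le> x" using x pi_gt3 by (simp add: divide_le_eq)
      have ef: "complex_of_real (psi_error_integral x) =
          - of_real (x / pi) * (LINT t|lborel. of_real (Re (zeta_logderiv (Complex a t))) * of_real x powr Complex a t /
              (Complex a t * (Complex a t + 1))) +
          (zeta_logderiv (of_real (2 * a)) - 1) * of_real x + (1 / 2 - zeta_logderiv (of_real (2 * a + 1)))"
        by (rule explicit_formula(2)[OF nz a x])
      have "\<bar>psi_error_integral x\<bar> = norm (complex_of_real (psi_error_integral x))" by simp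
      also have "\<dots> \<le> norm (- of_real (x / pi) * (LINT t|lborel. f t)) +
          norm ((zeta_logderiv (of_real (2 * a)) - 1) * of_real x) + norm (1 / 2 - zeta_logderiv (of_real (2 * a + 1)))"
        unfolding ef f_def
        by (rule order_trans[OF norm_triangle_ineq add_right_mono[OF norm_triangle_ineq]])
      also have "\<dots> \<le> x * (9 * x powr a * C4) + M * x + M * x"
      proof (intro add_mono)
        show "norm (- of_real (x / pi) * (LINT t|lborel. f t)) \<le> x * (9 * x powr a * C4)"
          unfolding norm_mult norm_minus_cancel norm_of_real using n1 n2 x by (intro mult_mono) auto
        show "norm ((zeta_logderiv (of_real (2 * a)) - 1) * of_real x) \<le> M * x"
          unfolding norm_mult norm_of_real using M(1) M(2)[OF a] x by (intro mult_mono) auto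
        have "M * 1 \<le> M * x" using M(1) x by (intro mult_left_mono) auto
        then show "norm (1 / 2 - zeta_logderiv (of_real (2 * a + 1))) \<le> M * x" using M(3)[OF a] by simp
      qed
      finally show ?thesis by simp
    qed
    \<comment> \<open>\<open>C4\<close> and \<open>M\<close> do not depend on a, so only the
      explicit power x^a takes part in the limit.\<close>
    then have "\<bar>psi_error_integral x\<bar> \<le> x * (9 * x powr (1 / 2) * C4) + 2 * M * x"
      using x C4(1) by (intro tendsto_bound_half[where f = "\<lambda>a. x * (9 * x powr a * C4) + 2 * M * x"] continuous_intros) auto
    also have "\<dots> = 9 * C4 * (x powr 1 * x powr (1 / 2)) + 2 * M * x powr 1" using x by simp
    also have "x powr 1 * x powr (1 / 2) = x powr (1 + 1 / 2)" by (rule powr_add[symmetric])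
    also have "9 * C4 * x powr (1 + 1 / 2) + 2 * M * x powr 1 \<le> 9 * C4 * x powr (3 / 2) + 2 * M * x powr (3 / 2)"
      using x M(1) C4(1) by (intro add_mono mult_left_mono powr_mono) auto
    finally show ?thesis by (simp add: algebra_simps)
  qed
  then show ?thesis using that[of "9 * C4 + 2 * M"] C4 M by auto
qed


section \<open>The mean square of the error term\<close>

lemma integral_swap_bounded_kernel:
  fixes g w :: "real \<Rightarrow> complex" and e :: "real \<Rightarrow> real \<Rightarrow> complex"
  assumes g: "integrable lborel g" and w: "integrable lborel w"
    and e: "case_prod e \<in> borel_measurable (lborel \<Otimes>\<^sub>M lborel)" "\<And>u t. norm (e u t) \<le> 1"
  shows "(LINT u|lborel. g u * (LINT t|lborel. w t * e u t)) = (LINT t|lborel. w t * (LINT u|lborel. g u * e u t))"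
proof -
  have e': "case_prod e \<in> borel_measurable (borel \<Otimes>\<^sub>M borel)"
    using e(1) by (simp cong: measurable_cong_sets sets_pair_measure_cong)
  have [measurable]: "g \<in> borel_measurable borel" "w \<in> borel_measurable borel" using g w by auto
  have prod: "integrable (lborel \<Otimes>\<^sub>M lborel) (\<lambda>z. g (fst z) * w (snd z))"
  proof (rule lborel_pair.Fubini_integrable)
    show "(\<lambda>z. g (fst z) * w (snd z)) \<in> borel_measurable (lborel \<Otimes>\<^sub>M lborel)" by measurable
    have "integrable lborel (\<lambda>x. norm (g x) * (LINT y|lborel. norm (w y)))"
      using g by (intro integrable_mult_left integrable_norm)
    then show "integrable lborel (\<lambda>x. LINT y|lborel. norm (g (fst (x, y)) * w (snd (x, y))))"
      by (simp add: norm_mult)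
    show "AE x in lborel. integrable lborel (\<lambda>y. g (fst (x, y)) * w (snd (x, y)))"
      using w by (auto intro!: integrable_mult_right)
  qed
  have int: "integrable (lborel \<Otimes>\<^sub>M lborel) (\<lambda>(u, t). g u * w t * e u t)"
  proof (rule Bochner_Integration.integrable_bound[OF prod])
    have "(\<lambda>z. g (fst z) * w (snd z) * case_prod e z) \<in> borel_measurable (lborel \<Otimes>\<^sub>M lborel)"
      using e' by measurable
    then show "(\<lambda>(u, t). g u * w t * e u t) \<in> borel_measurable (lborel \<Otimes>\<^sub>M lborel)"
      by (simp add: case_prod_beta')
    show "AE z in lborel \<Otimes>\<^sub>M lborel. norm (case z of (u, t) \<Rightarrow> g u * w t * e u t) \<le> norm (g (fst z) * w (snd z))"
      using e(2) by (auto simp: norm_mult intro!: AE_I2 mult_left_le)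
  qed
  have "(LINT u|lborel. g u * (LINT t|lborel. w t * e u t)) = (LINT u|lborel. (LINT t|lborel. g u * w t * e u t))"
    by (simp add: mult.assoc)
  also have "\<dots> = (LINT t|lborel. (LINT u|lborel. g u * w t * e u t))"
    by (rule lborel_pair.Fubini_integral[symmetric, OF int])
  also have "\<dots> = (LINT t|lborel. w t * (LINT u|lborel. g u * e u t))"
    by (simp add: mult.assoc mult.left_commute[of _ "w _"])
  finally show ?thesis .
qed

section \<open>An exponential weight and its Fourier transform\<close>

lemma exp_minus_abs_integrable: "integrable lborel (\<lambda>v::real. exp (- \<bar>v - U\<bar>))"
proof -
  have "integrable lborel (\<lambda>v::real. exp (- \<bar>v\<bar>))"
  proof (rule Bochner_Integration.integrable_bound[OF integrable_mult_right[OF integrable_decay[of 2], of 2]])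
    show "AE v in lborel. norm (exp (- \<bar>v\<bar>)) \<le> norm (2 * (1 + \<bar>v\<bar>) powr - 2 :: real)"
    proof (rule AE_I2)
      fix v :: real
      have "(1 + \<bar>v\<bar>)\<^sup>2 \<le> 2 * exp \<bar>v\<bar>"
        using exp_lower_Taylor_quadratic[of "\<bar>v\<bar>"] by (simp add: power2_eq_square algebra_simps)
      then show "norm (exp (- \<bar>v\<bar>)) \<le> norm (2 * (1 + \<bar>v\<bar>) powr - 2)"
        by (simp add: powr_minus exp_minus divide_simps)
    qed
  qed auto
  then show ?thesis using lborel_integrable_real_affine[of "\<lambda>v. exp (- \<bar>v\<bar>)" 1 "- U"] by simp
qed

text \<open>Split at 0, both halves have exponential primitives, with exponent c = -1 + i\<xi> on
  the right and d = 1 + i\<xi> on the left, and 1/d - 1/c is the stated value.\<close>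

lemma exp_minus_abs_Fourier:
  "(LINT v|lborel. of_real (exp (- \<bar>v\<bar>)) * cis (v * \<xi>)) = 2 / (1 + \<xi>\<^sup>2)"
proof -
  define c d where "c = Complex (- 1) \<xi>" and "d = Complex 1 \<xi>"
  have cd: "c \<noteq> 0" "d \<noteq> 0" by (auto simp: c_def d_def complex_eq_iff)
  define f where "f v = of_real (exp (- \<bar>v\<bar>)) * cis (v * \<xi>)" for v
  have fm [measurable]: "f \<in> borel_measurable borel"
    unfolding f_def by (intro borel_measurable_continuous_onI continuous_intros)
  have fi: "integrable lborel f"
    by (rule Bochner_Integration.integrable_bound[OF exp_minus_abs_integrable[of 0]])
       (auto simp: f_def norm_mult)
  have fp: "f v = exp (v *\<^sub>R c)" if "v \<ge> 0" for v
    using that by (simp add: f_def c_def exp_eq_polar)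
  have fn: "f v = exp (v *\<^sub>R d)" if "v \<le> 0" for v
    using that by (simp add: f_def d_def exp_eq_polar)
  have D: "((\<lambda>v. exp (v *\<^sub>R z) / z) has_vector_derivative exp (v *\<^sub>R z)) (at v)" if "z \<noteq> 0" for z :: complex and v
  proof -
    have "((\<lambda>v. exp (v *\<^sub>R z)) has_vector_derivative exp (v *\<^sub>R z) * z) (at v)"
      by (rule exp_scaleR_has_vector_derivative_right)
    then have "((\<lambda>v. exp (v *\<^sub>R z) * (1 / z)) has_vector_derivative exp (v *\<^sub>R z) * z * (1 / z)) (at v)"
      by (rule has_vector_derivative_mult_left)
    then show ?thesis using that by simp
  qed
  have P: "(LBINT v=0..\<infinity>. exp (v *\<^sub>R c)) = 0 - 1 / c"
  proof (rule interval_integral_FTC_integrable[where F = "\<lambda>v. exp (v *\<^sub>R c) / c"])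
    show "set_integrable lborel (einterval 0 \<infinity>) (\<lambda>v. exp (v *\<^sub>R c))"
      using integrable_mult_indicator[OF _ fi, of "einterval 0 \<infinity>"] unfolding set_integrable_def
      by (rule Bochner_Integration.integrable_cong[THEN iffD1, rotated -1])
         (auto simp: fp einterval_def indicator_def)
    have "((\<lambda>v. exp (v *\<^sub>R c) / c) \<longlongrightarrow> exp (0 *\<^sub>R c) / c) (at_right 0)"
      by (intro tendsto_intros cd)
    then show "(((\<lambda>v. exp (v *\<^sub>R c) / c) \<circ> real_of_ereal) \<longlongrightarrow> 1 / c) (at_right 0)"
      unfolding zero_ereal_def ereal_tendsto_simps by simp
    have "((\<lambda>v. norm (exp (v *\<^sub>R c) / c)) \<longlongrightarrow> 0 / norm c) at_top"
      unfolding norm_divide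
    proof (intro tendsto_divide tendsto_const)
      have "((\<lambda>v::real. exp (- v)) \<longlongrightarrow> 0) at_top" by real_asymp
      then show "((\<lambda>v. norm (exp (v *\<^sub>R c))) \<longlongrightarrow> 0) at_top" by (simp add: c_def)
    qed (use cd in auto)
    then have "((\<lambda>v. exp (v *\<^sub>R c) / c) \<longlongrightarrow> 0) at_top" by (simp add: tendsto_norm_zero_iff)
    then show "(((\<lambda>v. exp (v *\<^sub>R c) / c) \<circ> real_of_ereal) \<longlongrightarrow> 0) (at_left \<infinity>)"
      unfolding ereal_tendsto_simps .
  qed (auto intro!: D cd continuous_intros)
  have N: "(LBINT v=-\<infinity>..0. exp (v *\<^sub>R d)) = 1 / d - 0"
  proof (rule interval_integral_FTC_integrable[where F = "\<lambda>v. exp (v *\<^sub>R d) / d"])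
    show "set_integrable lborel (einterval (-\<infinity>) 0) (\<lambda>v. exp (v *\<^sub>R d))"
      using integrable_mult_indicator[OF _ fi, of "einterval (-\<infinity>) 0"] unfolding set_integrable_def
      by (rule Bochner_Integration.integrable_cong[THEN iffD1, rotated -1])
         (auto simp: fn einterval_def indicator_def)
    have "((\<lambda>v. exp (v *\<^sub>R d) / d) \<longlongrightarrow> exp (0 *\<^sub>R d) / d) (at_left 0)"
      by (intro tendsto_intros cd)
    then show "(((\<lambda>v. exp (v *\<^sub>R d) / d) \<circ> real_of_ereal) \<longlongrightarrow> 1 / d) (at_left 0)"
      unfolding zero_ereal_def ereal_tendsto_simps by simp
    have "((\<lambda>v. norm (exp (v *\<^sub>R d) / d)) \<longlongrightarrow> 0 / norm d) at_bot"
      unfolding norm_divide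
    proof (intro tendsto_divide tendsto_const)
      have "((\<lambda>v::real. exp v) \<longlongrightarrow> 0) at_bot" by real_asymp
      then show "((\<lambda>v. norm (exp (v *\<^sub>R d))) \<longlongrightarrow> 0) at_bot" by (simp add: d_def)
    qed (use cd in auto)
    then have "((\<lambda>v. exp (v *\<^sub>R d) / d) \<longlongrightarrow> 0) at_bot" by (simp add: tendsto_norm_zero_iff)
    then show "(((\<lambda>v. exp (v *\<^sub>R d) / d) \<circ> real_of_ereal) \<longlongrightarrow> 0) (at_right (-\<infinity>))"
      unfolding ereal_tendsto_simps .
  qed (auto intro!: D cd continuous_intros)
  have "(LINT v|lborel. f v) = (LBINT v=-\<infinity>..\<infinity>. f v)"
    by (simp add: interval_lebesgue_integral_def set_lebesgue_integral_def)
  also have "\<dots> = (LBINT v=-\<infinity>..0. f v) + (LBINT v=0..\<infinity>. f v)"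
    by (rule interval_integral_sum[symmetric])
       (use fi in \<open>auto simp: interval_lebesgue_integrable_def set_integrable_def\<close>)
  also have "(LBINT v=-\<infinity>..0. f v) = (LBINT v=-\<infinity>..0. exp (v *\<^sub>R d))"
    by (rule interval_integral_cong) (auto simp: fn einterval_def)
  also have "(LBINT v=0..\<infinity>. f v) = (LBINT v=0..\<infinity>. exp (v *\<^sub>R c))"
    by (rule interval_integral_cong) (auto simp: fp einterval_def)
  also have "(LBINT v=-\<infinity>..0. exp (v *\<^sub>R d)) + (LBINT v=0..\<infinity>. exp (v *\<^sub>R c)) = 1 / d - 1 / c"
    unfolding P N by simp
  also have "\<dots> = 2 / (1 + \<xi>\<^sup>2)"
  proof -
    have cd_eq: "c * d = - (1 + (of_real \<xi>)\<^sup>2)" "c - d = - 2"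
      by (auto simp: c_def d_def complex_eq_iff power2_eq_square)
    have "1 / d - 1 / c = (c - d) / (c * d)" using cd by (simp add: field_simps)
    then have "1 / d - 1 / c = - 2 / - (1 + (of_real \<xi>)\<^sup>2)" by (simp only: cd_eq)
    then show ?thesis by (simp only: minus_divide_divide) simp
  qed
  finally show ?thesis by (simp add: f_def)
qed

text \<open>
  The decay of order two of this transform is what matches the weight in the double mass bound.
\<close>

lemma norm_exp_minus_abs_Fourier:
  "norm (LINT u|lborel. of_real (exp (- \<bar>u - U\<bar>)) * cis (u * \<xi>)) = 2 / (1 + \<xi>\<^sup>2)"
proof -
  have "(LINT u|lborel. of_real (exp (- \<bar>u - U\<bar>)) * cis (u * \<xi>)) =
      (LINT v|lborel. of_real (exp (- \<bar>v\<bar>)) * cis ((U + v) * \<xi>))"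
    by (subst lborel_integral_real_affine[where c = 1 and t = U]) auto
  also have "\<dots> = (LINT v|lborel. cis (U * \<xi>) * (of_real (exp (- \<bar>v\<bar>)) * cis (v * \<xi>)))"
  proof -
    have "cis ((U + v) * \<xi>) = cis (U * \<xi>) * cis (v * \<xi>)" for v by (simp add: cis_mult distrib_right)
    then show ?thesis by (simp only: mult.left_commute)
  qed
  also have "\<dots> = cis (U * \<xi>) * (2 / (1 + (of_real \<xi>)\<^sup>2))"
    by (simp add: exp_minus_abs_Fourier)
  also have "norm \<dots> = norm (complex_of_real (2 / (1 + \<xi>\<^sup>2)))" unfolding norm_mult by simp
  finally show ?thesis unfolding norm_of_real by simp
qed

text \<open>Expanding the square and integrating over u leaves |w(t) w(t')| against the modulus of
  the transform of the weight at t - t', which is 2/(1 + (t - t')^2) wherever the weight is centred.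
  The hypothesis thus has the shape of \<open>double_mass_bound\<close>.\<close>

lemma Fourier_integral_weighted_square:
  fixes w :: "real \<Rightarrow> complex"
  assumes w: "integrable lborel w"
    and B: "(\<integral>\<^sup>+t. (\<integral>\<^sup>+t'. ennreal (norm (w t) * norm (w t') * (2 / (1 + (t - t')\<^sup>2))) \<partial>lborel) \<partial>lborel) \<le> B"
  shows "(\<integral>\<^sup>+u. ennreal ((norm (LINT t|lborel. w t * cis (u * t)))\<^sup>2 * exp (- \<bar>u - U\<bar>)) \<partial>lborel) \<le> B"
    and "continuous_on UNIV (\<lambda>u. LINT t|lborel. w t * cis (u * t))"
proof -
  have wm [measurable]: "w \<in> borel_measurable borel" using w by auto
  define f where "f u = (LINT t|lborel. w t * cis (u * t))" for u
  define k where "k u = exp (- \<bar>u - U\<bar>)" for u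
  define W where "W = (LINT t|lborel. norm (w t))"
  have ei: "integrable lborel (\<lambda>t. w t * cis (u * t))" for u
  proof (rule Bochner_Integration.integrable_bound[OF w])
    have "(\<lambda>t. cis (u * t)) \<in> borel_measurable borel"
      by (intro borel_measurable_continuous_onI continuous_intros)
    then show "(\<lambda>t. w t * cis (u * t)) \<in> borel_measurable lborel" by simp
  qed (auto simp: norm_mult)
  have fW: "norm (f u) \<le> W" for u
    using integral_norm_bound[of lborel "\<lambda>t. w t * cis (u * t)"] by (simp add: f_def W_def norm_mult)
  have fc: "continuous_on UNIV f"
    unfolding continuous_on_eq_continuous_at[OF open_UNIV]
  proof
    fix u :: real
    show "isCont f u" unfolding continuous_at_sequentially
    proof (intro allI impI)
      fix v :: "nat \<Rightarrow> real" assume v: "v \<longlonglongrightarrow> u"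
      show "(f \<circ> v) \<longlonglongrightarrow> f u" unfolding f_def o_def
      proof (rule integral_dominated_convergence[where w = "\<lambda>t. norm (w t)"])
        show "AE t in lborel. (\<lambda>n. w t * cis (v n * t)) \<longlonglongrightarrow> w t * cis (u * t)"
          by (intro AE_I2 tendsto_intros v)
      qed (use w ei in \<open>auto simp: norm_mult\<close>)
    qed
  qed
  then show "continuous_on UNIV (\<lambda>u. LINT t|lborel. w t * cis (u * t))" by (simp add: f_def[abs_def])
  have fm [measurable]: "f \<in> borel_measurable borel" by (rule borel_measurable_continuous_onI[OF fc])
  have ki: "integrable lborel k" unfolding k_def[abs_def] by (rule exp_minus_abs_integrable)
  have [measurable]: "k \<in> borel_measurable borel" using ki by auto
  have kc: "integrable lborel (\<lambda>u. complex_of_real (k u))" using ki by simp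
  have kf: "integrable lborel (\<lambda>u. of_real (k u) * f u)"
  proof (rule Bochner_Integration.integrable_bound[OF integrable_mult_left[OF ki, of W]])
    have "k u * norm (f u) \<le> k u * \<bar>W\<bar>" for u
      using fW[of u] by (intro mult_left_mono) (auto simp: k_def)
    then show "AE u in lborel. norm (of_real (k u) * f u) \<le> norm (k u * W)"
      by (intro AE_I2) (auto simp: norm_mult abs_mult k_def)
  qed auto
  have wc: "integrable lborel (\<lambda>t. cnj (w t))" using w by simp
  have meas: "(\<lambda>(u, t). cis (u * t)) \<in> borel_measurable (lborel \<Otimes>\<^sub>M lborel)"
      "(\<lambda>(u, t). cis (- u * t)) \<in> borel_measurable (lborel \<Otimes>\<^sub>M lborel)"
    by (auto simp: lborel_prod case_prod_beta' intro!: borel_measurable_continuous_onI continuous_intros)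
  have inner: "norm (LINT u|lborel. of_real (k u) * f u * cis (- u * t')) \<le> (LINT t|lborel. norm (w t) * (2 / (1 + (t - t')\<^sup>2)))"
    for t' :: real
  proof -
    have kci: "integrable lborel (\<lambda>u. of_real (k u) * cis (- u * t'))"
    proof (rule Bochner_Integration.integrable_bound[OF kc])
      have "(\<lambda>u. cis (- u * t')) \<in> borel_measurable borel"
        by (intro borel_measurable_continuous_onI continuous_intros)
      then show "(\<lambda>u. of_real (k u) * cis (- u * t')) \<in> borel_measurable lborel" by simp
    qed (auto simp: norm_mult)
    have "(LINT u|lborel. of_real (k u) * f u * cis (- u * t')) =
        (LINT u|lborel. (of_real (k u) * cis (- u * t')) * (LINT t|lborel. w t * cis (u * t)))"
      by (simp add: f_def mult_ac)
    also have "\<dots> = (LINT t|lborel. w t * (LINT u|lborel. of_real (k u) * cis (- u * t') * cis (u * t)))"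
      by (rule integral_swap_bounded_kernel[OF kci w meas(1)]) simp
    also have "\<dots> = (LINT t|lborel. w t * (LINT u|lborel. of_real (k u) * cis (u * (t - t'))))"
      by (simp add: cis_mult mult.assoc right_diff_distrib)
    also have "norm \<dots> \<le> (LINT t|lborel. norm (w t * (LINT u|lborel. of_real (k u) * cis (u * (t - t')))))"
      by (rule integral_norm_bound)
    also have "\<dots> = (LINT t|lborel. norm (w t) * (2 / (1 + (t - t')\<^sup>2)))"
      by (simp add: norm_mult k_def norm_exp_minus_abs_Fourier)
    finally show ?thesis .
  qed
  have sqi: "integrable lborel (\<lambda>u. (norm (f u))\<^sup>2 * k u)"
  proof (rule Bochner_Integration.integrable_bound[OF integrable_mult_right[OF ki, of "W\<^sup>2"]])
    show "AE u in lborel. norm ((norm (f u))\<^sup>2 * k u) \<le> norm (W\<^sup>2 * k u)"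
      using fW by (auto simp: k_def intro!: mult_right_mono power_mono)
  qed auto
  have wi: "integrable lborel (\<lambda>t. norm (w t) * (2 / (1 + (t - t')\<^sup>2)))" for t' :: real
  proof (rule Bochner_Integration.integrable_bound[OF integrable_mult_left[OF integrable_norm[OF w], of 2]])
    show "AE t in lborel. norm (norm (w t) * (2 / (1 + (t - t')\<^sup>2))) \<le> norm (norm (w t) * 2)"
    proof (rule AE_I2)
      fix t :: real
      have "2 / (1 + (t - t')\<^sup>2) \<le> 2 / 1" by (intro divide_left_mono) (auto intro: add_pos_nonneg)
      then have "norm (w t) * (2 / (1 + (t - t')\<^sup>2)) \<le> norm (w t) * 2" by (intro mult_left_mono) auto
      then show "norm (norm (w t) * (2 / (1 + (t - t')\<^sup>2))) \<le> norm (norm (w t) * 2)" by (simp add: abs_mult)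
    qed
  qed auto
  \<comment> \<open>One copy of the integral defining \<open>f\<close> is conjugated and moved
    outside, while the other is unfolded only in \<open>inner\<close>; two exchanges of two
    variables thus stand for one triple integral.\<close>
  have swap: "complex_of_real (LINT u|lborel. (norm (f u))\<^sup>2 * k u) =
      (LINT t'|lborel. cnj (w t') * (LINT u|lborel. of_real (k u) * f u * cis (- u * t')))"
  proof -
    have cf: "cnj (f u) = (LINT t|lborel. cnj (w t) * cis (- u * t))" for u
      unfolding f_def by (subst Bochner_Integration.integral_cnj[symmetric]) (simp add: cis_cnj)
    have "complex_of_real (LINT u|lborel. (norm (f u))\<^sup>2 * k u) = (LINT u|lborel. complex_of_real ((norm (f u))\<^sup>2 * k u))"
      by (rule integral_complex_of_real[symmetric])
    also have "\<dots> = (LINT u|lborel. of_real (k u) * f u * (LINT t|lborel. cnj (w t) * cis (- u * t)))"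
      by (simp only: of_real_mult complex_norm_square cf mult_ac)
    also have "\<dots> = (LINT t'|lborel. cnj (w t') * (LINT u|lborel. of_real (k u) * f u * cis (- u * t')))"
      by (rule integral_swap_bounded_kernel[OF kf wc meas(2)]) simp
    finally show ?thesis .
  qed
  have "(\<integral>\<^sup>+u. ennreal ((norm (f u))\<^sup>2 * k u) \<partial>lborel) = ennreal (LINT u|lborel. (norm (f u))\<^sup>2 * k u)"
    by (rule nn_integral_eq_integral[OF sqi]) (simp add: k_def)
  also have "\<dots> \<le> ennreal (norm (complex_of_real (LINT u|lborel. (norm (f u))\<^sup>2 * k u)))"
    by (intro ennreal_leI) simp
  also have "\<dots> = ennreal (norm (LINT t'|lborel. cnj (w t') * (LINT u|lborel. of_real (k u) * f u * cis (- u * t'))))"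
    by (simp only: swap)
  also have "\<dots> \<le> (\<integral>\<^sup>+t'. ennreal (norm (cnj (w t') * (LINT u|lborel. of_real (k u) * f u * cis (- u * t')))) \<partial>lborel)"
  proof (rule integral_norm_bound_ennreal)
    define v where "v t' = (LINT u|lborel. of_real (k u) * f u * cis (- u * t'))" for t'
    have vm: "v \<in> borel_measurable borel"
    proof -
      have c: "(\<lambda>z. cis (- snd z * fst z)) \<in> borel_measurable (borel \<Otimes>\<^sub>M borel)"
        by (auto simp: borel_prod intro!: borel_measurable_continuous_onI continuous_intros)
      have "(\<lambda>z. of_real (k (snd z)) * f (snd z) * cis (- snd z * fst z)) \<in> borel_measurable (borel \<Otimes>\<^sub>M lborel)"
        using c by measurable
      then have "(\<lambda>t'. LINT u|lborel. of_real (k (snd (t', u))) * f (snd (t', u)) * cis (- snd (t', u) * fst (t', u))) \<in> borel_measurable borel"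
        by (intro lborel.borel_measurable_lebesgue_integral) (simp add: case_prod_beta')
      then show ?thesis by (simp add: v_def[abs_def])
    qed
    have "integrable lborel (\<lambda>t'. cnj (w t') * v t')"
    proof (rule Bochner_Integration.integrable_bound[OF integrable_mult_left[OF wc, of "of_real (LINT u|lborel. norm (of_real (k u) * f u))"]])
      show "(\<lambda>t'. cnj (w t') * v t') \<in> borel_measurable lborel"
        by (intro borel_measurable_times borel_measurable_integrable[OF wc]) (simp add: vm)
      have "norm (v t') \<le> (LINT u|lborel. norm (of_real (k u) * f u))" for t'
        unfolding v_def using integral_norm_bound[of lborel "\<lambda>u. of_real (k u) * f u * cis (- u * t')"]
        by (simp add: norm_mult)
      then show "AE t' in lborel. norm (cnj (w t') * v t') \<le> norm (cnj (w t') * of_real (LINT u|lborel. norm (of_real (k u) * f u)))"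
        by (intro AE_I2) (auto simp only: norm_mult norm_of_real intro!: mult_left_mono order_trans[OF _ abs_ge_self] norm_ge_zero)
    qed
    then show "integrable lborel (\<lambda>t'. cnj (w t') * (LINT u|lborel. of_real (k u) * f u * cis (- u * t')))"
      by (simp add: v_def)
  qed
  also have "\<dots> \<le> (\<integral>\<^sup>+t'. (\<integral>\<^sup>+t. ennreal (norm (w t') * norm (w t) * (2 / (1 + (t' - t)\<^sup>2))) \<partial>lborel) \<partial>lborel)"
  proof (rule nn_integral_mono)
    fix t' :: real
    have "norm (cnj (w t') * (LINT u|lborel. of_real (k u) * f u * cis (- u * t'))) \<le>
        norm (w t') * (LINT t|lborel. norm (w t) * (2 / (1 + (t - t')\<^sup>2)))"
      unfolding norm_mult complex_mod_cnj by (intro mult_left_mono inner) auto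
    also have "\<dots> = (LINT t|lborel. norm (w t') * norm (w t) * (2 / (1 + (t' - t)\<^sup>2)))"
      by (simp only: mult.assoc power2_commute[of t'] integral_mult_right_zero)
    finally have "ennreal (norm (cnj (w t') * (LINT u|lborel. of_real (k u) * f u * cis (- u * t')))) \<le>
       ennreal (LINT t|lborel. norm (w t') * norm (w t) * (2 / (1 + (t' - t)\<^sup>2)))" by (rule ennreal_leI)
    also have "\<dots> = (\<integral>\<^sup>+t. ennreal (norm (w t') * norm (w t) * (2 / (1 + (t' - t)\<^sup>2))) \<partial>lborel)"
    proof (rule nn_integral_eq_integral[symmetric])
      show "integrable lborel (\<lambda>t. norm (w t') * norm (w t) * (2 / (1 + (t' - t)\<^sup>2)))"
        using integrable_mult_right[OF wi[of t'], of "norm (w t')"] by (simp only: mult.assoc power2_commute[of t'])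
    qed auto
    finally show "ennreal (norm (cnj (w t') * (LINT u|lborel. of_real (k u) * f u * cis (- u * t')))) \<le>
       (\<integral>\<^sup>+t. ennreal (norm (w t') * norm (w t) * (2 / (1 + (t' - t)\<^sup>2))) \<partial>lborel)" .
  qed
  also have "\<dots> \<le> B" by (rule B)
  finally show "(\<integral>\<^sup>+u. ennreal ((norm (LINT t|lborel. w t * cis (u * t)))\<^sup>2 * exp (- \<bar>u - U\<bar>)) \<partial>lborel) \<le> B"
    by (simp add: f_def k_def)
qed


section \<open>Difference quotients of the error integral\<close>

lemma norm_exp_minus_1_le:
  fixes z :: complex
  assumes "Re z \<ge> 0"
  shows "norm (exp z - 1) \<le> norm z * exp (Re z)"
proof -
  have "norm (exp z - exp 0) \<le> exp (Re z) * norm (z - 0)"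
  proof (rule field_differentiable_bound[where S = "closed_segment 0 z" and f' = exp])
    fix w assume "w \<in> closed_segment 0 z"
    then obtain u where u: "0 \<le> u" "u \<le> 1" "w = u *\<^sub>R z" by (auto simp: in_segment)
    have "Re w \<le> Re z" using u assms mult_right_mono[of u 1 "Re z"] by simp
    then show "norm (exp w) \<le> exp (Re z)" by simp
  qed (auto intro!: derivative_eq_intros)
  then show ?thesis by (simp add: mult.commute)
qed

text \<open>The increment is multiplicative so that x^s stays a common factor in the explicit
  formula: up to a bounded term the quotient is x^a times a Fourier integral in log x whose density
  does not depend on x.\<close>

definition psi_error_quotient :: "real \<Rightarrow> real \<Rightarrow> real" where
  "psi_error_quotient h x = (psi_error_integral ((1 + h) * x) - psi_error_integral x) / (h * x)"

text \<open>The increment brings in the factor ((1 + h)^(s + 1) - 1)/h, of modulus at most 4|s + 1|.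
  It cancels one factor of the Perron denominator uniformly in h and leaves the density of
  \<open>double_mass_bound\<close>; 12 is this 4 times the 3 of
  \<open>norm_Complex_ge\<close>.\<close>

lemma psi_error_quotient_formula:
  assumes nz: "\<And>s. Re s > 1 / 2 \<Longrightarrow> zeta_reg s \<noteq> 0" and a: "1 / 2 < a" "a \<le> 3 / 4"
    and h: "0 < h" "h \<le> 1"
  defines "w \<equiv> \<lambda>t. of_real (Re (zeta_logderiv (Complex a t))) *
     ((1 + of_real h) * of_real (1 + h) powr Complex a t - 1) / (of_real h * (Complex a t * (Complex a t + 1)))"
  shows "integrable lborel w"
    and "u \<ge> 0 \<Longrightarrow> complex_of_real (psi_error_quotient h (exp u)) =
      - of_real (exp (a * u) / pi) * (LINT t|lborel. w t * cis (u * t)) + (zeta_logderiv (of_real (2 * a)) - 1)"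
    and "norm (w t) \<le> 12 * (\<bar>Re (zeta_logderiv (Complex a t))\<bar> / (1 + \<bar>t\<bar>))"
proof -
  define g where "g x t = of_real (Re (zeta_logderiv (Complex a t))) * of_real x powr Complex a t /
      (Complex a t * (Complex a t + 1))" for x t
  have gi: "integrable lborel (g x)" if "x \<ge> 1" for x
    unfolding g_def[abs_def] by (rule explicit_formula(1)[OF nz a that])
  have w_eq: "w t = ((1 + of_real h) * g (1 + h) t - g 1 t) / of_real h" for t
    by (simp add: w_def g_def algebra_simps diff_divide_distrib add_divide_distrib)
  show "integrable lborel w"
    unfolding w_eq using gi[of 1] gi[of "1 + h"] h
    by (intro integrable_divide_zero Bochner_Integration.integrable_diff integrable_mult_right) auto
  show "complex_of_real (psi_error_quotient h (exp u)) =
      - of_real (exp (a * u) / pi) * (LINT t|lborel. w t * cis (u * t)) + (zeta_logderiv (of_real (2 * a)) - 1)"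
    if u: "u \<ge> 0"
  proof -
    define x where "x = exp u"
    define A where "A = zeta_logderiv (of_real (2 * a)) - 1"
    define B where "B = 1 / 2 - zeta_logderiv (of_real (2 * a + 1))"
    have x: "x \<ge> 1" "x > 0" using u by (auto simp: x_def)
    have hx: "(1 + h) * x \<ge> 1" using x h mult_mono[of 1 "1 + h" 1 x] by simp
    have f1: "complex_of_real (psi_error_integral x) = - of_real (x / pi) * (LINT t|lborel. g x t) + A * of_real x + B"
      unfolding g_def A_def B_def by (rule explicit_formula(2)[OF nz a x(1)])
    have f2: "complex_of_real (psi_error_integral ((1 + h) * x)) =
       - of_real ((1 + h) * x / pi) * (LINT t|lborel. g ((1 + h) * x) t) + A * of_real ((1 + h) * x) + B"
      unfolding g_def A_def B_def by (rule explicit_formula(2)[OF nz a hx])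
    have pw: "w t * cis (u * t) * (of_real h * of_real (exp (a * u))) = of_real (1 + h) * g ((1 + h) * x) t - g x t" for t
    proof -
      have "of_real x powr Complex a t = exp (Complex a t * of_real u)"
        by (simp add: powr_def x_def Ln_of_real)
      also have "\<dots> = of_real (exp (a * u)) * cis (u * t)"
        by (simp add: exp_eq_polar mult.commute)
      finally have px: "of_real x powr Complex a t = of_real (exp (a * u)) * cis (u * t)" .
      have phx: "of_real ((1 + h) * x) powr Complex a t = of_real (1 + h) powr Complex a t * of_real x powr Complex a t"
        unfolding of_real_mult using x h by (subst powr_times_real) auto
      have gx: "g x t = g 1 t * (of_real (exp (a * u)) * cis (u * t))"
        by (simp add: g_def px)
      have ghx: "g ((1 + h) * x) t = g (1 + h) t * (of_real (exp (a * u)) * cis (u * t))"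
        unfolding g_def phx px by simp
      show ?thesis unfolding gx ghx w_eq using h by (simp add: field_simps)
    qed
    have i12: "integrable lborel (g x)" "integrable lborel (g ((1 + h) * x))" using gi x hx by auto
    have "(LINT t|lborel. w t * cis (u * t)) * (of_real h * of_real (exp (a * u))) =
      (LINT t|lborel. w t * cis (u * t) * (of_real h * of_real (exp (a * u))))"
      by simp
    also have "\<dots> = (LINT t|lborel. of_real (1 + h) * g ((1 + h) * x) t - g x t)" by (simp only: pw)
    also have "\<dots> = of_real (1 + h) * (LINT t|lborel. g ((1 + h) * x) t) - (LINT t|lborel. g x t)"
      using i12 by (subst Bochner_Integration.integral_diff) auto
    finally have L: "(LINT t|lborel. w t * cis (u * t)) * (of_real h * of_real (exp (a * u))) =
      of_real (1 + h) * (LINT t|lborel. g ((1 + h) * x) t) - (LINT t|lborel. g x t)" .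
    \<comment> \<open>The constant term \<open>B\<close> cancels, and the linear term becomes the
      constant \<open>A\<close> after division by hx.\<close>
    have "complex_of_real (psi_error_integral ((1 + h) * x)) - complex_of_real (psi_error_integral x) =
      - of_real (x / pi) * (of_real (1 + h) * (LINT t|lborel. g ((1 + h) * x) t) - (LINT t|lborel. g x t)) + A * of_real (h * x)"
      unfolding f1 f2 by (simp add: algebra_simps add_divide_distrib)
    also have "\<dots> = of_real (h * x) * (- of_real (exp (a * u) / pi) * (LINT t|lborel. w t * cis (u * t)) + A)"
      unfolding L[symmetric] by (simp add: algebra_simps)
    finally have "complex_of_real (psi_error_integral ((1 + h) * x) - psi_error_integral x) / of_real (h * x) =
       - of_real (exp (a * u) / pi) * (LINT t|lborel. w t * cis (u * t)) + A"
      using h x by simp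
    then show ?thesis by (simp only: psi_error_quotient_def of_real_divide x_def A_def)
  qed
  show "norm (w t) \<le> 12 * (\<bar>Re (zeta_logderiv (Complex a t))\<bar> / (1 + \<bar>t\<bar>))"
  proof -
    define s where "s = Complex a t"
    have s0: "s + 1 \<noteq> 0" "s \<noteq> 0" using a by (auto simp: s_def complex_eq_iff)
    define l where "l = ln (1 + h)"
    have l: "0 \<le> l" "l \<le> h" using h ln_add_one_self_le_self[of h] by (auto simp: l_def)
    have "(1 + of_real h) * of_real (1 + h) powr s = exp ((s + 1) * of_real l)"
    proof -
      have "exp ((s + 1) * of_real l) = exp (of_real l) * exp (s * of_real l)"
        by (simp add: algebra_simps flip: exp_add)
      also have "exp (complex_of_real l) = of_real (exp l)" by (rule exp_of_real)
      also have "exp l = 1 + h" using h by (simp add: l_def)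
      also have "exp (s * of_real l) = of_real (1 + h) powr s"
      proof -
        have "complex_of_real (1 + h) \<noteq> 0" using h unfolding of_real_eq_0_iff by simp
        then show ?thesis using h by (simp add: powr_def l_def Ln_of_real del: of_real_add)
      qed
      finally show ?thesis by simp
    qed
    then have "norm ((1 + of_real h) * of_real (1 + h) powr s - 1) \<le> norm ((s + 1) * of_real l) * exp (Re ((s + 1) * of_real l))"
      using l a by (simp only:) (intro norm_exp_minus_1_le, simp add: s_def)
    also have "exp (Re ((s + 1) * of_real l)) \<le> 4"
    proof -
      have "Re ((s + 1) * of_real l) \<le> 2 * l" using a l by (simp add: s_def mult_right_mono)
      then have "exp (Re ((s + 1) * of_real l)) \<le> exp (2 * l)" by simp
      also have "\<dots> = (exp l)\<^sup>2" by (simp add: power2_eq_square flip: exp_add)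
      also have "exp l = 1 + h" using h by (simp add: l_def)
      also have "(1 + h)\<^sup>2 \<le> 2\<^sup>2" using h by (intro power_mono) auto
      finally show ?thesis by simp
    qed
    also have "norm ((s + 1) * of_real l) * 4 \<le> norm (s + 1) * h * 4"
      unfolding norm_mult norm_of_real using l by (intro mult_right_mono mult_left_mono) auto
    finally have num: "norm ((1 + of_real h) * of_real (1 + h) powr s - 1) \<le> norm (s + 1) * h * 4"
      by (simp add: mult_left_mono)
    have "norm (w t) = \<bar>Re (zeta_logderiv s)\<bar> * (norm ((1 + of_real h) * of_real (1 + h) powr s - 1) / (h * (norm s * norm (s + 1))))"
      unfolding w_def s_def[symmetric] norm_divide norm_mult norm_of_real using h by simp
    also have "\<dots> \<le> \<bar>Re (zeta_logderiv s)\<bar> * (norm (s + 1) * h * 4 / (h * (norm s * norm (s + 1))))"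
      using num h by (intro mult_left_mono divide_right_mono) auto
    also have "norm (s + 1) * h * 4 / (h * (norm s * norm (s + 1))) = 4 / norm s"
      using s0 h by simp
    also have "\<bar>Re (zeta_logderiv s)\<bar> * (4 / norm s) \<le> \<bar>Re (zeta_logderiv s)\<bar> * (4 / ((1 + \<bar>t\<bar>) / 3))"
      using norm_Complex_ge[of a t] a s0
      by (intro mult_left_mono divide_left_mono) (auto simp: s_def intro!: mult_pos_pos divide_pos_pos)
    finally show ?thesis by (simp add: s_def mult_ac)
  qed
qed

lemma step_integral_eq_of_no_nat:
  assumes "x \<le> y" "\<And>n. real n \<le> y \<Longrightarrow> real n \<le> x"
  shows "step_integral c y - step_integral c x = step_sum c x * (y - x)"
proof -
  have e: "{n. 1 \<le> n \<and> real n \<le> y} = {n. 1 \<le> n \<and> real n \<le> x}" using assms by force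
  have "step_integral c y - step_integral c x = (\<Sum>n | 1 \<le> n \<and> real n \<le> x. c n * (y - real n) - c n * (x - real n))"
    unfolding step_integral_def e by (simp add: sum_subtractf)
  also have "\<dots> = (\<Sum>n | 1 \<le> n \<and> real n \<le> x. c n * (y - x))" by (intro sum.cong) (auto simp: algebra_simps)
  finally show ?thesis by (simp add: step_sum_def sum_distrib_right)
qed

text \<open>For small h no integer lies in (x, (1 + h)x], so psi is constant between the two points
  and the quotient equals psi(x) - x(1 + h/2) exactly. As the increment is to the right, this holds
  at the jumps of psi as well.\<close>

lemma psi_error_quotient_tendsto:
  assumes x: "x \<ge> 1"
  shows "(\<lambda>n. psi_error_quotient (1 / real (Suc n)) x) \<longlonglongrightarrow> chebyshev_psi x - x"
proof -
  define m where "m = (of_int \<lfloor>x\<rfloor> + 1 :: real)"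
  have m: "x < m" unfolding m_def by linarith
  have ev: "\<forall>\<^sub>F n in sequentially. (1 + 1 / real (Suc n)) * x < m"
  proof -
    have "(\<lambda>n. (1 + 1 / real (Suc n)) * x) \<longlonglongrightarrow> (1 + 0) * x"
      by (intro tendsto_intros LIMSEQ_Suc[OF lim_1_over_n])
    then show ?thesis using order_tendstoD(2) m by fastforce
  qed
  have "\<forall>\<^sub>F n in sequentially. psi_error_quotient (1 / real (Suc n)) x = chebyshev_psi x - x * (1 + 1 / real (Suc n) / 2)"
    using ev
  proof eventually_elim
    case (elim n)
    define h where "h = 1 / real (Suc n)"
    have h: "h > 0" by (simp add: h_def)
    have "step_integral mangoldt ((1 + h) * x) - step_integral mangoldt x = step_sum mangoldt x * ((1 + h) * x - x)"
    proof (rule step_integral_eq_of_no_nat)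
      show "x \<le> (1 + h) * x" using x h by (simp add: distrib_right)
      fix k assume "real k \<le> (1 + h) * x"
      then have "real k < m" using elim by (simp add: h_def)
      then have "int k \<le> \<lfloor>x\<rfloor>" unfolding m_def by linarith
      then show "real k \<le> x" by linarith
    qed
    then have "psi_error_integral ((1 + h) * x) - psi_error_integral x = chebyshev_psi x * (h * x) - (((1 + h) * x)\<^sup>2 - x\<^sup>2) / 2"
      by (simp add: psi_error_integral_def chebyshev_psi_eq algebra_simps diff_divide_distrib)
    also have "\<dots> = (chebyshev_psi x - x * (1 + h / 2)) * (h * x)" by (simp add: power2_eq_square algebra_simps)
    finally show ?case unfolding psi_error_quotient_def h_def[symmetric] using h x by simp
  qed
  moreover have "(\<lambda>n. chebyshev_psi x - x * (1 + 1 / real (Suc n) / 2)) \<longlonglongrightarrow> chebyshev_psi x - x * (1 + 0 / 2)"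
    by (intro tendsto_intros LIMSEQ_Suc[OF lim_1_over_n]) auto
  ultimately show ?thesis by (simp add: tendsto_cong)
qed

lemma psi_error_quotient_measurable [measurable]: "psi_error_quotient h \<in> borel_measurable borel"
proof -
  have "step_integral mangoldt \<in> borel_measurable borel"
    by (intro borel_measurable_mono monoI step_integral_mono mangoldt_nonneg)
  then show ?thesis unfolding psi_error_quotient_def[abs_def] psi_error_integral_def[abs_def] by measurable
qed

text \<open>With x = exp u and U = log X, the factor exp u of the substitution equals X exp(-|u -
  U|) on [0, U], so the weight of \<open>Fourier_integral_weighted_square\<close> appears by itself.
  The square of x^a costs X^(2a), and X^(2a + 1) becomes X^2 as a -> 1/2.\<close>

lemma psi_error_quotient_square_bound:
  assumes nz: "\<And>s. Re s > 1 / 2 \<Longrightarrow> zeta_reg s \<noteq> 0"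
  obtains C where "C \<ge> 0"
    "\<And>h X. 0 < h \<Longrightarrow> h \<le> 1 \<Longrightarrow> X \<ge> 1 \<Longrightarrow>
      (\<integral>\<^sup>+x. ennreal ((psi_error_quotient h x)\<^sup>2) * indicator {1..X} x \<partial>lborel) \<le> ennreal (C * X\<^sup>2)"
proof -
  obtain C where C: "C \<ge> 0"
    "\<And>a. 1 / 2 < a \<Longrightarrow> a \<le> 3 / 4 \<Longrightarrow>
      (\<integral>\<^sup>+t. (\<integral>\<^sup>+t'. ennreal (\<bar>Re (zeta_logderiv (Complex a t))\<bar> / (1 + \<bar>t\<bar>) * (\<bar>Re (zeta_logderiv (Complex a t'))\<bar> / (1 + \<bar>t'\<bar>)) / (1 + (t - t')\<^sup>2)) \<partial>lborel) \<partial>lborel) \<le> ennreal C"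
    using double_mass_bound[OF nz] by blast
  obtain M where M: "M \<ge> 0"
    "\<And>a. 1 / 2 < a \<Longrightarrow> a \<le> 3 / 4 \<Longrightarrow> norm (zeta_logderiv (of_real (2 * a)) - 1) \<le> M"
    using zeta_logderiv_real_bound[OF nz] by metis
  \<comment> \<open>288 is 12 squared, from the bound on \<open>w\<close>, times the 2 of the
    Fourier transform.\<close>
  define B where "B = 288 * C"
  have B: "B \<ge> 0" using C by (simp add: B_def)
  show ?thesis
  proof (rule that[of "2 * B + 2 * M\<^sup>2"])
    show "2 * B + 2 * M\<^sup>2 \<ge> 0" using B by simp
    fix h X :: real assume h: "0 < h" "h \<le> 1" and X: "X \<ge> 1"
    define V where "V = (\<integral>\<^sup>+x. ennreal ((psi_error_quotient h x)\<^sup>2) * indicator {1..X} x \<partial>lborel)"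
    have "V \<le> ennreal (2 * X powr (2 * a + 1) * B + 2 * M\<^sup>2 * X)" if a: "1 / 2 < a" "a \<le> 3 / 4" for a
    proof -
      define U where "U = ln X"
      have U: "U \<ge> 0" "exp U = X" using X by (auto simp: U_def)
      define w where "w t = of_real (Re (zeta_logderiv (Complex a t))) *
        ((1 + of_real h) * of_real (1 + h) powr Complex a t - 1) / (of_real h * (Complex a t * (Complex a t + 1)))" for t
      have wi: "integrable lborel w" unfolding w_def[abs_def] by (rule psi_error_quotient_formula(1)[OF nz a h])
      define f where "f u = (LINT t|lborel. w t * cis (u * t))" for u
      define r where "r t = \<bar>Re (zeta_logderiv (Complex a t))\<bar>" for t
      have [measurable]: "r \<in> borel_measurable borel"
        unfolding r_def[abs_def] using zeta_logderiv_line_measurable[OF nz a(1)] by measurable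
      have wr: "norm (w t) \<le> 12 * (r t / (1 + \<bar>t\<bar>))" for t
        unfolding w_def r_def by (rule psi_error_quotient_formula(3)[OF nz a h])
      have "(\<integral>\<^sup>+t. (\<integral>\<^sup>+t'. ennreal (norm (w t) * norm (w t') * (2 / (1 + (t - t')\<^sup>2))) \<partial>lborel) \<partial>lborel) \<le>
         (\<integral>\<^sup>+t. (\<integral>\<^sup>+t'. ennreal 288 * ennreal (r t / (1 + \<bar>t\<bar>) * (r t' / (1 + \<bar>t'\<bar>)) / (1 + (t - t')\<^sup>2)) \<partial>lborel) \<partial>lborel)"
      proof (intro nn_integral_mono)
        fix t t' :: real
        have "norm (w t) * norm (w t') * (2 / (1 + (t - t')\<^sup>2)) \<le>
          (12 * (r t / (1 + \<bar>t\<bar>))) * (12 * (r t' / (1 + \<bar>t'\<bar>))) * (2 / (1 + (t - t')\<^sup>2))"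
          by (intro mult_right_mono mult_mono wr) (auto simp: r_def)
        also have "\<dots> = 288 * (r t / (1 + \<bar>t\<bar>) * (r t' / (1 + \<bar>t'\<bar>)) / (1 + (t - t')\<^sup>2))" by simp
        finally show "ennreal (norm (w t) * norm (w t') * (2 / (1 + (t - t')\<^sup>2))) \<le>
           ennreal 288 * ennreal (r t / (1 + \<bar>t\<bar>) * (r t' / (1 + \<bar>t'\<bar>)) / (1 + (t - t')\<^sup>2))"
          by (subst ennreal_mult'[symmetric]) (auto intro: ennreal_leI)
      qed
      also have "\<dots> = (\<integral>\<^sup>+t. ennreal 288 * (\<integral>\<^sup>+t'. ennreal (r t / (1 + \<bar>t\<bar>) * (r t' / (1 + \<bar>t'\<bar>)) / (1 + (t - t')\<^sup>2)) \<partial>lborel) \<partial>lborel)"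
        by (intro nn_integral_cong nn_integral_cmult) measurable
      also have "\<dots> = ennreal 288 * (\<integral>\<^sup>+t. (\<integral>\<^sup>+t'. ennreal (r t / (1 + \<bar>t\<bar>) * (r t' / (1 + \<bar>t'\<bar>)) / (1 + (t - t')\<^sup>2)) \<partial>lborel) \<partial>lborel)"
        by (intro nn_integral_cmult) measurable
      also have "\<dots> \<le> ennreal 288 * ennreal C" unfolding r_def by (intro mult_left_mono C(2) a) auto
      also have "\<dots> = ennreal B" using C(1) by (simp add: B_def ennreal_mult')
      finally have wB: "(\<integral>\<^sup>+t. (\<integral>\<^sup>+t'. ennreal (norm (w t) * norm (w t') * (2 / (1 + (t - t')\<^sup>2))) \<partial>lborel) \<partial>lborel) \<le> ennreal B" .
      have fB: "(\<integral>\<^sup>+u. ennreal ((norm (f u))\<^sup>2 * exp (- \<bar>u - U\<bar>)) \<partial>lborel) \<le> ennreal B"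
        unfolding f_def by (rule Fourier_integral_weighted_square(1)[OF wi wB])
      have [measurable]: "f \<in> borel_measurable borel"
        unfolding f_def[abs_def] by (rule borel_measurable_continuous_onI[OF Fourier_integral_weighted_square(2)[OF wi wB]])
      have pt: "(psi_error_quotient h (exp u))\<^sup>2 * exp u \<le>
          2 * X powr (2 * a + 1) * ((norm (f u))\<^sup>2 * exp (- \<bar>u - U\<bar>)) + 2 * M\<^sup>2 * exp u"
        if u: "0 \<le> u" "u \<le> U" for u
      proof -
        have "exp (a * u) * exp (a * u) * exp u = exp (2 * a * u) * exp U * exp (- \<bar>u - U\<bar>)"
          using u by (simp add: algebra_simps flip: exp_add)
        also have "\<dots> \<le> exp (2 * a * U) * exp U * exp (- \<bar>u - U\<bar>)"
          using u a by (intro mult_right_mono) auto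
        also have "exp (2 * a * U) * exp U = X powr (2 * a + 1)"
          using X by (simp add: powr_def U_def algebra_simps exp_add)
        finally have E: "exp (a * u) * exp (a * u) * exp u \<le> X powr (2 * a + 1) * exp (- \<bar>u - U\<bar>)" .
        have fe: "complex_of_real (psi_error_quotient h (exp u)) =
           - of_real (exp (a * u) / pi) * f u + (zeta_logderiv (of_real (2 * a)) - 1)"
          unfolding f_def w_def by (rule psi_error_quotient_formula(2)[OF nz a h u(1)])
        have "\<bar>psi_error_quotient h (exp u)\<bar> = norm (complex_of_real (psi_error_quotient h (exp u)))" by simp
        also have "\<dots> \<le> norm (- of_real (exp (a * u) / pi) * f u) + norm (zeta_logderiv (of_real (2 * a)) - 1)"
          unfolding fe by (rule norm_triangle_ineq)
        also have "norm (- of_real (exp (a * u) / pi) * f u) \<le> exp (a * u) * norm (f u)"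
          unfolding norm_mult norm_minus_cancel norm_of_real using pi_gt3
          by (intro mult_right_mono) (auto simp: divide_le_eq)
        finally have "\<bar>psi_error_quotient h (exp u)\<bar> \<le> exp (a * u) * norm (f u) + M"
          using M(2)[OF a] by linarith
        then have "\<bar>psi_error_quotient h (exp u)\<bar>\<^sup>2 \<le> (exp (a * u) * norm (f u) + M)\<^sup>2" by (intro power_mono) auto
        also have "\<dots> \<le> 2 * (exp (a * u) * norm (f u))\<^sup>2 + 2 * M\<^sup>2"
          using sum_squares_bound[of "exp (a * u) * norm (f u)" M] by (simp add: power2_sum)
        finally have "(psi_error_quotient h (exp u))\<^sup>2 * exp u \<le> (2 * (exp (a * u) * norm (f u))\<^sup>2 + 2 * M\<^sup>2) * exp u"
          by (intro mult_right_mono) auto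
        also have "\<dots> = 2 * (norm (f u))\<^sup>2 * (exp (a * u) * exp (a * u) * exp u) + 2 * M\<^sup>2 * exp u"
          by (simp add: power2_eq_square algebra_simps)
        also have "\<dots> \<le> 2 * (norm (f u))\<^sup>2 * (X powr (2 * a + 1) * exp (- \<bar>u - U\<bar>)) + 2 * M\<^sup>2 * exp u"
          by (intro add_right_mono mult_left_mono E) auto
        finally show ?thesis by (simp add: mult_ac)
      qed
      have "V = (\<integral>\<^sup>+x. ennreal ((psi_error_quotient h x)\<^sup>2) * indicator {exp 0..exp U} x \<partial>lborel)"
        by (simp add: V_def U)
      also have "\<dots> = (\<integral>\<^sup>+u. ennreal ((psi_error_quotient h (exp u))\<^sup>2) * ennreal (exp u) * indicator {0..U} u \<partial>lborel)"
      \<comment> \<open>For X = 1 both integrals extend over a single point; the substitution rule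
        is applied to a nondegenerate interval.\<close>
      proof (cases "U = 0")
        case True
        have "(\<integral>\<^sup>+x. F x * indicator {c} x \<partial>lborel) = integral\<^sup>N lborel (\<lambda>x::real. 0)" for F :: "real \<Rightarrow> ennreal" and c
          by (rule nn_integral_cong_AE) (use AE_lborel_singleton[of c] in \<open>auto elim!: eventually_mono simp: indicator_def\<close>)
        then show ?thesis using True by simp
      next
        case False
        then show ?thesis using U
          by (intro nn_integral_substitution_aux) (auto intro!: derivative_eq_intros continuous_intros)
      qed
      also have "\<dots> \<le> (\<integral>\<^sup>+u. ennreal (2 * X powr (2 * a + 1)) * ennreal ((norm (f u))\<^sup>2 * exp (- \<bar>u - U\<bar>)) +
           ennreal (2 * M\<^sup>2) * (ennreal (exp u) * indicator {0..U} u) \<partial>lborel)"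
      proof (intro nn_integral_mono)
        fix u :: real
        show "ennreal ((psi_error_quotient h (exp u))\<^sup>2) * ennreal (exp u) * indicator {0..U} u \<le>
           ennreal (2 * X powr (2 * a + 1)) * ennreal ((norm (f u))\<^sup>2 * exp (- \<bar>u - U\<bar>)) +
           ennreal (2 * M\<^sup>2) * (ennreal (exp u) * indicator {0..U} u)"
        proof (cases "u \<in> {0..U}")
          case True
          then have "ennreal ((psi_error_quotient h (exp u))\<^sup>2 * exp u) \<le>
             ennreal (2 * X powr (2 * a + 1) * ((norm (f u))\<^sup>2 * exp (- \<bar>u - U\<bar>)) + 2 * M\<^sup>2 * exp u)"
            by (intro ennreal_leI pt) auto
          then show ?thesis using True by (simp add: ennreal_mult' ennreal_plus)
        qed simp
      qed
      also have "\<dots> = ennreal (2 * X powr (2 * a + 1)) * (\<integral>\<^sup>+u. ennreal ((norm (f u))\<^sup>2 * exp (- \<bar>u - U\<bar>)) \<partial>lborel) +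
           ennreal (2 * M\<^sup>2) * (\<integral>\<^sup>+u. ennreal (exp u) * indicator {0..U} u \<partial>lborel)"
        by (subst nn_integral_add; (subst nn_integral_cmult)?; (subst nn_integral_cmult)?; measurable?)
      also have "(\<integral>\<^sup>+u. ennreal (exp u) * indicator {0..U} u \<partial>lborel) = ennreal (exp U - exp 0)"
        by (rule nn_integral_FTC_Icc) (use U in \<open>auto intro!: derivative_eq_intros\<close>)
      also have "ennreal (2 * X powr (2 * a + 1)) * (\<integral>\<^sup>+u. ennreal ((norm (f u))\<^sup>2 * exp (- \<bar>u - U\<bar>)) \<partial>lborel) +
           ennreal (2 * M\<^sup>2) * ennreal (exp U - exp 0) \<le>
          ennreal (2 * X powr (2 * a + 1)) * ennreal B + ennreal (2 * M\<^sup>2) * ennreal X"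
        using fB U by (intro add_mono mult_left_mono ennreal_leI) auto
      also have "\<dots> = ennreal (2 * X powr (2 * a + 1) * B + 2 * M\<^sup>2 * X)"
        using B X by (simp add: ennreal_mult' ennreal_plus)
      finally show ?thesis .
    qed
    note Vb = this
    have "V < \<infinity>" using Vb[of "3 / 4"] by (auto intro: le_less_trans)
    then obtain v where v: "V = ennreal v" "v \<ge> 0" by (cases V) auto
    have "v \<le> 2 * X powr (2 * (1 / 2) + 1) * B + 2 * M\<^sup>2 * X"
    proof (rule tendsto_bound_half[where f = "\<lambda>a. 2 * X powr (2 * a + 1) * B + 2 * M\<^sup>2 * X"])
      show "isCont (\<lambda>a. 2 * X powr (2 * a + 1) * B + 2 * M\<^sup>2 * X) (1 / 2)"
        using X by (intro continuous_intros) auto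
      fix a :: real assume "1 / 2 < a" "a \<le> 3 / 4"
      from Vb[OF this] have "ennreal v \<le> ennreal (2 * X powr (2 * a + 1) * B + 2 * M\<^sup>2 * X)" by (simp only: v(1))
      then show "v \<le> 2 * X powr (2 * a + 1) * B + 2 * M\<^sup>2 * X"
        using B X by (subst (asm) ennreal_le_iff) auto
    qed
    also have "X powr (2 * (1 / 2) + 1) = X\<^sup>2" using X by simp
    also have "2 * X\<^sup>2 * B + 2 * M\<^sup>2 * X \<le> 2 * X\<^sup>2 * B + 2 * M\<^sup>2 * X\<^sup>2"
      using X by (intro add_mono mult_left_mono) (auto simp: power2_eq_square)
    finally show "(\<integral>\<^sup>+x. ennreal ((psi_error_quotient h x)\<^sup>2) * indicator {1..X} x \<partial>lborel) \<le> ennreal ((2 * B + 2 * M\<^sup>2) * X\<^sup>2)"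
      unfolding V_def[symmetric] v by (intro ennreal_leI) (simp add: algebra_simps)
  qed
qed

lemma psi_error_square_integral_bound:
  assumes nz: "\<And>s. Re s > 1 / 2 \<Longrightarrow> zeta_reg s \<noteq> 0"
  obtains C where "C \<ge> 0" "\<And>X. X \<ge> 1 \<Longrightarrow> integral {0..X} (\<lambda>t. (chebyshev_psi t - t)\<^sup>2) \<le> C * X\<^sup>2"
proof -
  obtain C where C: "C \<ge> 0"
    "\<And>h X. 0 < h \<Longrightarrow> h \<le> 1 \<Longrightarrow> X \<ge> 1 \<Longrightarrow>
      (\<integral>\<^sup>+x. ennreal ((psi_error_quotient h x)\<^sup>2) * indicator {1..X} x \<partial>lborel) \<le> ennreal (C * X\<^sup>2)"
    using psi_error_quotient_square_bound[OF nz] by blast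
  show ?thesis
  proof (rule that[of "1 + C"])
    show "1 + C \<ge> 0" using C by simp
    fix X :: real assume X: "X \<ge> 1"
    have I: "(\<integral>\<^sup>+x. ennreal ((chebyshev_psi x - x)\<^sup>2) * indicator {1..X} x \<partial>lborel) \<le> ennreal (C * X\<^sup>2)"
    proof -
      have "(\<integral>\<^sup>+x. ennreal ((chebyshev_psi x - x)\<^sup>2) * indicator {1..X} x \<partial>lborel) =
        (\<integral>\<^sup>+x. liminf (\<lambda>n. ennreal ((psi_error_quotient (1 / real (Suc n)) x)\<^sup>2) * indicator {1..X} x) \<partial>lborel)"
      proof (intro nn_integral_cong)
        fix x :: real
        show "ennreal ((chebyshev_psi x - x)\<^sup>2) * indicator {1..X} x =
          liminf (\<lambda>n. ennreal ((psi_error_quotient (1 / real (Suc n)) x)\<^sup>2) * indicator {1..X} x)"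
        proof (cases "x \<in> {1..X}")
          case True
          then have "(\<lambda>n. ennreal ((psi_error_quotient (1 / real (Suc n)) x)\<^sup>2)) \<longlonglongrightarrow> ennreal ((chebyshev_psi x - x)\<^sup>2)"
            by (intro tendsto_ennrealI tendsto_power psi_error_quotient_tendsto) auto
          then have "liminf (\<lambda>n. ennreal ((psi_error_quotient (1 / real (Suc n)) x)\<^sup>2)) = ennreal ((chebyshev_psi x - x)\<^sup>2)"
            by (intro lim_imp_Liminf) auto
          then show ?thesis using True by simp
        qed (simp add: Liminf_const)
      qed
      also have "\<dots> \<le> liminf (\<lambda>n. \<integral>\<^sup>+x. ennreal ((psi_error_quotient (1 / real (Suc n)) x)\<^sup>2) * indicator {1..X} x \<partial>lborel)"
        by (rule nn_integral_liminf) measurable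
      also have "\<dots> \<le> liminf (\<lambda>n. ennreal (C * X\<^sup>2))"
        by (intro Liminf_mono always_eventually allI C(2)) (use X in auto)
      also have "\<dots> = ennreal (C * X\<^sup>2)" by (simp add: Liminf_const)
      finally show ?thesis .
    qed
    \<comment> \<open>On [0, 1) the error is -x, which adds at most 1 to the integral and is
      absorbed because X >= 1.\<close>
    have psi0: "chebyshev_psi x = 0" if "x < 1" for x
    proof -
      have "{n. 1 \<le> n \<and> real n \<le> x} = {}" using that by auto
      then show ?thesis by (simp only: chebyshev_psi_eq step_sum_def sum.empty)
    qed
    define f where "f x = (chebyshev_psi x - x)\<^sup>2 * indicator {0..X} x" for x
    have "(\<integral>\<^sup>+x. ennreal (f x) \<partial>lborel) \<le>
       (\<integral>\<^sup>+x. indicator {0..1::real} x + ennreal ((chebyshev_psi x - x)\<^sup>2) * indicator {1..X} x \<partial>lborel)"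
    proof (intro nn_integral_mono)
      fix x :: real
      show "ennreal (f x) \<le> indicator {0..1} x + ennreal ((chebyshev_psi x - x)\<^sup>2) * indicator {1..X} x"
      proof (cases "0 \<le> x \<and> x < 1")
        case True
        then have "x\<^sup>2 \<le> 1" by (simp add: power_le_one)
        then show ?thesis using True X by (auto simp: f_def psi0 indicator_def ennreal_le_1)
      qed (auto simp: f_def indicator_def)
    qed
    also have "\<dots> = 1 + (\<integral>\<^sup>+x. ennreal ((chebyshev_psi x - x)\<^sup>2) * indicator {1..X} x \<partial>lborel)"
      by (subst nn_integral_add) auto
    also have "\<dots> \<le> 1 + ennreal (C * X\<^sup>2)" by (intro add_left_mono I)
    also have "\<dots> = ennreal (1 + C * X\<^sup>2)" using C by (simp add: ennreal_plus)
    finally have fb: "(\<integral>\<^sup>+x. ennreal (f x) \<partial>lborel) \<le> ennreal (1 + C * X\<^sup>2)" .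
    then have "(\<integral>\<^sup>+x. ennreal (f x) \<partial>lborel) < \<infinity>" by (auto intro: le_less_trans)
    then obtain v where v: "(\<integral>\<^sup>+x. ennreal (f x) \<partial>lborel) = ennreal v" "v \<ge> 0"
      by (cases "\<integral>\<^sup>+x. ennreal (f x) \<partial>lborel") auto
    have "(f has_integral v) UNIV"
      by (rule nn_integral_has_integral) (use v in \<open>auto simp: f_def[abs_def]\<close>)
    then have "((\<lambda>x. if x \<in> {0..X} then (chebyshev_psi x - x)\<^sup>2 else 0) has_integral v) UNIV"
      by (rule has_integral_eq[rotated]) (auto simp: f_def)
    then have "((\<lambda>x. (chebyshev_psi x - x)\<^sup>2) has_integral v) {0..X}"
      by (simp only: has_integral_restrict_UNIV)
    then have "integral {0..X} (\<lambda>t. (chebyshev_psi t - t)\<^sup>2) = v" by (rule integral_unique)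
    also have "v \<le> 1 + C * X\<^sup>2" using fb[unfolded v(1)] C by (subst (asm) ennreal_le_iff) auto
    also have "\<dots> \<le> (1 + C) * X\<^sup>2" using X by (simp add: distrib_right)
    finally show "integral {0..X} (\<lambda>t. (chebyshev_psi t - t)\<^sup>2) \<le> (1 + C) * X\<^sup>2" .
  qed
qed


section \<open>Comparison of the Chebyshev functions\<close>

lemma finite_prime_power_pairs: "finite {(p, m). prime (p::nat) \<and> 1 \<le> m \<and> real (p ^ m) \<le> x}"
proof (rule finite_subset)
  show "{(p, m). prime (p::nat) \<and> 1 \<le> m \<and> real (p ^ m) \<le> x} \<subseteq> {..nat \<lfloor>x\<rfloor>} \<times> {..nat \<lfloor>x\<rfloor>}"
  proof safe
    fix p m :: nat assume p: "prime p" "1 \<le> m" "real (p ^ m) \<le> x"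
    then have le: "p ^ m \<le> nat \<lfloor>x\<rfloor>" by (simp only: le_nat_floor)
    have "p ^ 1 \<le> p ^ m" using p prime_gt_0_nat[of p] by (intro power_increasing) auto
    then show "p \<le> nat \<lfloor>x\<rfloor>" using le by simp
    have "m < 2 ^ m" by (rule less_exp)
    also have "2 ^ m \<le> p ^ m" using prime_ge_2_nat[OF p(1)] by (rule power_mono) simp
    finally show "m \<le> nat \<lfloor>x\<rfloor>" using le by simp
  qed
qed simp

lemma chebyshev_theta_le_psi: "chebyshev_theta x \<le> chebyshev_psi x"
  unfolding chebyshev_theta_eq chebyshev_psi_eq step_sum_def
  by (intro sum_mono) (auto simp: mangoldt_nonneg)

text \<open>A pair (p, m) with m >= 2 is halved to (p, m div 2), and p^(m div 2) <= sqrt x. The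
  parity of m is kept in the component {0, 1}, so each pair of the smaller sum is used at most
  twice.\<close>

lemma chebyshev_psi_minus_theta_le:
  assumes "x \<ge> 0"
  shows "chebyshev_psi x - chebyshev_theta x \<le> 2 * chebyshev_psi (sqrt x)"
proof -
  define A where "A = {(p, m). prime (p::nat) \<and> 1 \<le> m \<and> real (p ^ m) \<le> x}"
  define A1 where "A1 = (\<lambda>p. (p, 1::nat)) ` {p::nat. prime p \<and> real p \<le> x}"
  define B where "B = {(p, m). prime (p::nat) \<and> 1 \<le> m \<and> real (p ^ m) \<le> sqrt x}"
  have fin: "finite A" "finite B" unfolding A_def B_def by (rule finite_prime_power_pairs)+
  have A1: "A1 \<subseteq> A" by (auto simp: A1_def A_def)
  have th: "chebyshev_theta x = (\<Sum>(p, m)\<in>A1. ln (real p))"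
    unfolding A1_def chebyshev_theta_def by (subst sum.reindex) (auto simp: inj_on_def)
  have "chebyshev_psi x - chebyshev_theta x = (\<Sum>(p, m)\<in>A - A1. ln (real p))"
    unfolding th chebyshev_psi_def A_def[symmetric] by (simp only: sum_diff[OF fin(1) A1])
  also have "\<dots> \<le> (\<Sum>z\<in>B \<times> {0, 1::nat}. ln (real (fst (fst z))))"
  proof (rule sum_le_included[where i = "\<lambda>z. (fst (fst z), 2 * snd (fst z) + snd z)"])
    show "\<forall>z\<in>B \<times> {0, 1::nat}. 0 \<le> ln (real (fst (fst z)))"
      by (auto simp: B_def Suc_le_eq prime_gt_0_nat)
    show "\<forall>z\<in>A - A1. \<exists>y\<in>B \<times> {0, 1}. (fst (fst y), 2 * snd (fst y) + snd y) = z \<and>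
        (case z of (p, m) \<Rightarrow> ln (real p)) \<le> ln (real (fst (fst y)))"
    proof
      fix z assume z: "z \<in> A - A1"
      obtain p m where zz: "z = (p, m)" by (cases z)
      have p: "prime p" "1 \<le> m" "real (p ^ m) \<le> x" using z by (auto simp: zz A_def)
      have "m \<noteq> 1"
      proof
        assume "m = 1"
        then show False using z p by (auto simp: zz A1_def)
      qed
      then have m2: "m div 2 \<ge> 1" using p(2) by auto
      have "p ^ (m div 2 * 2) \<le> p ^ m" using prime_gt_0_nat[OF p(1)] by (intro power_increasing) auto
      then have "real (p ^ (m div 2 * 2)) \<le> x" using p(3) by (meson of_nat_mono order_trans)
      then have "real (p ^ (m div 2)) ^ 2 \<le> x" by (simp add: power_mult)
      then have "real (p ^ (m div 2)) \<le> sqrt x" by (rule real_le_rsqrt)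
      then have "(p, m div 2) \<in> B" using p m2 by (simp add: B_def)
      moreover have "m mod 2 \<in> {0, 1}" by auto
      ultimately show "\<exists>y\<in>B \<times> {0, 1}. (fst (fst y), 2 * snd (fst y) + snd y) = z \<and>
          (case z of (p, m) \<Rightarrow> ln (real p)) \<le> ln (real (fst (fst y)))"
        by (intro bexI[of _ "((p, m div 2), m mod 2)"]) (auto simp: zz)
    qed
  qed (use fin in auto)
  also have "\<dots> = (\<Sum>b\<in>B. \<Sum>r\<in>{0, 1::nat}. ln (real (fst b)))"
    by (subst sum.cartesian_product) (simp add: case_prod_beta')
  also have "\<dots> = 2 * chebyshev_psi (sqrt x)"
    unfolding chebyshev_psi_def B_def[symmetric] by (simp add: sum_distrib_left case_prod_beta')
  finally show ?thesis .
qed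

lemma chebyshev_psi_mono: "x \<le> y \<Longrightarrow> chebyshev_psi x \<le> chebyshev_psi y"
  unfolding chebyshev_psi_eq by (intro step_sum_mono mangoldt_nonneg)

lemma chebyshev_psi_nonneg: "chebyshev_psi x \<ge> 0"
  unfolding chebyshev_psi_eq by (intro step_sum_nonneg mangoldt_nonneg)

text \<open>This crude bound loses a logarithm, which is affordable where a factor x^e is at hand;
  the exact exponent relies on \<open>chebyshev_psi_linear_bound\<close>.\<close>

lemma chebyshev_psi_le_ln:
  assumes x: "x \<ge> 1"
  shows "chebyshev_psi x \<le> x * ln x"
proof -
  have "chebyshev_psi x \<le> (\<Sum>n | 1 \<le> n \<and> real n \<le> x. ln x)"
    unfolding chebyshev_psi_eq step_sum_def
  proof (intro sum_mono)
    fix n assume n: "n \<in> {n. 1 \<le> n \<and> real n \<le> x}"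
    then have "mangoldt n \<le> ln (real n)" by (intro mangoldt_le) auto
    also have "\<dots> \<le> ln x" using n x by simp
    finally show "mangoldt n \<le> ln x" .
  qed
  also have "\<dots> = real (card {n. 1 \<le> n \<and> real n \<le> x}) * ln x" by simp
  also have "{n. 1 \<le> n \<and> real n \<le> x} = {1..nat \<lfloor>x\<rfloor>}" using x by (auto simp: le_nat_floor le_nat_iff le_floor_iff)
  also have "real (card {1..nat \<lfloor>x\<rfloor>}) * ln x \<le> x * ln x"
    using x by (intro mult_right_mono) auto
  finally show ?thesis .
qed

lemma theta_error_integral_bounds:
  assumes x: "x \<ge> 0"
  shows "theta_error_integral x \<le> psi_error_integral x"
    and "psi_error_integral x - theta_error_integral x \<le> 2 * x * chebyshev_psi (sqrt x)"
proof -
  have ti: "((\<lambda>t. chebyshev_theta t - t) has_integral theta_error_integral x) {0..x}"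
    unfolding theta_error_integral_def chebyshev_theta_eq[abs_def]
    by (intro integrable_integral has_integral_integrable[OF has_integral_diff[OF has_integral_step_sum[OF x] has_integral_ident_0[OF x]]])
  note pt = has_integral_psi_error[OF x]
  show "theta_error_integral x \<le> psi_error_integral x"
    by (rule has_integral_le[OF ti pt]) (simp add: chebyshev_theta_le_psi)
  have "psi_error_integral x - theta_error_integral x \<le> 2 * chebyshev_psi (sqrt x) * (x - 0)"
  proof (rule has_integral_le[OF has_integral_diff[OF pt ti]])
    show "((\<lambda>t. 2 * chebyshev_psi (sqrt x)) has_integral 2 * chebyshev_psi (sqrt x) * (x - 0)) {0..x}"
      using has_integral_const_real[of "2 * chebyshev_psi (sqrt x)" 0 x] x by (simp add: mult_ac)
    fix t assume t: "t \<in> {0..x}"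
    then have "chebyshev_psi t - chebyshev_theta t \<le> 2 * chebyshev_psi (sqrt t)"
      by (intro chebyshev_psi_minus_theta_le) auto
    also have "\<dots> \<le> 2 * chebyshev_psi (sqrt x)" using t by (simp add: chebyshev_psi_mono)
    finally show "chebyshev_psi t - t - (chebyshev_theta t - t) \<le> 2 * chebyshev_psi (sqrt x)" by simp
  qed
  then show "psi_error_integral x - theta_error_integral x \<le> 2 * x * chebyshev_psi (sqrt x)" by (simp add: mult_ac)
qed

text \<open>As psi is nondecreasing, y psi(y) is at most its integral over [y, 2y], that is (3/2)y^2
  plus a difference of two values of the error integral. The result keeps a logarithm out of
  psi(sqrt x), and so out of the passage from psi to theta at the exponent 3/2.\<close>

lemma chebyshev_psi_linear_bound:
  assumes C: "C \<ge> 0" "\<And>x. x \<ge> 1 \<Longrightarrow> \<bar>psi_error_integral x\<bar> \<le> C * x powr (3 / 2)" and y: "y \<ge> 1"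
  shows "chebyshev_psi y \<le> (5 * C + 2) * y"
proof -
  have C2: "\<bar>psi_error_integral x\<bar> \<le> C * x\<^sup>2" if x: "x \<ge> 1" for x
  proof -
    have "\<bar>psi_error_integral x\<bar> \<le> C * x powr (3 / 2)" by (rule C(2)[OF x])
    also have "\<dots> \<le> C * x powr 2" using C(1) x by (intro mult_left_mono powr_mono) auto
    finally show ?thesis using x by simp
  qed
  have "y * chebyshev_psi y = (\<Sum>n | 1 \<le> n \<and> real n \<le> y. mangoldt n * (2 * y - real n)) - step_integral mangoldt y"
    unfolding chebyshev_psi_eq step_sum_def step_integral_def sum_distrib_left sum_subtractf[symmetric]
    by (intro sum.cong) (auto simp: algebra_simps)
  also have "\<dots> \<le> step_integral mangoldt (2 * y) - step_integral mangoldt y"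
    unfolding step_integral_def using y
    by (intro diff_right_mono sum_mono2 finite_nat_le_real) (auto intro!: mult_nonneg_nonneg mangoldt_nonneg)
  also have "\<dots> = psi_error_integral (2 * y) - psi_error_integral y + 3 / 2 * y\<^sup>2"
    by (simp add: psi_error_integral_def power_mult_distrib)
  also have "\<dots> \<le> C * (2 * y)\<^sup>2 + C * y\<^sup>2 + 2 * y\<^sup>2"
    using C2[of y] C2[of "2 * y"] y by (intro add_mono) auto
  also have "\<dots> = y * ((5 * C + 2) * y)" by (simp add: power2_eq_square algebra_simps)
  finally show ?thesis using y by simp
qed

section \<open>From the error terms back to the zeros\<close>

text \<open>
  Summing twice by parts replaces the coefficients $\Lambda(n) - 1$ of $-\zeta'/\zeta - \zeta$ by
  the error integral of $\psi$ at integers, which gains the continuation to the left of 1.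
\<close>

lemma double_partial_summation:
  fixes c f :: "nat \<Rightarrow> complex"
  defines "S \<equiv> \<lambda>n. \<Sum>i<n. c i" and "T \<equiv> \<lambda>n. \<Sum>i<n. (\<Sum>j<Suc i. c j)"
  shows "(\<Sum>i<M. c i * f i) = S M * f M - T M * (f (Suc M) - f M) +
    (\<Sum>i<M. T (Suc i) * (f (Suc (Suc i)) - 2 * f (Suc i) + f i))"
  by (induction M) (simp_all add: S_def T_def algebra_simps)

lemma sum_of_partial_sums:
  fixes c :: "nat \<Rightarrow> 'a :: comm_ring_1"
  shows "(\<Sum>i<M. \<Sum>j<Suc i. c j) = (\<Sum>j<M. c j * of_nat (M - j))"
proof (induction M)
  case (Suc M)
  have "(\<Sum>j<Suc M. c j * of_nat (Suc M - j)) = (\<Sum>j<Suc M. c j * of_nat (M - j) + c j)"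
    by (intro sum.cong) (auto simp: Suc_diff_le algebra_simps)
  also have "\<dots> = (\<Sum>j<M. c j * of_nat (M - j)) + (\<Sum>j<Suc M. c j)" by (simp add: sum.distrib)
  finally show ?case using Suc by simp
qed simp

text \<open>The mean value inequality is used for the difference f(z + 1) - f(z) and then for f'.
  What remains is the second derivative s(s + 1)z^(-s-2), whose modulus is largest at the left end
  point because Re s >= 0.\<close>

lemma norm_second_difference_powr:
  fixes s :: complex
  assumes s: "Re s \<ge> 0" and n: "n \<ge> 1"
  shows "norm (of_nat (Suc (Suc n)) powr - s - 2 * of_nat (Suc n) powr - s + of_nat n powr - s) \<le>
    norm s * norm (s + 1) * real n powr (- Re s - 2)"
proof -
  define f f1 f2 :: "complex \<Rightarrow> complex"
    where "f z = z powr - s" and "f1 z = - s * z powr (- s - 1)" and "f2 z = s * (s + 1) * z powr (- s - 2)" for z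
  define N where "N = real n"
  have N: "N \<ge> 1" using n by (simp add: N_def)
  define L where "L a b = complex_of_real ` {a..b::real}" for a b
  have cl: "convex (L a b)" for a b
    unfolding L_def by (intro convex_linear_image convex_real_interval) (simp add: linear_of_real)
  have Lmem: "a \<le> t \<Longrightarrow> t \<le> b \<Longrightarrow> of_real t \<in> L a b" for a b t by (simp add: L_def)
  have d1: "(f has_field_derivative f1 z) (at z)" "(f1 has_field_derivative f2 z) (at z)" if "Re z > 0" for z
  proof -
    have z: "z \<notin> \<real>\<^sub>\<le>\<^sub>0" using that complex_nonpos_Reals_iff by auto
    show "(f has_field_derivative f1 z) (at z)" unfolding f_def f1_def
      by (rule derivative_eq_intros z refl | simp)+
    show "(f1 has_field_derivative f2 z) (at z)" unfolding f1_def f2_def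
      by (rule derivative_eq_intros z refl | simp add: algebra_simps)+
  qed
  define K where "K = norm s * norm (s + 1) * N powr (- Re s - 2)"
  have f2b: "norm (f2 (of_real x)) \<le> K" if "x \<ge> N" for x
  proof -
    have "norm (f2 (of_real x)) = norm s * norm (s + 1) * x powr (- Re s - 2)"
      using that N by (simp add: f2_def norm_mult norm_powr_real_powr)
    also have "\<dots> \<le> K" unfolding K_def using that N s by (intro mult_left_mono powr_mono2') auto
    finally show ?thesis .
  qed
  have f1b: "norm (f1 (of_real x + 1) - f1 (of_real x)) \<le> K" if x: "x \<ge> N" for x
  proof -
    have "norm (f1 (of_real (x + 1)) - f1 (of_real x)) \<le> K * norm (complex_of_real (x + 1) - of_real x)"
    proof (rule field_differentiable_bound[where S = "L x (x + 1)" and f' = f2, OF cl])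
      fix z assume "z \<in> L x (x + 1)"
      then obtain t where t: "z = of_real t" "t \<ge> x" by (auto simp: L_def)
      then show "norm (f2 z) \<le> K" using f2b x by auto
      show "(f1 has_field_derivative f2 z) (at z within L x (x + 1))"
        using t x N by (intro has_field_derivative_at_within[OF d1(2)]) auto
    qed (auto intro!: Lmem simp del: of_real_add)
    then show ?thesis by simp
  qed
  have "norm ((\<lambda>z. f (z + 1) - f z) (of_real (N + 1)) - (\<lambda>z. f (z + 1) - f z) (of_real N)) \<le>
     K * norm (complex_of_real (N + 1) - of_real N)"
  proof (rule field_differentiable_bound[where S = "L N (N + 1)" and f' = "\<lambda>z. f1 (z + 1) - f1 z", OF cl])
    fix z assume "z \<in> L N (N + 1)"
    then obtain t where t: "z = of_real t" "t \<ge> N" by (auto simp: L_def)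
    show "norm (f1 (z + 1) - f1 z) \<le> K" unfolding t(1) by (rule f1b[OF t(2)])
    have "((\<lambda>z. f (z + 1)) has_field_derivative f1 (z + 1)) (at z)"
      using DERIV_shift[of f "f1 (z + 1)" z 1] d1(1)[of "z + 1"] t N by simp
    moreover have "(f has_field_derivative f1 z) (at z)" using d1(1)[of z] t N by simp
    ultimately show "((\<lambda>z. f (z + 1) - f z) has_field_derivative f1 (z + 1) - f1 z) (at z within L N (N + 1))"
      by (intro has_field_derivative_at_within[OF DERIV_diff])
  qed (auto intro!: Lmem simp del: of_real_add)
  then have "norm (f (of_real (N + 1) + 1) - f (of_real (N + 1)) - (f (of_real N + 1) - f (of_real N))) \<le> K" by simp
  also have "f (of_real (N + 1) + 1) - f (of_real (N + 1)) - (f (of_real N + 1) - f (of_real N)) =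
     of_nat (Suc (Suc n)) powr - s - 2 * of_nat (Suc n) powr - s + of_nat n powr - s"
    by (simp add: f_def N_def algebra_simps)
  finally show ?thesis by (simp add: K_def N_def)
qed

text \<open>The sum of psi(k) - k over 1 <= k <= M, that is, the second summatory function of
  mangoldt(n) - 1; the shift in \<open>Suc j\<close> is due to sequences starting at 0.\<close>

definition psi_excess :: "nat \<Rightarrow> real" where
  "psi_excess M = (\<Sum>i<M. \<Sum>j<Suc i. mangoldt (Suc j) - 1)"

text \<open>Between integers psi is constant, so its integral over [0, M + 1] is psi(1) + ... +
  psi(M); the extra (M + 1)/2 is the difference between (M + 1)^2/2 and 1 + ... + M.\<close>

lemma psi_excess_eq: "psi_excess M = psi_error_integral (real (Suc M)) + real (Suc M) / 2"
proof -
  have "(\<Sum>j<M. real (M - j)) = real M * real (Suc M) / 2"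
  proof (induction M)
    case (Suc M)
    have "(\<Sum>j<Suc M. real (Suc M - j)) = (\<Sum>j<Suc M. real (M - j) + 1)"
      by (intro sum.cong) (auto simp: Suc_diff_le)
    also have "\<dots> = (\<Sum>j<M. real (M - j)) + real (Suc M)" by (simp add: sum.distrib)
    finally show ?case unfolding Suc by (simp add: algebra_simps add_divide_distrib)
  qed simp
  moreover have "psi_excess M = (\<Sum>j<M. (mangoldt (Suc j) - 1) * real (M - j))"
    unfolding psi_excess_def by (rule sum_of_partial_sums)
  ultimately have 1: "psi_excess M = (\<Sum>j<M. mangoldt (Suc j) * real (M - j)) - real M * real (Suc M) / 2"
    by (simp add: left_diff_distrib sum_subtractf)
  have "step_integral mangoldt (real (Suc M)) = (\<Sum>n\<in>Suc ` {..<Suc M}. mangoldt n * (real (Suc M) - real n))"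
    unfolding step_integral_def by (rule sum.cong) (auto simp: image_iff Suc_le_eq gr0_conv_Suc less_Suc_eq_le)
  also have "\<dots> = (\<Sum>j<Suc M. mangoldt (Suc j) * (real (Suc M) - real (Suc j)))"
    by (subst sum.reindex) auto
  also have "\<dots> = (\<Sum>j<M. mangoldt (Suc j) * (real (Suc M) - real (Suc j)))" by simp
  also have "\<dots> = (\<Sum>j<M. mangoldt (Suc j) * real (M - j))"
    by (intro sum.cong) (auto simp: of_nat_diff)
  finally show ?thesis unfolding 1 psi_error_integral_def
    by (simp add: power2_eq_square algebra_simps add_divide_distrib)
qed

text \<open>In the range Re s > 3 the trivial estimates S(n) = O(n^2) and T(n) = O(n^3) dispose of
  the boundary terms of the double summation by parts; the identity is continued to the left
  afterwards.\<close>

lemma vonMangoldt_minus_zeta_sums: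
  assumes s: "Re s > 3"
  shows "(\<lambda>i. of_real (psi_excess (Suc i)) *
     (of_nat (Suc (Suc (Suc i))) powr - s - 2 * of_nat (Suc (Suc i)) powr - s + of_nat (Suc i) powr - s)) sums
     (vonMangoldt_series s - riemann_zeta s)"
proof -
  define c :: "nat \<Rightarrow> complex" where "c i = mangoldt (Suc i) - 1" for i
  define f where "f i = of_nat (Suc i) powr - s" for i
  define S where "S n = (\<Sum>i<n. c i)" for n
  define T where "T n = (\<Sum>i<n. (\<Sum>j<Suc i. c j))" for n
  have "(\<lambda>n. mangoldt (Suc n) / of_nat (Suc n) powr s) sums vonMangoldt_series s"
    using vonMangoldt_sums[of s] s by (subst sums_Suc_iff) simp
  moreover have "(\<lambda>n. 1 / of_nat (Suc n) powr s) sums riemann_zeta s"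
    using s by (intro riemann_zeta_sums) auto
  ultimately have "(\<lambda>n. mangoldt (Suc n) / of_nat (Suc n) powr s - 1 / of_nat (Suc n) powr s) sums
      (vonMangoldt_series s - riemann_zeta s)"
    by (rule sums_diff)
  then have cf: "(\<lambda>i. c i * f i) sums (vonMangoldt_series s - riemann_zeta s)"
    by (simp add: c_def f_def powr_minus_divide diff_divide_distrib left_diff_distrib)
  have nc: "norm (c i) \<le> real (Suc i)" for i
  proof -
    have "mangoldt (Suc i) \<le> ln (real (Suc i))" by (rule mangoldt_le) simp
    also have "\<dots> \<le> real (Suc i) - 1" by (rule ln_le_minus_one) simp
    finally have "norm (mangoldt (Suc i) :: complex) \<le> real i" by simp
    then show ?thesis using norm_triangle_ineq4[of "mangoldt (Suc i)" "1::complex"] by (simp add: c_def)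
  qed
  have nS: "norm (S n) \<le> real (Suc n) ^ 2" for n
  proof -
    have "norm (S n) \<le> (\<Sum>i<n. real (Suc n))" unfolding S_def
      by (rule sum_norm_le) (auto intro: order_trans[OF nc])
    also have "\<dots> \<le> real (Suc n) ^ 2" by (simp add: power2_eq_square mult_right_mono)
    finally show ?thesis .
  qed
  have nT: "norm (T n) \<le> real (Suc n) ^ 3" for n
  proof -
    have "norm (T n) \<le> (\<Sum>i<n. real (Suc n) ^ 2)" unfolding T_def S_def[symmetric]
    proof (rule sum_norm_le)
      fix i assume "i \<in> {..<n}"
      then show "norm (S (Suc i)) \<le> real (Suc n) ^ 2"
        by (intro order_trans[OF nS] power_mono) auto
    qed
    also have "\<dots> \<le> real (Suc n) ^ 3" by (simp add: power3_eq_cube power2_eq_square mult_right_mono)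
    finally show ?thesis .
  qed
  have nf: "norm (f n) = real (Suc n) powr - Re s" for n
    by (simp add: f_def norm_powr_real_powr del: of_nat_Suc)
  have lim: "(\<lambda>n. real (Suc n) powr (3 - Re s)) \<longlonglongrightarrow> 0"
    using s by (intro tendsto_neg_powr filterlim_compose[OF filterlim_real_sequentially filterlim_Suc]) auto
  have bS: "(\<lambda>n. S n * f n) \<longlonglongrightarrow> 0"
  proof (rule Lim_null_comparison[OF always_eventually[OF allI] lim])
    fix n
    have "norm (S n * f n) \<le> real (Suc n) ^ 2 * real (Suc n) powr - Re s"
      unfolding norm_mult nf by (intro mult_right_mono nS) auto
    also have "\<dots> = real (Suc n) powr 2 * real (Suc n) powr - Re s" by simp
    also have "\<dots> = real (Suc n) powr (2 - Re s)" by (simp only: powr_add[symmetric]) simp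
    also have "\<dots> \<le> real (Suc n) powr (3 - Re s)" by (intro powr_mono) auto
    finally show "norm (S n * f n) \<le> real (Suc n) powr (3 - Re s)" .
  qed
  have bT: "(\<lambda>n. T n * (f (Suc n) - f n)) \<longlonglongrightarrow> 0"
  proof (rule Lim_null_comparison[OF always_eventually[OF allI]])
    show "(\<lambda>n. 2 * real (Suc n) powr (3 - Re s)) \<longlonglongrightarrow> 0" using tendsto_mult[OF tendsto_const lim, of 2] by simp
    fix n
    have "norm (f (Suc n)) \<le> norm (f n)" unfolding nf using s by (intro powr_mono2') auto
    then have "norm (f (Suc n) - f n) \<le> 2 * real (Suc n) powr - Re s"
      using norm_triangle_ineq4[of "f (Suc n)" "f n"] unfolding nf by linarith
    then have "norm (T n * (f (Suc n) - f n)) \<le> real (Suc n) ^ 3 * (2 * real (Suc n) powr - Re s)"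
      unfolding norm_mult by (intro mult_mono nT) auto
    also have "\<dots> = 2 * (real (Suc n) powr 3 * real (Suc n) powr - Re s)" by simp
    also have "\<dots> = 2 * real (Suc n) powr (3 - Re s)" by (simp only: powr_add[symmetric]) simp
    finally show "norm (T n * (f (Suc n) - f n)) \<le> 2 * real (Suc n) powr (3 - Re s)" .
  qed
  have Te: "T n = of_real (psi_excess n)" for n
    by (simp add: T_def psi_excess_def c_def)
  have "(\<lambda>M. \<Sum>i<M. T (Suc i) * (f (Suc (Suc i)) - 2 * f (Suc i) + f i)) \<longlonglongrightarrow> (vonMangoldt_series s - riemann_zeta s) - 0 + 0"
  proof (rule Lim_transform_eventually)
    show "(\<lambda>M. (\<Sum>i<M. c i * f i) - S M * f M + T M * (f (Suc M) - f M)) \<longlonglongrightarrow> (vonMangoldt_series s - riemann_zeta s) - 0 + 0"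
      using cf unfolding sums_def by (intro tendsto_add tendsto_diff bS bT)
    show "\<forall>\<^sub>F M in sequentially. (\<Sum>i<M. c i * f i) - S M * f M + T M * (f (Suc M) - f M) =
        (\<Sum>i<M. T (Suc i) * (f (Suc (Suc i)) - 2 * f (Suc i) + f i))"
      unfolding S_def T_def by (intro always_eventually allI) (subst double_partial_summation, simp)
  qed
  then show ?thesis by (simp add: sums_def Te f_def)
qed

text \<open>The terms of the series are products of O(n^(3/2 + e)) from \<open>psi_excess\<close>
  and O(n^(-Re s - 2)) from the second difference; the total exponent is below -1 exactly when Re s
  > 1/2 + e.\<close>

lemma zeta_reg_nonzero_of_psi_error_bound:
  assumes e: "0 < e" "e \<le> 1" and C: "C \<ge> 0"
    and bd: "\<And>x. x \<ge> 1 \<Longrightarrow> \<bar>psi_error_integral x\<bar> \<le> C * x powr (3 / 2 + e)"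
    and z: "Re z > 1 / 2 + e"
  shows "zeta_reg z \<noteq> 0"
proof -
  define S where "S = {s. Re s > 1 / 2 + e}"
  define g where "g i s = of_real (psi_excess (Suc i)) *
     (of_nat (Suc (Suc (Suc i))) powr - s - 2 * of_nat (Suc (Suc i)) powr - s + of_nat (Suc i) powr - s)" for i and s :: complex
  have ex: "\<bar>psi_excess (Suc i)\<bar> \<le> 8 * (C + 1) * real (Suc i) powr (3 / 2 + e)" for i
  proof -
    define x where "x = real (Suc (Suc i))"
    have x: "x \<ge> 1" by (simp add: x_def)
    \<comment> \<open>Here x = i + 2 <= 2(i + 1), and 8 = 2^3 bounds 2^(3/2 + e) because e <=
      1.\<close>
    have "x powr (3 / 2 + e) \<le> (2 * real (Suc i)) powr (3 / 2 + e)"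
      using e by (intro powr_mono2) (auto simp: x_def)
    also have "\<dots> = 2 powr (3 / 2 + e) * real (Suc i) powr (3 / 2 + e)" by (rule powr_mult)
    also have "\<dots> \<le> 2 powr 3 * real (Suc i) powr (3 / 2 + e)" using e by (intro mult_right_mono powr_mono) auto
    finally have p: "x powr (3 / 2 + e) \<le> 8 * real (Suc i) powr (3 / 2 + e)" by simp
    have "\<bar>psi_excess (Suc i)\<bar> \<le> \<bar>psi_error_integral x\<bar> + x / 2"
      unfolding psi_excess_eq x_def[symmetric] using x by linarith
    also have "\<dots> \<le> C * x powr (3 / 2 + e) + x powr 1" using bd[OF x] x by (intro add_mono) auto
    also have "\<dots> \<le> C * x powr (3 / 2 + e) + x powr (3 / 2 + e)" using x e by (intro add_left_mono powr_mono) auto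
    also have "\<dots> = (C + 1) * x powr (3 / 2 + e)" by (simp add: algebra_simps)
    also have "\<dots> \<le> (C + 1) * (8 * real (Suc i) powr (3 / 2 + e))" using C by (intro mult_left_mono p) auto
    finally show ?thesis by (simp only: mult_ac)
  qed
  have ghol: "g i holomorphic_on A" for i A
    unfolding g_def by (intro holomorphic_intros) (auto simp del: of_nat_Suc)
  have gbd: "\<exists>h. summable h \<and> (\<forall>\<^sub>F i in sequentially. \<forall>s\<in>cball s0 d. norm (g i s) \<le> h i)"
    if d: "d > 0" "Re s0 - d > 1 / 2 + e" for s0 d
  proof -
    define R where "R = norm s0 + d + 1"
    have R: "R \<ge> 0" using d by (simp add: R_def)
    have "norm (g i s) \<le> 8 * (C + 1) * (R * R) * real (Suc i) powr - (Re s0 - d + 1 / 2 - e)" if s: "s \<in> cball s0 d" for i s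
    proof -
      have re: "Re s \<ge> Re s0 - d" by (rule cball_Re_ge[OF s])
      have ns: "norm s \<le> norm s0 + d" using s norm_triangle_ineq2[of s s0] by (simp add: dist_norm norm_minus_commute)
      have ns1: "norm s \<le> R" "norm (s + 1) \<le> R" using ns norm_triangle_ineq[of s 1] by (auto simp: R_def)
      have "norm (g i s) \<le> (8 * (C + 1) * real (Suc i) powr (3 / 2 + e)) * (norm s * norm (s + 1) * real (Suc i) powr (- Re s - 2))"
        unfolding g_def norm_mult norm_of_real using re d e C
        by (intro mult_mono ex norm_second_difference_powr) auto
      also have "\<dots> \<le> (8 * (C + 1) * real (Suc i) powr (3 / 2 + e)) * (R * R * real (Suc i) powr (- (Re s0 - d) - 2))"
        using ns1 R re C by (intro mult_left_mono mult_mono powr_mono) auto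
      also have "\<dots> = 8 * (C + 1) * (R * R) * (real (Suc i) powr (3 / 2 + e) * real (Suc i) powr (- (Re s0 - d) - 2))"
        by (simp only: mult_ac)
      also have "real (Suc i) powr (3 / 2 + e) * real (Suc i) powr (- (Re s0 - d) - 2) = real (Suc i) powr - (Re s0 - d + 1 / 2 - e)"
        unfolding powr_add[symmetric] by (rule arg_cong) simp
      finally show ?thesis .
    qed
    moreover have "summable (\<lambda>i. 8 * (C + 1) * (R * R) * real (Suc i) powr - (Re s0 - d + 1 / 2 - e))"
      using d by (intro summable_mult summable_powr_Suc) auto
    ultimately show ?thesis by (intro exI[of _ "\<lambda>i. 8 * (C + 1) * (R * R) * real (Suc i) powr - (Re s0 - d + 1 / 2 - e)"]) auto
  qed
  define G where "G s = (\<Sum>i. g i s)" for s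
  have Ghol: "G holomorphic_on S"
    unfolding G_def S_def by (rule holomorphic_suminf_Re_gt(1)[OF ghol gbd])
  \<comment> \<open>The first part is 1/(s - 1) - zeta(s) with its singularity at 1 removed. For Re
    s > 3 the terms in zeta cancel against those in \<open>G\<close>, and \<open>Q\<close> is 1/(s -
    1) - vonMangoldt_series(s).\<close>
  define Q where "Q s = - (if s = 1 then deriv zeta_reg 1 else (zeta_reg s - zeta_reg 1) / (s - 1)) - G s" for s
  have Qhol: "Q holomorphic_on S" unfolding Q_def
    by (intro holomorphic_on_diff holomorphic_on_minus Ghol pole_lemma_open zeta_reg_holomorphic) (simp add: S_def open_Re_gt)
  have ode: "(zeta_reg has_field_derivative Q s * zeta_reg s) (at s)" if s: "s \<in> S" for s
  proof -
    have "deriv zeta_reg s = Q s * zeta_reg s"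
    proof (rule analytic_continuation_open[of "{s. Re s > 3}" S "deriv zeta_reg" "\<lambda>s. Q s * zeta_reg s"])
      show "{s :: complex. Re s > 3} \<noteq> {}" by (auto intro!: exI[of _ 4])
      show "deriv zeta_reg holomorphic_on S"
        by (rule holomorphic_deriv[OF zeta_reg_holomorphic]) (simp add: S_def open_Re_gt)
      show "(\<lambda>s. Q s * zeta_reg s) holomorphic_on S" by (intro holomorphic_intros Qhol zeta_reg_holomorphic)
      fix t :: complex assume "t \<in> {s. Re s > 3}"
      then have t: "Re t > 3" "t \<noteq> 1" by auto
      have "G t = vonMangoldt_series t - riemann_zeta t"
        using vonMangoldt_minus_zeta_sums[OF t(1)] by (simp add: G_def g_def sums_iff)
      then have "Q t = 1 / (t - 1) - vonMangoldt_series t"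
        using t by (simp add: Q_def zeta_reg_def diff_divide_distrib)
      also have "\<dots> = zeta_logderiv t" using zeta_logderiv_Re_gt_1[of t] t by simp
      finally show "deriv zeta_reg t = Q t * zeta_reg t"
        using zeta_reg_nonzero_Re_ge_1[of t] t by (simp add: zeta_logderiv_def)
    qed (use s e in \<open>auto simp: S_def open_Re_gt connected_Re_gt\<close>)
    then show ?thesis using holomorphic_derivI[OF zeta_reg_holomorphic[of UNIV], of s UNIV] by simp
  qed
  show ?thesis
    by (rule linear_ode_nonzero[of S Q zeta_reg 2 z])
       (use Qhol ode z e zeta_reg_nonzero_Re_ge_1[of 2] in \<open>auto simp: S_def open_Re_gt convex_halfspace_Re_gt\<close>)
qed

lemma Riemann_Hypothesis_of_psi_error:
  assumes "\<And>e. e > 0 \<Longrightarrow> psi_error_integral \<in> O[at_top](\<lambda>x. x powr (3 / 2 + e))"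
  shows Riemann_Hypothesis
  unfolding RH_iff_zeta_reg_nonzero
proof (intro allI impI)
  fix s assume s: "Re s > 1 / 2"
  define e where "e = min 1 ((Re s - 1 / 2) / 2)"
  have e: "0 < e" "e \<le> 1" "Re s > 1 / 2 + e" using s by (auto simp: e_def min_def field_simps)
  obtain c where c: "c > 0" "\<forall>\<^sub>F x in at_top. norm (psi_error_integral x) \<le> c * norm (x powr (3 / 2 + e))"
    using landau_o.bigE[OF assms[OF e(1)]] by blast
  obtain x0 where x0: "\<And>x. x \<ge> x0 \<Longrightarrow> norm (psi_error_integral x) \<le> c * norm (x powr (3 / 2 + e))"
    using c(2) unfolding eventually_at_top_linorder by blast
  define y where "y = max x0 1"
  \<comment> \<open>The O-bound holds only beyond \<open>x0\<close>, while the series uses an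
    estimate for all x >= 1; on [1, y] a crude constant serves.\<close>
  define K where "K = step_integral mangoldt y + y\<^sup>2"
  have K: "\<bar>psi_error_integral x\<bar> \<le> K" if x: "1 \<le> x" "x \<le> y" for x
  proof -
    have 1: "step_integral mangoldt x \<le> step_integral mangoldt y"
      using x by (intro step_integral_mono mangoldt_nonneg) auto
    have 2: "step_integral mangoldt x \<ge> 0"
      unfolding step_integral_def by (intro sum_nonneg) (auto intro!: mult_nonneg_nonneg mangoldt_nonneg)
    have "x\<^sup>2 \<le> y\<^sup>2" using x by (intro power_mono) auto
    then show ?thesis unfolding psi_error_integral_def K_def abs_le_iff
      using 1 2 zero_le_power2[of x] zero_le_power2[of y] by linarith
  qed
  have K0: "K \<ge> 0" using K[of 1] by (simp add: y_def)
  show "zeta_reg s \<noteq> 0"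
  proof (rule zeta_reg_nonzero_of_psi_error_bound[OF e(1,2) _ _ e(3)])
    show "c + K \<ge> 0" using c K0 by simp
    fix x :: real assume x: "x \<ge> 1"
    have p: "x powr (3 / 2 + e) \<ge> 1" using x e by (intro ge_one_powr_ge_zero) auto
    show "\<bar>psi_error_integral x\<bar> \<le> (c + K) * x powr (3 / 2 + e)"
    proof (cases "x \<le> y")
      case True
      have "K * 1 \<le> (c + K) * x powr (3 / 2 + e)" using p K0 c by (intro mult_mono) auto
      then show ?thesis using K[OF x True] by simp
    next
      case False
      then have "\<bar>psi_error_integral x\<bar> \<le> c * x powr (3 / 2 + e)" using x0[of x] by (simp add: y_def)
      also have "\<dots> \<le> (c + K) * x powr (3 / 2 + e)" using K0 by (intro mult_right_mono) auto
      finally show ?thesis .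
    qed
  qed
qed

lemma psi_error_bigo_of_theta_error:
  assumes e: "e > 0" and th: "theta_error_integral \<in> O[at_top](\<lambda>x. x powr (3 / 2 + e))"
  shows "psi_error_integral \<in> O[at_top](\<lambda>x. x powr (3 / 2 + e))"
proof -
  have "(\<lambda>x. psi_error_integral x - theta_error_integral x) \<in> O[at_top](\<lambda>x. x powr (3 / 2 + e))"
  proof (rule bigoI[where c = "1 / e"], rule eventually_at_top_linorderI[of 1])
    fix x :: real assume x: "x \<ge> 1"
    have "psi_error_integral x - theta_error_integral x \<le> 2 * x * chebyshev_psi (sqrt x)"
      using theta_error_integral_bounds(2)[of x] x by simp
    also have "\<dots> \<le> 2 * x * (sqrt x * ln (sqrt x))"
      using chebyshev_psi_le_ln[of "sqrt x"] x by (intro mult_left_mono) auto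
    also have "\<dots> = x * sqrt x * ln x" using x by (simp add: ln_sqrt)
    also have "\<dots> \<le> x * sqrt x * (x powr e / e)"
      using x ln_powr_bound[of x e] e by (intro mult_left_mono) auto
    also have "x * sqrt x = x powr (1 + 1 / 2)" unfolding powr_add using x by (simp add: powr_half_sqrt)
    also have "x powr (1 + 1 / 2) * (x powr e / e) = 1 / e * x powr (3 / 2 + e)" by (simp add: powr_add)
    finally show "norm (psi_error_integral x - theta_error_integral x) \<le> 1 / e * norm (x powr (3 / 2 + e))"
      using theta_error_integral_bounds(1)[of x] x by simp
  qed
  from sum_in_bigo(1)[OF this th] show ?thesis by simp
qed

section \<open>From the mean square to the error integral\<close>

lemma psi_error_square_integrable:
  assumes x: "x \<ge> 0"
  shows "(\<lambda>t. (chebyshev_psi t - t)\<^sup>2) integrable_on {0..x}"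
proof -
  define K where "K = (chebyshev_psi x + x)\<^sup>2"
  have "set_integrable lborel {0..x} (\<lambda>t. (chebyshev_psi t - t)\<^sup>2)"
    unfolding set_integrable_def
  proof (rule Bochner_Integration.integrable_bound)
    show "integrable lborel (\<lambda>t. K * indicator {0..x} t)"
      by (intro integrable_mult_right) (auto simp: emeasure_lborel_Icc_eq)
    show "AE t in lborel. norm (indicat_real {0..x} t *\<^sub>R (chebyshev_psi t - t)\<^sup>2) \<le> norm (K * indicator {0..x} t)"
    proof (rule AE_I2)
      fix t :: real
      have "(chebyshev_psi t - t)\<^sup>2 \<le> K" if "t \<in> {0..x}" unfolding K_def
      proof (rule power2_le_iff_abs_le[THEN iffD2])
        show "0 \<le> chebyshev_psi x + x" using x chebyshev_psi_nonneg[of x] by simp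
        show "\<bar>chebyshev_psi t - t\<bar> \<le> chebyshev_psi x + x"
          using that chebyshev_psi_mono[of t x] chebyshev_psi_nonneg[of t] by auto
      qed
      then show "norm (indicat_real {0..x} t *\<^sub>R (chebyshev_psi t - t)\<^sup>2) \<le> norm (K * indicator {0..x} t)"
        by (auto simp: indicator_def)
    qed
  qed measurable
  then show ?thesis by (rule set_borel_integral_eq_integral(1))
qed

text \<open>Pointwise |u| <= (u^2/sqrt x + sqrt x)/2. The parameter sqrt x balances the two terms:
  both integrate to order x^(3/2) when the square integral is O(x^2).\<close>

lemma psi_error_le_square_integral:
  assumes x: "x > 0"
  shows "\<bar>psi_error_integral x\<bar> \<le> (integral {0..x} (\<lambda>t. (chebyshev_psi t - t)\<^sup>2) / sqrt x + x * sqrt x) / 2"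
proof -
  define I where "I = integral {0..x} (\<lambda>t. (chebyshev_psi t - t)\<^sup>2)"
  have sq: "((\<lambda>t. (chebyshev_psi t - t)\<^sup>2) has_integral I) {0..x}"
    unfolding I_def using psi_error_square_integrable[of x] x by (simp add: has_integral_integral)
  have "((\<lambda>t. sqrt x) has_integral x * sqrt x) {0..x}"
    using has_integral_const_real[of "sqrt x" 0 x] x by simp
  from has_integral_divide[OF has_integral_add[OF has_integral_divide[OF sq, of "sqrt x"] this], of 2]
  have hb: "((\<lambda>t. ((chebyshev_psi t - t)\<^sup>2 / sqrt x + sqrt x) / 2) has_integral (I / sqrt x + x * sqrt x) / 2) {0..x}" .
  have am: "\<bar>u\<bar> \<le> (u\<^sup>2 / sqrt x + sqrt x) / 2" for u :: real
  proof -
    have "2 * \<bar>u\<bar> * sqrt x \<le> u\<^sup>2 + (sqrt x)\<^sup>2" using sum_squares_bound[of "\<bar>u\<bar>" "sqrt x"] by simp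
    then have "2 * \<bar>u\<bar> * sqrt x / sqrt x \<le> (u\<^sup>2 + (sqrt x)\<^sup>2) / sqrt x" using x by (intro divide_right_mono) auto
    then show ?thesis using x by (simp add: add_divide_distrib real_div_sqrt)
  qed
  have "\<bar>psi_error_integral x\<bar> \<le> (I / sqrt x + x * sqrt x) / 2"
  proof (rule abs_leI)
    show "psi_error_integral x \<le> (I / sqrt x + x * sqrt x) / 2"
      using x by (intro has_integral_le[OF has_integral_psi_error hb] order_trans[OF abs_ge_self am]) auto
    show "- psi_error_integral x \<le> (I / sqrt x + x * sqrt x) / 2"
      using x by (intro has_integral_le[OF has_integral_neg[OF has_integral_psi_error] hb] order_trans[OF abs_ge_minus_self am]) auto
  qed
  then show ?thesis by (simp add: I_def)
qed

theorem corollary1: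
  shows "(Riemann_Hypothesis \<longleftrightarrow>
            (\<forall>\<epsilon>>0. theta_error_integral \<in> O[at_top](\<lambda>x::real. x powr (3 / 2 + \<epsilon>)))) \<and>
         (Riemann_Hypothesis \<longleftrightarrow>
            theta_error_integral \<in> O[at_top](\<lambda>x::real. x powr (3 / 2))) \<and>
         (Riemann_Hypothesis \<longleftrightarrow>
            (\<lambda>x. integral {0..x} (\<lambda>t. (chebyshev_psi t - t)\<^sup>2)) \<in> O[at_top](\<lambda>x::real. x\<^sup>2))"
proof -
  define P1 where "P1 \<longleftrightarrow> (\<forall>\<epsilon>>0. theta_error_integral \<in> O[at_top](\<lambda>x::real. x powr (3 / 2 + \<epsilon>)))"
  define P2 where "P2 \<longleftrightarrow> theta_error_integral \<in> O[at_top](\<lambda>x::real. x powr (3 / 2))"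
  define P3 where "P3 \<longleftrightarrow> (\<lambda>x. integral {0..x} (\<lambda>t. (chebyshev_psi t - t)\<^sup>2)) \<in> O[at_top](\<lambda>x::real. x\<^sup>2)"
  have nz: "zeta_reg s \<noteq> 0" if Riemann_Hypothesis "Re s > 1 / 2" for s
    using that RH_iff_zeta_reg_nonzero by blast
  have weaken: "(\<lambda>x::real. x powr (3 / 2)) \<in> O[at_top](\<lambda>x. x powr (3 / 2 + e))" if "e > 0" for e
    using that by (intro bigoI[where c = 1] eventually_at_top_linorderI[of 1]) (auto intro!: powr_mono)
  \<comment> \<open>The hypothesis, \<open>P2\<close> and \<open>P1\<close> are linked in a cycle;
    \<open>P3\<close> is tied to the hypothesis by two separate implications.\<close>
  have "P2" if RH: Riemann_Hypothesis
  proof -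
    obtain C where C: "C \<ge> 0" "\<And>x. x \<ge> 1 \<Longrightarrow> \<bar>psi_error_integral x\<bar> \<le> C * x powr (3 / 2)"
      using psi_error_integral_bound[OF nz[OF RH]] by blast
    show ?thesis unfolding P2_def
    proof (rule bigoI[where c = "C + 2 * (5 * C + 2)"], rule eventually_at_top_linorderI[of 1])
      fix x :: real assume x: "x \<ge> 1"
      have "psi_error_integral x - theta_error_integral x \<le> 2 * x * chebyshev_psi (sqrt x)"
        using theta_error_integral_bounds(2)[of x] x by simp
      \<comment> \<open>The linear bound for psi at sqrt x gives x^(3/2) without a logarithm, as the
        exact exponent demands.\<close>
      also have "\<dots> \<le> 2 * x * ((5 * C + 2) * sqrt x)"
        using chebyshev_psi_linear_bound[OF C, of "sqrt x"] x by (intro mult_left_mono) auto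
      also have "\<dots> = 2 * (5 * C + 2) * (x * sqrt x)" by simp
      also have "x * sqrt x = x powr (1 + 1 / 2)" unfolding powr_add using x by (simp add: powr_half_sqrt)
      finally have "psi_error_integral x - theta_error_integral x \<le> 2 * (5 * C + 2) * x powr (3 / 2)" by simp
      then have "\<bar>theta_error_integral x\<bar> \<le> C * x powr (3 / 2) + 2 * (5 * C + 2) * x powr (3 / 2)"
        using theta_error_integral_bounds(1)[of x] C(2)[OF x] x by linarith
      then show "norm (theta_error_integral x) \<le> (C + 2 * (5 * C + 2)) * norm (x powr (3 / 2))"
        by (simp add: algebra_simps)
    qed
  qed
  moreover have P1 if P2
    unfolding P1_def using that weaken landau_o.big_trans unfolding P2_def by blast
  moreover have Riemann_Hypothesis if P1
    using that psi_error_bigo_of_theta_error unfolding P1_def by (intro Riemann_Hypothesis_of_psi_error) blast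
  moreover have P3 if RH: Riemann_Hypothesis
  proof -
    obtain C where C: "C \<ge> 0" "\<And>X. X \<ge> 1 \<Longrightarrow> integral {0..X} (\<lambda>t. (chebyshev_psi t - t)\<^sup>2) \<le> C * X\<^sup>2"
      using psi_error_square_integral_bound[OF nz[OF RH]] by blast
    show ?thesis unfolding P3_def
    proof (rule bigoI[where c = C], rule eventually_at_top_linorderI[of 1])
      fix x :: real assume x: "x \<ge> 1"
      have "integral {0..x} (\<lambda>t. (chebyshev_psi t - t)\<^sup>2) \<ge> 0"
        using psi_error_square_integrable[of x] x by (intro Henstock_Kurzweil_Integration.integral_nonneg) auto
      then show "norm (integral {0..x} (\<lambda>t. (chebyshev_psi t - t)\<^sup>2)) \<le> C * norm (x\<^sup>2)"
        using C(2)[OF x] by simp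
    qed
  qed
  moreover have Riemann_Hypothesis if p3: P3
  proof (rule Riemann_Hypothesis_of_psi_error)
    fix e :: real assume e: "e > 0"
    obtain c where c: "c > 0" "\<forall>\<^sub>F x in at_top. norm (integral {0..x} (\<lambda>t. (chebyshev_psi t - t)\<^sup>2)) \<le> c * norm (x\<^sup>2)"
      using landau_o.bigE[OF p3[unfolded P3_def]] by blast
    have "psi_error_integral \<in> O[at_top](\<lambda>x. x powr (3 / 2))"
    proof (rule bigoI[where c = "(c + 1) / 2"])
      show "\<forall>\<^sub>F x in at_top. norm (psi_error_integral x) \<le> (c + 1) / 2 * norm (x powr (3 / 2))"
        using c(2) eventually_ge_at_top[of "1::real"]
      proof eventually_elim
        case (elim x)
        have "\<bar>psi_error_integral x\<bar> \<le> (integral {0..x} (\<lambda>t. (chebyshev_psi t - t)\<^sup>2) / sqrt x + x * sqrt x) / 2"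
          using elim by (intro psi_error_le_square_integral) auto
        also have "\<dots> \<le> (c * x\<^sup>2 / sqrt x + x * sqrt x) / 2"
          using elim by (intro divide_right_mono add_right_mono) auto
        also have "x\<^sup>2 = x * sqrt x * sqrt x" using elim by (simp add: power2_eq_square mult.assoc)
        also have "c * (x * sqrt x * sqrt x) / sqrt x = c * (x * sqrt x)" using elim by simp
        also have "x * sqrt x = x powr (1 + 1 / 2)" unfolding powr_add using elim by (simp add: powr_half_sqrt)
        finally show ?case by (simp add: algebra_simps)
      qed
    qed
    then show "psi_error_integral \<in> O[at_top](\<lambda>x. x powr (3 / 2 + e))"
      using weaken[OF e] by (rule landau_o.big_trans)
  qed
  ultimately show ?thesis unfolding P1_def[symmetric] P2_def[symmetric] P3_def[symmetric] by blast
qed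

end
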